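(* Let $\ell>1$ be an odd integer, $q=e^{2\pi is/\ell}$ a primitive $\ell$-th root of unity, and let $\Lambda\in\mathbb C^*$ satisfy $\Lambda^\ell\ne1$. Let $H_\Lambda$ be the weak Hopf algebra obtained from the small quantum group $\mathfrak u_q(\mathfrak{sl}_2)$ by the dynamical twist $\mathcal J_\Lambda$, with antipode $S$. Then $S^2$ is conjugation by the trivial grouplike element $$g=yS(y)^{-1},\qquad y=(y_1,\dots,y_\ell)\in A_s,\qquad y_i=\Lambda q^i-q^{-i}\quad(i\in\mathbb Z/\ell),$$ and $g$ is the pivotal element of the pivotal structure on $\mathrm{Rep}\,\mathfrak u_q(\mathfrak{sl}_2)$ defined by $K^{-1}$. In particular, the characteristic polynomial of $S^2$ on $H_\Lambda$ is $$\chi(z)=\prod_{i,j,k,l\in\mathbb Z/\ell}\left(z-\frac{(\Lambda q^j-q^{-j})(\Lambda q^k-q^{-k})}{(\Lambda q^i-q^{-i})(\Lambda q^l-q^{-l})}\right)^{\ell}.$$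
   Context: $U=\mathfrak u_q(\mathfrak{sl}_2)$ is the Hopf algebra over $\mathbb C$ generated by $E,F,K^{\pm1}$ with $KE=q^2EK$, $KF=q^{-2}FK$, $EF-FE=\frac{K-K^{-1}}{q-q^{-1}}$, $E^\ell=F^\ell=K^\ell-1=0$, $\Delta(E)=E\otimes1+K\otimes E$, $\Delta(F)=F\otimes K^{-1}+1\otimes F$, $\Delta(K)=K\otimes K$, $S(E)=-K^{-1}E$, $S(F)=-FK$, $S(K)=K^{-1}$, $\varepsilon(E)=\varepsilon(F)=0$, $\varepsilon(K)=1$. One has $S^2(x)=K^{-1}xK$ on $U$. For $\mu\in\mathbb Z/\ell$ let $P_\mu\in\mathbb C[K]$ be the idempotent with $KP_\mu=q^\mu P_\mu$. Grade $U$ by $\deg E=1$, $\deg F=-1$, $\deg K=0$. Let $I_+$ (resp. $I_-$) be the span of elements of positive (resp. negative) degree in the subalgebra generated by $E,K$ (resp. $F,K$). Put $Z=\sum_{\mu,\nu}q^{-\mu\nu/2}P_\mu\otimes P_\nu$ (with $1/2$ taken in $\mathbb Z/\ell$), and let $R\in(1+I_+\otimes I_-)Z$ be the universal R-matrix, $R\Delta(x)=\Delta^{\mathrm{op}}(x)R$. For $\lambda\in\mathbb Z/\ell$ let $D_\lambda$ be the automorphism of $U$ multiplying degree $b$ elements by $(\Lambda q^\lambda)^b$. For generic $\Lambda$ there is a unique degree-zero element $X(\lambda)\in1+I_+\otimes I_-$ with $RX(\lambda)Z^{-1}=(D_\lambda\otimes\mathrm{id})X(\lambda)$; it depends rationally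 on $\Lambda$ and is regular whenever $\Lambda^\ell\neq1$, and $X(\lambda)$ denotes its value at the given $\Lambda$. The dynamical twist is $\mathcal J_\Lambda(\lambda)=\sum_{\mu,\nu}X(2\lambda+\mu+\nu)(P_\mu\otimes P_\nu)$. Let $A=\mathbb C[\mathbb Z/\ell]\cong\bigoplus_{\lambda\in\mathbb Z/\ell}\mathbb C$, with matrix units $E_{\lambda\mu}$ of $\mathrm{End}\,A$. The algebra $\mathrm{End}\,A\otimes U$ is a weak Hopf algebra with $\Delta(E_{\lambda\mu}\otimes u)=(E_{\lambda\mu}\otimes u_{(1)})\otimes(E_{\lambda\mu}\otimes u_{(2)})$, $\varepsilon(E_{\lambda\mu}\otimes u)=\varepsilon(u)$, $S(E_{\lambda\mu}\otimes u)=E_{\mu\lambda}\otimes S(u)$. Put $\Theta=\sum_{\lambda,\mu}(E_{\lambda,\lambda+\mu}\otimes E_{\lambda\lambda})\,\mathcal J_\Lambda(\lambda)(1\otimes P_\mu)$ and $\overline\Theta=\sum_{\lambda,\mu}(E_{\lambda+\mu,\lambda}\otimes E_{\lambda\lambda})\,(1\otimes P_\mu)\mathcal J_\Lambda(\lambda)^{-1}$ (matrix units and elements of $U\otimes U$ sit in their respective tensor factors). Then $H_\Lambda$ is the weak Hopf algebra equal to $\mathrm{End}\,A\otimes U$ as an algebra, with coproduct $x\mapsto\overline\Theta\Delta(x)\Theta$ (and the counit and antipode $S$ determined by it). Its source base is $A_s=\{\sum_\lambda f_\lambda E_{\lambda\lambda}\otimes1\}\cong A$, and $y=(y_i)$ means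 $y=\sum_iy_iE_{ii}\otimes1$. A trivial grouplike element is one of the form $yS(y)^{-1}$ with $y\in A_s$ invertible. *)

theory Defs
  imports
    Complex_Main
    "HOL-Library.Poly_Mapping"
    "Jordan_Normal_Form.Char_Poly"
    "Berlekamp_Zassenhaus.Finite_Field"
begin

section \<open>Complex vector spaces and algebras\<close>

class complex_vec = ab_group_add +
  fixes scaleC :: "complex \<Rightarrow> 'a \<Rightarrow> 'a" (infixr "*\<^sub>C" 75)
  assumes scaleC_add_right: "c *\<^sub>C (x + y) = c *\<^sub>C x + c *\<^sub>C y"
    and scaleC_add_left: "(c + d) *\<^sub>C x = c *\<^sub>C x + d *\<^sub>C x"
    and scaleC_scaleC: "c *\<^sub>C d *\<^sub>C x = (c * d) *\<^sub>C x"
    and scaleC_one: "1 *\<^sub>C x = x"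

class complex_alg = complex_vec + ring_1 +
  assumes scaleC_mult_left: "(c *\<^sub>C x) * y = c *\<^sub>C (x * y)"
    and scaleC_mult_right: "x * (c *\<^sub>C y) = c *\<^sub>C (x * y)"

global_interpretation cvec: vector_space "scaleC :: complex \<Rightarrow> 'a \<Rightarrow> 'a::complex_vec"
  by unfold_locales
    (simp_all add: scaleC_add_right scaleC_add_left scaleC_scaleC scaleC_one)

global_interpretation cvecp: vector_space_pair
  "scaleC :: complex \<Rightarrow> 'a \<Rightarrow> 'a::complex_vec"
  "scaleC :: complex \<Rightarrow> 'b \<Rightarrow> 'b::complex_vec"
  by unfold_locales

abbreviation clinear :: "('a::complex_vec \<Rightarrow> 'b::complex_vec) \<Rightarrow> bool" where
  "clinear \<equiv> Vector_Spaces.linear scaleC scaleC"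

lemma clinearI:
  assumes "\<And>x y. f (x + y) = f x + f y" "\<And>c x. f (c *\<^sub>C x) = c *\<^sub>C f x"
  shows "clinear f"
  by (simp add: Vector_Spaces.linear_iff assms cvec.vector_space_axioms)

lemma clinear_add: "clinear f \<Longrightarrow> f (x + y) = f x + f y"
  and clinear_scaleC: "clinear f \<Longrightarrow> f (c *\<^sub>C x) = c *\<^sub>C f x"
  by (simp_all add: Vector_Spaces.linear_iff)

instantiation complex :: complex_alg
begin
definition scaleC_complex :: "complex \<Rightarrow> complex \<Rightarrow> complex" where
  "scaleC_complex c x = c * x"
instance by standard (simp_all add: scaleC_complex_def algebra_simps)
end

definition alg_hom :: "('a::complex_alg \<Rightarrow> 'b::complex_alg) \<Rightarrow> bool" where
  "alg_hom f \<longleftrightarrow> clinear f \<and> f 1 = 1 \<and> (\<forall>x y. f (x * y) = f x * f y)"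

definition alg_antihom :: "('a::complex_alg \<Rightarrow> 'b::complex_alg) \<Rightarrow> bool" where
  "alg_antihom f \<longleftrightarrow> clinear f \<and> f 1 = 1 \<and> (\<forall>x y. f (x * y) = f y * f x)"

definition unit_elem :: "'a::monoid_mult \<Rightarrow> bool" where
  "unit_elem x \<longleftrightarrow> (\<exists>y. x * y = 1 \<and> y * x = 1)"

definition alg_inv :: "'a::monoid_mult \<Rightarrow> 'a" where
  "alg_inv x = (THE y. x * y = 1 \<and> y * x = 1)"

definition subalg_gen :: "'a::complex_alg set \<Rightarrow> 'a set" where
  "subalg_gen G = cvec.span {prod_list w | w. set w \<subseteq> G}"

definition ideal_gen :: "'a::complex_alg set \<Rightarrow> 'a set" where
  "ideal_gen G = cvec.span {a * r * b | a r b. r \<in> G}"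


section \<open>Characteristic polynomial of an endomorphism\<close>

definition ordered_basis :: "'a::complex_vec list \<Rightarrow> bool" where
  "ordered_basis bs \<longleftrightarrow> distinct bs \<and> cvec.independent (set bs) \<and> cvec.span (set bs) = UNIV"

definition matrix_in_basis ::
  "'a::complex_vec list \<Rightarrow> ('a \<Rightarrow> 'a) \<Rightarrow> complex mat" where
  "matrix_in_basis bs f = mat (length bs) (length bs)
     (\<lambda>(i, j). cvec.representation (set bs) (f (bs ! j)) (bs ! i))"

definition has_char_poly :: "('a::complex_vec \<Rightarrow> 'a) \<Rightarrow> complex poly \<Rightarrow> bool" where
  "has_char_poly f p \<longleftrightarrow> clinear f \<and> (\<exists>bs :: 'a list. ordered_basis bs) \<and>
     (\<forall>bs. ordered_basis bs \<longrightarrow> char_poly (matrix_in_basis bs f) = p)"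


section \<open>Finitely supported functions and free algebras\<close>

instantiation poly_mapping :: (type, complex_vec) complex_vec
begin

definition scaleC_poly_mapping :: "complex \<Rightarrow> ('a \<Rightarrow>\<^sub>0 'b) \<Rightarrow> ('a \<Rightarrow>\<^sub>0 'b)" where
  "scaleC_poly_mapping c p = Poly_Mapping.map (scaleC c) p"

lemma lookup_scaleC: "Poly_Mapping.lookup (c *\<^sub>C p) k = c *\<^sub>C Poly_Mapping.lookup p k"
  for p :: "'a \<Rightarrow>\<^sub>0 'b"
  by (simp add: scaleC_poly_mapping_def Poly_Mapping.map.rep_eq when_def)

instance
  by standard
    (rule poly_mapping_eqI,
      simp add: lookup_scaleC lookup_add scaleC_add_right scaleC_add_left scaleC_scaleC scaleC_one)+

end

lemma scaleC_single: "c *\<^sub>C Poly_Mapping.single k v = Poly_Mapping.single k (c *\<^sub>C v)"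
  for v :: "'b::complex_vec"
  by (rule poly_mapping_eqI) (simp add: lookup_scaleC lookup_single when_def)

lemma poly_mapping_single_induct:
  fixes p :: "'a \<Rightarrow>\<^sub>0 'b::ab_group_add"
  assumes "\<And>k v. P (Poly_Mapping.single k v)" "\<And>p r. P p \<Longrightarrow> P r \<Longrightarrow> P (p + r)"
  shows "P p"
proof -
  have "p = (\<Sum>k\<in>Poly_Mapping.keys p. Poly_Mapping.single k (Poly_Mapping.lookup p k))"
    by (rule poly_mapping_eqI)
      (simp add: lookup_sum lookup_single when_def sum.delta' in_keys_iff)
  moreover have "P (\<Sum>k\<in>A. Poly_Mapping.single k (Poly_Mapping.lookup p k))" if "finite A" for A
    using that
  proof (induction A)
    case empty
    show ?case using assms(1)[of undefined 0] by simp
  next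
    case (insert x A)
    then show ?case using assms by simp
  qed
  ultimately show ?thesis by (metis finite_keys)
qed

instance poly_mapping :: (monoid_add, complex_alg) complex_alg
proof
  fix c :: complex and x y :: "'a \<Rightarrow>\<^sub>0 'b"
  show "(c *\<^sub>C x) * y = c *\<^sub>C (x * y)"
  proof (induction x rule: poly_mapping_single_induct)
    case (1 k v)
    show ?case
      by (induction y rule: poly_mapping_single_induct)
        (simp_all add: scaleC_single mult_single scaleC_mult_left distrib_left scaleC_add_right)
  qed (simp add: distrib_right scaleC_add_right)
  show "x * (c *\<^sub>C y) = c *\<^sub>C (x * y)"
  proof (induction x rule: poly_mapping_single_induct)
    case (1 k v)
    show ?case
      by (induction y rule: poly_mapping_single_induct)
        (simp_all add: scaleC_single mult_single scaleC_mult_right distrib_left scaleC_add_right)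
  qed (simp add: distrib_right scaleC_add_right)
qed

text \<open>The free monoid is made additive so that \<open>'g word \<Rightarrow>\<^sub>0 complex\<close>, with the convolution
  product of Poly-Mapping, is the free algebra on \<open>'g\<close>.\<close>

datatype 'g word = Word (letters: "'g list")

instantiation word :: (type) monoid_add
begin
definition "0 = Word []"
definition "u + v = Word (letters u @ letters v)"
instance
  by standard (simp_all add: zero_word_def plus_word_def)
end

definition free_gen :: "'g \<Rightarrow> ('g word \<Rightarrow>\<^sub>0 complex)" where
  "free_gen x = Poly_Mapping.single (Word [x]) 1"

text \<open>\<open>A\<close> is the algebra generated by the family \<open>g\<close> with defining relations \<open>Rel\<close>.\<close>

definition presented_by ::
  "('g word \<Rightarrow>\<^sub>0 complex) set \<Rightarrow> ('g \<Rightarrow> 'a::complex_alg) \<Rightarrow> bool" where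
  "presented_by Rel g \<longleftrightarrow>
     (\<exists>\<phi> :: ('g word \<Rightarrow>\<^sub>0 complex) \<Rightarrow> 'a. alg_hom \<phi> \<and> (\<forall>x. \<phi> (free_gen x) = g x) \<and>
        surj \<phi> \<and> {p. \<phi> p = 0} = ideal_gen Rel)"


section \<open>Tensor products\<close>

definition bilinear_relators ::
  "('a::complex_vec \<times> 'b::complex_vec \<Rightarrow>\<^sub>0 complex) set" where
  "bilinear_relators =
     {Poly_Mapping.single (a + a', b) 1 - Poly_Mapping.single (a, b) 1
        - Poly_Mapping.single (a', b) 1 | a a' b. True} \<union>
     {Poly_Mapping.single (a, b + b') 1 - Poly_Mapping.single (a, b) 1
        - Poly_Mapping.single (a, b') 1 | a b b'. True} \<union>
     {Poly_Mapping.single (c *\<^sub>C a, b) 1 - c *\<^sub>C Poly_Mapping.single (a, b) 1 | c a b. True} \<union>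
     {Poly_Mapping.single (a, c *\<^sub>C b) 1 - c *\<^sub>C Poly_Mapping.single (a, b) 1 | c a b. True}"

definition tensor_rel ::
  "('a::complex_vec \<times> 'b::complex_vec \<Rightarrow>\<^sub>0 complex) \<Rightarrow> ('a \<times> 'b \<Rightarrow>\<^sub>0 complex) \<Rightarrow> bool" where
  "tensor_rel p r \<longleftrightarrow> p - r \<in> cvec.span bilinear_relators"

lemma equivp_tensor_rel:
  "equivp (tensor_rel :: ('a::complex_vec \<times> 'b::complex_vec \<Rightarrow>\<^sub>0 complex) \<Rightarrow> _)"
proof (rule equivpI)
  show "reflp (tensor_rel :: ('a \<times> 'b \<Rightarrow>\<^sub>0 complex) \<Rightarrow> _)"
    by (rule reflpI) (simp add: tensor_rel_def cvec.span_zero)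
  show "symp (tensor_rel :: ('a \<times> 'b \<Rightarrow>\<^sub>0 complex) \<Rightarrow> _)"
    by (rule sympI) (metis cvec.span_neg minus_diff_eq tensor_rel_def)
  show "transp (tensor_rel :: ('a \<times> 'b \<Rightarrow>\<^sub>0 complex) \<Rightarrow> _)"
  proof (rule transpI)
    fix x y z :: "'a \<times> 'b \<Rightarrow>\<^sub>0 complex"
    assume "tensor_rel x y" "tensor_rel y z"
    then have "(x - y) + (y - z) \<in> cvec.span bilinear_relators"
      unfolding tensor_rel_def by (rule cvec.span_add)
    then show "tensor_rel x z" by (simp add: tensor_rel_def)
  qed
qed

quotient_type (overloaded) ('a, 'b) tensor =
  "'a::complex_vec \<times> 'b::complex_vec \<Rightarrow>\<^sub>0 complex" / tensor_rel
  by (rule equivp_tensor_rel)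

instantiation tensor :: (complex_vec, complex_vec) complex_vec
begin

lift_definition zero_tensor :: "('a, 'b) tensor" is 0 .

lift_definition plus_tensor :: "('a, 'b) tensor \<Rightarrow> ('a, 'b) tensor \<Rightarrow> ('a, 'b) tensor" is "(+)"
  unfolding tensor_rel_def by (metis add_diff_add cvec.span_add)

lift_definition uminus_tensor :: "('a, 'b) tensor \<Rightarrow> ('a, 'b) tensor" is uminus
  unfolding tensor_rel_def by (metis cvec.span_neg minus_diff_minus)

lift_definition minus_tensor :: "('a, 'b) tensor \<Rightarrow> ('a, 'b) tensor \<Rightarrow> ('a, 'b) tensor" is "(-)"
proof -
  fix p p' r r' :: "'a \<times> 'b \<Rightarrow>\<^sub>0 complex"
  assume "tensor_rel p p'" "tensor_rel r r'"
  then have "(p - p') - (r - r') \<in> cvec.span bilinear_relators"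
    unfolding tensor_rel_def by (rule cvec.span_diff)
  then show "tensor_rel (p - r) (p' - r')"
    by (simp add: tensor_rel_def algebra_simps)
qed

lift_definition scaleC_tensor :: "complex \<Rightarrow> ('a, 'b) tensor \<Rightarrow> ('a, 'b) tensor" is scaleC
  unfolding tensor_rel_def by (metis cvec.scale_right_diff_distrib cvec.span_scale)

instance
  by standard
    (transfer;
      simp add: algebra_simps scaleC_add_right scaleC_add_left scaleC_scaleC scaleC_one
        equivp_reflp[OF equivp_tensor_rel])+

end

lift_definition tens :: "'a::complex_vec \<Rightarrow> 'b::complex_vec \<Rightarrow> ('a, 'b) tensor" (infixr "\<boxtimes>" 76)
  is "\<lambda>a b. Poly_Mapping.single (a, b) 1" .

definition cbilinear :: "('a::complex_vec \<Rightarrow> 'b::complex_vec \<Rightarrow> 'c::complex_vec) \<Rightarrow> bool" where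
  "cbilinear f \<longleftrightarrow> (\<forall>a. clinear (f a)) \<and> (\<forall>b. clinear (\<lambda>a. f a b))"

lemma cbilinearD:
  assumes "cbilinear f"
  shows "f (a + a') b = f a b + f a' b" "f a (b + b') = f a b + f a b'"
    "f (c *\<^sub>C a) b = c *\<^sub>C f a b" "f a (c *\<^sub>C b) = c *\<^sub>C f a b"
  using assms by (auto simp: cbilinear_def Vector_Spaces.linear_iff)

lemma cbilinearI:
  assumes "\<And>a a' b. f (a + a') b = f a b + f a' b" "\<And>a b b'. f a (b + b') = f a b + f a b'"
    "\<And>c a b. f (c *\<^sub>C a) b = c *\<^sub>C f a b" "\<And>c a b. f a (c *\<^sub>C b) = c *\<^sub>C f a b"
  shows "cbilinear f"
  using assms by (auto simp: cbilinear_def intro!: clinearI)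

lemma cbilinear_tens: "cbilinear (\<boxtimes>)"
proof (rule cbilinearI; transfer; unfold tensor_rel_def; rule cvec.span_base)
  fix a a' :: 'a and b b' :: 'b and c
  show "Poly_Mapping.single (a + a', b) 1
      - (Poly_Mapping.single (a, b) 1 + Poly_Mapping.single (a', b) 1) \<in> bilinear_relators"
    unfolding bilinear_relators_def diff_add_eq_diff_diff_swap
    by (intro UnI1 CollectI exI[of _ a'] exI[of _ a] exI[of _ b]) (simp add: add.commute)
  show "Poly_Mapping.single (a, b + b') 1
      - (Poly_Mapping.single (a, b) 1 + Poly_Mapping.single (a, b') 1) \<in> bilinear_relators"
    unfolding bilinear_relators_def diff_add_eq_diff_diff_swap
    by (rule UnI1, rule UnI1, rule UnI2, intro CollectI exI[of _ a] exI[of _ b'] exI[of _ b])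
      (simp add: add.commute)
  show "Poly_Mapping.single (c *\<^sub>C a, b) 1 - c *\<^sub>C Poly_Mapping.single (a, b) 1
      \<in> bilinear_relators"
    unfolding bilinear_relators_def by blast
  show "Poly_Mapping.single (a, c *\<^sub>C b) 1 - c *\<^sub>C Poly_Mapping.single (a, b) 1
      \<in> bilinear_relators"
    unfolding bilinear_relators_def by blast
qed

lemmas tens_simps = cbilinearD[OF cbilinear_tens]

definition free_ext ::
  "('a \<Rightarrow> 'b \<Rightarrow> 'c::complex_vec) \<Rightarrow> ('a \<times> 'b \<Rightarrow>\<^sub>0 complex) \<Rightarrow> 'c" where
  "free_ext f p = (\<Sum>(a, b)\<in>Poly_Mapping.keys p. Poly_Mapping.lookup p (a, b) *\<^sub>C f a b)"

lemma free_ext_superset: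
  assumes "finite A" "Poly_Mapping.keys p \<subseteq> A"
  shows "free_ext f p = (\<Sum>(a, b)\<in>A. Poly_Mapping.lookup p (a, b) *\<^sub>C f a b)"
  unfolding free_ext_def
  by (rule sum.mono_neutral_left) (use assms in \<open>auto simp: in_keys_iff\<close>)

lemma clinear_free_ext: "clinear (free_ext f)"
proof (rule clinearI)
  fix p r :: "'a \<times> 'b \<Rightarrow>\<^sub>0 complex" and c
  have *: "Poly_Mapping.keys (p + r) \<subseteq> Poly_Mapping.keys p \<union> Poly_Mapping.keys r" by (rule Poly_Mapping.keys_add)
  show "free_ext f (p + r) = free_ext f p + free_ext f r"
    by (subst (1 2 3) free_ext_superset[of "Poly_Mapping.keys p \<union> Poly_Mapping.keys r"])
      (use * in \<open>auto simp: lookup_add scaleC_add_left sum.distrib case_prod_unfold\<close>)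
  show "free_ext f (c *\<^sub>C p) = c *\<^sub>C free_ext f p"
    by (subst (1 2) free_ext_superset[of "Poly_Mapping.keys p"])
      (auto simp: lookup_scaleC cvec.scale_sum_right case_prod_unfold
        in_keys_iff scaleC_complex_def)
qed

lemma free_ext_single: "free_ext f (Poly_Mapping.single (a, b) c) = c *\<^sub>C f a b"
  by (cases "c = 0") (simp_all add: free_ext_def)

lemma free_ext_relator:
  assumes f: "cbilinear f" and p: "p \<in> cvec.span bilinear_relators"
  shows "free_ext f p = 0"
proof -
  note lin = clinear_free_ext[of f]
  have d: "free_ext f (x - y) = free_ext f x - free_ext f y" for x y
    by (rule cvecp.linear_diff[OF lin])
  have "free_ext f p = 0" if "p \<in> bilinear_relators" for p
    using that cbilinearD[OF f] unfolding bilinear_relators_def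
    by (auto simp: d free_ext_single clinear_scaleC[OF lin] scaleC_one)
  then show ?thesis
    using p cvecp.linear_eq_0_on_span[OF lin] by blast
qed

text \<open>The linear map \<open>V \<otimes> W \<rightarrow> X\<close> induced by a bilinear map; meaningful only for bilinear
  arguments.\<close>

definition tensor_lift ::
  "('a::complex_vec \<Rightarrow> 'b::complex_vec \<Rightarrow> 'c::complex_vec) \<Rightarrow> ('a, 'b) tensor \<Rightarrow> 'c" where
  "tensor_lift f t = free_ext f (rep_tensor t)"

lemma tensor_lift_abs:
  assumes "cbilinear f"
  shows "tensor_lift f (abs_tensor p) = free_ext f p"
proof -
  have "tensor_rel (rep_tensor (abs_tensor p)) p"
    by (rule rep_abs_rsp_left[OF Quotient3_tensor]) (simp add: tensor_rel_def cvec.span_zero)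
  then have "free_ext f (rep_tensor (abs_tensor p) - p) = 0"
    unfolding tensor_rel_def by (rule free_ext_relator[OF assms])
  then show ?thesis
    unfolding tensor_lift_def by (simp add: cvecp.linear_diff[OF clinear_free_ext])
qed

lemma clinear_tensor_lift:
  fixes f :: "'a::complex_vec \<Rightarrow> 'b::complex_vec \<Rightarrow> 'c::complex_vec"
  assumes "cbilinear f"
  shows "clinear (tensor_lift f)"
proof (rule clinearI)
  fix x y :: "('a, 'b) tensor" and c
  define p r where "p = rep_tensor x" and "r = rep_tensor y"
  then have xy: "x = abs_tensor p" "y = abs_tensor r"
    by (simp_all add: Quotient3_abs_rep[OF Quotient3_tensor])
  show "tensor_lift f (x + y) = tensor_lift f x + tensor_lift f y"
    by (simp add: xy plus_tensor.abs_eq tensor_lift_abs[OF assms]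
        clinear_add[OF clinear_free_ext])
  show "tensor_lift f (c *\<^sub>C x) = c *\<^sub>C tensor_lift f x"
    by (simp add: xy scaleC_tensor.abs_eq tensor_lift_abs[OF assms]
        clinear_scaleC[OF clinear_free_ext])
qed

lemma tensor_lift_tens:
  assumes "cbilinear f"
  shows "tensor_lift f (a \<boxtimes> b) = f a b"
  by (simp add: tens.abs_eq tensor_lift_abs[OF assms] free_ext_single scaleC_one)

lemma tensor_induct:
  assumes tens: "\<And>a b. P (a \<boxtimes> b)" and add: "\<And>x y. P x \<Longrightarrow> P y \<Longrightarrow> P (x + y)"
  shows "P t"
proof -
  have "P (abs_tensor p)" for p
  proof (induction p rule: poly_mapping_single_induct)
    case (1 k v)
    obtain a b where k: "k = (a, b)" by force
    have "abs_tensor (Poly_Mapping.single k v) = v *\<^sub>C (a \<boxtimes> b)"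
      by (simp add: k tens.abs_eq scaleC_tensor.abs_eq scaleC_single scaleC_complex_def)
    also have "\<dots> = (v *\<^sub>C a) \<boxtimes> b" by (simp add: tens_simps)
    finally show ?case by (simp add: tens)
  next
    case (2 p r)
    then show ?case using add by (metis plus_tensor.abs_eq)
  qed
  from this[of "rep_tensor t"] show ?thesis
    by (simp add: Quotient3_abs_rep[OF Quotient3_tensor])
qed

lemma cbilinear_tensor_mult_inner:
  fixes a :: "'a::complex_alg" and b :: "'b::complex_alg"
  shows "cbilinear (\<lambda>c d. (a * c) \<boxtimes> (b * d))"
  by (rule cbilinearI) (simp_all add: tens_simps distrib_left scaleC_mult_right)

lemma tensor_lift_fun_add:
  "tensor_lift (\<lambda>a b. f a b + h a b) t = tensor_lift f t + tensor_lift h t"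
  by (simp add: tensor_lift_def free_ext_def scaleC_add_right sum.distrib case_prod_unfold)

lemma tensor_lift_fun_scaleC: "tensor_lift (\<lambda>a b. c *\<^sub>C f a b) t = c *\<^sub>C tensor_lift f t"
  by (simp add: tensor_lift_def free_ext_def cvec.scale_sum_right case_prod_unfold mult.commute)

lemma cbilinear_tensor_mult_outer:
  fixes u :: "('a::complex_alg, 'b::complex_alg) tensor"
  shows "cbilinear (\<lambda>a b. tensor_lift (\<lambda>c d. (a * c) \<boxtimes> (b * d)) u)"
  by (rule cbilinearI)
    (simp_all add: tens_simps distrib_right scaleC_mult_left tensor_lift_fun_add
      tensor_lift_fun_scaleC)

lemma ex_clinear_functional:
  fixes v :: "'a::complex_vec"
  assumes "v \<noteq> 0"
  shows "\<exists>f :: 'a \<Rightarrow> complex. clinear f \<and> f v = 1"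
proof -
  have "cvec.independent {v}" using assms by (simp add: cvec.independent_insert)
  from cvecp.linear_independent_extend[OF this, of "\<lambda>_. 1 :: complex"]
  show ?thesis by auto
qed

instantiation tensor :: (complex_alg, complex_alg) complex_alg
begin

definition one_tensor :: "('a, 'b) tensor" where "one_tensor = 1 \<boxtimes> 1"

definition times_tensor :: "('a, 'b) tensor \<Rightarrow> ('a, 'b) tensor \<Rightarrow> ('a, 'b) tensor" where
  "times_tensor t u = tensor_lift (\<lambda>a b. tensor_lift (\<lambda>c d. (a * c) \<boxtimes> (b * d)) u) t"

lemma tens_mult: "(a \<boxtimes> b) * u = tensor_lift (\<lambda>c d. (a * c) \<boxtimes> (b * d)) u"
  for a :: 'a and b :: 'b
  unfolding times_tensor_def by (rule tensor_lift_tens[OF cbilinear_tensor_mult_outer])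

lemma tens_mult_tens: "(a \<boxtimes> b) * (c \<boxtimes> d) = (a * c) \<boxtimes> (b * d)" for a c :: 'a and b d :: 'b
  unfolding tens_mult by (rule tensor_lift_tens[OF cbilinear_tensor_mult_inner])

lemma clinear_tensor_mult_left: "clinear (\<lambda>t. t * u)" for u :: "('a, 'b) tensor"
  unfolding times_tensor_def by (rule clinear_tensor_lift[OF cbilinear_tensor_mult_outer])

lemmas tensor_mult_left = clinear_add[OF clinear_tensor_mult_left]
  clinear_scaleC[OF clinear_tensor_mult_left]

lemma clinear_tensor_mult_right: "clinear (\<lambda>u. t * u)" for t :: "('a, 'b) tensor"
proof (induction t rule: tensor_induct)
  case (1 a b)
  show ?case
    unfolding tens_mult by (rule clinear_tensor_lift[OF cbilinear_tensor_mult_inner])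
next
  case (2 x y)
  then show ?case unfolding tensor_mult_left by (rule cvecp.linear_compose_add)
qed

lemmas tensor_mult_linear = tensor_mult_left clinear_add[OF clinear_tensor_mult_right]
  clinear_scaleC[OF clinear_tensor_mult_right]

instance
proof
  fix t u v :: "('a, 'b) tensor" and c
  note l = tensor_mult_linear tens_mult_tens
  show "t * u * v = t * (u * v)"
  proof (induction t rule: tensor_induct)
    case (1 a b)
    show ?case
    proof (induction u rule: tensor_induct)
      case (1 c d)
      show ?case by (induction v rule: tensor_induct) (simp_all add: l mult.assoc)
    qed (simp_all add: l)
  qed (simp_all add: l)
  show "1 * t = t"
    by (induction t rule: tensor_induct) (simp_all add: l one_tensor_def)
  show "t * 1 = t"
    by (induction t rule: tensor_induct) (simp_all add: l one_tensor_def)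
  show "(t + u) * v = t * v + u * v" "t * (u + v) = t * u + t * v"
    "(c *\<^sub>C t) * u = c *\<^sub>C (t * u)" "t * (c *\<^sub>C u) = c *\<^sub>C (t * u)"
    by (rule tensor_mult_linear)+
  obtain f :: "'a \<Rightarrow> complex" where f: "clinear f" "f 1 = 1"
    using ex_clinear_functional[of "1 :: 'a"] by auto
  obtain h :: "'b \<Rightarrow> complex" where h: "clinear h" "h 1 = 1"
    using ex_clinear_functional[of "1 :: 'b"] by auto
  have b: "cbilinear (\<lambda>a b. f a * h b)"
    using clinear_add[OF f(1)] clinear_add[OF h(1)]
      clinear_scaleC[OF f(1)] clinear_scaleC[OF h(1)]
    by (intro cbilinearI) (simp_all add: algebra_simps scaleC_complex_def)
  have "tensor_lift (\<lambda>a b. f a * h b) 1 = 1"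
    by (simp add: one_tensor_def tensor_lift_tens[OF b] f h)
  moreover have "tensor_lift (\<lambda>a b. f a * h b) 0 = 0"
    by (rule cvecp.linear_0[OF clinear_tensor_lift[OF b]])
  ultimately show "(0 :: ('a, 'b) tensor) \<noteq> 1" by force
qed

end

definition tensor_map ::
  "('a::complex_vec \<Rightarrow> 'c::complex_vec) \<Rightarrow> ('b::complex_vec \<Rightarrow> 'd::complex_vec) \<Rightarrow>
   ('a, 'b) tensor \<Rightarrow> ('c, 'd) tensor" where
  "tensor_map f h = tensor_lift (\<lambda>a b. f a \<boxtimes> h b)"

definition tensor_flip ::
  "('a::complex_vec, 'b::complex_vec) tensor \<Rightarrow> ('b, 'a) tensor" where
  "tensor_flip = tensor_lift (\<lambda>a b. b \<boxtimes> a)"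

definition tensor_assoc ::
  "(('a::complex_vec, 'b::complex_vec) tensor, 'c::complex_vec) tensor \<Rightarrow>
   ('a, ('b, 'c) tensor) tensor" where
  "tensor_assoc = tensor_lift (\<lambda>t c. tensor_lift (\<lambda>a b. a \<boxtimes> (b \<boxtimes> c)) t)"

definition tensor_subspace ::
  "'a::complex_vec set \<Rightarrow> 'b::complex_vec set \<Rightarrow> ('a, 'b) tensor set" where
  "tensor_subspace V W = cvec.span {a \<boxtimes> b | a b. a \<in> V \<and> b \<in> W}"


section \<open>Matrix algebras\<close>

text \<open>Square matrices indexed by a finite type, i.e. \<open>End (\<complex>\<^sup>d)\<close>, as an algebra.\<close>

typedef 'd sqmat = "UNIV :: ('d \<Rightarrow> 'd \<Rightarrow> complex) set"
  morphisms entry sqmat by simp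

setup_lifting type_definition_sqmat

instantiation sqmat :: (finite) complex_alg
begin

lift_definition zero_sqmat :: "'a sqmat" is "\<lambda>_ _. 0" .
lift_definition one_sqmat :: "'a sqmat" is "\<lambda>i j. if i = j then 1 else 0" .
lift_definition plus_sqmat :: "'a sqmat \<Rightarrow> 'a sqmat \<Rightarrow> 'a sqmat" is "\<lambda>A B i j. A i j + B i j" .
lift_definition minus_sqmat :: "'a sqmat \<Rightarrow> 'a sqmat \<Rightarrow> 'a sqmat" is "\<lambda>A B i j. A i j - B i j" .
lift_definition uminus_sqmat :: "'a sqmat \<Rightarrow> 'a sqmat" is "\<lambda>A i j. - A i j" .
lift_definition times_sqmat :: "'a sqmat \<Rightarrow> 'a sqmat \<Rightarrow> 'a sqmat"
  is "\<lambda>A B i j. \<Sum>k\<in>UNIV. A i k * B k j" .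
lift_definition scaleC_sqmat :: "complex \<Rightarrow> 'a sqmat \<Rightarrow> 'a sqmat" is "\<lambda>c A i j. c * A i j" .

instance
proof
  fix A B C :: "'a sqmat" and c d :: complex
  show "A * B * C = A * (B * C)"
  proof (transfer, intro ext)
    fix A B C :: "'a \<Rightarrow> 'a \<Rightarrow> complex" and i j
    have "(\<Sum>k\<in>UNIV. (\<Sum>m\<in>UNIV. A i m * B m k) * C k j) =
        (\<Sum>k\<in>UNIV. \<Sum>m\<in>UNIV. A i m * (B m k * C k j))"
      by (simp add: sum_distrib_right mult.assoc)
    also have "\<dots> = (\<Sum>m\<in>UNIV. \<Sum>k\<in>UNIV. A i m * (B m k * C k j))"
      by (rule sum.swap)
    finally show "(\<Sum>k\<in>UNIV. (\<Sum>m\<in>UNIV. A i m * B m k) * C k j) =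
        (\<Sum>m\<in>UNIV. A i m * (\<Sum>k\<in>UNIV. B m k * C k j))"
      by (simp add: sum_distrib_left)
  qed
  show "1 * A = A"
    by (transfer, intro ext) (simp add: if_distrib[of "\<lambda>x. x * _"] cong: if_cong)
  show "A * 1 = A"
    by (transfer, intro ext) (simp add: if_distrib[of "\<lambda>x. _ * x"] cong: if_cong)
  show "(A + B) * C = A * C + B * C" "A * (B + C) = A * B + A * C"
    by (transfer, simp add: algebra_simps sum.distrib)+
  show "(c *\<^sub>C A) * B = c *\<^sub>C (A * B)" "A * (c *\<^sub>C B) = c *\<^sub>C (A * B)"
    by (transfer, simp add: algebra_simps sum_distrib_left)+
  show "(0 :: 'a sqmat) \<noteq> 1"
    by transfer (metis zero_neq_one)
qed (transfer, simp add: algebra_simps)+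

end

definition matrix_unit :: "'d \<Rightarrow> 'd \<Rightarrow> 'd sqmat" where
  "matrix_unit i j = sqmat (\<lambda>a b. if a = i \<and> b = j then 1 else 0)"

definition mat_transp :: "'d sqmat \<Rightarrow> 'd sqmat" where
  "mat_transp A = sqmat (\<lambda>i j. entry A j i)"

definition kron :: "'d sqmat \<Rightarrow> 'e sqmat \<Rightarrow> ('d \<times> 'e) sqmat" where
  "kron A B = sqmat (\<lambda>(i, k) (j, l). entry A i j * entry B k l)"

definition mat_apply :: "'d::finite sqmat \<Rightarrow> ('d \<Rightarrow> complex) \<Rightarrow> 'd \<Rightarrow> complex" where
  "mat_apply A v i = (\<Sum>j\<in>UNIV. entry A i j * v j)"


section \<open>Weak Hopf algebras\<close>

definition counital_target ::
  "('h::complex_alg \<Rightarrow> ('h, 'h) tensor) \<Rightarrow> ('h \<Rightarrow> complex) \<Rightarrow> 'h \<Rightarrow> 'h" where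
  "counital_target \<Delta> \<epsilon> x = tensor_lift (\<lambda>a b. \<epsilon> (a * x) *\<^sub>C b) (\<Delta> 1)"

definition counital_source ::
  "('h::complex_alg \<Rightarrow> ('h, 'h) tensor) \<Rightarrow> ('h \<Rightarrow> complex) \<Rightarrow> 'h \<Rightarrow> 'h" where
  "counital_source \<Delta> \<epsilon> x = tensor_lift (\<lambda>a b. \<epsilon> (x * b) *\<^sub>C a) (\<Delta> 1)"

locale weak_hopf_algebra =
  fixes \<Delta> :: "'h::complex_alg \<Rightarrow> ('h, 'h) tensor" and \<epsilon> :: "'h \<Rightarrow> complex" and S :: "'h \<Rightarrow> 'h"
  assumes linear: "clinear \<Delta>" "clinear \<epsilon>" "clinear S"
    and comult_mult: "\<Delta> (x * y) = \<Delta> x * \<Delta> y"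
    and coassoc: "tensor_assoc (tensor_map \<Delta> id (\<Delta> x)) = tensor_map id \<Delta> (\<Delta> x)"
    and counit_left: "tensor_lift (\<lambda>a b. \<epsilon> a *\<^sub>C b) (\<Delta> x) = x"
    and counit_right: "tensor_lift (\<lambda>a b. \<epsilon> b *\<^sub>C a) (\<Delta> x) = x"
    and comult_one: "tensor_map id \<Delta> (\<Delta> 1) = tensor_assoc (\<Delta> 1 \<boxtimes> 1) * (1 \<boxtimes> \<Delta> 1)"
      "tensor_map id \<Delta> (\<Delta> 1) = (1 \<boxtimes> \<Delta> 1) * tensor_assoc (\<Delta> 1 \<boxtimes> 1)"
    and counit_mult: "\<epsilon> (x * y * z) = tensor_lift (\<lambda>a b. \<epsilon> (x * a) * \<epsilon> (b * z)) (\<Delta> y)"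
      "\<epsilon> (x * y * z) = tensor_lift (\<lambda>a b. \<epsilon> (x * b) * \<epsilon> (a * z)) (\<Delta> y)"
    and antipode_target: "tensor_lift (\<lambda>a b. a * S b) (\<Delta> x) = counital_target \<Delta> \<epsilon> x"
    and antipode_source: "tensor_lift (\<lambda>a b. S a * b) (\<Delta> x) = counital_source \<Delta> \<epsilon> x"
    and antipode_conv:
      "tensor_lift (\<lambda>a t. tensor_lift (\<lambda>b c. S a * b * S c) t) (tensor_map id \<Delta> (\<Delta> x)) = S x"

definition grouplike :: "('h::complex_alg \<Rightarrow> ('h, 'h) tensor) \<Rightarrow> 'h \<Rightarrow> bool" where
  "grouplike \<Delta> g \<longleftrightarrow> unit_elem g \<and> \<Delta> g = (g \<boxtimes> g) * \<Delta> 1 \<and> \<Delta> g = \<Delta> 1 * (g \<boxtimes> g)"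

text \<open>The elements \<open>g\<close> whose action \<open>V \<rightarrow> V\<^sup>*\<^sup>*\<close> is a monoidal natural isomorphism of
  \<open>H\<close>-modules.\<close>

definition pivotal_element ::
  "('h::complex_alg \<Rightarrow> ('h, 'h) tensor) \<Rightarrow> ('h \<Rightarrow> 'h) \<Rightarrow> 'h \<Rightarrow> bool" where
  "pivotal_element \<Delta> S g \<longleftrightarrow> grouplike \<Delta> g \<and> (\<forall>x. S (S x) = g * x * alg_inv g)"


section \<open>The small quantum group\<close>

datatype gen = GE | GF | GK | GKinv

definition uq_relations :: "nat \<Rightarrow> complex \<Rightarrow> (gen word \<Rightarrow>\<^sub>0 complex) set" where
  "uq_relations l q = (let E = free_gen GE; F = free_gen GF; K = free_gen GK; Ki = free_gen GKinv in
     {K * Ki - 1, Ki * K - 1,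
      K * E - (q ^ 2) *\<^sub>C (E * K),
      K * F - inverse (q ^ 2) *\<^sub>C (F * K),
      E * F - F * E - inverse (q - inverse q) *\<^sub>C (K - Ki),
      E ^ l, F ^ l, K ^ l - 1})"

locale small_quantum_sl2 =
  fixes l :: nat and q :: complex and g :: "gen \<Rightarrow> 'u::complex_alg"
    and \<Delta> :: "'u \<Rightarrow> ('u, 'u) tensor" and \<epsilon> :: "'u \<Rightarrow> complex" and S :: "'u \<Rightarrow> 'u"
  assumes presentation: "presented_by (uq_relations l q) g"
    and comult: "alg_hom \<Delta>"
      "\<Delta> (g GE) = g GE \<boxtimes> 1 + g GK \<boxtimes> g GE"
      "\<Delta> (g GF) = g GF \<boxtimes> g GKinv + 1 \<boxtimes> g GF"
      "\<Delta> (g GK) = g GK \<boxtimes> g GK"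
    and counit: "alg_hom \<epsilon>" "\<epsilon> (g GE) = 0" "\<epsilon> (g GF) = 0" "\<epsilon> (g GK) = 1"
    and antipode: "alg_antihom S"
      "S (g GE) = - (g GKinv * g GE)"
      "S (g GF) = - (g GF * g GK)"
      "S (g GK) = g GKinv"

text \<open>\<open>q\<^sup>\<mu>\<close> for \<open>\<mu> \<in> \<int>/\<ell>\<close>; \<open>'n mod_ring\<close> is \<open>\<int>/\<ell>\<close> with \<open>\<ell> = CARD('n)\<close>.\<close>

definition qpow :: "complex \<Rightarrow> 'n::finite mod_ring \<Rightarrow> complex" where
  "qpow q \<mu> = q powi to_int_mod_ring \<mu>"

text \<open>\<open>P\<^sub>\<mu> = \<ell>\<^sup>-\<^sup>1 \<Sum>\<^sub>j q\<^sup>-\<^sup>\<mu>\<^sup>j K\<^sup>j\<close>, the nonzero idempotent of \<open>\<complex>[K]\<close> with \<open>K P\<^sub>\<mu> = q\<^sup>\<mu> P\<^sub>\<mu>\<close>.\<close>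

definition weight_idem :: "complex \<Rightarrow> 'u::complex_alg \<Rightarrow> 'n::finite mod_ring \<Rightarrow> 'u" where
  "weight_idem q K \<mu> =
     inverse (of_nat CARD('n)) *\<^sub>C (\<Sum>j<CARD('n). inverse (qpow q \<mu>) ^ j *\<^sub>C K ^ j)"

primrec gen_degree :: "gen \<Rightarrow> int" where
  "gen_degree GE = 1"
| "gen_degree GF = -1"
| "gen_degree GK = 0"
| "gen_degree GKinv = 0"

definition degree_part :: "(gen \<Rightarrow> 'u::complex_alg) \<Rightarrow> int \<Rightarrow> 'u set" where
  "degree_part g b = cvec.span {prod_list (map g w) | w. sum_list (map gen_degree w) = b}"

definition I_plus :: "(gen \<Rightarrow> 'u::complex_alg) \<Rightarrow> 'u set" where
  "I_plus g = cvec.span (\<Union>b\<in>{0<..}. degree_part g b \<inter> subalg_gen {g GE, g GK, g GKinv})"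

definition I_minus :: "(gen \<Rightarrow> 'u::complex_alg) \<Rightarrow> 'u set" where
  "I_minus g = cvec.span (\<Union>b\<in>{..<0}. degree_part g b \<inter> subalg_gen {g GF, g GK, g GKinv})"

definition tensor_degree_zero :: "(gen \<Rightarrow> 'u::complex_alg) \<Rightarrow> ('u, 'u) tensor set" where
  "tensor_degree_zero g =
     cvec.span {a \<boxtimes> c | a c b. a \<in> degree_part g b \<and> c \<in> degree_part g (- b)}"

definition grading_aut :: "(gen \<Rightarrow> 'u::complex_alg) \<Rightarrow> complex \<Rightarrow> 'u \<Rightarrow> 'u" where
  "grading_aut g c =
     (THE D. clinear D \<and> (\<forall>b. \<forall>x\<in>degree_part g b. D x = (c powi b) *\<^sub>C x))"

text \<open>\<open>(\<ell> + 1) div 2\<close> represents \<open>1/2\<close> in \<open>\<int>/\<ell>\<close> for odd \<open>\<ell>\<close>.\<close>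

definition half_mod :: "'n::nontriv mod_ring" where
  "half_mod = of_nat ((CARD('n) + 1) div 2)"

definition Z_elem ::
  "complex \<Rightarrow> ('n::nontriv mod_ring \<Rightarrow> 'u::complex_alg) \<Rightarrow> ('u, 'u) tensor" where
  "Z_elem q P = (\<Sum>\<mu>\<in>UNIV. \<Sum>\<nu>\<in>UNIV. qpow q (- (\<mu> * \<nu> * half_mod)) *\<^sub>C (P \<mu> \<boxtimes> P \<nu>))"

definition universal_R_matrix ::
  "('u::complex_alg \<Rightarrow> ('u, 'u) tensor) \<Rightarrow> ('u, 'u) tensor \<Rightarrow> bool" where
  "universal_R_matrix \<Delta> R \<longleftrightarrow> unit_elem R \<and>
     (\<forall>x. R * \<Delta> x = tensor_flip (\<Delta> x) * R) \<and>
     tensor_assoc (tensor_map \<Delta> id R) = tensor_lift (\<lambda>a b. a \<boxtimes> (1 \<boxtimes> b)) R * (1 \<boxtimes> R) \<and>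
     tensor_map id \<Delta> R =
       tensor_lift (\<lambda>a b. a \<boxtimes> (1 \<boxtimes> b)) R * tensor_lift (\<lambda>a b. a \<boxtimes> (b \<boxtimes> 1)) R"


section \<open>The dynamical twist\<close>

definition dynamical_equation ::
  "complex \<Rightarrow> ('n::nontriv mod_ring \<Rightarrow> 'u::complex_alg) \<Rightarrow> (gen \<Rightarrow> 'u) \<Rightarrow> ('u, 'u) tensor \<Rightarrow>
   complex \<Rightarrow> 'n mod_ring \<Rightarrow> ('u, 'u) tensor \<Rightarrow> bool" where
  "dynamical_equation q P g R \<Lambda> lam x \<longleftrightarrow>
     x \<in> tensor_degree_zero g \<and> x - 1 \<in> tensor_subspace (I_plus g) (I_minus g) \<and>
     R * x * alg_inv (Z_elem q P) = tensor_map (grading_aut g (\<Lambda> * qpow q lam)) id x"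

text \<open>\<open>x\<close> is the value at \<open>\<Lambda>\<close> of the rational function of the parameter, regular at \<open>\<Lambda>\<close>, whose
  value at all but finitely many parameters \<open>t\<close> is the unique solution of the equation. At
  \<open>\<Lambda>\<close> itself the equation can have further solutions, e.g. when \<open>\<Lambda>\<close> is another root of unity.\<close>

definition dynamical_X ::
  "complex \<Rightarrow> ('n::nontriv mod_ring \<Rightarrow> 'u::complex_alg) \<Rightarrow> (gen \<Rightarrow> 'u) \<Rightarrow> ('u, 'u) tensor \<Rightarrow>
   complex \<Rightarrow> 'n mod_ring \<Rightarrow> ('u, 'u) tensor \<Rightarrow> bool" where
  "dynamical_X q P g R \<Lambda> lam x \<longleftrightarrow>
     (\<exists>(d :: complex poly) (N :: nat \<Rightarrow> ('u, 'u) tensor) m.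
        let r = (\<lambda>t. inverse (poly d t) *\<^sub>C (\<Sum>k\<le>m. t ^ k *\<^sub>C N k)) in
          poly d \<Lambda> \<noteq> 0 \<and> x = r \<Lambda> \<and>
          finite {t. \<not> (\<forall>z. dynamical_equation q P g R t lam z \<longleftrightarrow> z = r t)})"

definition dynamical_twist ::
  "('n::nontriv mod_ring \<Rightarrow> 'u::complex_alg) \<Rightarrow> ('n mod_ring \<Rightarrow> ('u, 'u) tensor) \<Rightarrow>
   'n mod_ring \<Rightarrow> ('u, 'u) tensor" where
  "dynamical_twist P X lam = (\<Sum>\<mu>\<in>UNIV. \<Sum>\<nu>\<in>UNIV. X (2 * lam + \<mu> + \<nu>) * (P \<mu> \<boxtimes> P \<nu>))"


section \<open>The weak Hopf algebra obtained by twisting\<close>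

type_synonym ('n, 'u) weak_alg = "('n mod_ring sqmat, 'u) tensor"

definition mat_comult ::
  "('u::complex_alg \<Rightarrow> ('u, 'u) tensor) \<Rightarrow>
   ('n::nontriv, 'u) weak_alg \<Rightarrow> (('n, 'u) weak_alg, ('n, 'u) weak_alg) tensor" where
  "mat_comult \<Delta> = tensor_lift (\<lambda>A u. \<Sum>i\<in>UNIV. \<Sum>j\<in>UNIV. entry A i j *\<^sub>C
     tensor_map (\<lambda>a. matrix_unit i j \<boxtimes> a) (\<lambda>b. matrix_unit i j \<boxtimes> b) (\<Delta> u))"

definition Theta ::
  "('n::nontriv mod_ring \<Rightarrow> 'u::complex_alg) \<Rightarrow> ('n mod_ring \<Rightarrow> ('u, 'u) tensor) \<Rightarrow>
   (('n, 'u) weak_alg, ('n, 'u) weak_alg) tensor" where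
  "Theta P J = (\<Sum>lam\<in>UNIV. \<Sum>\<mu>\<in>UNIV.
     tensor_map (\<lambda>a. matrix_unit lam (lam + \<mu>) \<boxtimes> a) (\<lambda>b. matrix_unit lam lam \<boxtimes> b)
       (J lam * (1 \<boxtimes> P \<mu>)))"

definition Theta_bar ::
  "('n::nontriv mod_ring \<Rightarrow> 'u::complex_alg) \<Rightarrow> ('n mod_ring \<Rightarrow> ('u, 'u) tensor) \<Rightarrow>
   (('n, 'u) weak_alg, ('n, 'u) weak_alg) tensor" where
  "Theta_bar P J = (\<Sum>lam\<in>UNIV. \<Sum>\<mu>\<in>UNIV.
     tensor_map (\<lambda>a. matrix_unit (lam + \<mu>) lam \<boxtimes> a) (\<lambda>b. matrix_unit lam lam \<boxtimes> b)
       ((1 \<boxtimes> P \<mu>) * alg_inv (J lam)))"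

definition twisted_comult ::
  "('u::complex_alg \<Rightarrow> ('u, 'u) tensor) \<Rightarrow> ('n::nontriv mod_ring \<Rightarrow> 'u) \<Rightarrow>
   ('n mod_ring \<Rightarrow> ('u, 'u) tensor) \<Rightarrow>
   ('n, 'u) weak_alg \<Rightarrow> (('n, 'u) weak_alg, ('n, 'u) weak_alg) tensor" where
  "twisted_comult \<Delta> P J x = Theta_bar P J * mat_comult \<Delta> x * Theta P J"

definition base_elem :: "('n::nontriv mod_ring \<Rightarrow> complex) \<Rightarrow> ('n, 'u::complex_alg) weak_alg" where
  "base_elem f = (\<Sum>i\<in>UNIV. f i *\<^sub>C (matrix_unit i i \<boxtimes> 1))"

definition source_base :: "('n::nontriv, 'u::complex_alg) weak_alg set" where
  "source_base = range base_elem"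

definition trivial_grouplike ::
  "(('n::nontriv, 'u::complex_alg) weak_alg \<Rightarrow> ('n, 'u) weak_alg) \<Rightarrow>
   ('n, 'u) weak_alg \<Rightarrow> bool" where
  "trivial_grouplike S h \<longleftrightarrow>
     (\<exists>y\<in>source_base. unit_elem y \<and> unit_elem (S y) \<and> h = y * alg_inv (S y))"


section \<open>Transport of the pivotal structure\<close>

text \<open>A representation on \<open>\<complex>\<^sup>d\<close> is an algebra map into \<open>'d sqmat\<close>, and the dual (hence also the
  double dual) lives on the same index type. The equivalence from \<open>U\<close>-modules to \<open>H\<close>-modules is
  \<open>V \<mapsto> A \<otimes> V\<close>.\<close>

definition dual_rep :: "('a \<Rightarrow> 'a) \<Rightarrow> ('a \<Rightarrow> 'd sqmat) \<Rightarrow> 'a \<Rightarrow> 'd sqmat" where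
  "dual_rep S \<rho> x = mat_transp (\<rho> (S x))"

definition base_functor ::
  "('u::complex_alg \<Rightarrow> 'd::finite sqmat) \<Rightarrow>
   ('n::nontriv, 'u) weak_alg \<Rightarrow> ('n mod_ring \<times> 'd) sqmat" where
  "base_functor \<rho> = tensor_lift (\<lambda>A u. kron A (\<rho> u))"

text \<open>The action of \<open>H \<otimes> H\<close> on \<open>M \<otimes> N\<close>, and the tensor product of the modules \<open>M\<close> and \<open>N\<close>, which
  for a weak Hopf algebra is \<open>\<Delta>(1)(M \<otimes> N)\<close>.\<close>

definition act2 ::
  "('h::complex_alg \<Rightarrow> 'd::finite sqmat) \<Rightarrow> ('h \<Rightarrow> 'e::finite sqmat) \<Rightarrow> ('h, 'h) tensor \<Rightarrow>
   ('d \<times> 'e \<Rightarrow> complex) \<Rightarrow> ('d \<times> 'e \<Rightarrow> complex)" where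
  "act2 \<rho> \<sigma> t = mat_apply (tensor_lift (\<lambda>a b. kron (\<rho> a) (\<sigma> b)) t)"

definition rep_tensor_space ::
  "('h::complex_alg \<Rightarrow> ('h, 'h) tensor) \<Rightarrow> ('h \<Rightarrow> 'd::finite sqmat) \<Rightarrow>
   ('h \<Rightarrow> 'e::finite sqmat) \<Rightarrow> ('d \<times> 'e \<Rightarrow> complex) set" where
  "rep_tensor_space \<Delta> \<rho> \<sigma> = range (act2 \<rho> \<sigma> (\<Delta> 1))"

text \<open>Evaluation \<open>M\<^sup>* \<otimes> M \<rightarrow> H\<^sub>t\<close>, \<open>\<phi> \<otimes> m \<mapsto> \<phi>(1\<^sub>1 m) 1\<^sub>2\<close>; here \<open>H\<^sub>t\<close>, the image of
  \<open>counital_target\<close>, is the unit object, with \<open>h\<close> acting by \<open>z \<mapsto> \<epsilon>\<^sub>t(h z)\<close>.\<close>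

definition weak_ev ::
  "('h::complex_alg \<Rightarrow> ('h, 'h) tensor) \<Rightarrow> ('h \<Rightarrow> 'd::finite sqmat) \<Rightarrow>
   ('d \<times> 'd \<Rightarrow> complex) \<Rightarrow> 'h" where
  "weak_ev \<Delta> \<rho> x =
     tensor_lift (\<lambda>a b. (\<Sum>i\<in>UNIV. \<Sum>j\<in>UNIV. x (i, j) * entry (\<rho> a) i j) *\<^sub>C b) (\<Delta> 1)"

text \<open>The tensor structure \<open>(A \<otimes> V) \<otimes> (A \<otimes> W) \<rightarrow> A \<otimes> V \<otimes> W\<close> of the equivalence: act by \<open>\<Theta>\<close>,
  whose image lies in the span of the \<open>(e\<^sub>i \<otimes> v) \<otimes> (e\<^sub>i \<otimes> w)\<close>, and identify such an element
  with \<open>e\<^sub>i \<otimes> v \<otimes> w\<close>.\<close>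

definition functor_tensor ::
  "(('n::nontriv, 'u::complex_alg) weak_alg, ('n, 'u) weak_alg) tensor \<Rightarrow>
   ('u \<Rightarrow> 'd::finite sqmat) \<Rightarrow> ('u \<Rightarrow> 'e::finite sqmat) \<Rightarrow>
   (('n mod_ring \<times> 'd) \<times> ('n mod_ring \<times> 'e) \<Rightarrow> complex) \<Rightarrow>
   'n mod_ring \<times> ('d \<times> 'e) \<Rightarrow> complex" where
  "functor_tensor \<Theta> \<rho> \<sigma> x =
     (\<lambda>(i, (d, e)). act2 (base_functor \<rho>) (base_functor \<sigma>) \<Theta> x ((i, d), (i, e)))"

text \<open>The image \<open>A\<close> of the trivial \<open>U\<close>-module.\<close>

definition unit_rep ::
  "('u::complex_alg \<Rightarrow> complex) \<Rightarrow> ('n::nontriv, 'u) weak_alg \<Rightarrow> 'n mod_ring sqmat" where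
  "unit_rep \<epsilon> = tensor_lift (\<lambda>A u. \<epsilon> u *\<^sub>C A)"

text \<open>\<open>\<eta>\<close> is the unit constraint of the equivalence, an isomorphism of \<open>H\<close>-modules
  \<open>H\<^sub>t \<rightarrow> A\<close> normalised by left unit coherence on \<open>A \<otimes> V\<close>; the left unit isomorphism
  \<open>H\<^sub>t \<otimes> M \<rightarrow> M\<close> is induced by \<open>z \<otimes> m \<mapsto> z m\<close>.\<close>

definition unit_constraint ::
  "('u::complex_alg \<Rightarrow> complex) \<Rightarrow> (('n::nontriv, 'u) weak_alg, ('n, 'u) weak_alg) tensor \<Rightarrow>
   (('n, 'u) weak_alg \<Rightarrow> (('n, 'u) weak_alg, ('n, 'u) weak_alg) tensor) \<Rightarrow>
   (('n, 'u) weak_alg \<Rightarrow> complex) \<Rightarrow> ('u \<Rightarrow> 'd::finite sqmat) \<Rightarrow>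
   (('n, 'u) weak_alg \<Rightarrow> 'n mod_ring \<Rightarrow> complex) \<Rightarrow> bool" where
  "unit_constraint \<epsilon> \<Theta> \<Delta>H \<epsilon>H \<rho> \<eta> \<longleftrightarrow>
     (let Ht = range (counital_target \<Delta>H \<epsilon>H) in
        (\<forall>i. clinear (\<lambda>z. \<eta> z i)) \<and> bij_betw \<eta> Ht UNIV \<and>
        (\<forall>h. \<forall>z\<in>Ht. \<eta> (counital_target \<Delta>H \<epsilon>H (h * z)) = mat_apply (unit_rep \<epsilon> h) (\<eta> z)) \<and>
        (\<forall>z\<in>Ht. \<forall>v i d.
           act2 (unit_rep \<epsilon>) (base_functor \<rho>) \<Theta> (\<lambda>(j, k). \<eta> z j * v k) (i, (i, d)) =
           mat_apply (base_functor \<rho> z) v (i, d)))"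

text \<open>\<open>\<xi>\<close> is the canonical isomorphism \<open>A \<otimes> V\<^sup>* \<rightarrow> (A \<otimes> V)\<^sup>*\<close>, i.e. the one that matches the
  evaluation of \<open>A \<otimes> V\<close> with the image under the equivalence of the evaluation of \<open>V\<close>.\<close>

definition duality_iso ::
  "('u::complex_alg \<Rightarrow> 'u) \<Rightarrow> (('n::nontriv, 'u) weak_alg, ('n, 'u) weak_alg) tensor \<Rightarrow>
   (('n, 'u) weak_alg \<Rightarrow> (('n, 'u) weak_alg, ('n, 'u) weak_alg) tensor) \<Rightarrow>
   (('n, 'u) weak_alg \<Rightarrow> ('n, 'u) weak_alg) \<Rightarrow>
   (('n, 'u) weak_alg \<Rightarrow> 'n mod_ring \<Rightarrow> complex) \<Rightarrow> ('u \<Rightarrow> 'd::finite sqmat) \<Rightarrow>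
   ('n mod_ring \<times> 'd) sqmat \<Rightarrow> bool" where
  "duality_iso S \<Theta> \<Delta>H SH \<eta> \<rho> \<xi> \<longleftrightarrow>
     unit_elem \<xi> \<and>
     (\<forall>h. \<xi> * base_functor (dual_rep S \<rho>) h = dual_rep SH (base_functor \<rho>) h * \<xi>) \<and>
     (\<forall>x\<in>rep_tensor_space \<Delta>H (base_functor (dual_rep S \<rho>)) (base_functor \<rho>).
        \<eta> (weak_ev \<Delta>H (base_functor \<rho>) (mat_apply (kron \<xi> 1) x)) =
        (\<lambda>i. \<Sum>d\<in>UNIV. functor_tensor \<Theta> (dual_rep S \<rho>) \<rho> x (i, (d, d))))"

text \<open>On \<open>A \<otimes> V\<close>, the isomorphism with the double dual given by \<open>h\<close> is the transport of the
  isomorphism \<open>V \<rightarrow> V\<^sup>*\<^sup>*\<close> given by \<open>k\<close>, that is, the composite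
  \<open>A \<otimes> V \<rightarrow> A \<otimes> V\<^sup>*\<^sup>* \<rightarrow> (A \<otimes> V\<^sup>*)\<^sup>* \<rightarrow> (A \<otimes> V)\<^sup>*\<^sup>*\<close>, whose last arrow is the inverse of the
  transpose of \<open>\<xi>\<close>.\<close>

definition transports_pivotal ::
  "('u::complex_alg \<Rightarrow> complex) \<Rightarrow> ('u \<Rightarrow> 'u) \<Rightarrow>
   (('n::nontriv, 'u) weak_alg, ('n, 'u) weak_alg) tensor \<Rightarrow>
   (('n, 'u) weak_alg \<Rightarrow> (('n, 'u) weak_alg, ('n, 'u) weak_alg) tensor) \<Rightarrow>
   (('n, 'u) weak_alg \<Rightarrow> complex) \<Rightarrow> (('n, 'u) weak_alg \<Rightarrow> ('n, 'u) weak_alg) \<Rightarrow>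
   ('u \<Rightarrow> 'd::finite sqmat) \<Rightarrow> 'u \<Rightarrow> ('n, 'u) weak_alg \<Rightarrow> bool" where
  "transports_pivotal \<epsilon> S \<Theta> \<Delta>H \<epsilon>H SH \<rho> k h \<longleftrightarrow>
     (\<exists>\<eta> \<xi> \<xi>'. unit_constraint \<epsilon> \<Theta> \<Delta>H \<epsilon>H \<rho> \<eta> \<and>
        duality_iso S \<Theta> \<Delta>H SH \<eta> \<rho> \<xi> \<and> duality_iso S \<Theta> \<Delta>H SH \<eta> (dual_rep S \<rho>) \<xi>' \<and>
        mat_transp \<xi> * base_functor \<rho> h = \<xi>' * kron 1 (\<rho> k))"

end

theory Submission
  imports Defs
begin

text \<open>
  Twisting changes an antipode by conjugation. For an ordinary twist \<open>J\<close> of a Hopf algebra the new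
  antipode is the old one conjugated by \<open>Q = \<Sum> S(J\<^sub>1) J\<^sub>2\<close>. Here the elements \<open>Q(\<lambda>) = \<Sum> S(J(\<lambda>)\<^sub>1) J(\<lambda>)\<^sub>2\<close>
  are assembled, weight by weight, to one invertible element \<open>QH\<close> of \<open>End A \<otimes> U\<close>, and the antipode of the
  twisted weak Hopf algebra is \<open>x \<mapsto> QH\<^sup>-\<^sup>1 S\<^sub>0(x) QH\<close>, where \<open>S\<^sub>0\<close> is the transpose tensored with the antipode of
  \<open>U\<close> (\<open>SH_eq\<close>). It follows from the uniqueness of antipodes (\<open>antipode_unique\<close>). Its square is conjugation by
  \<open>QH\<^sup>-\<^sup>1 S\<^sub>0(QH) (1 \<otimes> K\<^sup>-\<^sup>1)\<close>, so all depends on comparing \<open>S\<^sub>0(QH)\<close> with \<open>QH\<close>.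

  This comparison is explicit. The intertwining property of \<open>R\<close> forces the standard formula for it
  (\<open>universal_R_unique\<close>), and the dynamical equation is then solved by rational coefficients whose
  verification is a Newton interpolation identity (\<open>gauss_binomial_newton\<close>, \<open>X0_equation\<close>); a continuity
  argument identifies the prescribed solution at the given parameter (\<open>dynamical_X_eq\<close>). Since \<open>E\<^sup>n F\<^sup>n\<close> is
  a polynomial in the Casimir element on each weight (\<open>E_F_cas\<close>), \<open>Q(\<lambda>) P\<^sub>\<nu>\<close> is a terminating basic
  hypergeometric series evaluated at the Casimir element. With its denominators cleared, the series is a
  polynomial in \<open>A = \<Lambda> q\<^sup>2\<^sup>\<lambda>\<^sup>+\<^sup>\<nu>\<close> that satisfies a first order q-difference equation with a boundary term, because
  the series is cut off after \<open>\<ell>\<close> terms (\<open>Npoly_recurrence\<close>). Everything in this equation is symmetric under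
  \<open>\<nu> \<mapsto> - \<nu>\<close>, and it has only one monic solution of degree \<open>\<ell> - 1\<close>; hence the polynomial is symmetric as well
  (\<open>Npoly_symmetric\<close>). The same equation shows that \<open>Q(\<lambda>) P\<^sub>\<nu>\<close> is invertible on its weight (\<open>Qel_inverse\<close>). As \<open>S\<close>
  fixes the Casimir element and negates weights, \<open>S(Q(\<lambda> + \<mu>) P\<^sub>-\<^sub>\<mu>)\<close> is a scalar multiple of \<open>Q(\<lambda>) P\<^sub>\<mu>\<close>, and the scalar
  is \<open>q\<^sup>\<mu> y\<^sub>\<lambda> / y\<^sub>\<lambda>\<^sub>+\<^sub>\<mu>\<close> (\<open>S_Qel\<close>). The power \<open>q\<^sup>\<mu>\<close> is absorbed by \<open>K\<^sup>-\<^sup>1\<close>. What remains is \<open>QH hH = S\<^sub>0(QH) (1 \<otimes> K\<^sup>-\<^sup>1)\<close> for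
  \<open>hH = y S(y)\<^sup>-\<^sup>1\<close> (\<open>QH_hH\<close>).

  The other claims are consequences. Grouplikeness of \<open>hH\<close> comes from \<open>\<Delta>(1)\<close> being balanced over the
  source and target bases (\<open>comultH_1_balanced\<close>). The canonical isomorphism between \<open>A \<otimes> V\<^sup>*\<close> and the
  dual of \<open>A \<otimes> V\<close> is the transpose of the action of \<open>QH\<close>, so the identity for \<open>QH hH\<close> says that \<open>hH\<close> transports the pivotal structure given by \<open>K\<^sup>-\<^sup>1\<close>
  (\<open>transports_hH\<close>). Finally the matrix units tensored with a PBW basis of \<open>U\<close> are eigenvectors of the
  square of the antipode, and counting weights gives the characteristic polynomial (\<open>char_poly_SH_SH\<close>). That
  the monomials are a basis of the algebra given by generators and relations (\<open>pbw_basis\<close>) is seen on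
  tensor products of Verma modules.
\<close>

section \<open>Linear maps, tensor products and dual bases\<close>

lemma clinear_0: "clinear f \<Longrightarrow> f 0 = 0"
  by (rule cvecp.linear_0)

lemma clinear_diff: "clinear f \<Longrightarrow> f (x - y) = f x - f y"
  by (rule cvecp.linear_diff)

lemma clinear_neg: "clinear f \<Longrightarrow> f (- x) = - f x"
  by (rule cvecp.linear_neg)

lemma clinear_sum: "clinear f \<Longrightarrow> f (\<Sum>i\<in>A. h i) = (\<Sum>i\<in>A. f (h i))"
  by (rule cvecp.linear_sum)

lemma clinear_id: "clinear (\<lambda>x. x)"
  by (rule clinearI) simp_all

lemma clinear_compose: "clinear f \<Longrightarrow> clinear g \<Longrightarrow> clinear (\<lambda>x. g (f x))"
  by (rule clinearI) (simp_all add: clinear_add clinear_scaleC)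

lemma clinear_sum_fun: "(\<And>i. clinear (f i)) \<Longrightarrow> clinear (\<lambda>x. \<Sum>i\<in>A. f i x)"
  by (rule clinearI) (simp_all add: clinear_add clinear_scaleC sum.distrib cvec.scale_sum_right)

lemma clinear_mult_const: "clinear f \<Longrightarrow> clinear (\<lambda>x. a * f x)"
    "clinear f \<Longrightarrow> clinear (\<lambda>x. f x * a)" for a :: "'a::complex_alg"
  by (rule clinearI; simp add: clinear_add clinear_scaleC algebra_simps scaleC_mult_left
      scaleC_mult_right)+

lemma clinear_vec: "clinear f \<Longrightarrow> clinear (\<lambda>x. f x *\<^sub>C v)"
  by (rule clinearI)
    (simp_all add: clinear_add clinear_scaleC scaleC_add_left scaleC_complex_def scaleC_scaleC)

lemma clinear_tens: "clinear f \<Longrightarrow> clinear (\<lambda>x. a \<boxtimes> f x)" "clinear f \<Longrightarrow> clinear (\<lambda>x. f x \<boxtimes> b)"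
  by (rule clinearI; simp add: clinear_add clinear_scaleC tens_simps)+

lemma tens_0 [simp]: "a \<boxtimes> 0 = 0" "0 \<boxtimes> b = 0"
  using clinear_0[OF clinear_tens(1)[OF clinear_id]] clinear_0[OF clinear_tens(2)[OF clinear_id]]
  by blast+

lemma tens_sum: "a \<boxtimes> (\<Sum>i\<in>A. f i) = (\<Sum>i\<in>A. a \<boxtimes> f i)" "(\<Sum>i\<in>A. f i) \<boxtimes> b = (\<Sum>i\<in>A. f i \<boxtimes> b)"
  by (rule clinear_sum, intro clinear_tens clinear_id)+

lemma cbilinear_compose:
  "cbilinear f \<Longrightarrow> clinear g \<Longrightarrow> clinear h \<Longrightarrow> cbilinear (\<lambda>a b. f (g a) (h b))"
  by (rule cbilinearI) (simp_all add: clinear_add clinear_scaleC cbilinearD)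

lemma cbilinear_post: "cbilinear f \<Longrightarrow> clinear g \<Longrightarrow> cbilinear (\<lambda>a b. g (f a b))"
  by (rule cbilinearI) (simp_all add: clinear_add clinear_scaleC cbilinearD)

lemma cbilinear_mult: "cbilinear (\<lambda>a b. a * b :: 'a::complex_alg)"
  by (rule cbilinearI) (simp_all add: algebra_simps scaleC_mult_left scaleC_mult_right)

lemma cbilinear_scale: "cbilinear (\<lambda>(a::complex) b. a *\<^sub>C b)"
  by (rule cbilinearI)
    (simp_all add: scaleC_add_left scaleC_add_right scaleC_scaleC scaleC_complex_def mult.commute)

lemma cbilinear_scale': "cbilinear (\<lambda>b (a::complex). a *\<^sub>C b)"
  by (rule cbilinearI)
    (simp_all add: scaleC_add_left scaleC_add_right scaleC_scaleC scaleC_complex_def mult.commute)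

lemma cbilinear_cmult: "clinear f \<Longrightarrow> clinear h \<Longrightarrow> cbilinear (\<lambda>a b. f a * h b :: complex)"
  by (rule cbilinear_compose[OF cbilinear_mult])

lemma tensor_lift_post: "clinear g \<Longrightarrow> g (tensor_lift f t) = tensor_lift (\<lambda>a b. g (f a b)) t"
  by (simp add: tensor_lift_def free_ext_def clinear_sum clinear_scaleC case_prod_unfold)

lemma tensor_lift_map:
  assumes "cbilinear f" "clinear g" "clinear h"
  shows "tensor_lift f (tensor_map g h t) = tensor_lift (\<lambda>a b. f (g a) (h b)) t"
  unfolding tensor_map_def
  by (subst tensor_lift_post[OF clinear_tensor_lift]) (simp_all add: assms tensor_lift_tens)

lemma tensor_map_tens:
  "clinear g \<Longrightarrow> clinear h \<Longrightarrow> tensor_map g h (a \<boxtimes> b) = g a \<boxtimes> h b"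
  unfolding tensor_map_def by (rule tensor_lift_tens, rule cbilinear_compose[OF cbilinear_tens])

lemma clinear_tensor_map: "clinear g \<Longrightarrow> clinear h \<Longrightarrow> clinear (tensor_map g h)"
  unfolding tensor_map_def by (intro clinear_tensor_lift cbilinear_compose[OF cbilinear_tens])

lemma clinear_tensor_eqI:
  assumes "clinear f" "clinear g" "\<And>a b. f (a \<boxtimes> b) = g (a \<boxtimes> b)"
  shows "f t = g t"
  by (induction t rule: tensor_induct) (simp_all add: assms clinear_add)

lemma clinear_flip: "clinear (tensor_flip :: ('a::complex_vec, 'b::complex_vec) tensor \<Rightarrow> _)"
  unfolding tensor_flip_def by (rule clinear_tensor_lift) (rule cbilinearI; simp add: tens_simps)

lemma tensor_flip_tens: "tensor_flip (a \<boxtimes> b) = b \<boxtimes> a"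
  unfolding tensor_flip_def by (rule tensor_lift_tens) (rule cbilinearI; simp add: tens_simps)

lemma clinear_eq_if_functionals_eq:
  assumes "\<And>f :: 'a::complex_vec \<Rightarrow> complex. clinear f \<Longrightarrow> f x = f y"
  shows "x = y"
proof (rule ccontr)
  assume "x \<noteq> y"
  then obtain f :: "'a \<Rightarrow> complex" where "clinear f" "f (x - y) = 1"
    using ex_clinear_functional[of "x - y"] by auto
  with assms[of f] show False by (simp add: clinear_diff)
qed

text \<open>A basis is carried together with its coordinate functionals, so that comparing coefficients
  means applying functionals; this passes to tensor products.\<close>

definition dual_basis ::
  "'i set \<Rightarrow> ('i \<Rightarrow> 'a::complex_vec) \<Rightarrow> ('i \<Rightarrow> 'a \<Rightarrow> complex) \<Rightarrow> bool" where
  "dual_basis I b c \<longleftrightarrow> finite I \<and> (\<forall>i. clinear (c i)) \<and>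
     (\<forall>i\<in>I. \<forall>j\<in>I. c i (b j) = (if i = j then 1 else 0)) \<and> (\<forall>x. (\<Sum>i\<in>I. c i x *\<^sub>C b i) = x)"

lemma dual_basisD:
  assumes "dual_basis I b c"
  shows "finite I" "clinear (c i)" "i \<in> I \<Longrightarrow> j \<in> I \<Longrightarrow> c i (b j) = (if i = j then 1 else 0)"
    "(\<Sum>i\<in>I. c i x *\<^sub>C b i) = x"
  using assms by (auto simp: dual_basis_def)

lemma dual_basis_exists:
  fixes b :: "'i \<Rightarrow> 'a::complex_vec"
  assumes fin: "finite I"
    and indep: "\<And>\<alpha> i. (\<Sum>i\<in>I. \<alpha> i *\<^sub>C b i) = 0 \<Longrightarrow> i \<in> I \<Longrightarrow> \<alpha> i = 0"
    and span: "\<And>x. \<exists>\<alpha>. x = (\<Sum>i\<in>I. \<alpha> i *\<^sub>C b i)"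
  shows "\<exists>c. dual_basis I b c"
proof -
  from span obtain \<alpha> where \<alpha>: "\<And>x. x = (\<Sum>i\<in>I. \<alpha> x i *\<^sub>C b i)" by metis
  have uniq: "\<beta> i = \<alpha> x i" if "x = (\<Sum>i\<in>I. \<beta> i *\<^sub>C b i)" "i \<in> I" for x \<beta> i
  proof -
    have "(\<Sum>i\<in>I. (\<beta> i - \<alpha> x i) *\<^sub>C b i) = 0"
      by (simp add: cvec.scale_left_diff_distrib sum_subtractf that(1)[symmetric] \<alpha>[symmetric])
    from indep[OF this that(2)] show ?thesis by simp
  qed
  define c where "c i x = (if i \<in> I then \<alpha> x i else 0)" for i x
  have "clinear (c i)" for i
  proof (rule clinearI)
    fix x y k
    have "i \<in> I \<Longrightarrow> \<alpha> x i + \<alpha> y i = \<alpha> (x + y) i"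
      by (rule uniq) (simp_all add: scaleC_add_left sum.distrib \<alpha>[symmetric])
    then show "c i (x + y) = c i x + c i y" by (simp add: c_def)
    have "k *\<^sub>C x = (\<Sum>i\<in>I. (k * \<alpha> x i) *\<^sub>C b i)"
      using arg_cong[OF \<alpha>[of x], of "scaleC k"] by (simp only: cvec.scale_sum_right scaleC_scaleC)
    then have "i \<in> I \<Longrightarrow> k * \<alpha> x i = \<alpha> (k *\<^sub>C x) i" by (rule uniq)
    then show "c i (k *\<^sub>C x) = k *\<^sub>C c i x" by (simp add: c_def scaleC_complex_def)
  qed
  moreover have "c i (b j) = (if i = j then 1 else 0)" if "i \<in> I" "j \<in> I" for i j
  proof -
    have "(if i = j then 1 else 0) = \<alpha> (b j) i"
      by (rule uniq[of _ "\<lambda>i. if i = j then 1 else 0"])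
        (use that fin in \<open>simp_all add: if_distrib[of "\<lambda>k. k *\<^sub>C _"] scaleC_one cong: if_cong\<close>)
    then show ?thesis using that by (simp add: c_def)
  qed
  moreover have "(\<Sum>i\<in>I. c i x *\<^sub>C b i) = x" for x
    by (simp add: c_def \<alpha>[symmetric])
  ultimately show ?thesis using fin unfolding dual_basis_def by blast
qed

lemma dual_basis_coord_sum:
  assumes "dual_basis I b c" "i \<in> I"
  shows "c i (\<Sum>j\<in>I. \<alpha> j *\<^sub>C b j) = \<alpha> i"
proof -
  have "c i (\<Sum>j\<in>I. \<alpha> j *\<^sub>C b j) = (\<Sum>j\<in>I. if i = j then \<alpha> j else 0)"
    unfolding clinear_sum[OF dual_basisD(2)[OF assms(1)]]
    by (rule sum.cong)
      (use assms in \<open>auto simp: dual_basisD(3)[OF assms(1)] clinear_scaleC[OF dual_basisD(2)[OF assms(1)]] scaleC_complex_def\<close>)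
  also have "\<dots> = \<alpha> i" using assms(2) dual_basisD(1)[OF assms(1)] by simp
  finally show ?thesis .
qed

definition tensor_coord :: "('a::complex_vec \<Rightarrow> complex) \<Rightarrow> ('b::complex_vec \<Rightarrow> complex) \<Rightarrow>
    ('a, 'b) tensor \<Rightarrow> complex" where
  "tensor_coord f h = tensor_lift (\<lambda>a b. f a * h b)"

lemma clinear_tensor_coord: "clinear f \<Longrightarrow> clinear h \<Longrightarrow> clinear (tensor_coord f h)"
  unfolding tensor_coord_def by (intro clinear_tensor_lift cbilinear_cmult)

lemma tensor_coord_tens: "clinear f \<Longrightarrow> clinear h \<Longrightarrow> tensor_coord f h (a \<boxtimes> b) = f a * h b"
  unfolding tensor_coord_def by (intro tensor_lift_tens cbilinear_cmult)

lemma dual_basis_tensor: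
  assumes b: "dual_basis I b c" and d: "dual_basis J d e"
  shows "dual_basis (I \<times> J) (\<lambda>(i, j). b i \<boxtimes> d j) (\<lambda>(i, j). tensor_coord (c i) (e j))"
proof -
  note lin = dual_basisD(2)[OF b] dual_basisD(2)[OF d]
  have lin2: "clinear (tensor_coord (c i) (e j))" for i j
    by (rule clinear_tensor_coord[OF lin])
  have "(\<Sum>(i, j)\<in>I \<times> J. tensor_coord (c i) (e j) t *\<^sub>C (b i \<boxtimes> d j)) = t" for t
  proof (rule clinear_tensor_eqI[where g = "\<lambda>t. t"])
    show "clinear (\<lambda>t. \<Sum>(i, j)\<in>I \<times> J. tensor_coord (c i) (e j) t *\<^sub>C (b i \<boxtimes> d j))"
      unfolding case_prod_unfold by (intro clinear_sum_fun clinear_vec lin2)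
    fix x y
    have "x \<boxtimes> y = (\<Sum>i\<in>I. c i x *\<^sub>C b i) \<boxtimes> (\<Sum>j\<in>J. e j y *\<^sub>C d j)"
      by (simp add: dual_basisD(4)[OF b] dual_basisD(4)[OF d])
    also have "\<dots> = (\<Sum>(i, j)\<in>I \<times> J. tensor_coord (c i) (e j) (x \<boxtimes> y) *\<^sub>C (b i \<boxtimes> d j))"
      unfolding sum.cartesian_product[symmetric]
      by (simp add: tens_sum tens_simps scaleC_scaleC tensor_coord_tens[OF lin] mult.commute
          cvec.scale_sum_right) (rule sum.swap)
    finally show "(\<Sum>(i, j)\<in>I \<times> J. tensor_coord (c i) (e j) (x \<boxtimes> y) *\<^sub>C (b i \<boxtimes> d j)) = x \<boxtimes> y" ..
  qed (rule clinear_id)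
  then show ?thesis
    using b d lin lin2 unfolding dual_basis_def case_prod_unfold
    by (auto simp: tensor_coord_tens[OF lin])
qed

section \<open>Units, homomorphisms and evaluation of polynomials\<close>

lemma alg_inv_eqI:
  fixes x y :: "'a::monoid_mult"
  assumes "x * y = 1" "y * x = 1"
  shows "alg_inv x = y"
  unfolding alg_inv_def
proof (rule the_equality)
  fix z assume "x * z = 1 \<and> z * x = 1"
  then show "z = y" by (metis assms mult.assoc mult_1_left mult_1_right)
qed (use assms in simp)

lemma unit_elemI: "x * y = 1 \<Longrightarrow> y * x = 1 \<Longrightarrow> unit_elem x"
  by (auto simp: unit_elem_def)

lemma alg_inv_cancel:
  assumes "unit_elem x"
  shows "x * alg_inv x = 1" "alg_inv x * x = 1"
  using assms alg_inv_eqI[of x] unfolding unit_elem_def by auto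

lemma alg_homD:
  assumes "alg_hom f"
  shows "clinear f" "f 1 = 1" "f (x * y) = f x * f y"
  using assms by (auto simp: alg_hom_def)

lemma alg_hom_power:
  assumes "alg_hom f"
  shows "f (x ^ n) = f x ^ n"
  by (induction n) (simp_all add: alg_homD[OF assms])

lemma alg_antihomD:
  assumes "alg_antihom f"
  shows "clinear f" "f 1 = 1" "f (x * y) = f y * f x"
  using assms by (auto simp: alg_antihom_def)

lemma alg_antihom_power:
  assumes "alg_antihom f"
  shows "f (x ^ n) = f x ^ n"
  by (induction n) (simp_all add: alg_antihomD[OF assms] power_commutes)

lemma alg_hom_prod_list:
  assumes "alg_hom f"
  shows "f (prod_list w) = prod_list (map f w)"
  by (induction w) (simp_all add: alg_homD[OF assms])

lemma alg_hom_id: "alg_hom (\<lambda>x. x)" "alg_hom id"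
  by (simp_all add: alg_hom_def clinear_id id_def)

text \<open>The multiplicativity assumption holds for \<open>m a b = f a * h b\<close> with algebra maps \<open>f\<close> and \<open>h\<close>
  whose images commute, and for outer products of representations.\<close>

lemma alg_hom_tensor_lift:
  assumes "cbilinear m" "m 1 1 = 1"
    and "\<And>a b c d. m (a * c) (b * d) = m a b * m c d"
  shows "alg_hom (tensor_lift m)"
proof -
  note l = clinear_tensor_lift[OF assms(1)]
  note s = tensor_lift_tens[OF assms(1)]
  have "tensor_lift m (t * u) = tensor_lift m t * tensor_lift m u" for t u
  proof (induction t rule: tensor_induct)
    case (1 a b)
    show ?case
      by (induction u rule: tensor_induct)
        (simp_all add: tens_mult_tens s clinear_add[OF l] distrib_left assms)
  qed (simp add: clinear_add[OF l] distrib_right)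
  then show ?thesis using l s unfolding alg_hom_def
    by (simp add: one_tensor_def assms)
qed

text \<open>Evaluation of a polynomial at an element of a complex algebra, which need not be commutative.\<close>

definition aeval :: "'a::complex_alg \<Rightarrow> complex poly \<Rightarrow> 'a" where
  "aeval x p = fold_coeffs (\<lambda>a y. a *\<^sub>C 1 + x * y) p 0"

lemma aeval_0 [simp]: "aeval x 0 = 0"
  by (simp add: aeval_def)

lemma aeval_pCons: "aeval x (pCons a p) = a *\<^sub>C 1 + x * aeval x p"
  by (cases "p = 0 \<and> a = 0") (auto simp: aeval_def)

lemma aeval_1 [simp]: "aeval x 1 = 1"
  by (simp add: one_pCons aeval_pCons scaleC_one)

lemma aeval_add: "aeval x (p + r) = aeval x p + aeval x r"
  by (induction p r rule: poly_induct2)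
    (simp_all add: aeval_pCons scaleC_add_left algebra_simps)

lemma aeval_smult: "aeval x (Polynomial.smult c p) = c *\<^sub>C aeval x p"
  by (induction p) (simp_all add: aeval_pCons scaleC_add_right scaleC_scaleC scaleC_mult_right)

lemma aeval_mult: "aeval x (p * r) = aeval x p * aeval x r"
  by (induction p)
    (simp_all add: aeval_pCons aeval_add aeval_smult algebra_simps scaleC_mult_left mult.assoc)

lemma aeval_sum: "aeval x (\<Sum>i\<in>A. f i) = (\<Sum>i\<in>A. aeval x (f i))"
  by (induction A rule: infinite_finite_induct) (simp_all add: aeval_add)

lemma aeval_commute: "x * y = y * x \<Longrightarrow> aeval x p * y = y * aeval x p"
proof (induction p)
  case (pCons a p)
  then have IH: "aeval x p * y = y * aeval x p" by blast
  have "x * aeval x p * y = x * y * aeval x p" unfolding mult.assoc IH ..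
  also have "\<dots> = y * x * aeval x p" unfolding pCons.prems ..
  finally have "x * aeval x p * y = y * (x * aeval x p)" unfolding mult.assoc .
  then show ?case
    by (simp add: aeval_pCons distrib_left distrib_right scaleC_mult_left scaleC_mult_right)
qed simp

lemma aeval_antihom:
  assumes "alg_antihom f"
  shows "f (aeval x p) = aeval (f x) p"
proof (induction p)
  case (pCons a p)
  have "aeval (f x) p * f x = f x * aeval (f x) p" by (rule aeval_commute) simp
  with pCons show ?case
    by (simp add: aeval_pCons clinear_add[OF alg_antihomD(1)[OF assms]]
        clinear_scaleC[OF alg_antihomD(1)[OF assms]] alg_antihomD[OF assms])
qed (simp add: clinear_0[OF alg_antihomD(1)[OF assms]])

section \<open>Algebras given by generators and relations\<close>

text \<open>The universal property of the free algebra: the extension of a choice of images of the generators.\<close>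

definition free_eval :: "('g \<Rightarrow> 'a::complex_alg) \<Rightarrow> ('g word \<Rightarrow>\<^sub>0 complex) \<Rightarrow> 'a" where
  "free_eval G p = (\<Sum>w\<in>Poly_Mapping.keys p. Poly_Mapping.lookup p w *\<^sub>C prod_list (map G (letters w)))"

lemma free_eval_superset:
  assumes "finite A" "Poly_Mapping.keys p \<subseteq> A"
  shows "free_eval G p = (\<Sum>w\<in>A. Poly_Mapping.lookup p w *\<^sub>C prod_list (map G (letters w)))"
  unfolding free_eval_def
  by (rule sum.mono_neutral_left) (use assms in \<open>auto simp: in_keys_iff\<close>)

lemma clinear_free_eval: "clinear (free_eval G)"
proof (rule clinearI)
  fix p r :: "'a word \<Rightarrow>\<^sub>0 complex" and c
  have *: "Poly_Mapping.keys (p + r) \<subseteq> Poly_Mapping.keys p \<union> Poly_Mapping.keys r"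
    by (rule Poly_Mapping.keys_add)
  show "free_eval G (p + r) = free_eval G p + free_eval G r"
    by (subst (1 2 3) free_eval_superset[of "Poly_Mapping.keys p \<union> Poly_Mapping.keys r"])
      (use * in \<open>auto simp: lookup_add scaleC_add_left sum.distrib\<close>)
  show "free_eval G (c *\<^sub>C p) = c *\<^sub>C free_eval G p"
    by (subst (1 2) free_eval_superset[of "Poly_Mapping.keys p"])
      (auto simp: lookup_scaleC cvec.scale_sum_right in_keys_iff scaleC_complex_def scaleC_scaleC)
qed

lemma free_eval_single:
  "free_eval G (Poly_Mapping.single w c) = c *\<^sub>C prod_list (map G (letters w))"
  by (cases "c = 0") (simp_all add: free_eval_def)

lemma alg_hom_free_eval: "alg_hom (free_eval G)"
proof -
  note l = clinear_free_eval[of G]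
  have "free_eval G (p * r) = free_eval G p * free_eval G r" for p r
  proof (induction p rule: poly_mapping_single_induct)
    case (1 k v)
    show ?case
      by (induction r rule: poly_mapping_single_induct)
        (simp_all add: mult_single free_eval_single plus_word_def scaleC_mult_left
          scaleC_mult_right scaleC_scaleC clinear_add[OF l] distrib_left)
  qed (simp add: clinear_add[OF l] distrib_right)
  moreover have "free_eval G 1 = 1"
    unfolding single_one[symmetric] free_eval_single by (simp add: zero_word_def scaleC_one)
  ultimately show ?thesis using l by (simp add: alg_hom_def)
qed

lemma free_eval_gen: "free_eval G (free_gen x) = G x"
  by (simp add: free_gen_def free_eval_single scaleC_one)

lemmas free_eval_simps = free_eval_gen alg_homD(2,3)[OF alg_hom_free_eval]
  alg_hom_power[OF alg_hom_free_eval] clinear_diff[OF clinear_free_eval]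
  clinear_scaleC[OF clinear_free_eval]

lemma free_alg_hom_unique:
  assumes "alg_hom \<phi>" "\<And>x. \<phi> (free_gen x) = G x"
  shows "\<phi> p = free_eval G p"
proof (induction p rule: poly_mapping_single_induct)
  case (1 w c)
  have "\<phi> (Poly_Mapping.single (Word xs) 1) = prod_list (map G xs)" for xs
  proof (induction xs)
    case Nil
    show ?case using alg_homD(2)[OF assms(1)]
      by (simp add: zero_word_def[symmetric])
  next
    case (Cons x xs)
    have "Poly_Mapping.single (Word (x # xs)) (1::complex) = free_gen x * Poly_Mapping.single (Word xs) 1"
      by (simp add: free_gen_def mult_single plus_word_def)
    then show ?case using Cons assms(2) by (simp add: alg_homD[OF assms(1)])
  qed
  from this[of "letters w"] have "\<phi> (c *\<^sub>C Poly_Mapping.single w 1) = c *\<^sub>C prod_list (map G (letters w))"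
    by (simp add: clinear_scaleC[OF alg_homD(1)[OF assms(1)]])
  then show ?case by (simp add: scaleC_single scaleC_complex_def free_eval_single)
next
  case (2 p r)
  then show ?case
    by (simp add: clinear_add[OF alg_homD(1)[OF assms(1)]] clinear_add[OF clinear_free_eval])
qed

lemma presented_by_free_eval:
  assumes "presented_by Rel g"
  shows "surj (free_eval g)" "{p. free_eval g p = 0} = ideal_gen Rel"
proof -
  obtain \<phi> where \<phi>: "alg_hom \<phi>" "\<And>x. \<phi> (free_gen x) = g x" "surj \<phi>" "{p. \<phi> p = 0} = ideal_gen Rel"
    using assms unfolding presented_by_def by auto
  have "\<phi> = free_eval g" by (rule ext) (rule free_alg_hom_unique[OF \<phi>(1,2)])
  with \<phi>(3,4) show "surj (free_eval g)" "{p. free_eval g p = 0} = ideal_gen Rel" by simp_all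
qed

lemma presented_by_relation: "presented_by Rel g \<Longrightarrow> r \<in> Rel \<Longrightarrow> free_eval g r = 0"
proof -
  assume *: "presented_by Rel g" "r \<in> Rel"
  have "1 * r * 1 \<in> {a * r * b | a r b. r \<in> Rel}" using *(2) by blast
  then have "r \<in> ideal_gen Rel" unfolding ideal_gen_def by (intro cvec.span_base) simp
  then show ?thesis using presented_by_free_eval(2)[OF *(1)] by blast
qed

lemma presented_by_induct [consumes 1, case_names word add scale]:
  assumes "presented_by Rel g"
    and "\<And>w. Q (prod_list (map g w))" "\<And>x y. Q x \<Longrightarrow> Q y \<Longrightarrow> Q (x + y)" "\<And>c x. Q x \<Longrightarrow> Q (c *\<^sub>C x)"
  shows "Q x"
proof -
  have "Q (free_eval g p)" for p
    by (induction p rule: poly_mapping_single_induct)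
      (simp_all add: free_eval_single assms clinear_add[OF clinear_free_eval])
  then show ?thesis using presented_by_free_eval(1)[OF assms(1)] by (metis surjD)
qed

text \<open>The kernel of the presentation is the ideal generated by the relators, so evaluation at \<open>G\<close>
  factors through it; this is how representations of the small quantum group are constructed.\<close>

lemma presented_by_lift:
  assumes pres: "presented_by Rel g" and rel: "\<And>r. r \<in> Rel \<Longrightarrow> free_eval G r = 0"
  shows "\<exists>\<psi>. alg_hom \<psi> \<and> (\<forall>x. \<psi> (g x) = G x)"
proof -
  note l = clinear_free_eval[of G]
  have ker: "free_eval G p = 0" if "free_eval g p = 0" for p
  proof -
    from that have "p \<in> ideal_gen Rel" using presented_by_free_eval(2)[OF pres] by blast
    then have "p \<in> cvec.span {a * r * b | a r b. r \<in> Rel}" by (simp add: ideal_gen_def)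
    moreover have "free_eval G x = 0" if "x \<in> {a * r * b | a r b. r \<in> Rel}" for x
      using that rel by (auto simp: alg_homD[OF alg_hom_free_eval])
    ultimately show ?thesis using cvecp.linear_eq_0_on_span[OF l] by blast
  qed
  have eq: "free_eval G p = free_eval G p'" if "free_eval g p = free_eval g p'" for p p'
    using ker[of "p - p'"] that by (simp add: clinear_diff[OF clinear_free_eval])
  define pre where "pre x = (SOME p. free_eval g p = x)" for x
  have pre: "free_eval g (pre x) = x" for x
    unfolding pre_def using presented_by_free_eval(1)[OF pres] by (metis (mono_tags) someI surjD)
  define \<psi> where "\<psi> x = free_eval G (pre x)" for x
  have \<psi>: "\<psi> (free_eval g p) = free_eval G p" for p
    unfolding \<psi>_def by (rule eq) (simp add: pre)
  have "alg_hom \<psi>"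
    unfolding alg_hom_def
  proof (intro conjI allI clinearI)
    fix x y c
    show "\<psi> (x + y) = \<psi> x + \<psi> y"
      using \<psi>[of "pre x + pre y"] by (simp add: pre \<psi>_def clinear_add[OF clinear_free_eval])
    show "\<psi> (c *\<^sub>C x) = c *\<^sub>C \<psi> x"
      using \<psi>[of "c *\<^sub>C pre x"] by (simp add: pre \<psi>_def clinear_scaleC[OF clinear_free_eval])
    show "\<psi> 1 = 1"
      using \<psi>[of 1] by (simp add: alg_homD[OF alg_hom_free_eval])
    show "\<psi> (x * y) = \<psi> x * \<psi> y"
      using \<psi>[of "pre x * pre y"] by (simp add: pre \<psi>_def alg_homD[OF alg_hom_free_eval])
  qed
  moreover have "\<psi> (g x) = G x" for x
    using \<psi>[of "free_gen x"] by (simp add: free_eval_gen)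
  ultimately show ?thesis by blast
qed

lemma presented_by_alg_hom_eqI:
  assumes "presented_by Rel g" "alg_hom \<phi>" "alg_hom \<psi>" "\<And>x. \<phi> (g x) = \<psi> (g x)"
  shows "\<phi> x = \<psi> x"
  using assms(1)
proof (induction x rule: presented_by_induct)
  case (word w)
  show ?case by (simp add: alg_hom_prod_list[OF assms(2)] alg_hom_prod_list[OF assms(3)] assms(4) comp_def)
qed (simp_all add: clinear_add[OF alg_homD(1)[OF assms(2)]] clinear_add[OF alg_homD(1)[OF assms(3)]]
    clinear_scaleC[OF alg_homD(1)[OF assms(2)]] clinear_scaleC[OF alg_homD(1)[OF assms(3)]])

section \<open>Characters of the cyclic group\<close>

text \<open>The argument \<open>ty\<close> only serves to fix the type \<open>'n mod_ring\<close>, a copy of \<open>\<int>/\<ell>\<close>; \<open>\<chi> \<mu>\<close> is \<open>q\<^sup>\<mu>\<close>.\<close>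

locale root_of_unity_card =
  fixes q :: complex and ty :: "'n::nontriv itself"
  assumes prim: "q ^ k = 1 \<longleftrightarrow> CARD('n) dvd k" and odd_card: "odd CARD('n)"
begin

abbreviation \<chi> :: "'n mod_ring \<Rightarrow> complex" where "\<chi> \<equiv> qpow q"

lemma card_gt: "CARD('n) > 1"
  by (rule nontriv)

lemma q_nz [simp]: "q \<noteq> 0"
proof
  assume "q = 0"
  then have "q ^ CARD('n) = 0" using card_gt by simp
  moreover have "q ^ CARD('n) = 1" by (simp add: prim)
  ultimately show False by simp
qed

lemma powi_card: "q powi (int CARD('n)) = 1"
  by (simp add: power_int_def prim)

lemma chi_of_int: "\<chi> (of_int k) = q powi k"
proof -
  have *: "to_int_mod_ring (of_int k :: 'n mod_ring) = k mod int CARD('n)"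
    by (simp add: of_int_of_int_mod_ring) (transfer, simp)
  have "k = k mod int CARD('n) + int CARD('n) * (k div int CARD('n))" by simp
  then have "q powi k = q powi (k mod int CARD('n) + int CARD('n) * (k div int CARD('n)))"
    by (rule arg_cong)
  also have "\<dots> = q powi (k mod int CARD('n))"
    unfolding power_int_add[OF disjI1[OF q_nz]] power_int_mult powi_card by simp
  finally show ?thesis by (simp add: qpow_def *)
qed

lemma of_int_to_int [simp]: "of_int (to_int_mod_ring (\<mu> :: 'n mod_ring)) = \<mu>"
  by (simp add: of_int_of_int_mod_ring)

lemma chi_0 [simp]: "\<chi> 0 = 1"
  using chi_of_int[of 0] by simp

lemma chi_1 [simp]: "\<chi> 1 = q"
  using chi_of_int[of 1] by simp

lemma chi_add: "\<chi> (\<mu> + \<nu>) = \<chi> \<mu> * \<chi> \<nu>"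
proof -
  have "\<chi> (\<mu> + \<nu>) = \<chi> (of_int (to_int_mod_ring \<mu> + to_int_mod_ring \<nu>))" by simp
  also have "\<dots> = \<chi> (of_int (to_int_mod_ring \<mu>)) * \<chi> (of_int (to_int_mod_ring \<nu>))"
    unfolding chi_of_int by (simp add: power_int_add)
  finally show ?thesis by simp
qed

lemma chi_nz [simp]: "\<chi> \<mu> \<noteq> 0"
  by (simp add: qpow_def)

lemma chi_neg: "\<chi> (- \<mu>) = inverse (\<chi> \<mu>)"
  using chi_add[of \<mu> "- \<mu>"] by (simp add: field_simps)

lemma chi_diff: "\<chi> (\<mu> - \<nu>) = \<chi> \<mu> * inverse (\<chi> \<nu>)"
  using chi_add[of \<mu> "- \<nu>"] by (simp add: chi_neg)

lemma chi_of_nat_mult: "\<chi> (of_nat n * \<mu>) = \<chi> \<mu> ^ n"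
  by (induction n) (simp_all add: chi_add algebra_simps)

lemma chi_of_nat: "\<chi> (of_nat n) = q ^ n"
  using chi_of_nat_mult[of n 1] by simp

lemma chi_2: "\<chi> 2 = q ^ 2"
  using chi_of_nat[of 2] by simp

lemma chi_2_mult: "\<chi> (2 * \<mu>) = \<chi> \<mu> ^ 2"
  using chi_of_nat_mult[of 2 \<mu>] by simp

lemma chi_2_of_nat: "\<chi> (2 * of_nat n) = (q ^ 2) ^ n"
  unfolding chi_2_mult chi_of_nat power_mult[symmetric] by (simp add: mult.commute)

lemma chi_card: "\<chi> \<mu> ^ CARD('n) = 1"
  using chi_of_nat_mult[of "CARD('n)" \<mu>] by simp

lemma chi_eq_1: "\<chi> \<mu> = 1 \<longleftrightarrow> \<mu> = 0"
proof
  assume *: "\<chi> \<mu> = 1"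
  define k where "k = nat (to_int_mod_ring \<mu>)"
  have r: "0 \<le> to_int_mod_ring \<mu> \<and> to_int_mod_ring \<mu> < int CARD('n)"
    using range_to_int_mod_ring[where 'a = 'n] by (metis atLeastLessThan_iff rangeI)
  then have "\<chi> \<mu> = q ^ k" by (simp add: qpow_def k_def power_int_def)
  with * have "CARD('n) dvd k" by (simp add: prim)
  moreover have "k < CARD('n)" using r by (simp add: k_def nat_less_iff)
  ultimately have "k = 0" by (auto dest: dvd_imp_le)
  then have "to_int_mod_ring \<mu> = 0" using r by (simp add: k_def)
  then show "\<mu> = 0" by (metis of_int_0 of_int_to_int)
qed simp

lemma chi_inj [simp]: "\<chi> \<mu> = \<chi> \<nu> \<longleftrightarrow> \<mu> = \<nu>"
  using chi_eq_1[of "\<mu> - \<nu>"] by (auto simp: chi_diff field_simps)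

lemma two_half: "(2 :: 'n mod_ring) * half_mod = 1"
proof -
  have "2 * ((CARD('n) + 1) div 2) = CARD('n) + 1" using odd_card by simp
  then have "(of_nat (2 * ((CARD('n) + 1) div 2)) :: 'n mod_ring) = of_nat (CARD('n) + 1)" by simp
  then show ?thesis unfolding half_mod_def by (simp del: of_nat_div)
qed

lemma two_cancel [simp]: "(2 :: 'n mod_ring) * \<mu> = 2 * \<nu> \<longleftrightarrow> \<mu> = \<nu>"
proof
  assume "2 * \<mu> = 2 * \<nu>"
  then have "half_mod * (2 * \<mu>) = half_mod * (2 * \<nu>)" by simp
  then show "\<mu> = \<nu>" using two_half by (simp add: mult.assoc[symmetric] mult.commute[of half_mod])
qed simp

text \<open>Since \<open>\<ell>\<close> is odd, shifting by even multiples reaches every residue exactly once.\<close>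

lemma bij_of_nat: "bij_betw (\<lambda>j. 2 * of_nat j + \<kappa> :: 'n mod_ring) {..<CARD('n)} UNIV"
proof -
  have "inj_on (\<lambda>j. 2 * of_nat j + \<kappa> :: 'n mod_ring) {..<CARD('n)}"
  proof (rule inj_onI)
    fix a b assume ab: "a \<in> {..<CARD('n)}" "b \<in> {..<CARD('n)}"
      and "2 * of_nat a + \<kappa> = 2 * of_nat b + (\<kappa> :: 'n mod_ring)"
    then have "2 * of_nat a = (2 * of_nat b :: 'n mod_ring)" by simp
    then have "of_nat a = (of_nat b :: 'n mod_ring)" by (simp only: two_cancel)
    then have "(of_int (int a) :: 'n mod_ring) = of_int (int b)" by simp
    then have "to_int_mod_ring (of_int_mod_ring (int a) :: 'n mod_ring) = to_int_mod_ring (of_int_mod_ring (int b) :: 'n mod_ring)"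
      by (simp only: of_int_of_int_mod_ring)
    moreover have "to_int_mod_ring (of_int_mod_ring (int a) :: 'n mod_ring) = int a"
        "to_int_mod_ring (of_int_mod_ring (int b) :: 'n mod_ring) = int b"
      using ab by (intro to_int_mod_ring_of_int_mod_ring; simp)+
    ultimately show "a = b" by simp
  qed
  moreover from this have "(\<lambda>j. 2 * of_nat j + \<kappa> :: 'n mod_ring) ` {..<CARD('n)} = UNIV"
    by (intro card_subset_eq) (simp_all add: card_image)
  ultimately show ?thesis by (simp add: bij_betw_def)
qed

lemma q2_pow: "(q ^ 2) ^ k = 1 \<longleftrightarrow> CARD('n) dvd k"
  unfolding power_mult[symmetric] prim using odd_card
  by (metis coprime_dvd_mult_right_iff coprime_right_2_iff_odd)

lemma q2_pow_less: "0 < k \<Longrightarrow> k < CARD('n) \<Longrightarrow> (q ^ 2) ^ k \<noteq> 1"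
  unfolding q2_pow by (auto dest: dvd_imp_le)

lemma q_pow_less: "0 < k \<Longrightarrow> k < CARD('n) \<Longrightarrow> q ^ k \<noteq> 1"
  unfolding prim by (auto dest: dvd_imp_le)

lemma q_inv_neq: "q - inverse q \<noteq> 0"
proof
  assume "q - inverse q = 0"
  then have "q ^ 2 = 1" by (simp add: power2_eq_square field_simps)
  then have "CARD('n) dvd 2" by (simp add: prim)
  then have "CARD('n) = 2" using card_gt by (auto dest: dvd_imp_le)
  then show False using odd_card by simp
qed

lemma chi_sum_vanish:
  assumes "\<mu> \<noteq> 0"
  shows "(\<Sum>\<nu>\<in>UNIV. \<chi> (\<mu> * \<nu>)) = 0"
proof -
  have "bij (\<lambda>\<nu> :: 'n mod_ring. \<nu> + 1)" by (rule bijI') (auto intro: exI[of _ "_ - 1"])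
  then have "(\<Sum>\<nu>\<in>UNIV. \<chi> (\<mu> * \<nu>)) = (\<Sum>\<nu>\<in>UNIV. \<chi> (\<mu> * (\<nu> + 1)))"
    by (rule sum.reindex_bij_betw[symmetric])
  also have "\<dots> = \<chi> \<mu> * (\<Sum>\<nu>\<in>UNIV. \<chi> (\<mu> * \<nu>))"
    by (simp add: distrib_left chi_add sum_distrib_left mult.commute)
  finally show ?thesis using assms by (simp add: chi_eq_1)
qed

lemma chi_sum_pow:
  assumes "j < CARD('n)"
  shows "(\<Sum>\<nu>\<in>UNIV. inverse (\<chi> \<nu>) ^ j) = (if j = 0 then of_nat CARD('n) else 0)"
proof (cases "j = 0")
  case False
  have "\<chi> (- of_nat j) \<noteq> 1"
    using q_pow_less[OF _ assms] False by (simp add: chi_neg chi_of_nat)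
  then have "- of_nat j \<noteq> (0 :: 'n mod_ring)" by (metis chi_0)
  from chi_sum_vanish[OF this] False show ?thesis
    by (simp add: chi_neg chi_of_nat_mult power_inverse)
qed simp

section \<open>Weight idempotents\<close>

text \<open>An element that commutes with \<open>K\<close> up to the scalar \<open>q\<^sup>-\<^sup>\<delta>\<close> shifts weights by \<open>\<delta>\<close>.\<close>

lemma weight_idem_cong:
  assumes "x * K = c *\<^sub>C (K * x)" "c * \<chi> \<delta> = 1"
  shows "x * weight_idem q K \<mu> = weight_idem q K (\<mu> + \<delta>) * (x :: 'u::complex_alg)"
proof -
  have *: "x * K ^ j = c ^ j *\<^sub>C (K ^ j * x)" for j
  proof (induction j)
    case (Suc j)
    have "x * K ^ Suc j = (x * K) * K ^ j" by (simp add: mult.assoc)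
    also have "\<dots> = c *\<^sub>C (K * (x * K ^ j))" by (simp add: assms(1) scaleC_mult_left mult.assoc)
    also have "\<dots> = c ^ Suc j *\<^sub>C (K ^ Suc j * x)"
      by (simp add: Suc scaleC_mult_right scaleC_scaleC mult.assoc)
    finally show ?case .
  qed (simp add: scaleC_one)
  have c: "c = inverse (\<chi> \<delta>)" using assms(2) by (simp add: field_simps)
  show ?thesis
    unfolding weight_idem_def scaleC_mult_left scaleC_mult_right sum_distrib_left sum_distrib_right *
      scaleC_scaleC c by (simp add: chi_add power_mult_distrib mult.commute)
qed

lemma weight_idem_eigen:
  assumes "K ^ CARD('n) = 1"
  shows "K * weight_idem q K \<mu> = \<chi> \<mu> *\<^sub>C (weight_idem q K \<mu> :: 'u::complex_alg)"
proof -
  let ?f = "\<lambda>j. inverse (\<chi> \<mu>) ^ j *\<^sub>C K ^ j"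
  have "sum ?f {..<Suc CARD('n)} = ?f 0 + (\<Sum>j<CARD('n). ?f (Suc j))"
    by (rule sum.lessThan_Suc_shift)
  moreover have "?f CARD('n) = ?f 0"
    using assms chi_card[of \<mu>] by (simp add: power_inverse)
  ultimately have *: "(\<Sum>j<CARD('n). ?f (Suc j)) = (\<Sum>j<CARD('n). ?f j)" by simp
  have "K * (\<Sum>j<CARD('n). ?f j) = \<chi> \<mu> *\<^sub>C (\<Sum>j<CARD('n). ?f (Suc j))"
    unfolding sum_distrib_left cvec.scale_sum_right
    by (intro sum.cong refl) (simp add: scaleC_mult_right scaleC_scaleC)
  then show ?thesis
    unfolding * weight_idem_def by (simp add: scaleC_mult_right scaleC_scaleC mult.commute)
qed

lemma weight_idem_eigenvector:
  assumes "K * x = \<chi> \<nu> *\<^sub>C (x :: 'u::complex_alg)"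
  shows "weight_idem q K \<mu> * x = (if \<mu> = \<nu> then x else 0)"
proof -
  have *: "K ^ j * x = \<chi> \<nu> ^ j *\<^sub>C x" for j
    by (induction j) (simp_all add: mult.assoc assms scaleC_one scaleC_mult_right scaleC_scaleC mult.commute)
  have "(inverse (\<chi> \<mu>) ^ j *\<^sub>C K ^ j) * x = \<chi> (\<nu> - \<mu>) ^ j *\<^sub>C x" for j
    by (simp add: scaleC_mult_left * scaleC_scaleC chi_diff power_mult_distrib mult.commute)
  then have "weight_idem q K \<mu> * x = (inverse (of_nat CARD('n)) * (\<Sum>j<CARD('n). \<chi> (\<nu> - \<mu>) ^ j)) *\<^sub>C x"
    unfolding weight_idem_def scaleC_mult_left sum_distrib_right scaleC_scaleC[symmetric]
      cvec.scale_sum_left by simp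
  also have "\<dots> = (if \<mu> = \<nu> then x else 0)"
  proof (cases "\<mu> = \<nu>")
    case False
    then have "\<chi> (\<nu> - \<mu>) \<noteq> 1" by (simp add: chi_eq_1)
    then have "(\<Sum>j<CARD('n). \<chi> (\<nu> - \<mu>) ^ j) = 0" by (simp add: geometric_sum chi_card)
    then show ?thesis using False by simp
  qed (simp add: scaleC_one)
  finally show ?thesis .
qed

lemma weight_idem_sum: "(\<Sum>\<mu>\<in>UNIV. weight_idem q K (\<mu> :: 'n mod_ring)) = (1 :: 'u::complex_alg)"
proof -
  have "(\<Sum>\<mu>\<in>UNIV. weight_idem q K (\<mu> :: 'n mod_ring)) =
      inverse (of_nat CARD('n)) *\<^sub>C (\<Sum>j<CARD('n). (\<Sum>\<mu>\<in>UNIV. inverse (\<chi> \<mu>) ^ j) *\<^sub>C K ^ j)"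
    unfolding weight_idem_def cvec.scale_sum_right[symmetric] cvec.scale_sum_left
    by (subst sum.swap) simp
  also have "\<dots> = inverse (of_nat CARD('n)) *\<^sub>C (\<Sum>j<CARD('n). if j = 0 then of_nat CARD('n) *\<^sub>C 1 else 0)"
    by (intro arg_cong[of _ _ "\<lambda>x. _ *\<^sub>C x"] sum.cong refl) (simp add: chi_sum_pow)
  also have "\<dots> = 1" by (simp add: scaleC_scaleC scaleC_one)
  finally show ?thesis .
qed

end

section \<open>Matrices\<close>

lemma sqmat_eqI: "(\<And>i j. entry A i j = entry B i j) \<Longrightarrow> A = B"
  by (metis entry_inject ext)

lemma entry_sqmat [simp]: "entry (sqmat f) = f"
  by (simp add: sqmat_inverse)

lemmas entry_simps = plus_sqmat.rep_eq minus_sqmat.rep_eq uminus_sqmat.rep_eq times_sqmat.rep_eq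
  zero_sqmat.rep_eq one_sqmat.rep_eq scaleC_sqmat.rep_eq

lemma entry_sum: "entry (\<Sum>x\<in>A. f x) i j = (\<Sum>x\<in>A. entry (f x) i j)"
  by (induction A rule: infinite_finite_induct) (simp_all add: entry_simps)

lemma entry_kron: "entry (kron A B) (i, k) (j, m) = entry A i j * entry B k m"
  by (simp add: kron_def)

lemma cbilinear_kron: "cbilinear (kron :: 'd::finite sqmat \<Rightarrow> 'e::finite sqmat \<Rightarrow> _)"
  by (rule cbilinearI; rule sqmat_eqI; clarsimp simp: entry_kron entry_simps algebra_simps)

lemma kron_one: "kron 1 1 = (1 :: ('d::finite \<times> 'e::finite) sqmat)"
  by (rule sqmat_eqI) (clarsimp simp: entry_kron entry_simps)

lemma kron_mult: "kron (A * C) (B * D) = kron A B * (kron C D :: ('d::finite \<times> 'e::finite) sqmat)"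
proof (rule sqmat_eqI, clarify)
  fix i k j m
  have "entry (kron A B * kron C D) (i, k) (j, m) =
      (\<Sum>x\<in>UNIV \<times> UNIV. entry (kron A B) (i, k) x * entry (kron C D) x (j, m))"
    unfolding UNIV_Times_UNIV by (simp add: entry_simps)
  also have "\<dots> = (\<Sum>a\<in>UNIV. \<Sum>b\<in>UNIV. entry A i a * entry C a j * (entry B k b * entry D b m))"
    unfolding sum.cartesian_product by (intro sum.cong refl) (auto simp: entry_kron)
  also have "\<dots> = entry (kron (A * C) (B * D)) (i, k) (j, m)"
    by (simp add: entry_kron entry_simps sum_product)
  finally show "entry (kron (A * C) (B * D)) (i, k) (j, m) = entry (kron A B * kron C D) (i, k) (j, m)" ..
qed

lemma alg_hom_kron:
  fixes \<rho> :: "'a::complex_alg \<Rightarrow> 'd::finite sqmat" and \<sigma> :: "'b::complex_alg \<Rightarrow> 'e::finite sqmat"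
  assumes "alg_hom \<rho>" "alg_hom \<sigma>"
  shows "cbilinear (\<lambda>a b. kron (\<rho> a) (\<sigma> b))" "alg_hom (tensor_lift (\<lambda>a b. kron (\<rho> a) (\<sigma> b)))"
proof -
  show *: "cbilinear (\<lambda>a b. kron (\<rho> a) (\<sigma> b))"
    by (rule cbilinear_compose[OF cbilinear_kron alg_homD(1)[OF assms(1)] alg_homD(1)[OF assms(2)]])
  show "alg_hom (tensor_lift (\<lambda>a b. kron (\<rho> a) (\<sigma> b)))"
    by (rule alg_hom_tensor_lift[OF *])
      (simp_all add: alg_homD(2,3)[OF assms(1)] alg_homD(2,3)[OF assms(2)] kron_one kron_mult)
qed

section \<open>The PBW basis of the small quantum group\<close>

lemma span_image_closed:
  assumes "clinear f" "\<And>v. v \<in> A \<Longrightarrow> f v \<in> cvec.span T" "v \<in> cvec.span A"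
  shows "f v \<in> cvec.span T"
  using assms(3)
proof (induction v rule: cvec.span_induct)
  case base
  show ?case
    by (rule cvec.subspaceI)
      (simp_all add: clinear_0[OF assms(1)] clinear_add[OF assms(1)] clinear_scaleC[OF assms(1)]
        cvec.span_zero cvec.span_add cvec.span_scale)
next
  case (step x)
  then show ?case by (rule assms(2))
qed

lemma span_family_coeffs:
  assumes "finite I" "x \<in> cvec.span (b ` I)"
  shows "\<exists>\<alpha>. x = (\<Sum>i\<in>I. \<alpha> i *\<^sub>C b i)"
  using assms(2)
proof (induction x rule: cvec.span_induct)
  case base
  show ?case
  proof (rule cvec.subspaceI)
    show "0 \<in> {x. \<exists>\<alpha>. x = (\<Sum>i\<in>I. \<alpha> i *\<^sub>C b i)}"
      by (auto intro!: exI[of _ "\<lambda>_. 0"])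
    fix x y c
    assume "x \<in> {x. \<exists>\<alpha>. x = (\<Sum>i\<in>I. \<alpha> i *\<^sub>C b i)}"
    then obtain \<alpha> where \<alpha>: "x = (\<Sum>i\<in>I. \<alpha> i *\<^sub>C b i)" by auto
    show "c *\<^sub>C x \<in> {x. \<exists>\<alpha>. x = (\<Sum>i\<in>I. \<alpha> i *\<^sub>C b i)}"
      unfolding \<alpha> by (auto intro!: exI[of _ "\<lambda>i. c * \<alpha> i"] simp: cvec.scale_sum_right)
    assume "y \<in> {x. \<exists>\<alpha>. x = (\<Sum>i\<in>I. \<alpha> i *\<^sub>C b i)}"
    then obtain \<beta> where \<beta>: "y = (\<Sum>i\<in>I. \<beta> i *\<^sub>C b i)" by auto
    show "x + y \<in> {x. \<exists>\<alpha>. x = (\<Sum>i\<in>I. \<alpha> i *\<^sub>C b i)}"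
      unfolding \<alpha> \<beta> by (auto intro!: exI[of _ "\<lambda>i. \<alpha> i + \<beta> i"] simp: scaleC_add_left sum.distrib)
  qed
next
  case (step x)
  then obtain j where "j \<in> I" "x = b j" by auto
  then have "x = (\<Sum>i\<in>I. (if i = j then 1 else 0) *\<^sub>C b i)"
    using assms(1) by (simp add: if_distrib[of "\<lambda>c. c *\<^sub>C _"] cong: if_cong)
  then show ?case by (rule exI[of _ "\<lambda>i. if i = j then 1 else 0"])
qed

lemma coord_span_outside:
  assumes "dual_basis I b c" "A \<subseteq> I" "x \<in> cvec.span (b ` A)" "i \<in> I" "i \<notin> A"
  shows "c i x = 0"
proof -
  have "finite A" using assms(1,2) dual_basisD(1) finite_subset by metis
  from span_family_coeffs[OF this assms(3)] obtain \<alpha> where "x = (\<Sum>j\<in>A. \<alpha> j *\<^sub>C b j)" ..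
  then have "c i x = (\<Sum>j\<in>A. \<alpha> j * c i (b j))"
    by (simp add: clinear_sum[OF dual_basisD(2)[OF assms(1)]]
        clinear_scaleC[OF dual_basisD(2)[OF assms(1)]] scaleC_complex_def)
  also have "\<dots> = 0"
    by (rule sum.neutral) (use assms dual_basisD(3)[OF assms(1,4)] in \<open>auto split: if_splits\<close>)
  finally show ?thesis .
qed

text \<open>For nilpotency: a nonzero entry of a high power would join two indices whose heights are further
  apart than the height function permits.\<close>

lemma sqmat_power_shift:
  fixes A :: "'d::finite sqmat" and h :: "'d \<Rightarrow> int"
  assumes "\<And>i j. entry A i j \<noteq> 0 \<Longrightarrow> h j = h i + d"
  shows "entry (A ^ n) i j \<noteq> 0 \<Longrightarrow> h j = h i + int n * d"
proof (induction n arbitrary: i)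
  case 0
  then show ?case by (auto simp: entry_simps split: if_splits)
next
  case (Suc n)
  have "(\<Sum>k\<in>UNIV. entry A i k * entry (A ^ n) k j) \<noteq> 0"
    using Suc.prems by (simp add: entry_simps)
  then obtain k where "entry A i k * entry (A ^ n) k j \<noteq> 0" by (meson sum.neutral)
  then have "h k = h i + d" "h j = h k + int n * d"
    using assms Suc.IH[of k] by auto
  then show ?case by (simp add: algebra_simps)
qed

locale sl2_root =
  root_of_unity_card q ty + small_quantum_sl2 "CARD('n)" q g \<Delta> \<epsilon> S
  for q :: complex and ty :: "'n::nontriv itself" and g :: "gen \<Rightarrow> 'u::complex_alg"
    and \<Delta> :: "'u \<Rightarrow> ('u, 'u) tensor" and \<epsilon> :: "'u \<Rightarrow> complex" and S :: "'u \<Rightarrow> 'u"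
begin

abbreviation "E \<equiv> g GE"
abbreviation "F \<equiv> g GF"
abbreviation "K \<equiv> g GK"
abbreviation "Ki \<equiv> g GKinv"
abbreviation P :: "'n mod_ring \<Rightarrow> 'u" where "P \<equiv> weight_idem q (g GK)"
abbreviation "cq \<equiv> inverse (q - inverse q)"

lemma rel:
  "K * Ki = 1" "Ki * K = 1" "K * E = (q ^ 2) *\<^sub>C (E * K)" "K * F = inverse (q ^ 2) *\<^sub>C (F * K)"
  "E * F - F * E = cq *\<^sub>C (K - Ki)" "E ^ CARD('n) = 0" "F ^ CARD('n) = 0" "K ^ CARD('n) = 1"
proof -
  note r = presented_by_relation[OF presentation]
  note d = uq_relations_def Let_def
  show "K * Ki = 1" using r[of "free_gen GK * free_gen GKinv - 1"] by (simp add: free_eval_simps d)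
  show "Ki * K = 1" using r[of "free_gen GKinv * free_gen GK - 1"] by (simp add: free_eval_simps d)
  show "K * E = (q ^ 2) *\<^sub>C (E * K)"
    using r[of "free_gen GK * free_gen GE - (q ^ 2) *\<^sub>C (free_gen GE * free_gen GK)"]
    by (simp add: free_eval_simps d)
  show "K * F = inverse (q ^ 2) *\<^sub>C (F * K)"
    using r[of "free_gen GK * free_gen GF - inverse (q ^ 2) *\<^sub>C (free_gen GF * free_gen GK)"]
    by (simp add: free_eval_simps d)
  show "E * F - F * E = cq *\<^sub>C (K - Ki)"
    using r[of "free_gen GE * free_gen GF - free_gen GF * free_gen GE
        - inverse (q - inverse q) *\<^sub>C (free_gen GK - free_gen GKinv)"]
    by (simp add: free_eval_simps d)
  show "E ^ CARD('n) = 0" using r[of "free_gen GE ^ CARD('n)"] by (simp add: free_eval_simps d)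
  show "F ^ CARD('n) = 0" using r[of "free_gen GF ^ CARD('n)"] by (simp add: free_eval_simps d)
  show "K ^ CARD('n) = 1" using r[of "free_gen GK ^ CARD('n) - 1"] by (simp add: free_eval_simps d)
qed

lemma EF: "E * F = F * E + cq *\<^sub>C (K - Ki)"
  using rel(5) by (simp add: algebra_simps)

lemma E_pow_0: "n \<ge> CARD('n) \<Longrightarrow> E ^ n = 0"
  using rel(6) by (metis le_add_diff_inverse mult_zero_left power_add)

lemma F_pow_0: "n \<ge> CARD('n) \<Longrightarrow> F ^ n = 0"
  using rel(7) by (metis le_add_diff_inverse mult_zero_left power_add)

lemma K_P: "K * P \<mu> = \<chi> \<mu> *\<^sub>C P \<mu>"
  by (rule weight_idem_eigen[OF rel(8)])

lemma P_K: "P \<mu> * K = \<chi> \<mu> *\<^sub>C P \<mu>"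
  using weight_idem_cong[of K K 1 0 \<mu>] by (simp add: scaleC_one K_P)

lemma Ki_P: "Ki * P \<mu> = inverse (\<chi> \<mu>) *\<^sub>C P \<mu>"
proof -
  have "P \<mu> = \<chi> \<mu> *\<^sub>C (Ki * P \<mu>)"
    using K_P[of \<mu>] rel(2) by (metis mult.assoc mult_1_left scaleC_mult_right)
  then have "inverse (\<chi> \<mu>) *\<^sub>C P \<mu> = (inverse (\<chi> \<mu>) * \<chi> \<mu>) *\<^sub>C (Ki * P \<mu>)"
    by (metis scaleC_scaleC)
  then show ?thesis by (simp add: scaleC_one)
qed

lemma P_Ki: "P \<mu> * Ki = inverse (\<chi> \<mu>) *\<^sub>C P \<mu>"
proof -
  have "P \<mu> = \<chi> \<mu> *\<^sub>C (P \<mu> * Ki)"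
    using P_K[of \<mu>] rel(1) by (metis mult.assoc mult_1_right scaleC_mult_left)
  then have "inverse (\<chi> \<mu>) *\<^sub>C P \<mu> = (inverse (\<chi> \<mu>) * \<chi> \<mu>) *\<^sub>C (P \<mu> * Ki)"
    by (metis scaleC_scaleC)
  then show ?thesis by (simp add: scaleC_one)
qed

lemma P_P: "P \<mu> * P \<nu> = (if \<mu> = \<nu> then P \<nu> else 0)"
  by (rule weight_idem_eigenvector[OF K_P])

lemma P_P_same [simp]: "P \<mu> * P \<mu> = P \<mu>"
  by (simp add: P_P)

lemma P_sum: "(\<Sum>\<mu>\<in>UNIV. P \<mu>) = 1"
  by (rule weight_idem_sum)

lemma E_P: "E * P \<mu> = P (\<mu> + 2) * E"
proof (rule weight_idem_cong)
  show "E * K = inverse (q ^ 2) *\<^sub>C (K * E)" by (simp add: rel(3) scaleC_one)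
qed (simp add: chi_2)

lemma F_P: "F * P \<mu> = P (\<mu> - 2) * F"
proof -
  have "F * P \<mu> = P (\<mu> + - 2) * F"
  proof (rule weight_idem_cong)
    show "F * K = q ^ 2 *\<^sub>C (K * F)" by (simp add: rel(4) scaleC_one)
  qed (simp add: chi_2 chi_neg)
  then show ?thesis by simp
qed

lemma E_pow_P: "E ^ n * P \<mu> = P (\<mu> + 2 * of_nat n) * E ^ n"
proof (induction n)
  case (Suc n)
  have "E ^ Suc n * P \<mu> = E * P (\<mu> + 2 * of_nat n) * E ^ n" by (simp add: mult.assoc Suc)
  also have "\<dots> = P (\<mu> + 2 * of_nat (Suc n)) * E ^ Suc n"
    by (simp add: E_P mult.assoc algebra_simps)
  finally show ?case .
qed simp

lemma F_pow_P: "F ^ n * P \<mu> = P (\<mu> - 2 * of_nat n) * F ^ n"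
proof (induction n)
  case (Suc n)
  have "F ^ Suc n * P \<mu> = F * P (\<mu> - 2 * of_nat n) * F ^ n" by (simp add: mult.assoc Suc)
  also have "\<dots> = P (\<mu> - 2 * of_nat (Suc n)) * F ^ Suc n"
    by (simp add: F_P mult.assoc algebra_simps)
  finally show ?case .
qed simp

lemma P_F_pow: "P \<mu> * F ^ n = F ^ n * P (\<mu> + 2 * of_nat n)"
  by (simp add: F_pow_P)

lemma P_E_pow: "P \<mu> * E ^ n = E ^ n * P (\<mu> - 2 * of_nat n)"
  by (simp add: E_pow_P)

text \<open>The commutator of \<open>E\<close> with \<open>F\<^sup>n\<^sup>+\<^sup>1\<close> is \<open>F\<^sup>n\<close> times an element of \<open>\<complex>[K]\<close>; this is its value at the left
  weight \<open>\<gamma>\<close>.\<close>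

definition EF_scalar :: "'n mod_ring \<Rightarrow> nat \<Rightarrow> complex" where
  "EF_scalar \<gamma> n = cq * (\<Sum>i<Suc n. \<chi> (\<gamma> + 2 * of_nat i) - inverse (\<chi> (\<gamma> + 2 * of_nat i)))"

lemma P_E_F_pow:
  "P \<gamma> * (E * F ^ Suc n) = P \<gamma> * (F ^ Suc n * E) + EF_scalar \<gamma> n *\<^sub>C (P \<gamma> * F ^ n)"
proof (induction n)
  case 0
  show ?case
    by (simp add: EF EF_scalar_def distrib_left scaleC_mult_right right_diff_distrib P_K P_Ki
        cvec.scale_right_diff_distrib cvec.scale_left_diff_distrib)
next
  case (Suc n)
  let ?\<delta> = "\<gamma> + 2 * of_nat (Suc n)"
  have "P \<gamma> * (E * F ^ Suc (Suc n)) = P \<gamma> * (E * F ^ Suc n) * F"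
    by (metis mult.assoc power_Suc2)
  also have "\<dots> = P \<gamma> * F ^ Suc n * (E * F) + EF_scalar \<gamma> n *\<^sub>C (P \<gamma> * F ^ Suc n)"
    unfolding Suc by (simp add: distrib_right mult.assoc scaleC_mult_left power_commutes)
  also have "P \<gamma> * F ^ Suc n * (E * F) = P \<gamma> * F ^ Suc n * F * E + F ^ Suc n * (P ?\<delta> * (cq *\<^sub>C (K - Ki)))"
    unfolding EF by (simp only: distrib_left P_F_pow mult.assoc)
  also have "F ^ Suc n * (P ?\<delta> * (cq *\<^sub>C (K - Ki))) = (cq * (\<chi> ?\<delta> - inverse (\<chi> ?\<delta>))) *\<^sub>C (P \<gamma> * F ^ Suc n)"
    unfolding P_F_pow
    by (simp add: scaleC_mult_right right_diff_distrib P_K P_Ki cvec.scale_right_diff_distrib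
        cvec.scale_left_diff_distrib del: of_nat_Suc power_Suc)
  finally show ?case
    unfolding EF_scalar_def sum.lessThan_Suc[of _ "Suc n"]
    by (simp add: distrib_left scaleC_add_left mult.assoc power_commutes add.assoc del: of_nat_Suc)
qed

text \<open>The factor \<open>\<complex>[K]\<close> of the usual monomials \<open>K\<^sup>c F\<^sup>a E\<^sup>b\<close> is written in the basis of idempotents, which makes
  every basis vector a weight vector on both sides.\<close>

definition pbw :: "'n mod_ring \<times> nat \<times> nat \<Rightarrow> 'u" where
  "pbw = (\<lambda>(\<gamma>, a, b). P \<gamma> * F ^ a * E ^ b)"

definition pbw_index :: "('n mod_ring \<times> nat \<times> nat) set" where
  "pbw_index = UNIV \<times> {..<CARD('n)} \<times> {..<CARD('n)}"

definition pbw_degree :: "'n mod_ring \<times> nat \<times> nat \<Rightarrow> int" where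
  "pbw_degree = (\<lambda>(\<gamma>, a, b). int b - int a)"

definition pbw_span :: "int \<Rightarrow> 'u set" where
  "pbw_span k = cvec.span (pbw ` {i. i \<in> pbw_index \<and> pbw_degree i = k})"

lemma finite_pbw_index: "finite pbw_index"
  by (simp add: pbw_index_def)

lemma pbw_in_span: "pbw (\<gamma>, a, b) \<in> pbw_span (int b - int a)"
proof (cases "a < CARD('n) \<and> b < CARD('n)")
  case True
  then show ?thesis unfolding pbw_span_def
    by (intro cvec.span_base imageI) (simp add: pbw_index_def pbw_degree_def)
next
  case False
  then have "pbw (\<gamma>, a, b) = 0" by (auto simp: pbw_def E_pow_0 F_pow_0)
  then show ?thesis by (simp add: pbw_span_def cvec.span_zero)
qed

lemma F_pbw: "F * pbw (\<gamma>, a, b) = pbw (\<gamma> - 2, Suc a, b)"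
  by (simp add: pbw_def mult.assoc[symmetric] F_P)

lemma K_pbw: "K * pbw (\<gamma>, a, b) = \<chi> \<gamma> *\<^sub>C pbw (\<gamma>, a, b)"
  by (simp add: pbw_def mult.assoc[symmetric] K_P scaleC_mult_left)

lemma Ki_pbw: "Ki * pbw (\<gamma>, a, b) = inverse (\<chi> \<gamma>) *\<^sub>C pbw (\<gamma>, a, b)"
  by (simp add: pbw_def mult.assoc[symmetric] Ki_P scaleC_mult_left)

lemma E_pbw_0: "E * pbw (\<gamma>, 0, b) = pbw (\<gamma> + 2, 0, Suc b)"
  by (simp add: pbw_def mult.assoc[symmetric] E_P)

lemma E_pbw_Suc: "E * pbw (\<gamma>, Suc a, b) =
  pbw (\<gamma> + 2, Suc a, Suc b) + EF_scalar (\<gamma> + 2) a *\<^sub>C pbw (\<gamma> + 2, a, b)"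
proof -
  have "E * pbw (\<gamma>, Suc a, b) = (P (\<gamma> + 2) * (E * F ^ Suc a)) * E ^ b"
    by (simp add: pbw_def mult.assoc[symmetric] E_P del: power_Suc)
  then show ?thesis
    unfolding P_E_F_pow by (simp add: pbw_def distrib_right scaleC_mult_left mult.assoc)
qed

text \<open>Left multiplication by a generator straightens by the commutation rules only, so it respects the
  degree. This gives spanning and the compatibility with the grading together.\<close>

lemma gen_pbw_span:
  assumes "v \<in> pbw_span k"
  shows "g x * v \<in> pbw_span (gen_degree x + k)"
  unfolding pbw_span_def
proof (rule span_image_closed[OF clinear_mult_const(1)[OF clinear_id]])
  show "v \<in> cvec.span (pbw ` {i \<in> pbw_index. pbw_degree i = k})" using assms by (simp add: pbw_span_def)
  fix v assume "v \<in> pbw ` {i \<in> pbw_index. pbw_degree i = k}"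
  then obtain \<gamma> a b where v: "v = pbw (\<gamma>, a, b)" "k = int b - int a"
    by (auto simp: pbw_degree_def)
  have "g x * v \<in> pbw_span (gen_degree x + k)"
  proof (cases x)
    case GE
    show ?thesis
    proof (cases a)
      case 0
      then show ?thesis using pbw_in_span[of "\<gamma> + 2" 0 "Suc b"]
        by (simp add: GE v E_pbw_0 algebra_simps)
    next
      case (Suc c)
      have "pbw (\<gamma> + 2, Suc c, Suc b) \<in> pbw_span (gen_degree x + k)"
          "pbw (\<gamma> + 2, c, b) \<in> pbw_span (gen_degree x + k)"
        using pbw_in_span[of "\<gamma> + 2" "Suc c" "Suc b"] pbw_in_span[of "\<gamma> + 2" c b]
        by (simp_all add: GE v Suc algebra_simps)
      then show ?thesis
        by (simp add: GE v Suc E_pbw_Suc pbw_span_def cvec.span_add cvec.span_scale)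
    qed
  next
    case GF
    then show ?thesis using pbw_in_span[of "\<gamma> - 2" "Suc a" b]
      by (simp add: v F_pbw algebra_simps)
  next
    case GK
    then show ?thesis using pbw_in_span[of \<gamma> a b]
      by (simp add: v K_pbw cvec.span_scale pbw_span_def)
  next
    case GKinv
    then show ?thesis using pbw_in_span[of \<gamma> a b]
      by (simp add: v Ki_pbw cvec.span_scale pbw_span_def)
  qed
  then show "g x * v \<in> cvec.span (pbw ` {i \<in> pbw_index. pbw_degree i = gen_degree x + k})"
    by (simp add: pbw_span_def)
qed

lemma word_pbw_span: "prod_list (map g w) \<in> pbw_span (sum_list (map gen_degree w))"
proof (induction w)
  case Nil
  have "(\<Sum>\<gamma>\<in>UNIV. pbw (\<gamma>, 0, 0)) \<in> pbw_span 0"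
    unfolding pbw_span_def
    by (rule cvec.span_sum) (use pbw_in_span[of _ 0 0] in \<open>simp add: pbw_span_def\<close>)
  then show ?case by (simp add: pbw_def P_sum)
qed (simp add: gen_pbw_span)

lemma degree_part_pbw: "degree_part g k \<subseteq> pbw_span k"
  unfolding degree_part_def
proof
  fix x assume "x \<in> cvec.span {prod_list (map g w) | w. sum_list (map gen_degree w) = k}"
  then have "(\<lambda>x. x) x \<in> cvec.span (pbw ` {i \<in> pbw_index. pbw_degree i = k})"
    by (rule span_image_closed[OF clinear_id, rotated])
      (use word_pbw_span in \<open>auto simp: pbw_span_def\<close>)
  then show "x \<in> pbw_span k" by (simp add: pbw_span_def)
qed

lemma pbw_spans: "x \<in> cvec.span (pbw ` pbw_index)"
  using presentation
proof (induction x rule: presented_by_induct)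
  case (word w)
  have "pbw_span k \<subseteq> cvec.span (pbw ` pbw_index)" for k
    unfolding pbw_span_def by (rule cvec.span_mono) auto
  then show ?case using word_pbw_span by blast
qed (simp_all add: cvec.span_add cvec.span_scale)

subsection \<open>Linear independence\<close>

lemma exists_alg_hom:
  fixes e f k k' :: "'a::complex_alg"
  assumes "k * k' = 1" "k' * k = 1" "k * e = (q ^ 2) *\<^sub>C (e * k)" "k * f = inverse (q ^ 2) *\<^sub>C (f * k)"
    "e * f - f * e = cq *\<^sub>C (k - k')" "e ^ CARD('n) = 0" "f ^ CARD('n) = 0" "k ^ CARD('n) = 1"
  shows "\<exists>\<psi>. alg_hom \<psi> \<and> \<psi> E = e \<and> \<psi> F = f \<and> \<psi> K = k \<and> \<psi> Ki = k'"
proof -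
  let ?G = "\<lambda>x. case x of GE \<Rightarrow> e | GF \<Rightarrow> f | GK \<Rightarrow> k | GKinv \<Rightarrow> k'"
  have "\<exists>\<psi>. alg_hom \<psi> \<and> (\<forall>x. \<psi> (g x) = ?G x)"
    by (rule presented_by_lift[OF presentation])
      (use assms in \<open>auto simp: uq_relations_def Let_def free_eval_simps\<close>)
  then obtain \<psi> where \<psi>: "alg_hom \<psi>" "\<forall>x. \<psi> (g x) = ?G x" by blast
  from \<psi>(2)[rule_format, of GE] \<psi>(2)[rule_format, of GF] \<psi>(2)[rule_format, of GK]
    \<psi>(2)[rule_format, of GKinv] \<psi>(1)
  show ?thesis by (intro exI[of _ \<psi>]) simp
qed

text \<open>The baby Verma module with basis \<open>v\<^sub>0, \<dots>, v\<^sub>\<ell>\<^sub>-\<^sub>1\<close> and highest weight \<open>\<alpha>\<close>: \<open>F\<close> maps \<open>v\<^sub>j\<close> to \<open>v\<^sub>j\<^sub>+\<^sub>1\<close> and kills the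
  last vector, and \<open>E\<close> maps \<open>v\<^sub>j\<close> to \<open>[j] [\<alpha> + 1 - j] v\<^sub>j\<^sub>-\<^sub>1\<close> in terms of the q-integers. Indices live in
  \<open>\<int>/\<ell>\<close>; the factor \<open>[j]\<close> vanishes where \<open>E\<close> would wrap around.\<close>

definition vermaE :: "'n mod_ring \<Rightarrow> 'n mod_ring \<Rightarrow> complex" where
  "vermaE \<alpha> j = cq ^ 2 * (\<chi> j - inverse (\<chi> j)) * (\<chi> (\<alpha> + 1 - j) - inverse (\<chi> (\<alpha> + 1 - j)))"

definition "matE \<alpha> = sqmat (\<lambda>i j. if j = i + 1 then vermaE \<alpha> j else 0)"
definition matF :: "'n mod_ring sqmat" where
  "matF = sqmat (\<lambda>i j. if i = j + 1 \<and> i \<noteq> 0 then 1 else 0)"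
definition "matK \<alpha> = sqmat (\<lambda>i j. if i = j then \<chi> (\<alpha> - 2 * i) else 0)"
definition "matKi \<alpha> = sqmat (\<lambda>i j. if i = j then inverse (\<chi> (\<alpha> - 2 * i)) else 0)"

lemma entry_mult_delta:
  fixes A B :: "'d::finite sqmat"
  shows "(\<And>k. k \<noteq> m \<Longrightarrow> entry A i k = 0) \<Longrightarrow> entry (A * B) i j = entry A i m * entry B m j"
    and "(\<And>k. k \<noteq> m \<Longrightarrow> entry B k j = 0) \<Longrightarrow> entry (A * B) i j = entry A i m * entry B m j"
proof -
  assume *: "\<And>k. k \<noteq> m \<Longrightarrow> entry A i k = 0"
  have "(\<Sum>k\<in>UNIV. entry A i k * entry B k j) = (\<Sum>k\<in>{m}. entry A i k * entry B k j)"
    by (rule sum.mono_neutral_right) (auto simp: *)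
  then show "entry (A * B) i j = entry A i m * entry B m j" by (simp add: entry_simps)
next
  assume *: "\<And>k. k \<noteq> m \<Longrightarrow> entry B k j = 0"
  have "(\<Sum>k\<in>UNIV. entry A i k * entry B k j) = (\<Sum>k\<in>{m}. entry A i k * entry B k j)"
    by (rule sum.mono_neutral_right) (auto simp: *)
  then show "entry (A * B) i j = entry A i m * entry B m j" by (simp add: entry_simps)
qed

lemma entry_matE_mult: "entry (matE \<alpha> * B) i j = vermaE \<alpha> (i + 1) * entry B (i + 1) j"
  by (subst entry_mult_delta(1)[of "i + 1"]) (simp_all add: matE_def)

lemma entry_matF_mult: "entry (matF * B) i j = (if i = 0 then 0 else entry B (i - 1) j)"
  by (subst entry_mult_delta(1)[of "i - 1"]) (auto simp: matF_def)

lemma entry_matK_mult: "entry (matK \<alpha> * B) i j = \<chi> (\<alpha> - 2 * i) * entry B i j"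
  by (subst entry_mult_delta(1)[of i]) (simp_all add: matK_def)

lemma entry_matKi_mult: "entry (matKi \<alpha> * B) i j = inverse (\<chi> (\<alpha> - 2 * i)) * entry B i j"
  by (subst entry_mult_delta(1)[of i]) (simp_all add: matKi_def)

lemmas entry_mats = entry_matE_mult entry_matF_mult entry_matK_mult entry_matKi_mult

lemma to_int_Suc:
  assumes "i + 1 \<noteq> (0 :: 'n mod_ring)"
  shows "to_int_mod_ring (i + 1) = to_int_mod_ring i + 1"
proof -
  have r: "0 \<le> to_int_mod_ring i \<and> to_int_mod_ring i < int CARD('n)"
    using range_to_int_mod_ring[where 'a = 'n] by (metis atLeastLessThan_iff rangeI)
  have "to_int_mod_ring i + 1 \<noteq> int CARD('n)"
  proof
    assume *: "to_int_mod_ring i + 1 = int CARD('n)"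
    have "i + 1 = of_int (to_int_mod_ring i + 1)" by simp
    also have "\<dots> = 0" unfolding * by simp
    finally show False using assms by simp
  qed
  with r have "to_int_mod_ring i + 1 < int CARD('n)" by simp
  then have "to_int_mod_ring (of_int_mod_ring (to_int_mod_ring i + 1) :: 'n mod_ring) = to_int_mod_ring i + 1"
    using r by (intro to_int_mod_ring_of_int_mod_ring) auto
  then show ?thesis by (simp add: of_int_of_int_mod_ring[symmetric])
qed

text \<open>Both matrices move the index by one step without wrapping around.\<close>

lemma verma_power_0: "matE \<alpha> ^ CARD('n) = 0" "matF ^ CARD('n) = 0"
proof -
  have r: "0 \<le> to_int_mod_ring i \<and> to_int_mod_ring i < int CARD('n)" for i :: "'n mod_ring"
    using range_to_int_mod_ring[where 'a = 'n] by (metis atLeastLessThan_iff rangeI)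
  show "matE \<alpha> ^ CARD('n) = 0"
  proof (rule sqmat_eqI, rule ccontr)
    fix i j assume "entry (matE \<alpha> ^ CARD('n)) i j \<noteq> entry 0 i j"
    then have nz: "entry (matE \<alpha> ^ CARD('n)) i j \<noteq> 0" by (simp add: entry_simps)
    have "to_int_mod_ring j = to_int_mod_ring i + 1" if "entry (matE \<alpha>) i j \<noteq> 0" for i j
    proof -
      from that have "j = i + 1" "vermaE \<alpha> j \<noteq> 0" by (auto simp: matE_def split: if_splits)
      then show ?thesis using to_int_Suc[of i] by (cases "i + 1 = 0") (simp_all add: vermaE_def)
    qed
    from sqmat_power_shift[of "matE \<alpha>", OF this nz]
    have "to_int_mod_ring j = to_int_mod_ring i + int CARD('n) * 1" .
    then show False using r[of i] r[of j] by simp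
  qed
  show "matF ^ CARD('n) = 0"
  proof (rule sqmat_eqI, rule ccontr)
    fix i j assume "entry (matF ^ CARD('n)) i j \<noteq> entry 0 i j"
    then have "to_int_mod_ring j = to_int_mod_ring i + int CARD('n) * (- 1)"
      by (intro sqmat_power_shift[where A = matF])
        (auto simp: matF_def entry_simps to_int_Suc split: if_splits)
    then show False using r[of i] r[of j] by simp
  qed
qed

lemma verma_relations:
  "matK \<alpha> * matKi \<alpha> = 1" "matKi \<alpha> * matK \<alpha> = 1"
  "matK \<alpha> * matE \<alpha> = (q ^ 2) *\<^sub>C (matE \<alpha> * matK \<alpha>)"
  "matK \<alpha> * matF = inverse (q ^ 2) *\<^sub>C (matF * matK \<alpha>)"
  "matE \<alpha> * matF - matF * matE \<alpha> = cq *\<^sub>C (matK \<alpha> - matKi \<alpha>)"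
  "matK \<alpha> ^ CARD('n) = 1"
proof -
  show "matK \<alpha> * matKi \<alpha> = 1" "matKi \<alpha> * matK \<alpha> = 1"
    by (rule sqmat_eqI; simp add: entry_mats; simp add: matK_def matKi_def entry_simps)+
  show "matK \<alpha> * matE \<alpha> = (q ^ 2) *\<^sub>C (matE \<alpha> * matK \<alpha>)"
    by (rule sqmat_eqI, simp add: entry_mats scaleC_sqmat.rep_eq)
      (simp add: matK_def matE_def chi_diff chi_add chi_2 chi_2_mult field_simps)
  show "matK \<alpha> * matF = inverse (q ^ 2) *\<^sub>C (matF * matK \<alpha>)"
    by (rule sqmat_eqI, simp add: entry_mats scaleC_sqmat.rep_eq)
      (auto simp add: matK_def matF_def chi_diff chi_add chi_2 chi_2_mult field_simps)
  show "matE \<alpha> * matF - matF * matE \<alpha> = cq *\<^sub>C (matK \<alpha> - matKi \<alpha>)"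
  proof (rule sqmat_eqI)
    fix i j
    have "vermaE \<alpha> (i + 1) - vermaE \<alpha> i = cq * (\<chi> (\<alpha> - 2 * i) - inverse (\<chi> (\<alpha> - 2 * i)))"
    proof -
      define x where "x = \<chi> i"
      define a where "a = \<chi> \<alpha>"
      have nz: "x \<noteq> 0" "a \<noteq> 0" by (simp_all add: x_def a_def)
      have "(x * q - inverse (x * q)) * (a / x - x / a) - (x - inverse x) * (a * q / x - x / (a * q)) =
          (q - inverse q) * (a / x ^ 2 - x ^ 2 / a)"
        using nz by (simp add: field_simps power2_eq_square)
      then have h1: "cq ^ 2 * ((x * q - inverse (x * q)) * (a / x - x / a) - (x - inverse x) * (a * q / x - x / (a * q))) =
          cq * (a / x ^ 2 - x ^ 2 / a)"
        using q_inv_neq by (simp add: power2_eq_square mult.assoc)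
      have h2: "vermaE \<alpha> (i + 1) = cq ^ 2 * ((x * q - inverse (x * q)) * (a / x - x / a))"
        using nz by (simp add: vermaE_def chi_add chi_diff x_def[symmetric] a_def[symmetric] field_simps)
      have h3: "vermaE \<alpha> i = cq ^ 2 * ((x - inverse x) * (a * q / x - x / (a * q)))"
        using nz by (simp add: vermaE_def chi_add chi_diff x_def[symmetric] a_def[symmetric] field_simps)
      have h4: "\<chi> (\<alpha> - 2 * i) = a / x ^ 2" "inverse (\<chi> (\<alpha> - 2 * i)) = x ^ 2 / a"
        unfolding chi_diff chi_2_mult x_def a_def by (simp_all add: field_simps)
      show ?thesis unfolding h2 h3 h4(1) right_diff_distrib[symmetric] inverse_divide by (rule h1)
    qed
    moreover have "vermaE \<alpha> 0 = 0" by (simp add: vermaE_def)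
    ultimately show "entry (matE \<alpha> * matF - matF * matE \<alpha>) i j = entry (cq *\<^sub>C (matK \<alpha> - matKi \<alpha>)) i j"
      by (simp add: minus_sqmat.rep_eq scaleC_sqmat.rep_eq entry_mats)
        (auto simp: matK_def matKi_def matF_def matE_def)
  qed
  have "entry (matK \<alpha> ^ n) i j = (if i = j then \<chi> (\<alpha> - 2 * i) ^ n else 0)" for n i j
    by (induction n arbitrary: i j) (simp_all add: entry_mats one_sqmat.rep_eq)
  then show "matK \<alpha> ^ CARD('n) = 1"
    by (intro sqmat_eqI) (simp add: one_sqmat.rep_eq chi_card)
qed

lemma of_nat_eq_0: "(of_nat n :: 'n mod_ring) = 0 \<longleftrightarrow> CARD('n) dvd n"
  unfolding chi_eq_1[symmetric] chi_of_nat prim ..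

text \<open>In the tensor product of a highest weight Verma module with highest weight vector \<open>v\<^sub>0\<close> and a lowest
  weight Verma module with lowest weight vector \<open>w\<^sub>0\<close>, the power \<open>E\<^sup>\<ell>\<^sup>-\<^sup>1\<close> can act on \<open>v\<^sub>0 \<otimes> w\<^sub>0\<close> only through
  the second factor and then \<open>F\<^sup>\<ell>\<^sup>-\<^sup>1\<close> reaches \<open>v\<^sub>\<ell>\<^sub>-\<^sub>1 \<otimes> w\<^sub>\<ell>\<^sub>-\<^sub>1\<close> only through the first. This matrix coefficient of
  \<open>F\<^sup>\<ell>\<^sup>-\<^sup>1 E\<^sup>\<ell>\<^sup>-\<^sup>1\<close> is therefore a nonzero scalar, and the highest weight is chosen such that the target has
  weight \<open>\<gamma>\<close>.\<close>

lemma pbw_top_nonzero: "P \<gamma> * F ^ (CARD('n) - 1) * E ^ (CARD('n) - 1) \<noteq> 0"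
proof -
  obtain \<rho> :: "'u \<Rightarrow> 'n mod_ring sqmat" where
    \<rho>: "alg_hom \<rho>" "\<rho> E = matE \<gamma>" "\<rho> F = matF" "\<rho> K = matK \<gamma>" "\<rho> Ki = matKi \<gamma>"
    using exists_alg_hom[OF verma_relations(1-5)[of \<gamma>] verma_power_0 verma_relations(6)] by blast
  have swap: "matKi 0 * matF = (q ^ 2) *\<^sub>C (matF * matKi 0)"
      "matKi 0 * matE 0 = inverse (q ^ 2) *\<^sub>C (matE 0 * matKi 0)"
      "matF * matE 0 - matE 0 * matF = cq *\<^sub>C (matKi 0 - matK 0)" "matKi 0 ^ CARD('n) = 1"
  proof -
    have "matF * matKi 0 = matKi 0 * (matK 0 * matF) * matKi 0"
      by (simp add: mult.assoc[symmetric] verma_relations(2))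
    also have "\<dots> = inverse (q ^ 2) *\<^sub>C (matKi 0 * matF * (matK 0 * matKi 0))"
      unfolding verma_relations(4) by (simp add: scaleC_mult_left scaleC_mult_right mult.assoc)
    finally show "matKi 0 * matF = (q ^ 2) *\<^sub>C (matF * matKi 0)"
      by (simp add: verma_relations scaleC_one)
    have "matE 0 * matKi 0 = matKi 0 * (matK 0 * matE 0) * matKi 0"
      by (simp add: mult.assoc[symmetric] verma_relations(2))
    also have "\<dots> = (q ^ 2) *\<^sub>C (matKi 0 * matE 0 * (matK 0 * matKi 0))"
      unfolding verma_relations(3) by (simp add: scaleC_mult_left scaleC_mult_right mult.assoc)
    finally show "matKi 0 * matE 0 = inverse (q ^ 2) *\<^sub>C (matE 0 * matKi 0)"
      by (simp add: verma_relations scaleC_one)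
    have "matF * matE 0 - matE 0 * matF = - (cq *\<^sub>C (matK 0 - matKi 0))"
      unfolding verma_relations(5)[symmetric] by simp
    also have "\<dots> = cq *\<^sub>C (matKi 0 - matK 0)" by (metis cvec.scale_minus_right minus_diff_eq)
    finally show "matF * matE 0 - matE 0 * matF = cq *\<^sub>C (matKi 0 - matK 0)" .
    have "matKi 0 ^ n * matK 0 ^ n = 1" for n
    proof (induction n)
      case (Suc n)
      have "matKi 0 ^ Suc n * matK 0 ^ Suc n = matKi 0 ^ n * (matKi 0 * matK 0) * matK 0 ^ n"
        by (metis mult.assoc power_Suc power_Suc2)
      then show ?case using Suc by (simp add: verma_relations)
    qed simp
    from this[of "CARD('n)"] show "matKi 0 ^ CARD('n) = 1" by (simp add: verma_relations)
  qed
  \<comment> \<open>Exchanging the roles of \<open>E\<close> and \<open>F\<close> gives the lowest weight module of lowest weight 0.\<close>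
  obtain \<sigma> :: "'u \<Rightarrow> 'n mod_ring sqmat" where
    \<sigma>: "alg_hom \<sigma>" "\<sigma> E = matF" "\<sigma> F = matE 0" "\<sigma> K = matKi 0" "\<sigma> Ki = matK 0"
    using exists_alg_hom[OF verma_relations(2,1)[of 0] swap(1-3) verma_power_0(2,1) swap(4)] by blast
  define \<kappa> where "\<kappa> = tensor_lift (\<lambda>a b. kron (\<rho> a) (\<sigma> b))"
  have \<kappa>: "alg_hom \<kappa>" "\<And>a b. \<kappa> (a \<boxtimes> b) = kron (\<rho> a) (\<sigma> b)"
    unfolding \<kappa>_def using alg_hom_kron[OF \<rho>(1) \<sigma>(1)] by (simp_all add: tensor_lift_tens)
  define \<tau> where "\<tau> x = \<kappa> (\<Delta> x)" for x
  note hom = alg_homD[OF \<kappa>(1)] alg_homD[OF comult(1)]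
  have \<tau>: "\<tau> (x * y) = \<tau> x * \<tau> y" "\<tau> (x ^ n) = \<tau> x ^ n" "\<tau> (c *\<^sub>C x) = c *\<^sub>C \<tau> x" for x y n c
    by (simp_all add: \<tau>_def hom alg_hom_power[OF \<kappa>(1)] alg_hom_power[OF comult(1)]
        clinear_scaleC[OF hom(1)] clinear_scaleC[OF hom(4)])
  have \<tau>_sum: "\<tau> (sum f A) = (\<Sum>x\<in>A. \<tau> (f x))" for f :: "nat \<Rightarrow> 'u" and A
    by (simp add: \<tau>_def clinear_sum[OF hom(1)] clinear_sum[OF hom(4)])
  have \<tau>E: "\<tau> E = kron (matE \<gamma>) 1 + kron (matK \<gamma>) matF"
    by (simp add: \<tau>_def comult clinear_add[OF hom(1)] \<kappa>(2) \<rho> \<sigma> alg_homD(2)[OF \<rho>(1)] alg_homD(2)[OF \<sigma>(1)])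
  have \<tau>F: "\<tau> F = kron matF (matK 0) + kron 1 (matE 0)"
    by (simp add: \<tau>_def comult clinear_add[OF hom(1)] \<kappa>(2) \<rho> \<sigma> alg_homD(2)[OF \<rho>(1)] alg_homD(2)[OF \<sigma>(1)])
  have \<tau>K: "\<tau> K = kron (matK \<gamma>) (matKi 0)"
    by (simp add: \<tau>_def comult \<kappa>(2) \<rho> \<sigma>)
  have e0: "vermaE \<alpha> 0 = 0" for \<alpha> by (simp add: vermaE_def)
  have row: "entry (\<tau> F ^ n) (- 1, - 1) (i, j) = (if i = - 1 - of_nat n \<and> j = - 1 then \<chi> 2 ^ n else 0)"
    if "n < CARD('n)" for n i j
    using that
  proof (induction n arbitrary: i j)
    case 0
    then show ?case by (auto simp: entry_simps)
  next
    case (Suc n)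
    have nz: "- 1 - of_nat n \<noteq> (0 :: 'n mod_ring)"
    proof
      assume *: "- 1 - of_nat n = (0 :: 'n mod_ring)"
      have "of_nat (Suc n) = - (- 1 - of_nat n :: 'n mod_ring)" by simp
      then have "of_nat (Suc n) = (0 :: 'n mod_ring)" unfolding * by simp
      then show False using Suc.prems unfolding of_nat_eq_0 by (auto dest: dvd_imp_le)
    qed
    have "entry (\<tau> F ^ Suc n) (- 1, - 1) (i, j) =
        entry (\<tau> F ^ n) (- 1, - 1) (- 1 - of_nat n, - 1) * entry (\<tau> F) (- 1 - of_nat n, - 1) (i, j)"
      unfolding power_Suc2
      by (rule entry_mult_delta(1)) (use Suc in \<open>auto split: prod.splits if_splits\<close>)
    also have "\<dots> = \<chi> 2 ^ n * entry (\<tau> F) (- 1 - of_nat n, - 1) (i, j)"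
      using Suc by simp
    also have "entry (\<tau> F) (- 1 - of_nat n, - 1) (i, j) =
        (if i = - 1 - of_nat (Suc n) \<and> j = - 1 then \<chi> 2 else 0)"
    proof -
      define m where "m = - 1 - (of_nat n :: 'n mod_ring)"
      have m: "- 1 - of_nat (Suc n) = m - 1" "m \<noteq> 0" using nz by (simp_all add: m_def)
      have "i = m - 1 \<longleftrightarrow> m = i + 1" by (auto simp: eq_diff_eq)
      then show ?thesis
        unfolding \<tau>F m m_def[symmetric] using m(2) e0
        by (auto simp: entry_kron entry_simps matF_def matK_def matE_def)
    qed
    finally show ?case by simp
  qed
  have col: "entry (\<tau> E ^ n) (i, j) (0, 0) = (if i = 0 \<and> j = of_nat n then \<chi> \<gamma> ^ n else 0)"
    if "n < CARD('n)" for n i j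
    using that
  proof (induction n arbitrary: i j)
    case 0
    then show ?case by (auto simp: entry_simps)
  next
    case (Suc n)
    have nz: "of_nat (Suc n) \<noteq> (0 :: 'n mod_ring)"
      using Suc.prems unfolding of_nat_eq_0 by (auto dest: dvd_imp_le)
    have "entry (\<tau> E ^ Suc n) (i, j) (0, 0) =
        entry (\<tau> E) (i, j) (0, of_nat n) * entry (\<tau> E ^ n) (0, of_nat n) (0, 0)"
      unfolding power_Suc
      by (rule entry_mult_delta(2)) (use Suc in \<open>auto split: prod.splits if_splits\<close>)
    also have "\<dots> = entry (\<tau> E) (i, j) (0, of_nat n) * \<chi> \<gamma> ^ n"
      using Suc by simp
    also have "entry (\<tau> E) (i, j) (0, of_nat n) = (if i = 0 \<and> j = of_nat (Suc n) then \<chi> \<gamma> else 0)"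
      unfolding \<tau>E using nz e0
      by (auto simp: entry_kron entry_simps matF_def matK_def matE_def algebra_simps)
    finally show ?case by simp
  qed
  define f where "f x = entry (\<tau> x) (- 1, - 1) (0, 0)" for x
  let ?m = "CARD('n) - 1"
  have m: "?m < CARD('n)" using card_gt by simp
  have m1: "of_nat ?m = (- 1 :: 'n mod_ring)" using card_gt by (simp add: of_nat_diff)
  have "f (F ^ ?m * E ^ ?m) = entry (\<tau> F ^ ?m) (- 1, - 1) (- 1 - of_nat ?m, - 1) * entry (\<tau> E ^ ?m) (- 1 - of_nat ?m, - 1) (0, 0)"
    unfolding f_def \<tau> by (rule entry_mult_delta(1)) (use row[OF m] in \<open>auto split: prod.splits if_splits\<close>)
  then have nz: "f (F ^ ?m * E ^ ?m) \<noteq> 0"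
    unfolding row[OF m] col[OF m] m1 by simp
  have fK: "f (K * x) = \<chi> \<gamma> * f x" for x
  proof -
    have "f (K * x) = entry (\<tau> K) (- 1, - 1) (- 1, - 1) * f x"
      unfolding f_def \<tau> by (rule entry_mult_delta(1))
        (auto simp: \<tau>K entry_kron matK_def matKi_def split: prod.splits if_splits)
    also have "entry (\<tau> K) (- 1, - 1) (- 1, - 1) = \<chi> \<gamma>"
      by (simp add: \<tau>K entry_kron matK_def matKi_def chi_add)
    finally show ?thesis .
  qed
  have fKp: "f (K ^ j * x) = \<chi> \<gamma> ^ j * f x" for j x
    by (induction j) (simp_all add: fK mult.assoc)
  have fP: "f (P \<gamma> * x) = f x" for x
  proof -
    have "f (P \<gamma> * x) = inverse (of_nat CARD('n)) * (\<Sum>j<CARD('n). inverse (\<chi> \<gamma>) ^ j * f (K ^ j * x))"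
      unfolding weight_idem_def scaleC_mult_left sum_distrib_right f_def \<tau>_sum \<tau>(3) scaleC_sqmat.rep_eq
        entry_sum ..
    also have "\<dots> = f x"
      by (simp add: fKp mult.assoc[symmetric] power_mult_distrib[symmetric] power_inverse[symmetric])
    finally show ?thesis .
  qed
  show ?thesis
  proof
    assume "P \<gamma> * F ^ ?m * E ^ ?m = 0"
    then have "f (P \<gamma> * (F ^ ?m * E ^ ?m)) = f 0" by (simp add: mult.assoc)
    moreover have "f 0 = 0" using fK[of 0] fP[of 0] \<tau>(3)[of 0 0] by (simp add: f_def zero_sqmat.rep_eq)
    ultimately show False using nz fP by simp
  qed
qed

text \<open>Multiplying a relation by \<open>F\<^sup>x\<close> on the left and \<open>E\<^sup>y\<close> on the right, with \<open>x\<close> and \<open>y\<close> complementary to a term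
  of least total exponent, kills every other term and turns this one into the nonzero top element.\<close>

lemma pbw_independent:
  assumes "(\<Sum>i\<in>pbw_index. \<alpha> i *\<^sub>C pbw i) = 0" "i \<in> pbw_index"
  shows "\<alpha> i = 0"
proof (rule ccontr)
  assume "\<alpha> i \<noteq> 0"
  obtain \<gamma> a1 b1 where i: "i = (\<gamma>, a1, b1)" by (cases i)
  let ?Q = "\<lambda>(a, b). a < CARD('n) \<and> b < CARD('n) \<and> \<alpha> (\<gamma>, a, b) \<noteq> 0"
  have "?Q (a1, b1)" using assms(2) \<open>\<alpha> i \<noteq> 0\<close> by (simp add: i pbw_index_def)
  from ex_has_least_nat[of ?Q, OF this, of "\<lambda>(a, b). a + b"]
  obtain a0 b0 where Q: "a0 < CARD('n)" "b0 < CARD('n)" "\<alpha> (\<gamma>, a0, b0) \<noteq> 0"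
    and least: "\<And>a b. ?Q (a, b) \<Longrightarrow> a0 + b0 \<le> a + b" by auto
  define x where "x = CARD('n) - 1 - a0"
  define y where "y = CARD('n) - 1 - b0"
  define \<gamma>' where "\<gamma>' = \<gamma> - 2 * of_nat x"
  have summand: "F ^ x * (P \<gamma> * (\<alpha> i *\<^sub>C pbw i)) * E ^ y =
      (if i = (\<gamma>, a0, b0) then \<alpha> i *\<^sub>C (P \<gamma>' * F ^ (CARD('n) - 1) * E ^ (CARD('n) - 1)) else 0)"
    if "i \<in> pbw_index" for i
  proof -
    obtain \<delta> a b where i: "i = (\<delta>, a, b)" by (cases i)
    have ab: "a < CARD('n)" "b < CARD('n)" using that by (simp_all add: i pbw_index_def)
    show ?thesis
    proof (cases "\<delta> = \<gamma>")
      case True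
      have "F ^ x * (P \<gamma> * pbw i) * E ^ y = F ^ x * P \<gamma> * F ^ a * (E ^ b * E ^ y)"
        by (simp add: i True pbw_def mult.assoc[symmetric])
      also have "\<dots> = P \<gamma>' * F ^ (x + a) * E ^ (b + y)"
        by (simp add: F_pow_P \<gamma>'_def power_add mult.assoc)
      finally have eq: "F ^ x * (P \<gamma> * (\<alpha> i *\<^sub>C pbw i)) * E ^ y = \<alpha> i *\<^sub>C (P \<gamma>' * F ^ (x + a) * E ^ (b + y))"
        by (simp add: scaleC_mult_right scaleC_mult_left)
      show ?thesis
      proof (cases "a = a0 \<and> b = b0")
        case True2: True
        then have "x + a = CARD('n) - 1" "b + y = CARD('n) - 1"
          using Q by (simp_all add: x_def y_def)
        then show ?thesis unfolding eq using True True2 by (simp add: i)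
      next
        case False
        have "\<alpha> i = 0 \<or> x + a \<ge> CARD('n) \<or> b + y \<ge> CARD('n)"
        proof (rule ccontr)
          assume n: "\<not> ?thesis"
          then have "a0 + b0 \<le> a + b" using least[of a b] ab True by (simp add: i)
          moreover have "a \<le> a0" "b \<le> b0" using n Q by (auto simp: x_def y_def)
          ultimately show False using False by auto
        qed
        then show ?thesis unfolding eq using False by (auto simp: i E_pow_0 F_pow_0)
      qed
    next
      case False
      then have "P \<gamma> * pbw i = 0" by (simp add: i pbw_def mult.assoc[symmetric] P_P)
      then show ?thesis using False by (simp add: i scaleC_mult_right)
    qed
  qed
  have "0 = F ^ x * (P \<gamma> * (\<Sum>i\<in>pbw_index. \<alpha> i *\<^sub>C pbw i)) * E ^ y" by (simp add: assms)
  also have "\<dots> = (\<Sum>i\<in>pbw_index. F ^ x * (P \<gamma> * (\<alpha> i *\<^sub>C pbw i)) * E ^ y)"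
    by (simp add: sum_distrib_left sum_distrib_right)
  also have "\<dots> = (\<Sum>i\<in>pbw_index. if i = (\<gamma>, a0, b0)
      then \<alpha> i *\<^sub>C (P \<gamma>' * F ^ (CARD('n) - 1) * E ^ (CARD('n) - 1)) else 0)"
    by (intro sum.cong refl summand)
  also have "\<dots> = \<alpha> (\<gamma>, a0, b0) *\<^sub>C (P \<gamma>' * F ^ (CARD('n) - 1) * E ^ (CARD('n) - 1))"
    using Q finite_pbw_index by (simp add: pbw_index_def)
  finally show False using Q(3) pbw_top_nonzero[of \<gamma>'] by simp
qed

definition pbw_coord :: "'n mod_ring \<times> nat \<times> nat \<Rightarrow> 'u \<Rightarrow> complex" where
  "pbw_coord = (SOME c. dual_basis pbw_index pbw c)"

lemma pbw_basis: "dual_basis pbw_index pbw pbw_coord"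
  unfolding pbw_coord_def
proof (rule someI_ex[where P = "dual_basis pbw_index pbw"], rule dual_basis_exists[OF finite_pbw_index])
  show "\<exists>\<alpha>. x = (\<Sum>i\<in>pbw_index. \<alpha> i *\<^sub>C pbw i)" for x
    by (rule span_family_coeffs[OF finite_pbw_index pbw_spans])
qed (rule pbw_independent)

end

section \<open>The grading\<close>

lemma sum_eq_single:
  assumes "finite A" "a \<in> A" "\<And>x. x \<in> A \<Longrightarrow> x \<noteq> a \<Longrightarrow> f x = 0"
  shows "sum f A = f a"
proof -
  have "sum f A = sum f {a}" by (rule sum.mono_neutral_right) (use assms in auto)
  then show ?thesis by simp
qed

context sl2_root
begin

lemma degree_part_word: "prod_list (map g w) \<in> degree_part g (sum_list (map gen_degree w))"
  unfolding degree_part_def by (rule cvec.span_base) blast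

lemma degree_part_mult:
  assumes "x \<in> degree_part g a" "y \<in> degree_part g b"
  shows "x * y \<in> degree_part g (a + b)"
proof -
  have "prod_list (map g w) * y \<in> degree_part g (a + b)" if "sum_list (map gen_degree w) = a" for w
    unfolding degree_part_def
  proof (rule span_image_closed[OF clinear_mult_const(1)[OF clinear_id]])
    show "y \<in> cvec.span {prod_list (map g w) | w. sum_list (map gen_degree w) = b}"
      using assms(2) by (simp add: degree_part_def)
    fix v assume "v \<in> {prod_list (map g w) | w. sum_list (map gen_degree w) = b}"
    then obtain w' where "v = prod_list (map g w')" "sum_list (map gen_degree w') = b" by blast
    then show "prod_list (map g w) * v \<in> cvec.span {prod_list (map g w) | w. sum_list (map gen_degree w) = a + b}"
      using degree_part_word[of "w @ w'"] that by (simp add: degree_part_def)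
  qed
  then have "(\<lambda>x. x * y) x \<in> cvec.span {prod_list (map g w) | w. sum_list (map gen_degree w) = a + b}"
    by (intro span_image_closed[OF clinear_mult_const(2)[OF clinear_id] _ assms(1)[unfolded degree_part_def]])
      (auto simp: degree_part_def)
  then show ?thesis by (simp add: degree_part_def)
qed

lemma degree_part_1: "1 \<in> degree_part g 0"
  using degree_part_word[of "[]"] by simp

lemma degree_part_gen: "g x \<in> degree_part g (gen_degree x)"
  using degree_part_word[of "[x]"] by simp

lemma degree_part_power: "x \<in> degree_part g a \<Longrightarrow> x ^ n \<in> degree_part g (int n * a)"
proof (induction n)
  case (Suc n)
  from degree_part_mult[OF Suc.prems Suc.IH[OF Suc.prems]] show ?case by (simp add: algebra_simps)
qed (simp add: degree_part_1)

lemma degree_part_P: "P \<mu> \<in> degree_part g 0"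
proof -
  have "K ^ j \<in> degree_part g 0" for j
    using degree_part_power[OF degree_part_gen[of GK], of j] by simp
  then show ?thesis
    unfolding weight_idem_def degree_part_def by (intro cvec.span_scale cvec.span_sum) auto
qed

lemma degree_part_E_P: "E ^ n * P \<mu> \<in> degree_part g (int n)"
  using degree_part_mult[OF degree_part_power[OF degree_part_gen[of GE]] degree_part_P] by simp

lemma degree_part_F_P: "F ^ n * P \<mu> \<in> degree_part g (- int n)"
  using degree_part_mult[OF degree_part_power[OF degree_part_gen[of GF]] degree_part_P] by simp

lemma pbw_outside: "j \<notin> pbw_index \<Longrightarrow> pbw j = 0"
  by (cases j) (auto simp: pbw_def pbw_index_def E_pow_0 F_pow_0)

lemma clinear_pbw_coord: "clinear (pbw_coord i)"
  by (rule dual_basisD(2)[OF pbw_basis])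

lemma pbw_coord_pbw: "i \<in> pbw_index \<Longrightarrow> pbw_coord i (pbw j) = (if i = j then 1 else 0)"
  using dual_basisD(3)[OF pbw_basis, of i j] pbw_outside[of j]
  by (cases "j \<in> pbw_index") (auto simp: clinear_0[OF clinear_pbw_coord])

lemma pbw_expand: "(\<Sum>i\<in>pbw_index. pbw_coord i x *\<^sub>C pbw i) = x"
  by (rule dual_basisD(4)[OF pbw_basis])

lemma pbw_coord_degree:
  assumes "x \<in> degree_part g k" "i \<in> pbw_index" "pbw_degree i \<noteq> k"
  shows "pbw_coord i x = 0"
  by (rule coord_span_outside[OF pbw_basis, of "{i. i \<in> pbw_index \<and> pbw_degree i = k}"])
    (use assms degree_part_pbw in \<open>auto simp: pbw_span_def\<close>)

text \<open>Existence comes from rescaling the homogeneous basis, uniqueness from the homogeneity of the words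
  in the generators.\<close>

lemma grading_aut:
  shows "clinear (grading_aut g t)" "x \<in> degree_part g b \<Longrightarrow> grading_aut g t x = (t powi b) *\<^sub>C x"
proof -
  let ?Q = "\<lambda>D. clinear D \<and> (\<forall>b. \<forall>x\<in>degree_part g b. D x = (t powi b) *\<^sub>C x)"
  define D where "D x = (\<Sum>i\<in>pbw_index. pbw_coord i x *\<^sub>C ((t powi pbw_degree i) *\<^sub>C pbw i))" for x
  have lin: "clinear D"
    unfolding D_def by (intro clinear_sum_fun clinear_vec clinear_pbw_coord)
  have D: "D x = (t powi b) *\<^sub>C x" if "x \<in> degree_part g b" for x b
  proof -
    have "D x = (\<Sum>i\<in>pbw_index. (t powi b) *\<^sub>C (pbw_coord i x *\<^sub>C pbw i))"
      unfolding D_def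
    proof (rule sum.cong[OF refl])
      fix i assume "i \<in> pbw_index"
      then show "pbw_coord i x *\<^sub>C ((t powi pbw_degree i) *\<^sub>C pbw i) = (t powi b) *\<^sub>C (pbw_coord i x *\<^sub>C pbw i)"
        using pbw_coord_degree[OF that, of i]
        by (cases "pbw_degree i = b") (simp_all add: mult.commute)
    qed
    then show ?thesis by (simp only: cvec.scale_sum_right[symmetric] pbw_expand)
  qed
  have "grading_aut g t = D"
    unfolding grading_aut_def
  proof (rule the_equality)
    show "?Q D" using lin D by blast
    fix D' assume D': "?Q D'"
    show "D' = D"
    proof
      fix x
      show "D' x = D x" using presentation
      proof (induction x rule: presented_by_induct)
        case (word w)
        show ?case using degree_part_word[of w] D D' by metis
      qed (use D' lin in \<open>simp_all add: Vector_Spaces.linear_iff\<close>)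
    qed
  qed
  with lin D show "clinear (grading_aut g t)"
    "x \<in> degree_part g b \<Longrightarrow> grading_aut g t x = (t powi b) *\<^sub>C x" by simp_all
qed

lemma subalg_E_K: "subalg_gen {E, K, Ki} \<subseteq> cvec.span (pbw ` {(\<gamma>, 0, b) | \<gamma> b. b < CARD('n)})" (is "_ \<subseteq> ?V")
proof -
  have base: "pbw (\<gamma>, 0, b) \<in> ?V" for \<gamma> b
    using pbw_outside[of "(\<gamma>, 0, b)"]
    by (cases "b < CARD('n)") (auto intro!: cvec.span_base imageI simp: pbw_index_def cvec.span_zero)
  have scale: "c *\<^sub>C pbw (\<gamma>, 0, b) \<in> ?V" for c \<gamma> b
    by (rule cvec.span_scale, rule base)
  have step: "x * v \<in> ?V" if "x \<in> {E, K, Ki}" "v \<in> ?V" for x v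
    by (rule span_image_closed[OF clinear_mult_const(1)[OF clinear_id] _ that(2)])
      (use that(1) base scale in \<open>auto simp: E_pbw_0 K_pbw Ki_pbw\<close>)
  have "prod_list w \<in> ?V" if "set w \<subseteq> {E, K, Ki}" for w
    using that
  proof (induction w)
    case Nil
    have "(\<Sum>\<gamma>\<in>UNIV. pbw (\<gamma>, 0, 0)) \<in> ?V" by (rule cvec.span_sum) (rule base)
    then show ?case by (simp add: pbw_def P_sum)
  qed (use step in auto)
  then have "(\<lambda>x. x) x \<in> ?V" if "x \<in> subalg_gen {E, K, Ki}" for x
    by (intro span_image_closed[OF clinear_id _ that[unfolded subalg_gen_def]]) auto
  then show ?thesis by blast
qed

lemma subalg_F_K: "subalg_gen {F, K, Ki} \<subseteq> cvec.span (pbw ` {(\<gamma>, a, 0) | \<gamma> a. a < CARD('n)})" (is "_ \<subseteq> ?V")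
proof -
  have base: "pbw (\<gamma>, a, 0) \<in> ?V" for \<gamma> a
    using pbw_outside[of "(\<gamma>, a, 0)"]
    by (cases "a < CARD('n)") (auto intro!: cvec.span_base imageI simp: pbw_index_def cvec.span_zero)
  have scale: "c *\<^sub>C pbw (\<gamma>, a, 0) \<in> ?V" for c \<gamma> a
    by (rule cvec.span_scale, rule base)
  have step: "x * v \<in> ?V" if "x \<in> {F, K, Ki}" "v \<in> ?V" for x v
    by (rule span_image_closed[OF clinear_mult_const(1)[OF clinear_id] _ that(2)])
      (use that(1) base scale in \<open>auto simp: F_pbw K_pbw Ki_pbw\<close>)
  have "prod_list w \<in> ?V" if "set w \<subseteq> {F, K, Ki}" for w
    using that
  proof (induction w)
    case Nil
    have "(\<Sum>\<gamma>\<in>UNIV. pbw (\<gamma>, 0, 0)) \<in> ?V" by (rule cvec.span_sum) (rule base)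
    then show ?case by (simp add: pbw_def P_sum)
  qed (use step in auto)
  then have "(\<lambda>x. x) x \<in> ?V" if "x \<in> subalg_gen {F, K, Ki}" for x
    by (intro span_image_closed[OF clinear_id _ that[unfolded subalg_gen_def]]) auto
  then show ?thesis by blast
qed

lemma I_plus_span: "I_plus g \<subseteq> cvec.span (pbw ` {(\<gamma>, 0, b) | \<gamma> b. 0 < b \<and> b < CARD('n)})" (is "_ \<subseteq> ?V")
proof -
  have "x \<in> ?V" if x: "x \<in> degree_part g k" "x \<in> subalg_gen {E, K, Ki}" "0 < k" for x k
  proof -
    have "pbw_coord i x *\<^sub>C pbw i \<in> ?V" if "i \<in> pbw_index" for i
    proof (cases "pbw_coord i x = 0")
      case False
      have "i \<in> {(\<gamma>, 0, b) | \<gamma> b. b < CARD('n)}"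
      proof (rule ccontr)
        assume "i \<notin> {(\<gamma>, 0, b) | \<gamma> b. b < CARD('n)}"
        then have "pbw_coord i x = 0"
          by (intro coord_span_outside[OF pbw_basis _ subsetD[OF subalg_E_K x(2)] that])
            (auto simp: pbw_index_def)
        with False show False ..
      qed
      moreover have "pbw_degree i = k" using pbw_coord_degree[OF x(1) that] False by blast
      ultimately have "i \<in> {(\<gamma>, 0, b) | \<gamma> b. 0 < b \<and> b < CARD('n)}"
        using x(3) by (auto simp: pbw_degree_def)
      then show ?thesis by (intro cvec.span_scale cvec.span_base imageI)
    qed (simp add: cvec.span_zero)
    then have "(\<Sum>i\<in>pbw_index. pbw_coord i x *\<^sub>C pbw i) \<in> ?V" by (rule cvec.span_sum)
    then show ?thesis by (simp only: pbw_expand)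
  qed
  then have "(\<lambda>x. x) x \<in> ?V" if "x \<in> I_plus g" for x
    by (intro span_image_closed[OF clinear_id _ that[unfolded I_plus_def]]) auto
  then show ?thesis by blast
qed

lemma I_minus_span: "I_minus g \<subseteq> cvec.span (pbw ` {(\<gamma>, a, 0) | \<gamma> a. 0 < a \<and> a < CARD('n)})" (is "_ \<subseteq> ?V")
proof -
  have "x \<in> ?V" if x: "x \<in> degree_part g k" "x \<in> subalg_gen {F, K, Ki}" "k < 0" for x k
  proof -
    have "pbw_coord i x *\<^sub>C pbw i \<in> ?V" if "i \<in> pbw_index" for i
    proof (cases "pbw_coord i x = 0")
      case False
      have "i \<in> {(\<gamma>, a, 0) | \<gamma> a. a < CARD('n)}"
      proof (rule ccontr)
        assume "i \<notin> {(\<gamma>, a, 0) | \<gamma> a. a < CARD('n)}"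
        then have "pbw_coord i x = 0"
          by (intro coord_span_outside[OF pbw_basis _ subsetD[OF subalg_F_K x(2)] that])
            (auto simp: pbw_index_def)
        with False show False ..
      qed
      moreover have "pbw_degree i = k" using pbw_coord_degree[OF x(1) that] False by blast
      ultimately have "i \<in> {(\<gamma>, a, 0) | \<gamma> a. 0 < a \<and> a < CARD('n)}"
        using x(3) by (auto simp: pbw_degree_def)
      then show ?thesis by (intro cvec.span_scale cvec.span_base imageI)
    qed (simp add: cvec.span_zero)
    then have "(\<Sum>i\<in>pbw_index. pbw_coord i x *\<^sub>C pbw i) \<in> ?V" by (rule cvec.span_sum)
    then show ?thesis by (simp only: pbw_expand)
  qed
  then have "(\<lambda>x. x) x \<in> ?V" if "x \<in> I_minus g" for x
    by (intro span_image_closed[OF clinear_id _ that[unfolded I_minus_def]]) auto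
  then show ?thesis by blast
qed

lemma E_P_I_plus: "0 < n \<Longrightarrow> E ^ n * P \<mu> \<in> I_plus g"
  and F_P_I_minus: "0 < n \<Longrightarrow> F ^ n * P \<mu> \<in> I_minus g"
proof -
  have word: "x ^ n * K ^ j \<in> subalg_gen {x, K, Ki}" for x n j
  proof -
    have "prod_list (replicate n x @ replicate j K) \<in> subalg_gen {x, K, Ki}"
      unfolding subalg_gen_def
      by (rule cvec.span_base, intro CollectI exI[of _ "replicate n x @ replicate j K"])
        (auto simp: set_replicate_conv_if)
    then show ?thesis by simp
  qed
  have sub: "x ^ n * P \<mu> \<in> subalg_gen {x, K, Ki}" for x
    unfolding weight_idem_def scaleC_mult_right sum_distrib_left subalg_gen_def
    by (intro cvec.span_scale cvec.span_sum) (use word in \<open>simp add: subalg_gen_def\<close>)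
  show "0 < n \<Longrightarrow> E ^ n * P \<mu> \<in> I_plus g"
    unfolding I_plus_def using degree_part_E_P sub[of E] by (intro cvec.span_base) force
  show "0 < n \<Longrightarrow> F ^ n * P \<mu> \<in> I_minus g"
    unfolding I_minus_def using degree_part_F_P sub[of F] by (intro cvec.span_base) force
qed

section \<open>The universal R-matrix\<close>

text \<open>The elements of \<open>\<complex>[K] \<otimes> \<complex>[K]\<close>, given by their eigenvalues on pairs of weights.\<close>

definition diag :: "('n mod_ring \<Rightarrow> 'n mod_ring \<Rightarrow> complex) \<Rightarrow> ('u, 'u) tensor" where
  "diag f = (\<Sum>\<mu>\<in>UNIV. \<Sum>\<nu>\<in>UNIV. f \<mu> \<nu> *\<^sub>C (P \<mu> \<boxtimes> P \<nu>))"

lemma P_tens_diag: "(P \<mu> \<boxtimes> P \<nu>) * diag f = f \<mu> \<nu> *\<^sub>C (P \<mu> \<boxtimes> P \<nu>)"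
proof -
  have "(P \<mu> \<boxtimes> P \<nu>) * diag f = (\<Sum>\<mu>'\<in>UNIV. \<Sum>\<nu>'\<in>UNIV. f \<mu>' \<nu>' *\<^sub>C (P \<mu> \<boxtimes> P \<nu>) * (P \<mu>' \<boxtimes> P \<nu>'))"
    unfolding diag_def by (simp add: sum_distrib_left scaleC_mult_left scaleC_mult_right)
  also have "\<dots> = (\<Sum>\<mu>'\<in>UNIV. \<Sum>\<nu>'\<in>UNIV. if \<mu>' = \<mu> then if \<nu>' = \<nu> then f \<mu> \<nu> *\<^sub>C (P \<mu> \<boxtimes> P \<nu>) else 0 else 0)"
    by (intro sum.cong refl) (auto simp: scaleC_mult_left tens_mult_tens P_P)
  also have "\<dots> = f \<mu> \<nu> *\<^sub>C (P \<mu> \<boxtimes> P \<nu>)"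
    by (subst sum_eq_single[of _ \<mu>]) auto
  finally show ?thesis .
qed

lemma diag_P_tens: "diag f * (P \<mu> \<boxtimes> P \<nu>) = f \<mu> \<nu> *\<^sub>C (P \<mu> \<boxtimes> P \<nu>)"
proof -
  have "diag f * (P \<mu> \<boxtimes> P \<nu>) = (\<Sum>\<mu>'\<in>UNIV. \<Sum>\<nu>'\<in>UNIV. f \<mu>' \<nu>' *\<^sub>C (P \<mu>' \<boxtimes> P \<nu>') * (P \<mu> \<boxtimes> P \<nu>))"
    unfolding diag_def by (simp add: sum_distrib_right scaleC_mult_left scaleC_mult_right)
  also have "\<dots> = (\<Sum>\<mu>'\<in>UNIV. \<Sum>\<nu>'\<in>UNIV. if \<mu>' = \<mu> then if \<nu>' = \<nu> then f \<mu> \<nu> *\<^sub>C (P \<mu> \<boxtimes> P \<nu>) else 0 else 0)"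
    by (intro sum.cong refl) (auto simp: scaleC_mult_left tens_mult_tens P_P)
  also have "\<dots> = f \<mu> \<nu> *\<^sub>C (P \<mu> \<boxtimes> P \<nu>)"
    by (subst sum_eq_single[of _ \<mu>]) auto
  finally show ?thesis .
qed

lemma diag_mult: "diag f * diag h = diag (\<lambda>\<mu> \<nu>. f \<mu> \<nu> * h \<mu> \<nu>)"
  unfolding diag_def[of f] sum_distrib_right scaleC_mult_left P_tens_diag
  by (simp add: diag_def)

lemma diag_1: "diag (\<lambda>\<mu> \<nu>. 1) = 1"
  unfolding diag_def one_tensor_def P_sum[symmetric] tens_sum by (simp add: scaleC_one) (rule sum.swap)

lemma diag_add: "diag (\<lambda>\<mu> \<nu>. f \<mu> \<nu> + h \<mu> \<nu>) = diag f + diag h"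
  by (simp add: diag_def scaleC_add_left sum.distrib)

lemma diag_scale: "diag (\<lambda>\<mu> \<nu>. c * f \<mu> \<nu>) = c *\<^sub>C diag f"
  by (simp add: diag_def cvec.scale_sum_right)

lemma diag_0: "diag (\<lambda>\<mu> \<nu>. 0) = 0"
  by (simp add: diag_def)

lemma diag_sum: "diag (\<lambda>\<mu> \<nu>. \<Sum>i\<in>A. f i \<mu> \<nu>) = (\<Sum>i\<in>A. diag (f i))"
  by (induction A rule: infinite_finite_induct) (simp_all add: diag_0 diag_add)

lemma diag_shift:
  assumes "\<And>\<mu>. x * P \<mu> = P (\<mu> + \<alpha>) * x" "\<And>\<nu>. y * P \<nu> = P (\<nu> + \<beta>) * y"
  shows "diag f * (x \<boxtimes> y) = (x \<boxtimes> y) * diag (\<lambda>\<mu> \<nu>. f (\<mu> + \<alpha>) (\<nu> + \<beta>))"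
proof -
  have reindex: "(\<Sum>\<mu>\<in>UNIV. h \<mu>) = (\<Sum>\<mu>\<in>UNIV. h (\<mu> + \<alpha>))"
    for h :: "'n mod_ring \<Rightarrow> ('u, 'u) tensor" and \<alpha>
  proof (rule sum.reindex_bij_betw[symmetric])
    show "bij (\<lambda>\<mu>. \<mu> + \<alpha>)" by (rule bijI') (auto intro: exI[of _ "_ - \<alpha>"])
  qed
  have "diag f = (\<Sum>\<mu>\<in>UNIV. \<Sum>\<nu>\<in>UNIV. f (\<mu> + \<alpha>) (\<nu> + \<beta>) *\<^sub>C (P (\<mu> + \<alpha>) \<boxtimes> P (\<nu> + \<beta>)))"
    unfolding diag_def by (rule trans[OF reindex[of _ \<alpha>]], rule sum.cong[OF refl], rule reindex)
  then show ?thesis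
    by (simp add: diag_def sum_distrib_left sum_distrib_right scaleC_mult_left scaleC_mult_right
        tens_mult_tens assms)
qed

lemma diag_E_F: "diag f * (E ^ m \<boxtimes> F ^ n) = (E ^ m \<boxtimes> F ^ n) * diag (\<lambda>\<mu> \<nu>. f (\<mu> + 2 * of_nat m) (\<nu> - 2 * of_nat n))"
  using diag_shift[of "E ^ m" "2 * of_nat m" "F ^ n" "- 2 * of_nat n" f] by (simp add: E_pow_P F_pow_P)

text \<open>The eigenvalue of \<open>Z\<close> on a pair of weights.\<close>

definition zf :: "'n mod_ring \<Rightarrow> 'n mod_ring \<Rightarrow> complex" where
  "zf \<mu> \<nu> = \<chi> (- (\<mu> * \<nu> * half_mod))"

lemma Z_diag: "Z_elem q P = diag zf"
  by (simp add: Z_elem_def diag_def zf_def)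

lemma zf_nz [simp]: "zf \<mu> \<nu> \<noteq> 0"
  by (simp add: zf_def)

lemma Z_inv: "diag zf * diag (\<lambda>\<mu> \<nu>. inverse (zf \<mu> \<nu>)) = 1" "diag (\<lambda>\<mu> \<nu>. inverse (zf \<mu> \<nu>)) * diag zf = 1"
  "alg_inv (diag zf) = diag (\<lambda>\<mu> \<nu>. inverse (zf \<mu> \<nu>))"
proof -
  show *: "diag zf * diag (\<lambda>\<mu> \<nu>. inverse (zf \<mu> \<nu>)) = 1" "diag (\<lambda>\<mu> \<nu>. inverse (zf \<mu> \<nu>)) * diag zf = 1"
    by (simp_all add: diag_mult diag_1)
  then show "alg_inv (diag zf) = diag (\<lambda>\<mu> \<nu>. inverse (zf \<mu> \<nu>))" by (rule alg_inv_eqI)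
qed

lemma zf_shift: "zf (\<mu> + 2 * \<alpha>) (\<nu> + 2 * \<beta>) = zf \<mu> \<nu> * \<chi> (- (\<alpha> * \<nu> + \<mu> * \<beta> + 2 * \<alpha> * \<beta>))"
proof -
  have "(\<mu> + 2 * \<alpha>) * (\<nu> + 2 * \<beta>) * half_mod =
      \<mu> * \<nu> * half_mod + (2 * half_mod) * (\<alpha> * \<nu> + \<mu> * \<beta> + 2 * \<alpha> * \<beta>)"
    by (simp add: algebra_simps)
  then show ?thesis unfolding zf_def by (simp add: two_half chi_add chi_diff chi_neg)
qed

lemma one_P: "1 * P \<mu> = P (\<mu> + 0) * 1" "K * P \<mu> = P (\<mu> + 0) * K" "Ki * P \<mu> = P (\<mu> + 0) * Ki"
  by (simp_all add: K_P P_K Ki_P P_Ki)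

lemma K_sum: "(\<Sum>\<mu>\<in>UNIV. \<chi> \<mu> *\<^sub>C P \<mu>) = K" "(\<Sum>\<mu>\<in>UNIV. inverse (\<chi> \<mu>) *\<^sub>C P \<mu>) = Ki"
proof -
  have "(\<Sum>\<mu>\<in>UNIV. \<chi> \<mu> *\<^sub>C P \<mu>) = K * (\<Sum>\<mu>\<in>UNIV. P \<mu>)" by (simp add: sum_distrib_left K_P)
  then show "(\<Sum>\<mu>\<in>UNIV. \<chi> \<mu> *\<^sub>C P \<mu>) = K" by (simp add: P_sum)
  have "(\<Sum>\<mu>\<in>UNIV. inverse (\<chi> \<mu>) *\<^sub>C P \<mu>) = Ki * (\<Sum>\<mu>\<in>UNIV. P \<mu>)" by (simp add: sum_distrib_left Ki_P)
  then show "(\<Sum>\<mu>\<in>UNIV. inverse (\<chi> \<mu>) *\<^sub>C P \<mu>) = Ki" by (simp add: P_sum)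
qed

lemma K_diag: "diag (\<lambda>\<mu> \<nu>. f \<mu>) = (\<Sum>\<mu>\<in>UNIV. f \<mu> *\<^sub>C P \<mu>) \<boxtimes> 1" "diag (\<lambda>\<mu> \<nu>. f \<nu>) = 1 \<boxtimes> (\<Sum>\<nu>\<in>UNIV. f \<nu> *\<^sub>C P \<nu>)"
  unfolding diag_def P_sum[symmetric] tens_sum by (simp_all add: tens_simps) (rule sum.swap)+

text \<open>\<open>Z\<close> accounts for the powers of \<open>K\<close> in \<open>\<Delta>(E)\<close>, so that the remaining factor of \<open>R\<close> intertwines two
  expressions that differ only by replacing \<open>K\<close> by its inverse.\<close>

lemma Z_E: "diag zf * (E \<boxtimes> 1 + K \<boxtimes> E) = (E \<boxtimes> Ki + 1 \<boxtimes> E) * diag zf"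
proof -
  have 1: "diag zf * (E \<boxtimes> 1) = (E \<boxtimes> Ki) * diag zf"
  proof -
    have "diag zf * (E \<boxtimes> 1) = (E \<boxtimes> 1) * diag (\<lambda>\<mu> \<nu>. zf (\<mu> + 2) (\<nu> + 0))"
      by (rule diag_shift[OF E_P one_P(1)])
    also have "(\<lambda>\<mu> \<nu>. zf (\<mu> + 2) (\<nu> + 0)) = (\<lambda>\<mu> \<nu>. inverse (\<chi> \<nu>) * zf \<mu> \<nu>)"
      using zf_shift[of _ 1 _ 0] by (simp add: chi_neg mult.commute)
    also have "diag \<dots> = (1 \<boxtimes> Ki) * diag zf"
      unfolding diag_mult[symmetric] K_diag(2) K_sum ..
    finally show ?thesis by (simp add: mult.assoc[symmetric] tens_mult_tens)
  qed
  have 2: "diag zf * (K \<boxtimes> E) = (1 \<boxtimes> E) * diag zf"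
  proof -
    have "diag zf * (K \<boxtimes> E) = (K \<boxtimes> E) * diag (\<lambda>\<mu> \<nu>. zf (\<mu> + 0) (\<nu> + 2))"
      by (rule diag_shift[OF one_P(2) E_P])
    also have "(\<lambda>\<mu> \<nu>. zf (\<mu> + 0) (\<nu> + 2)) = (\<lambda>\<mu> \<nu>. inverse (\<chi> \<mu>) * zf \<mu> \<nu>)"
      using zf_shift[of _ 0 _ 1] by (simp add: chi_neg mult.commute)
    also have "diag \<dots> = (Ki \<boxtimes> 1) * diag zf"
      unfolding diag_mult[symmetric] K_diag(1) K_sum ..
    finally show ?thesis by (simp add: mult.assoc[symmetric] tens_mult_tens rel(1))
  qed
  show ?thesis by (simp add: distrib_left distrib_right 1 2)
qed

lemma Z_K: "diag zf * (K \<boxtimes> K) = (K \<boxtimes> K) * diag zf"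
  using diag_shift[OF one_P(2) one_P(2), of zf] by simp

lemma EF_scalar_eq:
  "EF_scalar \<nu> n = cq * ((q ^ 2) ^ Suc n - 1) / (q ^ 2 - 1) * (\<chi> \<nu> - inverse (\<chi> \<nu> * (q ^ 2) ^ n))"
proof -
  define p where "p = q ^ 2"
  define x where "x = \<chi> \<nu>"
  have p1: "p - 1 \<noteq> 0" using q2_pow_less[of 1] odd_card card_gt by (auto simp: p_def)
  have nz: "p \<noteq> 0" "x \<noteq> 0" by (simp_all add: p_def x_def)
  have "(\<Sum>i<Suc n. x * p ^ i - inverse (x * p ^ i)) = (p ^ Suc n - 1) / (p - 1) * (x - inverse (x * p ^ n))"
  proof (induction n)
    case 0
    then show ?case using p1 by simp
  next
    case (Suc n)
    have "(p ^ Suc (Suc n) - 1) / (p - 1) * (x - inverse (x * p ^ Suc n)) -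
      (p ^ Suc n - 1) / (p - 1) * (x - inverse (x * p ^ n)) = x * p ^ Suc n - inverse (x * p ^ Suc n)"
      using p1 nz by (simp add: divide_simps) (simp add: algebra_simps)
    then show ?case using Suc by (simp add: algebra_simps)
  qed
  then show ?thesis
    unfolding EF_scalar_def chi_add chi_2_of_nat p_def x_def by simp
qed

text \<open>The coefficients of the quasi-R-matrix.\<close>

definition rcoef :: "nat \<Rightarrow> complex" where
  "rcoef k = (\<Prod>i<k. - q * (q - inverse q) ^ 2 / ((q ^ 2) ^ Suc i - 1))"

text \<open>Write \<open>R = R' Z\<close> and expand \<open>R'\<close> in the PBW basis. Commuting with \<open>K \<otimes> K\<close> leaves the terms
  \<open>E\<^sup>k \<otimes> F\<^sup>k\<close> only. In the intertwining relation for \<open>E\<close>, the coefficient of \<open>E\<^sup>k \<otimes> F\<^sup>k E\<close> shows that the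
  coefficients of \<open>R'\<close> do not depend on the second weight, and the coefficient of \<open>E\<^sup>k\<^sup>+\<^sup>1 \<otimes> F\<^sup>k\<close> is a
  recurrence which determines them from the constant term 1.\<close>

lemma universal_R_unique:
  assumes R: "universal_R_matrix \<Delta> R"
    and T: "T \<in> tensor_subspace (I_plus g) (I_minus g)" "R = (1 + T) * Z_elem q P"
  shows "R = (\<Sum>k<CARD('n). rcoef k *\<^sub>C (E ^ k \<boxtimes> F ^ k)) * diag zf"
proof -
  let ?l = "CARD('n)"
  define W where "W = {..<?l} \<times> {..<?l} \<times> (UNIV :: 'n mod_ring set) \<times> (UNIV :: 'n mod_ring set)"
  have finW: "finite W" by (simp add: W_def)
  define B where "B = (\<lambda>(a, b, \<mu>, \<nu>). pbw (\<mu>, 0, a) \<boxtimes> pbw (\<nu>, b, 0))"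
  define W' where "W' = {(a, b, \<mu>, \<nu>) \<in> W. 0 < a \<and> 0 < b}"
  have "T \<in> cvec.span (B ` W')"
  proof -
    have pure: "x \<boxtimes> y \<in> cvec.span (B ` W')" if "x \<in> I_plus g" "y \<in> I_minus g" for x y
    proof -
      have "pbw i \<boxtimes> y \<in> cvec.span (B ` W')" if i: "i \<in> {(\<gamma>, 0, b) | \<gamma> b. 0 < b \<and> b < ?l}" for i
      proof (rule span_image_closed[OF clinear_tens(1)[OF clinear_id] _ subsetD[OF I_minus_span \<open>y \<in> I_minus g\<close>]])
        fix v assume "v \<in> pbw ` {(\<gamma>, a, 0) | \<gamma> a. 0 < a \<and> a < ?l}"
        then obtain \<nu> b where v: "v = pbw (\<nu>, b, 0)" "0 < b" "b < ?l" by auto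
        from i obtain \<mu> a where "i = (\<mu>, 0, a)" "0 < a" "a < ?l" by auto
        then show "pbw i \<boxtimes> v \<in> cvec.span (B ` W')"
          using v by (intro cvec.span_base image_eqI[of _ _ "(a, b, \<mu>, \<nu>)"]) (auto simp: B_def W_def W'_def)
      qed
      then show ?thesis
        by (intro span_image_closed[OF clinear_tens(2)[OF clinear_id] _ subsetD[OF I_plus_span that(1)]]) blast
    qed
    have "(\<lambda>x. x) T \<in> cvec.span (B ` W')"
      by (rule span_image_closed[OF clinear_id _ T(1)[unfolded tensor_subspace_def]]) (use pure in auto)
    then show ?thesis .
  qed
  moreover have finW': "finite W'" by (rule finite_subset[OF _ finW]) (auto simp: W'_def)
  ultimately obtain \<tau>' where \<tau>': "T = (\<Sum>t\<in>W'. \<tau>' t *\<^sub>C B t)"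
    using span_family_coeffs by blast
  define \<tau> where "\<tau> = (\<lambda>(a, b, \<mu>, \<nu>). if a = 0 \<and> b = 0 then 1 else if a = 0 \<or> b = 0 then 0 else \<tau>' (a, b, \<mu>, \<nu>))"
  have RT: "1 + T = (\<Sum>t\<in>W. \<tau> t *\<^sub>C B t)"
  proof -
    let ?W0 = "{0} \<times> {0} \<times> (UNIV :: 'n mod_ring set) \<times> (UNIV :: 'n mod_ring set)"
    have "(\<Sum>t\<in>W. \<tau> t *\<^sub>C B t) = (\<Sum>t\<in>?W0 \<union> W'. \<tau> t *\<^sub>C B t)"
      by (rule sum.mono_neutral_right) (auto simp: finW W_def W'_def \<tau>_def split: if_splits)
    also have "\<dots> = (\<Sum>t\<in>?W0. \<tau> t *\<^sub>C B t) + (\<Sum>t\<in>W'. \<tau> t *\<^sub>C B t)"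
      by (rule sum.union_disjoint) (auto simp: W'_def finW'[unfolded W'_def])
    also have "(\<Sum>t\<in>W'. \<tau> t *\<^sub>C B t) = T"
      unfolding \<tau>' by (intro sum.cong refl) (auto simp: W'_def \<tau>_def)
    also have "(\<Sum>t\<in>?W0. \<tau> t *\<^sub>C B t) =
        (\<Sum>a\<in>{0}. \<Sum>b\<in>{0}. \<Sum>\<mu>\<in>UNIV. \<Sum>\<nu>\<in>UNIV. \<tau> (a, b, \<mu>, \<nu>) *\<^sub>C B (a, b, \<mu>, \<nu>))"
      unfolding sum.cartesian_product by (rule sum.cong) auto
    also have "\<dots> = diag (\<lambda>\<mu> \<nu>. 1)"
      by (simp add: \<tau>_def B_def diag_def pbw_def)
    finally show ?thesis by (simp add: diag_1)
  qed
  define Rh where "Rh = 1 + T"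
  have Rh: "Rh = (\<Sum>t\<in>W. \<tau> t *\<^sub>C B t)" using RT by (simp add: Rh_def)
  have R_eq: "R = Rh * diag zf" using T(2) by (simp add: Rh_def Z_diag)
  have cancel: "x = y" if "x * diag zf = y * diag zf" for x y
  proof -
    have "x * (diag zf * diag (\<lambda>\<mu> \<nu>. inverse (zf \<mu> \<nu>))) = y * (diag zf * diag (\<lambda>\<mu> \<nu>. inverse (zf \<mu> \<nu>)))"
      using that by (simp only: mult.assoc[symmetric])
    then show ?thesis by (simp add: Z_inv)
  qed
  have inter: "R * \<Delta> x = tensor_flip (\<Delta> x) * R" for x using R by (simp add: universal_R_matrix_def)
  have commK: "Rh * (K \<boxtimes> K) = (K \<boxtimes> K) * Rh"
  proof (rule cancel)
    show "Rh * (K \<boxtimes> K) * diag zf = (K \<boxtimes> K) * Rh * diag zf"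
      using inter[of K] unfolding comult tensor_flip_tens R_eq mult.assoc Z_K .
  qed
  have commE: "Rh * (E \<boxtimes> Ki + 1 \<boxtimes> E) = (1 \<boxtimes> E + E \<boxtimes> K) * Rh"
  proof (rule cancel)
    show "Rh * (E \<boxtimes> Ki + 1 \<boxtimes> E) * diag zf = (1 \<boxtimes> E + E \<boxtimes> K) * Rh * diag zf"
      using inter[of E] unfolding comult clinear_add[OF clinear_flip] tensor_flip_tens R_eq mult.assoc Z_E .
  qed
  define \<phi> where "\<phi> i j = tensor_coord (pbw_coord i) (pbw_coord j)" for i j
  have \<phi>lin: "clinear (\<phi> i j)" for i j
    unfolding \<phi>_def by (intro clinear_tensor_coord clinear_pbw_coord)
  have \<phi>: "\<phi> i j (x \<boxtimes> y) = pbw_coord i x * pbw_coord j y" for i j x y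
    unfolding \<phi>_def by (intro tensor_coord_tens clinear_pbw_coord)
  have left: "\<phi> i j ((x \<boxtimes> y) * Rh) =
      (\<Sum>(a, b, \<mu>, \<nu>)\<in>W. \<tau> (a, b, \<mu>, \<nu>) * (pbw_coord i (x * pbw (\<mu>, 0, a)) * pbw_coord j (y * pbw (\<nu>, b, 0))))" for i j x y
    unfolding Rh sum_distrib_left clinear_sum[OF \<phi>lin] B_def
    by (intro sum.cong refl) (auto simp: scaleC_mult_right clinear_scaleC[OF \<phi>lin] tens_mult_tens \<phi> scaleC_complex_def)
  have right: "\<phi> i j (Rh * (x \<boxtimes> y)) =
      (\<Sum>(a, b, \<mu>, \<nu>)\<in>W. \<tau> (a, b, \<mu>, \<nu>) * (pbw_coord i (pbw (\<mu>, 0, a) * x) * pbw_coord j (pbw (\<nu>, b, 0) * y)))" for i j x y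
    unfolding Rh sum_distrib_right clinear_sum[OF \<phi>lin] B_def
    by (intro sum.cong refl) (auto simp: scaleC_mult_left clinear_scaleC[OF \<phi>lin] tens_mult_tens \<phi> scaleC_complex_def)
  have pE: "pbw (\<mu>, a, b) * E = pbw (\<mu>, a, Suc b)" for \<mu> a b
    by (simp add: pbw_def mult.assoc power_commutes)
  have pK: "pbw (\<mu>, 0, a) * K = \<chi> (\<mu> - 2 * of_nat a) *\<^sub>C pbw (\<mu>, 0, a)"
      "pbw (\<nu>, b, 0) * K = \<chi> (\<nu> + 2 * of_nat b) *\<^sub>C pbw (\<nu>, b, 0)"
      "pbw (\<nu>, b, 0) * Ki = inverse (\<chi> (\<nu> + 2 * of_nat b)) *\<^sub>C pbw (\<nu>, b, 0)" for \<mu> \<nu> a b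
    by (simp_all add: pbw_def P_E_pow P_F_pow mult.assoc P_K P_Ki scaleC_mult_right)
  note coord_scale = clinear_scaleC[OF clinear_pbw_coord] scaleC_complex_def
  have diag_only: "\<tau> (a, b, \<mu>, \<nu>) = 0" if "a < ?l" "b < ?l" "a \<noteq> b" for a b \<mu> \<nu>
  proof -
    have idx: "(\<mu>, 0, a) \<in> pbw_index" "(\<nu>, b, 0) \<in> pbw_index" using that by (simp_all add: pbw_index_def)
    have W: "(a, b, \<mu>, \<nu>) \<in> W" using that by (simp add: W_def)
    have "\<phi> (\<mu>, 0, a) (\<nu>, b, 0) ((K \<boxtimes> K) * Rh) = \<tau> (a, b, \<mu>, \<nu>) * (\<chi> \<mu> * \<chi> \<nu>)"
      unfolding left
      by (subst sum_eq_single[OF finW W]) (auto simp: K_pbw coord_scale pbw_coord_pbw[OF idx(1)] pbw_coord_pbw[OF idx(2)] split: if_splits)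
    moreover have "\<phi> (\<mu>, 0, a) (\<nu>, b, 0) (Rh * (K \<boxtimes> K)) =
        \<tau> (a, b, \<mu>, \<nu>) * (\<chi> (\<mu> - 2 * of_nat a) * \<chi> (\<nu> + 2 * of_nat b))"
      unfolding right
      by (subst sum_eq_single[OF finW W]) (auto simp: pK coord_scale pbw_coord_pbw[OF idx(1)] pbw_coord_pbw[OF idx(2)] split: if_splits)
    ultimately have "\<tau> (a, b, \<mu>, \<nu>) * \<chi> (\<mu> + \<nu>) = \<tau> (a, b, \<mu>, \<nu>) * \<chi> (\<mu> - 2 * of_nat a + (\<nu> + 2 * of_nat b))"
      using commK by (simp add: chi_add)
    moreover have "\<mu> + \<nu> \<noteq> \<mu> - 2 * of_nat a + (\<nu> + 2 * of_nat b)"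
    proof
      assume "\<mu> + \<nu> = \<mu> - 2 * of_nat a + (\<nu> + 2 * of_nat b)"
      then have "2 * of_nat a = (2 * of_nat b :: 'n mod_ring)" by (simp add: algebra_simps)
      then show False using inj_onD[OF bij_betw_imp_inj_on[OF bij_of_nat[of 0]], of a b] that by simp
    qed
    ultimately show ?thesis by simp
  qed
  have indep: "\<tau> (k, k, \<mu>, \<nu> - 2) = \<tau> (k, k, \<mu>, \<nu>)" if "k < ?l" for k \<mu> \<nu>
  proof (cases "k = 0")
    case False
    then have Suc0: "Suc 0 < ?l" using that by simp
    have idx: "(\<mu>, 0, k) \<in> pbw_index" "(\<nu>, k, Suc 0) \<in> pbw_index" using that Suc0 by (simp_all add: pbw_index_def)
    have W: "(k, k, \<mu>, \<nu> - 2) \<in> W" "(k, k, \<mu>, \<nu>) \<in> W" using that by (simp_all add: W_def)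
    have cE: "pbw_coord (\<nu>, k, Suc 0) (E * pbw (\<nu>', b, 0)) = (if \<nu>' = \<nu> - 2 \<and> b = k then 1 else 0)" for \<nu>' b
      by (cases b) (auto simp: E_pbw_0 E_pbw_Suc clinear_add[OF clinear_pbw_coord] coord_scale pbw_coord_pbw[OF idx(2)] False)
    have "\<phi> (\<mu>, 0, k) (\<nu>, k, Suc 0) ((1 \<boxtimes> E) * Rh) = \<tau> (k, k, \<mu>, \<nu> - 2)"
      unfolding left
      by (subst sum_eq_single[OF finW W(1)]) (auto simp: cE pbw_coord_pbw[OF idx(1)] split: if_splits)
    moreover have "\<phi> (\<mu>, 0, k) (\<nu>, k, Suc 0) ((E \<boxtimes> K) * Rh) = 0"
      unfolding left
      by (rule sum.neutral) (auto simp: K_pbw coord_scale pbw_coord_pbw[OF idx(2)])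
    moreover have "\<phi> (\<mu>, 0, k) (\<nu>, k, Suc 0) (Rh * (1 \<boxtimes> E)) = \<tau> (k, k, \<mu>, \<nu>)"
      unfolding right
      by (subst sum_eq_single[OF finW W(2)]) (auto simp: pE pbw_coord_pbw[OF idx(1)] pbw_coord_pbw[OF idx(2)] split: if_splits)
    moreover have "\<phi> (\<mu>, 0, k) (\<nu>, k, Suc 0) (Rh * (E \<boxtimes> Ki)) = 0"
      unfolding right
      by (rule sum.neutral) (auto simp: pK coord_scale pbw_coord_pbw[OF idx(2)])
    ultimately show ?thesis
      using arg_cong[OF commE, of "\<phi> (\<mu>, 0, k) (\<nu>, k, Suc 0)"]
      by (simp add: distrib_left distrib_right clinear_add[OF \<phi>lin])
  qed (simp add: \<tau>_def)
  have indep2: "\<tau> (k, k, \<mu>, \<nu>) = \<tau> (k, k, \<mu>, \<nu>')" if "k < ?l" for k \<mu> \<nu> \<nu>'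
  proof -
    have *: "\<tau> (k, k, \<mu>, \<nu> - 2 * of_nat m) = \<tau> (k, k, \<mu>, \<nu>)" for m
    proof (induction m)
      case (Suc m)
      have eq: "\<nu> - 2 * of_nat (Suc m) = \<nu> - 2 * of_nat m - 2" by (simp add: algebra_simps)
      show ?case unfolding eq using Suc indep[OF that, of \<mu> "\<nu> - 2 * of_nat m"] by simp
    qed simp
    have "\<nu> \<in> (\<lambda>j. 2 * of_nat j + \<nu>') ` {..<CARD('n)}"
      unfolding bij_betw_imp_surj_on[OF bij_of_nat] by (rule UNIV_I)
    then obtain m where "\<nu> = 2 * of_nat m + \<nu>'" by (rule imageE)
    then have "\<nu> - 2 * of_nat m = \<nu>'" by (simp add: algebra_simps)
    with *[of m] show ?thesis by simp
  qed
  have step: "\<tau> (Suc k, Suc k, \<mu>, \<nu> - 2) * EF_scalar \<nu> k + \<tau> (k, k, \<mu> - 2, \<nu>) * \<chi> \<nu> =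
      \<tau> (k, k, \<mu>, \<nu>) * inverse (\<chi> (\<nu> + 2 * of_nat k))" if "Suc k < ?l" for k \<mu> \<nu>
  proof -
    have idx: "(\<mu>, 0, Suc k) \<in> pbw_index" "(\<nu>, k, 0) \<in> pbw_index" using that by (simp_all add: pbw_index_def)
    have W: "(Suc k, Suc k, \<mu>, \<nu> - 2) \<in> W" "(k, k, \<mu> - 2, \<nu>) \<in> W" "(k, k, \<mu>, \<nu>) \<in> W" using that by (simp_all add: W_def)
    have cE: "pbw_coord (\<nu>, k, 0) (E * pbw (\<nu>', b, 0)) = (if \<nu>' = \<nu> - 2 \<and> b = Suc k then EF_scalar \<nu> k else 0)" for \<nu>' b
      by (cases b) (auto simp: E_pbw_0 E_pbw_Suc clinear_add[OF clinear_pbw_coord] coord_scale pbw_coord_pbw[OF idx(2)])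
    have "\<phi> (\<mu>, 0, Suc k) (\<nu>, k, 0) ((1 \<boxtimes> E) * Rh) = \<tau> (Suc k, Suc k, \<mu>, \<nu> - 2) * EF_scalar \<nu> k"
      unfolding left
      by (subst sum_eq_single[OF finW W(1)]) (auto simp: cE pbw_coord_pbw[OF idx(1)] split: if_splits)
    moreover have "\<phi> (\<mu>, 0, Suc k) (\<nu>, k, 0) ((E \<boxtimes> K) * Rh) = \<tau> (k, k, \<mu> - 2, \<nu>) * \<chi> \<nu>"
      unfolding left
      by (subst sum_eq_single[OF finW W(2)]) (auto simp: K_pbw E_pbw_0 coord_scale pbw_coord_pbw[OF idx(1)] pbw_coord_pbw[OF idx(2)] split: if_splits)
    moreover have "\<phi> (\<mu>, 0, Suc k) (\<nu>, k, 0) (Rh * (1 \<boxtimes> E)) = 0"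
      unfolding right
      by (rule sum.neutral) (auto simp: pE pbw_coord_pbw[OF idx(2)])
    moreover have "\<phi> (\<mu>, 0, Suc k) (\<nu>, k, 0) (Rh * (E \<boxtimes> Ki)) = \<tau> (k, k, \<mu>, \<nu>) * inverse (\<chi> (\<nu> + 2 * of_nat k))"
      unfolding right
      by (subst sum_eq_single[OF finW W(3)]) (auto simp: pE pK coord_scale pbw_coord_pbw[OF idx(1)] pbw_coord_pbw[OF idx(2)] split: if_splits)
    ultimately show ?thesis
      using arg_cong[OF commE, of "\<phi> (\<mu>, 0, Suc k) (\<nu>, k, 0)"]
      by (simp add: distrib_left distrib_right clinear_add[OF \<phi>lin])
  qed
  have val: "\<tau> (k, k, \<mu>, \<nu>) = rcoef k" if "k < ?l" for k \<mu> \<nu>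
    using that
  proof (induction k arbitrary: \<mu> \<nu>)
    case 0
    show ?case by (simp add: \<tau>_def rcoef_def)
  next
    case (Suc k)
    \<comment> \<open>At this weight the q-integer in the recurrence is \<open>[1]\<close>, hence nonzero.\<close>
    define \<nu>0 where "\<nu>0 = 1 - (of_nat k :: 'n mod_ring)"
    define p where "p = q ^ 2"
    define x where "x = \<chi> \<nu>0"
    define t where "t = \<tau> (Suc k, Suc k, \<mu>, \<nu>)"
    have nz: "p \<noteq> 0" "x \<noteq> 0" "p ^ Suc k - 1 \<noteq> 0" "p - 1 \<noteq> 0"
      using q2_pow_less[of "Suc k"] q2_pow_less[of 1] Suc.prems card_gt by (auto simp: p_def x_def)
    have y: "x - inverse (x * p ^ k) \<noteq> 0"
    proof
      assume "x - inverse (x * p ^ k) = 0"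
      then have "x ^ 2 * p ^ k = 1" using nz by (simp add: field_simps power2_eq_square)
      moreover have "x ^ 2 * p ^ k = \<chi> (2 * \<nu>0 + 2 * of_nat k)"
        by (simp add: chi_add chi_2_of_nat chi_2_mult[of \<nu>0] x_def p_def)
      moreover have "2 * \<nu>0 + 2 * of_nat k = (2 :: 'n mod_ring)" by (simp add: \<nu>0_def algebra_simps)
      ultimately have "p = 1" by (simp add: chi_2 p_def)
      then show False using nz by simp
    qed
    have "\<chi> (\<nu>0 + 2 * of_nat k) = x * p ^ k"
      by (simp add: chi_add chi_2_of_nat x_def p_def)
    then have "t * EF_scalar \<nu>0 k + rcoef k * x = rcoef k * inverse (x * p ^ k)"
      using step[OF Suc.prems, of \<mu> \<nu>0] Suc indep2[OF Suc.prems, of \<mu> "\<nu>0 - 2" \<nu>] by (simp add: t_def x_def)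
    then have "(t * (cq * (p ^ Suc k - 1) / (p - 1)) + rcoef k) * (x - inverse (x * p ^ k)) = 0"
      unfolding EF_scalar_eq p_def[symmetric] x_def[symmetric] by (simp add: algebra_simps)
    then have "t * (cq * (p ^ Suc k - 1) / (p - 1)) = - rcoef k" using y by (simp add: add_eq_0_iff2)
    moreover have "t = - r * (d * B) / A" if "t * (inverse d * A / B) = - r" "d \<noteq> 0" "A \<noteq> 0" "B \<noteq> 0"
      for t r d A B :: complex
    proof -
      have "t = (t * (inverse d * A / B)) * (d * B) / A" using that(2-4) by simp
      then show ?thesis unfolding that(1) .
    qed
    ultimately have "t = - rcoef k * ((q - inverse q) * (p - 1)) / (p ^ Suc k - 1)"
      using nz q_inv_neq by blast
    also have "p - 1 = q * (q - inverse q)" by (simp add: p_def algebra_simps power2_eq_square)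
    finally show ?case
      by (simp add: t_def rcoef_def p_def power2_eq_square[of "q - inverse q"] mult_ac del: power_Suc)
  qed
  have "Rh = (\<Sum>k<?l. rcoef k *\<^sub>C (E ^ k \<boxtimes> F ^ k))"
  proof -
    have "Rh = (\<Sum>a<?l. \<Sum>b<?l. \<Sum>\<mu>\<in>UNIV. \<Sum>\<nu>\<in>UNIV. \<tau> (a, b, \<mu>, \<nu>) *\<^sub>C (pbw (\<mu>, 0, a) \<boxtimes> pbw (\<nu>, b, 0)))"
      unfolding Rh B_def W_def by (simp add: sum.cartesian_product case_prod_unfold)
    also have "\<dots> = (\<Sum>a<?l. \<Sum>\<mu>\<in>UNIV. \<Sum>\<nu>\<in>UNIV. rcoef a *\<^sub>C (pbw (\<mu>, 0, a) \<boxtimes> pbw (\<nu>, a, 0)))"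
    proof (intro sum.cong refl)
      fix a assume "a \<in> {..<?l}"
      then show "(\<Sum>b<?l. \<Sum>\<mu>\<in>UNIV. \<Sum>\<nu>\<in>UNIV. \<tau> (a, b, \<mu>, \<nu>) *\<^sub>C (pbw (\<mu>, 0, a) \<boxtimes> pbw (\<nu>, b, 0))) =
          (\<Sum>\<mu>\<in>UNIV. \<Sum>\<nu>\<in>UNIV. rcoef a *\<^sub>C (pbw (\<mu>, 0, a) \<boxtimes> pbw (\<nu>, a, 0)))"
        by (subst sum_eq_single[of _ a]) (auto simp: diag_only val)
    qed
    also have "\<dots> = (\<Sum>k<?l. rcoef k *\<^sub>C (((\<Sum>\<mu>\<in>UNIV. P \<mu>) * E ^ k) \<boxtimes> ((\<Sum>\<nu>\<in>UNIV. P \<nu>) * F ^ k)))"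
    proof (intro sum.cong refl)
      fix k
      have "((\<Sum>\<mu>\<in>UNIV. P \<mu>) * E ^ k) \<boxtimes> ((\<Sum>\<nu>\<in>UNIV. P \<nu>) * F ^ k) =
          (\<Sum>\<mu>\<in>UNIV. \<Sum>\<nu>\<in>UNIV. (P \<mu> * E ^ k) \<boxtimes> (P \<nu> * F ^ k))"
        unfolding sum_distrib_right tens_sum(2) by (intro sum.cong refl) (rule tens_sum(1))
      then show "(\<Sum>\<mu>\<in>UNIV. \<Sum>\<nu>\<in>UNIV. rcoef k *\<^sub>C (pbw (\<mu>, 0, k) \<boxtimes> pbw (\<nu>, k, 0))) =
          rcoef k *\<^sub>C (((\<Sum>\<mu>\<in>UNIV. P \<mu>) * E ^ k) \<boxtimes> ((\<Sum>\<nu>\<in>UNIV. P \<nu>) * F ^ k))"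
        by (simp add: pbw_def cvec.scale_sum_right)
    qed
    finally show ?thesis by (simp add: P_sum)
  qed
  then show ?thesis by (simp add: R_eq)
qed

end

section \<open>The solution of the dynamical equation\<close>

text \<open>The Pascal recursion defines the Gaussian binomial coefficients without division, hence also when
  \<open>p\<close> is a root of unity.\<close>

fun gauss_binomial :: "complex \<Rightarrow> nat \<Rightarrow> nat \<Rightarrow> complex" where
  "gauss_binomial p n 0 = 1"
| "gauss_binomial p 0 (Suc k) = 0"
| "gauss_binomial p (Suc n) (Suc k) = gauss_binomial p n k + p ^ Suc k * gauss_binomial p n (Suc k)"

lemma gauss_binomial_eq_0: "n < k \<Longrightarrow> gauss_binomial p n k = 0"
proof (induction n arbitrary: k)
  case 0
  then show ?case by (cases k) auto
next
  case (Suc n)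
  then show ?case by (cases k) auto
qed

text \<open>The q-factorial up to a power of \<open>p - 1\<close>.\<close>

definition qfact :: "complex \<Rightarrow> nat \<Rightarrow> complex" where
  "qfact p n = (\<Prod>i<n. p ^ Suc i - 1)"

lemma (in root_of_unity_card) qfact_nz: "k < CARD('n) \<Longrightarrow> qfact (q ^ 2) k \<noteq> 0"
  using q2_pow_less by (auto simp: qfact_def simp del: power_Suc)

lemma gauss_binomial_qfact: "k \<le> n \<Longrightarrow> gauss_binomial p n k * (qfact p k * qfact p (n - k)) = qfact p n"
proof (induction n arbitrary: k)
  case 0
  then show ?case by (simp add: qfact_def)
next
  case (Suc n)
  show ?case
  proof (cases k)
    case 0
    then show ?thesis by (simp add: qfact_def)
  next
    case (Suc m)
    have m: "m \<le> n" using Suc.prems Suc by simp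
    have 1: "gauss_binomial p n m * (qfact p (Suc m) * qfact p (n - m)) = (p ^ Suc m - 1) * qfact p n"
      using Suc.IH[OF m] by (simp add: qfact_def mult_ac)
    have 2: "gauss_binomial p n (Suc m) * (qfact p (Suc m) * qfact p (n - m)) = (p ^ (n - m) - 1) * qfact p n"
    proof (cases "m < n")
      case True
      then have "qfact p (n - m) = (p ^ (n - m) - 1) * qfact p (n - Suc m)"
        by (simp add: qfact_def Suc_diff_Suc[symmetric])
      then show ?thesis using Suc.IH[of "Suc m"] True by (simp add: mult_ac)
    qed (use m in \<open>simp add: gauss_binomial_eq_0\<close>)
    have "gauss_binomial p (Suc n) (Suc m) * (qfact p (Suc m) * qfact p (n - m)) =
        (p ^ Suc m - 1) * qfact p n + p ^ Suc m * ((p ^ (n - m) - 1) * qfact p n)"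
      unfolding gauss_binomial.simps distrib_right mult.assoc 1[unfolded mult.assoc] 2[unfolded mult.assoc]
      using 1 2 by (simp add: mult.assoc)
    also have "\<dots> = (p ^ Suc (m + (n - m)) - 1) * qfact p n"
      by (simp add: algebra_simps power_add)
    also have "\<dots> = qfact p (Suc n)" using m by (simp add: qfact_def)
    finally show ?thesis by (simp add: Suc)
  qed
qed

text \<open>Newton's interpolation of \<open>w\<^sup>n\<close> at the nodes \<open>p, p\<^sup>2, \<dots>, p\<^sup>n\<close>, which are removed in increasing
  order.\<close>

lemma gauss_binomial_newton:
  assumes "p \<noteq> 0"
  shows "w ^ n = (\<Sum>m\<le>n. gauss_binomial p n m * (p ^ (m * m) * (\<Prod>j\<in>{m..<n}. w - p ^ Suc j)))"
proof (induction n arbitrary: w)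
  case (Suc n)
  define t where "t m = p ^ (m * m) * (\<Prod>j\<in>{m..<Suc n}. w - p ^ Suc j)" for m
  have "(\<Sum>m\<le>Suc n. gauss_binomial p (Suc n) m * t m) =
      t 0 + (\<Sum>k\<le>n. gauss_binomial p n k * t (Suc k) + p ^ Suc k * gauss_binomial p n (Suc k) * t (Suc k))"
    by (simp only: sum.atMost_Suc_shift gauss_binomial.simps) (simp add: algebra_simps)
  also have "\<dots> = (\<Sum>k\<le>n. gauss_binomial p n k * t (Suc k)) + (\<Sum>m\<le>Suc n. p ^ m * gauss_binomial p n m * t m)"
    by (simp only: sum.atMost_Suc_shift sum.distrib) simp
  also have "\<dots> = (\<Sum>k\<le>n. gauss_binomial p n k * (t (Suc k) + p ^ k * t k))"
    by (simp add: gauss_binomial_eq_0 sum.distrib algebra_simps)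
  \<comment> \<open>The two terms combine into the induction hypothesis at \<open>w / p\<close>.\<close>
  also have "\<dots> = (\<Sum>k\<le>n. (w * p ^ n) * (gauss_binomial p n k * (p ^ (k * k) * (\<Prod>j\<in>{k..<n}. w / p - p ^ Suc j))))"
  proof (rule sum.cong[OF refl])
    fix k assume "k \<in> {..n}"
    then have k: "k \<le> n" by simp
    have "(\<Prod>j\<in>{Suc k..<Suc n}. w - p ^ Suc j) = (\<Prod>j\<in>{k..<n}. p * (w / p - p ^ Suc j))"
      unfolding prod.shift_bounds_Suc_ivl using assms by (intro prod.cong refl) (simp add: algebra_simps)
    also have "\<dots> = p ^ (n - k) * (\<Prod>j\<in>{k..<n}. w / p - p ^ Suc j)" by (simp add: prod.distrib)
    finally have sh: "(\<Prod>j\<in>{Suc k..<Suc n}. w - p ^ Suc j) = p ^ (n - k) * (\<Prod>j\<in>{k..<n}. w / p - p ^ Suc j)" .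
    have "(\<Prod>j\<in>{k..<Suc n}. w - p ^ Suc j) = (w - p ^ Suc k) * (\<Prod>j\<in>{Suc k..<Suc n}. w - p ^ Suc j)"
      using k by (intro prod.atLeast_Suc_lessThan) simp
    then have "t k = p ^ (k * k) * ((w - p ^ Suc k) * (\<Prod>j\<in>{Suc k..<Suc n}. w - p ^ Suc j))"
      by (simp only: t_def)
    moreover have "t (Suc k) = p ^ (k * k) * p ^ k * p ^ Suc k * (\<Prod>j\<in>{Suc k..<Suc n}. w - p ^ Suc j)"
      unfolding t_def power_add[symmetric] by (simp add: add_ac)
    ultimately have "t (Suc k) + p ^ k * t k = p ^ (k * k) * p ^ k * w * (\<Prod>j\<in>{Suc k..<Suc n}. w - p ^ Suc j)"
      by (simp only:) (simp only: algebra_simps)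
    also have "\<dots> = p ^ (k * k) * w * (p ^ k * p ^ (n - k)) * (\<Prod>j\<in>{k..<n}. w / p - p ^ Suc j)"
      unfolding sh by simp
    also have "p ^ k * p ^ (n - k) = p ^ n" using k by (simp add: power_add[symmetric])
    finally show "gauss_binomial p n k * (t (Suc k) + p ^ k * t k) =
        (w * p ^ n) * (gauss_binomial p n k * (p ^ (k * k) * (\<Prod>j\<in>{k..<n}. w / p - p ^ Suc j)))"
      by (simp add: mult_ac)
  qed
  also have "\<dots> = (w * p ^ n) * (w / p) ^ n" unfolding sum_distrib_left[symmetric] Suc ..
  also have "\<dots> = w ^ Suc n" using assms by (simp add: power_divide)
  finally show ?case by (simp add: t_def)
qed simp

context sl2_root
begin

lemma rcoef_qfact: "rcoef k = (- q * (q - inverse q) ^ 2) ^ k / qfact (q ^ 2) k"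
  unfolding rcoef_def qfact_def prod_dividef by simp

text \<open>The coefficient of \<open>E\<^sup>n \<otimes> F\<^sup>n\<close> in the solution of the dynamical equation with parameter \<open>w\<close>, at weights
  \<open>\<mu>\<close> and \<open>\<nu>\<close> with \<open>a = q\<^sup>\<mu>\<^sup>-\<^sup>\<nu>\<close>.\<close>

definition xi :: "nat \<Rightarrow> complex \<Rightarrow> complex \<Rightarrow> complex" where
  "xi n w a = rcoef n * (\<Prod>j<n. inverse (w - a * (q ^ 2) ^ Suc j))"

text \<open>After division by the product of all denominators this is the interpolation formula for \<open>w\<^sup>m\<close>,
  because the products of the coefficients of \<open>R\<close> are Gaussian binomials.\<close>

lemma xi_recurrence:
  assumes m: "m < CARD('n)" and a: "a \<noteq> 0" and w: "\<And>j. j < m \<Longrightarrow> w \<noteq> a * (q ^ 2) ^ Suc j"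
  shows "w ^ m * xi m w a = (\<Sum>n\<le>m. rcoef (m - n) * (a ^ n * (q ^ 2) ^ (n * n) * xi n w a))"
proof -
  define p where "p = q ^ 2"
  define u where "u = w / a"
  define D where "D n = (\<Prod>j<n. u - p ^ Suc j)" for n
  have wu: "w = a * u" using a by (simp add: u_def)
  have xi: "xi n w a = rcoef n / (a ^ n * D n)" for n
  proof -
    have "(\<Prod>j<n. inverse (w - a * p ^ Suc j)) = (\<Prod>j<n. inverse (a * (u - p ^ Suc j)))"
      by (simp add: wu algebra_simps)
    also have "\<dots> = inverse (a ^ n * D n)"
      by (induction n) (simp_all add: D_def mult_ac)
    finally show ?thesis by (simp add: xi_def p_def divide_inverse)
  qed
  have Dm: "D m \<noteq> 0" using w a by (auto simp: D_def wu p_def)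
  have split: "D n * (\<Prod>j\<in>{n..<m}. u - p ^ Suc j) = D m" if "n \<le> m" for n
    unfolding D_def lessThan_atLeast0 using that by (simp add: prod.atLeastLessThan_concat)
  have rr: "rcoef (m - n) * rcoef n = rcoef m * gauss_binomial p m n" if "n \<le> m" for n
  proof -
    let ?D = "- q * (q - inverse q) ^ 2"
    have nz: "qfact p n \<noteq> 0" "qfact p (m - n) \<noteq> 0" "qfact p m \<noteq> 0"
      using qfact_nz that m by (auto simp: p_def)
    have "gauss_binomial p m n = qfact p m / (qfact p n * qfact p (m - n))"
      using gauss_binomial_qfact[OF that, of p] nz by (simp add: field_simps)
    moreover have "?D ^ (m - n) * ?D ^ n = ?D ^ m" using that by (simp only: power_add[symmetric]) simp
    ultimately show ?thesis
      using nz unfolding rcoef_qfact p_def[symmetric] by (simp add: field_simps)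
  qed
  have "(\<Sum>n\<le>m. rcoef (m - n) * (a ^ n * p ^ (n * n) * xi n w a)) =
      (\<Sum>n\<le>m. rcoef m / D m * (gauss_binomial p m n * (p ^ (n * n) * (\<Prod>j\<in>{n..<m}. u - p ^ Suc j))))"
  proof (rule sum.cong[OF refl])
    fix n assume "n \<in> {..m}"
    then have n: "n \<le> m" by simp
    have Dn: "D n \<noteq> 0" using split[OF n] Dm by auto
    have "rcoef (m - n) * (a ^ n * p ^ (n * n) * xi n w a) = (rcoef (m - n) * rcoef n) * p ^ (n * n) / D n"
      using a by (simp add: xi)
    also have "\<dots> = rcoef m * gauss_binomial p m n * p ^ (n * n) * ((\<Prod>j\<in>{n..<m}. u - p ^ Suc j) / D m)"
    proof -
      have "(\<Prod>j\<in>{n..<m}. u - p ^ Suc j) / D m = 1 / D n"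
        using split[OF n] Dn Dm by (simp add: frac_eq_eq mult.commute)
      then show ?thesis unfolding rr[OF n] by simp
    qed
    finally show "rcoef (m - n) * (a ^ n * p ^ (n * n) * xi n w a) =
      rcoef m / D m * (gauss_binomial p m n * (p ^ (n * n) * (\<Prod>j\<in>{n..<m}. u - p ^ Suc j)))" by simp
  qed
  also have "\<dots> = rcoef m / D m * u ^ m"
    unfolding sum_distrib_left[symmetric] by (subst gauss_binomial_newton[of p u m]) (simp_all add: p_def)
  also have "\<dots> = w ^ m * xi m w a" unfolding xi using a by (simp add: wu power_mult_distrib)
  finally show ?thesis by (simp add: p_def)
qed

text \<open>The zero-weight elements \<open>\<Sum> (E\<^sup>n \<otimes> F\<^sup>n) f\<^sub>n(K \<otimes> 1, 1 \<otimes> K)\<close>.\<close>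

definition zero_weight :: "(nat \<Rightarrow> 'n mod_ring \<Rightarrow> 'n mod_ring \<Rightarrow> complex) \<Rightarrow> ('u, 'u) tensor" where
  "zero_weight f = (\<Sum>n<CARD('n). (E ^ n \<boxtimes> F ^ n) * diag (f n))"

definition X0 :: "complex \<Rightarrow> ('u, 'u) tensor" where
  "X0 w = zero_weight (\<lambda>n \<mu> \<nu>. xi n w (\<chi> (\<mu> - \<nu>)))"

lemma E_F_diag: "(E ^ n \<boxtimes> F ^ n) * diag f = (\<Sum>\<mu>\<in>UNIV. \<Sum>\<nu>\<in>UNIV. f \<mu> \<nu> *\<^sub>C ((E ^ n * P \<mu>) \<boxtimes> (F ^ n * P \<nu>)))"
  by (simp add: diag_def sum_distrib_left scaleC_mult_right tens_mult_tens)

lemma zero_weight_degree: "zero_weight f \<in> tensor_degree_zero g"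
  unfolding zero_weight_def E_F_diag tensor_degree_zero_def
proof (intro cvec.span_sum cvec.span_scale cvec.span_base)
  fix n \<mu> \<nu>
  show "(E ^ n * P \<mu>) \<boxtimes> (F ^ n * P \<nu>) \<in> {a \<boxtimes> c | a c b. a \<in> degree_part g b \<and> c \<in> degree_part g (- b)}"
    by (rule CollectI, rule exI, rule exI, rule exI, rule conjI[OF refl conjI])
      (rule degree_part_E_P degree_part_F_P)+
qed

lemma card_Suc: "CARD('n) = Suc (CARD('n) - 1)"
  using card_gt by simp

lemma zero_weight_split: "zero_weight f = diag (f 0) + (\<Sum>n\<in>{1..<CARD('n)}. (E ^ n \<boxtimes> F ^ n) * diag (f n))"
proof -
  have "{..<CARD('n)} = insert 0 {1..<CARD('n)}" using card_gt by auto
  then show ?thesis unfolding zero_weight_def by (simp add: one_tensor_def[symmetric])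
qed

lemma zero_weight_minus_1:
  assumes "f 0 = (\<lambda>\<mu> \<nu>. 1)"
  shows "zero_weight f - 1 \<in> tensor_subspace (I_plus g) (I_minus g)"
proof -
  have "(\<Sum>n\<in>{1..<CARD('n)}. (E ^ n \<boxtimes> F ^ n) * diag (f n)) \<in> tensor_subspace (I_plus g) (I_minus g)"
    unfolding E_F_diag tensor_subspace_def
  proof (intro cvec.span_sum cvec.span_scale cvec.span_base)
    fix n \<mu> \<nu> assume "n \<in> {1..<CARD('n)}"
    then have n: "0 < n" by simp
    show "(E ^ n * P \<mu>) \<boxtimes> (F ^ n * P \<nu>) \<in> {a \<boxtimes> b | a b. a \<in> I_plus g \<and> b \<in> I_minus g}"
      by (rule CollectI, rule exI, rule exI, rule conjI[OF refl conjI])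
        (rule E_P_I_plus[OF n] F_P_I_minus[OF n])+
  qed
  then show ?thesis by (simp add: zero_weight_split assms diag_1)
qed

lemma grading_zero_weight:
  "tensor_map (grading_aut g w) id (zero_weight f) = zero_weight (\<lambda>n \<mu> \<nu>. w ^ n * f n \<mu> \<nu>)"
proof -
  have l: "clinear (tensor_map (grading_aut g w) (id :: 'u \<Rightarrow> 'u))"
    by (rule clinear_tensor_map[OF grading_aut(1)]) (simp add: id_def clinear_id)
  have "tensor_map (grading_aut g w) id ((E ^ n * P \<mu>) \<boxtimes> (F ^ n * P \<nu>)) =
      w ^ n *\<^sub>C ((E ^ n * P \<mu>) \<boxtimes> (F ^ n * P \<nu>))" for n \<mu> \<nu>
    by (subst tensor_map_tens[OF grading_aut(1)])
      (simp_all add: id_def clinear_id grading_aut(2)[OF degree_part_E_P] tens_simps)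
  then show ?thesis
    unfolding zero_weight_def E_F_diag
    by (simp add: clinear_sum[OF l] clinear_scaleC[OF l] scaleC_scaleC mult.commute)
qed

lemma E_F_mult: "(E ^ k \<boxtimes> F ^ k) * (E ^ n \<boxtimes> F ^ n) = (E ^ (k + n) \<boxtimes> F ^ (k + n))"
  by (simp add: tens_mult_tens power_add)

lemma E_F_0: "n \<ge> CARD('n) \<Longrightarrow> E ^ n \<boxtimes> F ^ n = 0"
  by (simp add: E_pow_0)

lemma triangle_sum:
  fixes f :: "nat \<Rightarrow> nat \<Rightarrow> 'a::comm_monoid_add"
  assumes "\<And>k n. k + n \<ge> m \<Longrightarrow> f k n = 0"
  shows "(\<Sum>k<m. \<Sum>n<m. f k n) = (\<Sum>i<m. \<Sum>n\<le>i. f (i - n) n)"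
proof -
  have "(\<Sum>k<m. \<Sum>n<m. f k n) = (\<Sum>(n, k)\<in>{..<m} \<times> {..<m}. f k n)"
    by (subst sum.swap) (rule sum.cartesian_product)
  also have "\<dots> = (\<Sum>(n, k)\<in>{(n, k). n + k < m}. f k n)"
    by (rule sum.mono_neutral_right) (auto, metis assms add.commute not_le)
  also have "\<dots> = (\<Sum>i<m. \<Sum>n\<le>i. f (i - n) n)" by (rule sum.triangle_reindex)
  finally show ?thesis .
qed

text \<open>Moving \<open>Z\<close> past \<open>E\<^sup>n \<otimes> F\<^sup>n\<close> produces the factor \<open>q\<^sup>n\<^sup>(\<^sup>\<mu>\<^sup>-\<^sup>\<nu>\<^sup>) q\<^sup>2\<^sup>n\<^sup>n\<close>, and the coefficient of \<open>E\<^sup>m \<otimes> F\<^sup>m\<close> is then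
  the recurrence for \<open>xi\<close>.\<close>

lemma X0_equation:
  assumes R: "R = (\<Sum>k<CARD('n). rcoef k *\<^sub>C (E ^ k \<boxtimes> F ^ k)) * diag zf" and t: "t ^ CARD('n) \<noteq> 1"
  shows "dynamical_equation q P g R t lam (X0 (t * \<chi> lam))"
proof -
  define w where "w = t * \<chi> lam"
  have nodes: "w \<noteq> \<chi> \<mu> * (q ^ 2) ^ j" for \<mu> j
  proof
    assume "w = \<chi> \<mu> * (q ^ 2) ^ j"
    then have "w = \<chi> (\<mu> + 2 * of_nat j)" by (simp only: chi_add chi_2_of_nat)
    then have "w ^ CARD('n) = 1" by (simp only: chi_card)
    then show False using t by (simp add: w_def power_mult_distrib chi_card)
  qed
  let ?x = "\<lambda>n \<mu> \<nu>. xi n w (\<chi> (\<mu> - \<nu>))"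
  let ?y = "\<lambda>n \<mu> \<nu>. \<chi> (\<mu> - \<nu>) ^ n * (q ^ 2) ^ (n * n) * ?x n \<mu> \<nu>"
  have z: "zf (\<mu> + 2 * of_nat n) (\<nu> - 2 * of_nat n) * inverse (zf \<mu> \<nu>) = \<chi> (\<mu> - \<nu>) ^ n * (q ^ 2) ^ (n * n)" for \<mu> \<nu> n
  proof -
    have "- (of_nat n * \<nu> + \<mu> * - of_nat n + 2 * of_nat n * - of_nat n) = of_nat n * (\<mu> - \<nu>) + 2 * of_nat (n * n)"
      by (simp add: algebra_simps)
    then have "zf (\<mu> + 2 * of_nat n) (\<nu> + 2 * - of_nat n) = zf \<mu> \<nu> * \<chi> (of_nat n * (\<mu> - \<nu>) + 2 * of_nat (n * n))"
      by (simp only: zf_shift)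
    then show ?thesis by (simp add: chi_add chi_2_of_nat chi_of_nat_mult del: of_nat_mult)
  qed
  have summand: "rcoef k *\<^sub>C (E ^ k \<boxtimes> F ^ k) * (diag zf * ((E ^ n \<boxtimes> F ^ n) * diag (?x n)) * diag (\<lambda>\<mu> \<nu>. inverse (zf \<mu> \<nu>))) =
      (E ^ (k + n) \<boxtimes> F ^ (k + n)) * diag (\<lambda>\<mu> \<nu>. rcoef k * ?y n \<mu> \<nu>)" for k n
  proof -
    have "diag zf * ((E ^ n \<boxtimes> F ^ n) * diag (?x n)) * diag (\<lambda>\<mu> \<nu>. inverse (zf \<mu> \<nu>)) =
        (E ^ n \<boxtimes> F ^ n) * diag (\<lambda>\<mu> \<nu>. zf (\<mu> + 2 * of_nat n) (\<nu> - 2 * of_nat n) * ?x n \<mu> \<nu> * inverse (zf \<mu> \<nu>))"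
      unfolding mult.assoc[symmetric] diag_E_F unfolding mult.assoc diag_mult ..
    also have "(\<lambda>\<mu> \<nu>. zf (\<mu> + 2 * of_nat n) (\<nu> - 2 * of_nat n) * ?x n \<mu> \<nu> * inverse (zf \<mu> \<nu>)) = ?y n"
      by (intro ext) (simp add: z[symmetric])
    finally have "rcoef k *\<^sub>C (E ^ k \<boxtimes> F ^ k) * (diag zf * ((E ^ n \<boxtimes> F ^ n) * diag (?x n)) * diag (\<lambda>\<mu> \<nu>. inverse (zf \<mu> \<nu>))) =
        (rcoef k *\<^sub>C (E ^ k \<boxtimes> F ^ k)) * ((E ^ n \<boxtimes> F ^ n) * diag (?y n))" by (simp only:)
    also have "\<dots> = ((E ^ k \<boxtimes> F ^ k) * (E ^ n \<boxtimes> F ^ n)) * (rcoef k *\<^sub>C diag (?y n))"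
      by (simp only: scaleC_mult_left scaleC_mult_right mult.assoc)
    finally show ?thesis unfolding E_F_mult diag_scale[symmetric] .
  qed
  have "R * X0 w * alg_inv (Z_elem q P) =
    (\<Sum>k<CARD('n). \<Sum>n<CARD('n). rcoef k *\<^sub>C (E ^ k \<boxtimes> F ^ k) * (diag zf * ((E ^ n \<boxtimes> F ^ n) * diag (?x n)) * diag (\<lambda>\<mu> \<nu>. inverse (zf \<mu> \<nu>))))"
    unfolding R X0_def zero_weight_def Z_diag Z_inv(3)
    by (simp add: sum_distrib_left sum_distrib_right mult.assoc) (rule sum.swap)
  also have "\<dots> = (\<Sum>k<CARD('n). \<Sum>n<CARD('n). (E ^ (k + n) \<boxtimes> F ^ (k + n)) * diag (\<lambda>\<mu> \<nu>. rcoef k * ?y n \<mu> \<nu>))"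
    by (simp only: summand)
  also have "\<dots> = (\<Sum>m<CARD('n). \<Sum>n\<le>m. (E ^ (m - n + n) \<boxtimes> F ^ (m - n + n)) * diag (\<lambda>\<mu> \<nu>. rcoef (m - n) * ?y n \<mu> \<nu>))"
    by (rule triangle_sum) (simp add: E_F_0)
  also have "\<dots> = (\<Sum>m<CARD('n). (E ^ m \<boxtimes> F ^ m) * diag (\<lambda>\<mu> \<nu>. w ^ m * ?x m \<mu> \<nu>))"
  proof (rule sum.cong[OF refl])
    fix m assume "m \<in> {..<CARD('n)}"
    then have m: "m < CARD('n)" by simp
    have "(\<Sum>n\<le>m. (E ^ (m - n + n) \<boxtimes> F ^ (m - n + n)) * diag (\<lambda>\<mu> \<nu>. rcoef (m - n) * ?y n \<mu> \<nu>)) =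
        (E ^ m \<boxtimes> F ^ m) * diag (\<lambda>\<mu> \<nu>. \<Sum>n\<le>m. rcoef (m - n) * ?y n \<mu> \<nu>)"
      by (simp add: diag_sum sum_distrib_left)
    also have "(\<lambda>\<mu> \<nu>. \<Sum>n\<le>m. rcoef (m - n) * ?y n \<mu> \<nu>) = (\<lambda>\<mu> \<nu>. w ^ m * ?x m \<mu> \<nu>)"
      by (intro ext, rule xi_recurrence[symmetric, OF m]) (use nodes in \<open>auto simp del: power_Suc\<close>)
    finally show "(\<Sum>n\<le>m. (E ^ (m - n + n) \<boxtimes> F ^ (m - n + n)) * diag (\<lambda>\<mu> \<nu>. rcoef (m - n) * ?y n \<mu> \<nu>)) =
        (E ^ m \<boxtimes> F ^ m) * diag (\<lambda>\<mu> \<nu>. w ^ m * ?x m \<mu> \<nu>)" .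
  qed
  finally have "R * X0 w * alg_inv (Z_elem q P) = zero_weight (\<lambda>m \<mu> \<nu>. w ^ m * ?x m \<mu> \<nu>)"
    unfolding zero_weight_def .
  then have eq: "R * X0 w * alg_inv (Z_elem q P) = tensor_map (grading_aut g w) id (X0 w)"
    unfolding X0_def grading_zero_weight .
  show ?thesis
    unfolding dynamical_equation_def w_def[symmetric] using eq
    by (auto simp: X0_def zero_weight_degree intro!: zero_weight_minus_1 simp: xi_def rcoef_def)
qed

text \<open>At every parameter outside a finite set the equation has exactly one solution; away from the roots
  of unity it is solved by \<open>X0\<close>, so the two rational functions agree near \<open>\<Lambda>\<close>, hence by continuity at \<open>\<Lambda>\<close>.\<close>

lemma dynamical_X_eq:
  assumes R: "R = (\<Sum>k<CARD('n). rcoef k *\<^sub>C (E ^ k \<boxtimes> F ^ k)) * diag zf" and \<Lambda>: "\<Lambda> ^ CARD('n) \<noteq> 1"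
    and x: "dynamical_X q P g R \<Lambda> lam x"
  shows "x = X0 (\<Lambda> * \<chi> lam)"
proof -
  obtain d :: "complex poly" and N :: "nat \<Rightarrow> ('u, 'u) tensor" and m where
    d: "poly d \<Lambda> \<noteq> 0" and x: "x = inverse (poly d \<Lambda>) *\<^sub>C (\<Sum>k\<le>m. \<Lambda> ^ k *\<^sub>C N k)"
    and fin: "finite {t. \<not> (\<forall>z. dynamical_equation q P g R t lam z \<longleftrightarrow> z = inverse (poly d t) *\<^sub>C (\<Sum>k\<le>m. t ^ k *\<^sub>C N k))}"
    using x unfolding dynamical_X_def Let_def by blast
  let ?r = "\<lambda>t. inverse (poly d t) *\<^sub>C (\<Sum>k\<le>m. t ^ k *\<^sub>C N k)"
  let ?Bad = "{t. \<not> (\<forall>z. dynamical_equation q P g R t lam z \<longleftrightarrow> z = ?r t)}"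
  have "open (- (?Bad - {\<Lambda>}))" using fin by (intro open_Compl finite_imp_closed) auto
  then have "eventually (\<lambda>t. t \<in> - (?Bad - {\<Lambda>})) (nhds \<Lambda>)" by (rule eventually_nhds_in_open) auto
  then have ev1: "eventually (\<lambda>t. t \<notin> ?Bad) (at \<Lambda>)"
    unfolding eventually_at_filter by (rule eventually_mono) auto
  have "((\<lambda>t. t ^ CARD('n)) \<longlongrightarrow> \<Lambda> ^ CARD('n)) (at \<Lambda>)" by (intro tendsto_intros)
  then have ev2: "eventually (\<lambda>t. t ^ CARD('n) \<noteq> 1) (at \<Lambda>)" using \<Lambda> by (rule tendsto_imp_eventually_ne)
  have ev: "eventually (\<lambda>t. ?r t = X0 (t * \<chi> lam)) (at \<Lambda>)"
    using ev1 ev2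
  proof eventually_elim
    case (elim t)
    then show ?case using X0_equation[OF R elim(2), of lam] by auto
  qed
  show ?thesis
  proof (rule clinear_eq_if_functionals_eq)
    fix f :: "('u, 'u) tensor \<Rightarrow> complex"
    assume f: "clinear f"
    have fr: "f (?r t) = inverse (poly d t) * (\<Sum>k\<le>m. t ^ k * f (N k))" for t
      by (simp add: clinear_scaleC[OF f] clinear_sum[OF f] scaleC_complex_def)
    have fX: "f (X0 w) = (\<Sum>n<CARD('n). \<Sum>\<mu>\<in>UNIV. \<Sum>\<nu>\<in>UNIV. xi n w (\<chi> (\<mu> - \<nu>)) * f ((E ^ n * P \<mu>) \<boxtimes> (F ^ n * P \<nu>)))" for w
      by (simp add: X0_def zero_weight_def E_F_diag clinear_scaleC[OF f] clinear_sum[OF f] scaleC_complex_def)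
    have nodes: "\<Lambda> * \<chi> lam - \<chi> \<mu> * (q ^ 2) ^ j \<noteq> 0" for \<mu> j
    proof
      assume "\<Lambda> * \<chi> lam - \<chi> \<mu> * (q ^ 2) ^ j = 0"
      then have "\<Lambda> * \<chi> lam = \<chi> (\<mu> + 2 * of_nat j)" by (simp only: chi_add chi_2_of_nat) simp
      then have "(\<Lambda> * \<chi> lam) ^ CARD('n) = 1" by (simp only: chi_card)
      then show False using \<Lambda> by (simp add: power_mult_distrib chi_card)
    qed
    have lim1: "((\<lambda>t. f (?r t)) \<longlongrightarrow> f x) (at \<Lambda>)"
      unfolding fr x using d by (intro tendsto_intros)
    have lim2: "((\<lambda>t. f (X0 (t * \<chi> lam))) \<longlongrightarrow> f (X0 (\<Lambda> * \<chi> lam))) (at \<Lambda>)"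
      unfolding fX xi_def by (intro tendsto_intros nodes)
    have "((\<lambda>t. f (?r t)) \<longlongrightarrow> f (X0 (\<Lambda> * \<chi> lam))) (at \<Lambda>)"
      by (rule Lim_transform_eventually[OF lim2]) (use ev in eventually_elim, simp)
    with lim1 show "f x = f (X0 (\<Lambda> * \<chi> lam))" by (rule tendsto_unique[OF at_neq_bot])
  qed
qed

text \<open>The coefficients of the dynamical twist: those of \<open>X0\<close> with the parameter evaluated at the weights.\<close>

definition jcoef :: "complex \<Rightarrow> 'n mod_ring \<Rightarrow> nat \<Rightarrow> 'n mod_ring \<Rightarrow> 'n mod_ring \<Rightarrow> complex" where
  "jcoef \<Lambda> lam n \<mu> \<nu> = xi n (\<Lambda> * \<chi> (2 * lam + \<mu> + \<nu>)) (\<chi> (\<mu> - \<nu>))"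

lemma dynamical_twist_eq:
  assumes "\<And>lam. X lam = X0 (\<Lambda> * \<chi> lam)"
  shows "dynamical_twist P X lam = zero_weight (jcoef \<Lambda> lam)"
proof -
  have "X (2 * lam + \<mu> + \<nu>) * (P \<mu> \<boxtimes> P \<nu>) =
      (\<Sum>n<CARD('n). (E ^ n \<boxtimes> F ^ n) * (jcoef \<Lambda> lam n \<mu> \<nu> *\<^sub>C (P \<mu> \<boxtimes> P \<nu>)))" for \<mu> \<nu>
    unfolding assms X0_def zero_weight_def sum_distrib_right mult.assoc diag_P_tens jcoef_def ..
  then have "dynamical_twist P X lam = (\<Sum>\<mu>\<in>UNIV. \<Sum>\<nu>\<in>UNIV. \<Sum>n<CARD('n). (E ^ n \<boxtimes> F ^ n) * (jcoef \<Lambda> lam n \<mu> \<nu> *\<^sub>C (P \<mu> \<boxtimes> P \<nu>)))"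
    by (simp add: dynamical_twist_def)
  also have "\<dots> = (\<Sum>n<CARD('n). \<Sum>\<mu>\<in>UNIV. \<Sum>\<nu>\<in>UNIV. (E ^ n \<boxtimes> F ^ n) * (jcoef \<Lambda> lam n \<mu> \<nu> *\<^sub>C (P \<mu> \<boxtimes> P \<nu>)))"
    by (rule trans[OF sum.cong[OF refl sum.swap] sum.swap])
  also have "\<dots> = zero_weight (jcoef \<Lambda> lam)"
    by (simp add: zero_weight_def diag_def sum_distrib_left)
  finally show ?thesis .
qed

lemma jcoef_0: "jcoef \<Lambda> lam 0 = (\<lambda>\<mu> \<nu>. 1)"
  by (intro ext) (simp add: jcoef_def xi_def rcoef_def)

text \<open>The terms with \<open>n > 0\<close> raise the degree of the first tensor factor, so their sum is nilpotent.\<close>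

lemma zero_weight_unit:
  assumes "f 0 = (\<lambda>\<mu> \<nu>. 1)"
  shows "unit_elem (zero_weight f)"
proof -
  let ?l = "CARD('n)"
  define L where "L m = {\<Sum>n\<in>{m..<?l}. (E ^ n \<boxtimes> F ^ n) * diag (h n) | h. True}" for m
  define y where "y = (\<Sum>n\<in>{1..<?l}. (E ^ n \<boxtimes> F ^ n) * diag (f n))"
  have zf: "zero_weight f = 1 + y" by (simp add: zero_weight_split assms diag_1 y_def)
  have step: "y * x \<in> L (Suc m)" if "x \<in> L m" for x m
  proof -
    have "\<exists>h. x = (\<Sum>n\<in>{m..<?l}. (E ^ n \<boxtimes> F ^ n) * diag (h n))"
      using that by (simp only: L_def mem_Collect_eq simp_thms)
    then obtain h where h: "x = (\<Sum>n\<in>{m..<?l}. (E ^ n \<boxtimes> F ^ n) * diag (h n))" ..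
    define h' where "h' i n = (\<lambda>\<mu> \<nu>. f i (\<mu> + 2 * of_nat n) (\<nu> - 2 * of_nat n) * h n \<mu> \<nu>)" for i n
    define k where "k j = (\<lambda>\<mu> \<nu>. \<Sum>i\<in>{1..<?l}. \<Sum>n\<in>{m..<?l}. if i + n = j then h' i n \<mu> \<nu> else 0)" for j
    have "y * x = (\<Sum>i\<in>{1..<?l}. \<Sum>n\<in>{m..<?l}. (E ^ (i + n) \<boxtimes> F ^ (i + n)) * diag (h' i n))"
    proof -
      have "(E ^ i \<boxtimes> F ^ i) * diag (f i) * ((E ^ n \<boxtimes> F ^ n) * diag (h n)) =
          (E ^ (i + n) \<boxtimes> F ^ (i + n)) * diag (h' i n)" for i n
      proof -
        have "(E ^ i \<boxtimes> F ^ i) * diag (f i) * ((E ^ n \<boxtimes> F ^ n) * diag (h n)) =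
            (E ^ i \<boxtimes> F ^ i) * (diag (f i) * (E ^ n \<boxtimes> F ^ n)) * diag (h n)" by (simp only: mult.assoc)
        also have "\<dots> = ((E ^ i \<boxtimes> F ^ i) * (E ^ n \<boxtimes> F ^ n)) * (diag (\<lambda>\<mu> \<nu>. f i (\<mu> + 2 * of_nat n) (\<nu> - 2 * of_nat n)) * diag (h n))"
          unfolding diag_E_F by (simp only: mult.assoc)
        finally show ?thesis unfolding E_F_mult diag_mult h'_def .
      qed
      then show ?thesis unfolding y_def h sum_distrib_left sum_distrib_right by (subst sum.swap) simp
    qed
    also have "\<dots> = (\<Sum>i\<in>{1..<?l}. \<Sum>n\<in>{m..<?l}. \<Sum>j\<in>{Suc m..<?l}. (E ^ j \<boxtimes> F ^ j) * diag (\<lambda>\<mu> \<nu>. if i + n = j then h' i n \<mu> \<nu> else 0))"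
    proof (intro sum.cong refl)
      fix i n assume in_: "i \<in> {1..<?l}" "n \<in> {m..<?l}"
      show "(E ^ (i + n) \<boxtimes> F ^ (i + n)) * diag (h' i n) =
          (\<Sum>j\<in>{Suc m..<?l}. (E ^ j \<boxtimes> F ^ j) * diag (\<lambda>\<mu> \<nu>. if i + n = j then h' i n \<mu> \<nu> else 0))"
      proof (cases "i + n < ?l")
        case True
        then show ?thesis using in_ by (subst sum_eq_single[of _ "i + n"]) (auto simp: diag_0)
      next
        case False
        then have "(\<Sum>j\<in>{Suc m..<?l}. (E ^ j \<boxtimes> F ^ j) * diag (\<lambda>\<mu> \<nu>. if i + n = j then h' i n \<mu> \<nu> else 0)) = 0"
          by (intro sum.neutral) (auto simp: diag_0)
        then show ?thesis using False by (simp add: E_F_0)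
      qed
    qed
    also have "\<dots> = (\<Sum>j\<in>{Suc m..<?l}. (E ^ j \<boxtimes> F ^ j) * diag (k j))"
      unfolding k_def diag_sum sum_distrib_left by (rule trans[OF sum.cong[OF refl sum.swap] sum.swap])
    finally show ?thesis unfolding L_def by (auto intro!: exI[of _ k])
  qed
  have "y ^ Suc m \<in> L (Suc m)" for m
  proof (induction m)
    case 0
    show ?case unfolding L_def y_def by (auto intro!: exI[of _ f])
  next
    case (Suc m)
    then show ?case using step[OF Suc] by simp
  qed
  from this[of "?l - 1"] have "y ^ ?l \<in> L ?l" by (simp only: card_Suc[symmetric])
  then have nil: "y ^ ?l = 0" unfolding L_def by auto
  define z where "z = (\<Sum>k<?l. (- y) ^ k)"
  have "(1 - (- y)) * (\<Sum>k<m. (- y) ^ k) = 1 - (- y) ^ m" for m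
    by (induction m) (simp_all add: algebra_simps)
  then have "(1 - (- y)) * z = 1 - (- y) ^ ?l" unfolding z_def .
  then have r: "(1 + y) * z = 1" using nil by (simp add: power_minus[of y])
  have "y * z = z * y"
    unfolding z_def sum_distrib_left sum_distrib_right
    by (intro sum.cong refl, rule power_commuting_commutes[symmetric]) simp
  then have "z * (1 + y) = 1" using r by (simp add: distrib_left distrib_right)
  with r show ?thesis unfolding zf by (rule unit_elemI)
qed

end

section \<open>A terminating basic hypergeometric sum at a root of unity\<close>

text \<open>The factors are treated one at a time, so that repetitions are allowed; this matters because the nodes
  of the Casimir element coincide in pairs.\<close>

lemma bezout_linear_factors:
  fixes f :: "complex poly" and t :: "nat \<Rightarrow> complex"
  assumes "\<And>j. j < n \<Longrightarrow> poly f (t j) \<noteq> 0"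
  shows "\<exists>u v. u * f + v * (\<Prod>j<n. [:- t j, 1:]) = 1"
  using assms
proof (induction n)
  case 0
  show ?case by (intro exI[of _ 0] exI[of _ 1]) simp
next
  case (Suc n)
  then obtain u v where uv: "u * f + v * (\<Prod>j<n. [:- t j, 1:]) = 1" by fastforce
  have "[:- t n, 1:] dvd f - [:poly f (t n):]" by (simp add: poly_eq_0_iff_dvd[symmetric])
  then obtain h where h: "f - [:poly f (t n):] = [:- t n, 1:] * h" by (elim dvdE)
  define L where "L = [:- t n, 1:]"
  define M where "M = (\<Prod>j<n. [:- t j, 1:])"
  define k where "k = inverse (poly f (t n))"
  have "Polynomial.smult k (f - L * h) = 1"
    unfolding L_def h[symmetric] using Suc.prems[of n] by (simp add: one_pCons k_def)
  then have "1 = (u * f + v * M) * Polynomial.smult k (f - L * h)"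
    using uv by (simp add: M_def)
  also have "\<dots> = Polynomial.smult k (u * (f - L * h) + v * M) * f + Polynomial.smult (- k) (v * h) * (M * L)"
    by (simp add: algebra_simps smult_add_right smult_diff_right)
  also have "M * L = (\<Prod>j<Suc n. [:- t j, 1:])" by (simp add: M_def L_def)
  finally show ?case by metis
qed

context root_of_unity_card
begin

text \<open>The Casimir element takes the value \<open>node (q\<^sup>\<nu>) j\<close> on a vector of weight \<open>\<nu> - 2j\<close> that is killed by \<open>E F\<close>, so
  these are the zeros of \<open>E\<^sup>n F\<^sup>n\<close> as a polynomial in the Casimir element on the weight \<open>\<nu>\<close>.\<close>

definition node :: "complex \<Rightarrow> nat \<Rightarrow> complex" where
  "node b j = (q ^ 2) ^ j * q / b + b / ((q ^ 2) ^ j * q)"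

lemma node_chi: "node (\<chi> \<nu>) j = \<chi> (2 * of_nat j + (1 - \<nu>)) + \<chi> (- (2 * of_nat j + (1 - \<nu>)))"
  unfolding node_def chi_neg chi_add chi_2_of_nat chi_diff by (simp add: field_simps)

lemma prod_nodes: "(\<Prod>j<CARD('n). c - node (\<chi> \<nu>) j) = (\<Prod>e\<in>UNIV. c - (\<chi> e + \<chi> (- e)))"
  unfolding node_chi by (rule prod.reindex_bij_betw[OF bij_of_nat])

lemma prod_full: "(\<Prod>j<CARD('n). A - (q ^ 2) ^ j / \<chi> \<nu>) = (\<Prod>\<mu>\<in>UNIV. A - \<chi> \<mu>)"
proof -
  have "(\<Prod>j<CARD('n). A - \<chi> (2 * of_nat j + - \<nu>)) = (\<Prod>\<mu>\<in>UNIV. A - \<chi> \<mu>)"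
    by (rule prod.reindex_bij_betw[OF bij_of_nat])
  then show ?thesis unfolding chi_add chi_2_of_nat chi_neg by (simp add: divide_inverse)
qed

lemma not_root_of_unity: "A ^ CARD('n) \<noteq> 1 \<Longrightarrow> A \<noteq> \<chi> \<mu>"
  using chi_card by metis

definition sfac :: "nat \<Rightarrow> complex" where
  "sfac n = q ^ (n * n) / qfact (q ^ 2) n"

text \<open>As a polynomial in \<open>A\<close>, this is the terminating series that represents the
  contraction \<open>Q\<close> of the twist on the weight with \<open>q\<^sup>\<nu> = b\<close> when the Casimir element acts by \<open>c\<close>; the
  denominators of the series have been cleared.\<close>

definition Npoly :: "complex \<Rightarrow> complex \<Rightarrow> complex poly" where
  "Npoly b c = (\<Sum>n<CARD('n). Polynomial.smult (sfac n * (\<Prod>j<n. c - node b j))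
     (\<Prod>j\<in>{Suc n..<CARD('n)}. [:- ((q ^ 2) ^ j / b), 1:]))"

text \<open>The combination telescopes term by term. Because the series is cut off after \<open>\<ell>\<close> terms, the last
  boundary term survives, and it is the product over all nodes.\<close>

lemma Npoly_recurrence:
  defines "p \<equiv> q ^ 2"
  assumes b: "b \<noteq> 0"
  shows "(A - b) * (A - 1 / b) * poly (Npoly b c) A - (A ^ 2 - q * c * A + p) / p * poly (Npoly b c) (A / p) =
     A * (p ^ (CARD('n) - 1) * q * sfac (CARD('n) - 1) * (\<Prod>j<CARD('n). c - node b j))"
proof -
  obtain m where m: "CARD('n) = Suc m" using card_gt by (cases "CARD('n)") auto
  have pl: "p ^ CARD('n) = 1" using q2_pow[of "CARD('n)"] by (simp add: p_def)
  have p0: "p \<noteq> 0" by (simp add: p_def)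
  define M where "M n = sfac n * (\<Prod>j<n. c - node b j)" for n
  define T where "T n = (\<Prod>j\<in>{Suc (Suc n)..<Suc (CARD('n))}. A - p ^ j / b)" for n
  define V where "V n = M n * (p ^ n - 1) * (A - p ^ Suc n / b) * T n" for n
  define W where "W n = M n * p ^ n * q * (c - node b n) * T n" for n
  have poly_N: "poly (Npoly b c) z = (\<Sum>n<CARD('n). M n * (\<Prod>j\<in>{Suc n..<CARD('n)}. z - p ^ j / b))" for z
    by (simp add: Npoly_def poly_sum poly_prod M_def p_def)
  \<comment> \<open>The factor \<open>A - 1/b\<close> is \<open>A - p\<^sup>\<ell> / b\<close> and extends the product by one term.\<close>
  have up: "(A - 1 / b) * (\<Prod>j\<in>{Suc n..<CARD('n)}. A - p ^ j / b) = (A - p ^ Suc n / b) * T n" if "n < CARD('n)" for n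
  proof -
    have "(\<Prod>j\<in>{Suc n..<Suc (CARD('n))}. A - p ^ j / b) = (\<Prod>j\<in>{Suc n..<CARD('n)}. A - p ^ j / b) * (A - p ^ CARD('n) / b)"
      using that by (intro prod.atLeastLessThan_Suc) simp
    moreover have "(\<Prod>j\<in>{Suc n..<Suc (CARD('n))}. A - p ^ j / b) = (A - p ^ Suc n / b) * T n"
      unfolding T_def using that by (intro prod.atLeast_Suc_lessThan) simp
    ultimately show ?thesis unfolding pl by (simp only: mult.commute)
  qed
  have down: "(\<Prod>j\<in>{Suc n..<CARD('n)}. A / p - p ^ j / b) = p ^ Suc n * T n" if "n < CARD('n)" for n
  proof -
    have "p ^ (CARD('n) - Suc n) * (\<Prod>j\<in>{Suc n..<CARD('n)}. A / p - p ^ j / b) = (\<Prod>j\<in>{Suc n..<CARD('n)}. p * (A / p - p ^ j / b))"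
      by (simp add: prod.distrib)
    also have "\<dots> = T n"
      unfolding T_def prod.shift_bounds_Suc_ivl using p0 by (intro prod.cong refl) (simp add: right_diff_distrib)
    finally have "p ^ Suc n * T n = (p ^ Suc n * p ^ (CARD('n) - Suc n)) * (\<Prod>j\<in>{Suc n..<CARD('n)}. A / p - p ^ j / b)"
      by (simp only: mult.assoc)
    also have "p ^ Suc n * p ^ (CARD('n) - Suc n) = 1" unfolding power_add[symmetric] using that pl by simp
    finally show ?thesis by simp
  qed
  have scal: "(A - b) * (A - p ^ Suc n / b) - (A ^ 2 - q * c * A + p) / p * p ^ Suc n =
      A * (p ^ n * q * (c - node b n) - (p ^ n - 1) * (A - p ^ Suc n / b))" for n
  proof -
    define r where "r = p ^ n"
    have r0: "r \<noteq> 0" using p0 by (simp add: r_def)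
    have "r * q * node b n = r ^ 2 * p / b + b"
    proof -
      have "r * q * (r * q / b + b / (r * q)) = r ^ 2 * (q * q) / b + b"
        using r0 b q_nz by (simp add: field_simps power2_eq_square)
      then show ?thesis unfolding node_def p_def[symmetric] r_def[symmetric] by (simp add: p_def power2_eq_square)
    qed
    then have 1: "r * q * (c - node b n) = r * q * c - (r ^ 2 * p / b + b)" by (simp only: right_diff_distrib)
    have 2: "x / p * (r * p) = x * r" for x using p0 by simp
    have 3: "p ^ Suc n = r * p" by (simp add: r_def)
    have "(A - b) * (A - r * p / b) - (A ^ 2 - q * c * A + p) * r =
        A * (r * q * c - (r ^ 2 * p / b + b) - (r - 1) * (A - r * p / b))"
      using b by (simp add: divide_simps) (simp add: algebra_simps power2_eq_square)
    then show ?thesis unfolding 3 2 r_def[symmetric] 1 .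
  qed
  \<comment> \<open>The telescoping identity.\<close>
  have WV: "W n = V (Suc n)" if "Suc n < CARD('n)" for n
  proof -
    have "T n = (A - p ^ Suc (Suc n) / b) * T (Suc n)"
      unfolding T_def using that by (intro prod.atLeast_Suc_lessThan) simp
    moreover have "M (Suc n) * (p ^ Suc n - 1) = M n * (p ^ n * q * (c - node b n))"
    proof -
      have nz: "qfact p n \<noteq> 0" "p ^ Suc n - 1 \<noteq> 0"
        using qfact_nz[of n] q2_pow_less[of "Suc n"] that by (simp_all add: p_def)
      have "qfact p (Suc n) = qfact p n * (p ^ Suc n - 1)" by (simp add: qfact_def)
      then have "sfac (Suc n) * (p ^ Suc n - 1) = q ^ (Suc n * Suc n) / qfact p n"
        using nz unfolding sfac_def p_def[symmetric] by simp
      also have "q ^ (Suc n * Suc n) = q ^ (n * n) * (p ^ n * q)"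
        unfolding p_def power_mult[symmetric] power_Suc2[symmetric] power_add[symmetric]
          by (rule arg_cong[where f = "power q"]) simp
      finally have "sfac (Suc n) * (p ^ Suc n - 1) = sfac n * (p ^ n * q)" by (simp add: sfac_def p_def)
      note e = this
      have "M (Suc n) * (p ^ Suc n - 1) = (sfac (Suc n) * (p ^ Suc n - 1)) * ((\<Prod>j<n. c - node b j) * (c - node b n))"
        unfolding M_def prod.lessThan_Suc by (simp only: mult_ac)
      then show ?thesis unfolding e M_def by (simp only: mult_ac)
    qed
    ultimately have "M (Suc n) * (p ^ Suc n - 1) * (A - p ^ Suc (Suc n) / b) * T (Suc n) =
        M n * (p ^ n * q * (c - node b n)) * T n" by (simp only: mult.assoc)
    then show ?thesis unfolding W_def V_def by (simp only: mult.assoc)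
  qed
  have "(A - b) * (A - 1 / b) * poly (Npoly b c) A - (A ^ 2 - q * c * A + p) / p * poly (Npoly b c) (A / p) =
      (\<Sum>n<CARD('n). A * (W n - V n))"
    unfolding poly_N sum_distrib_left sum_subtractf[symmetric]
  proof (rule sum.cong[OF refl])
    fix n assume "n \<in> {..<CARD('n)}"
    then have n: "n < CARD('n)" by simp
    have "(A - b) * (A - 1 / b) * (M n * (\<Prod>j\<in>{Suc n..<CARD('n)}. A - p ^ j / b)) =
        M n * ((A - b) * ((A - 1 / b) * (\<Prod>j\<in>{Suc n..<CARD('n)}. A - p ^ j / b)))" by (simp only: mult_ac)
    then have "(A - b) * (A - 1 / b) * (M n * (\<Prod>j\<in>{Suc n..<CARD('n)}. A - p ^ j / b)) -
        (A ^ 2 - q * c * A + p) / p * (M n * (\<Prod>j\<in>{Suc n..<CARD('n)}. A / p - p ^ j / b)) =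
        M n * T n * ((A - b) * (A - p ^ Suc n / b) - (A ^ 2 - q * c * A + p) / p * p ^ Suc n)"
      unfolding up[OF n] down[OF n] by (simp only: right_diff_distrib mult_ac)
    also have "\<dots> = A * (W n - V n)"
    proof -
      have "M n * T n * (A * (u - v)) = A * (M n * T n * u - M n * T n * v)" for u v
        by (simp add: algebra_simps)
      moreover have "W n = M n * T n * (p ^ n * q * (c - node b n))"
        unfolding W_def by (simp only: mult_ac)
      moreover have "V n = M n * T n * ((p ^ n - 1) * (A - p ^ Suc n / b))"
        unfolding V_def by (simp only: mult_ac)
      ultimately show ?thesis unfolding scal by simp
    qed
    finally show "(A - b) * (A - 1 / b) * (M n * (\<Prod>j\<in>{Suc n..<CARD('n)}. A - p ^ j / b)) -
        (A ^ 2 - q * c * A + p) / p * (M n * (\<Prod>j\<in>{Suc n..<CARD('n)}. A / p - p ^ j / b)) = A * (W n - V n)" .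
  qed
  also have "\<dots> = A * (W m)"
  proof -
    have "(\<Sum>n<m. W n - V n) = (\<Sum>n<m. V (Suc n) - V n)" by (intro sum.cong refl) (simp add: WV m)
    also have "\<dots> = V m - V 0" by (rule sum_lessThan_telescope)
    finally have "(\<Sum>n<Suc m. W n - V n) = W m" by (simp add: V_def)
    then show ?thesis unfolding sum_distrib_left[symmetric] m by simp
  qed
  also have "W m = p ^ m * q * sfac m * (\<Prod>j<CARD('n). c - node b j)"
    by (simp add: W_def M_def T_def m)
  finally show ?thesis by (simp add: m)
qed

lemma prod_linear_degree:
  fixes r :: "nat \<Rightarrow> complex"
  shows "Polynomial.degree (\<Prod>j\<in>S. [:- r j, 1:]) = card S" "Polynomial.lead_coeff (\<Prod>j\<in>S. [:- r j, 1:]) = 1"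
proof -
  show "Polynomial.degree (\<Prod>j\<in>S. [:- r j, 1:]) = card S"
    by (subst degree_prod_eq_sum_degree) simp_all
  show "Polynomial.lead_coeff (\<Prod>j\<in>S. [:- r j, 1:]) = 1"
    by (simp add: lead_coeff_prod)
qed

lemma Npoly_lead: "Polynomial.degree (Npoly b c) \<le> CARD('n) - 1" "Polynomial.coeff (Npoly b c) (CARD('n) - 1) = 1"
proof -
  let ?T = "\<lambda>n. (\<Prod>j\<in>{Suc n..<CARD('n)}. [:- ((q ^ 2) ^ j / b), 1:])"
  have deg: "Polynomial.degree (?T n) = CARD('n) - Suc n" for n
    by (subst prod_linear_degree(1)[of "\<lambda>j. (q ^ 2) ^ j / b"]) simp
  show "Polynomial.degree (Npoly b c) \<le> CARD('n) - 1"
    unfolding Npoly_def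
  proof (rule degree_sum_le)
    fix n
    have "Polynomial.degree (Polynomial.smult (sfac n * (\<Prod>j<n. c - node b j)) (?T n)) \<le> Polynomial.degree (?T n)" by (rule degree_smult_le)
    then show "Polynomial.degree (Polynomial.smult (sfac n * (\<Prod>j<n. c - node b j)) (?T n)) \<le> CARD('n) - 1" by (simp only: deg)
  qed simp
  have "Polynomial.coeff (Npoly b c) (CARD('n) - 1) = (\<Sum>n<CARD('n). sfac n * (\<Prod>j<n. c - node b j) * Polynomial.coeff (?T n) (CARD('n) - 1))"
    by (simp add: Npoly_def coeff_sum)
  also have "\<dots> = sfac 0 * (\<Prod>j<0. c - node b j) * Polynomial.coeff (?T 0) (CARD('n) - 1)"
  proof (rule sum_eq_single)
    fix n assume "n \<in> {..<CARD('n)}" "n \<noteq> 0"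
    then have "Polynomial.degree (?T n) < CARD('n) - 1" unfolding deg by auto
    then show "sfac n * (\<Prod>j<n. c - node b j) * Polynomial.coeff (?T n) (CARD('n) - 1) = 0" by (simp add: coeff_eq_0)
  qed simp_all
  also have "Polynomial.coeff (?T 0) (CARD('n) - 1) = 1"
    using prod_linear_degree(2)[of "\<lambda>j. (q ^ 2) ^ j / b" "{Suc 0..<CARD('n)}"] by (simp add: deg)
  finally show "Polynomial.coeff (Npoly b c) (CARD('n) - 1) = 1" by (simp add: sfac_def qfact_def)
qed

text \<open>Both sides satisfy the same inhomogeneous difference equation with a right-hand side symmetric
  in \<open>b\<close> and \<open>1/b\<close>; their difference has degree below \<open>\<ell> - 1\<close>, and its leading coefficient would
  have to be multiplied by a nontrivial power of \<open>q\<^sup>2\<close>.\<close>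

lemma Npoly_symmetric: "Npoly (\<chi> (- \<nu>)) c = Npoly (\<chi> \<nu>) c"
proof (rule ccontr)
  assume neq: "\<not> ?thesis"
  define p where "p = q ^ 2"
  have p0: "p \<noteq> 0" by (simp add: p_def)
  define D where "D = Npoly (\<chi> (- \<nu>)) c - Npoly (\<chi> \<nu>) c"
  have D0: "D \<noteq> 0" using neq by (simp add: D_def)
  have degD: "Polynomial.degree D < CARD('n) - 1"
  proof (rule ccontr)
    assume "\<not> Polynomial.degree D < CARD('n) - 1"
    moreover have "Polynomial.degree D \<le> CARD('n) - 1" unfolding D_def by (rule degree_diff_le) (rule Npoly_lead(1))+
    ultimately have "Polynomial.degree D = CARD('n) - 1" by simp
    moreover have "Polynomial.coeff D (CARD('n) - 1) = 0" unfolding D_def coeff_diff Npoly_lead(2) by simp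
    ultimately have "Polynomial.lead_coeff D = 0" by (simp only:)
    then show False using D0 by simp
  qed
  define b where "b = \<chi> \<nu>"
  have b: "b \<noteq> 0" "\<chi> (- \<nu>) = 1 / b" by (simp_all add: b_def chi_neg divide_inverse)
  have rec: "(A - b) * (A - 1 / b) * poly D A = (A ^ 2 - q * c * A + p) / p * poly D (A / p)" for A
  proof -
    have nodes: "(\<Prod>j<CARD('n). c - node (1 / b) j) = (\<Prod>j<CARD('n). c - node b j)"
      unfolding b(2)[symmetric] unfolding b_def prod_nodes ..
    show ?thesis
      using Npoly_recurrence[of b A c] Npoly_recurrence[of "1 / b" A c] b(1)
      unfolding D_def b(2) p_def[symmetric] nodes b_def[symmetric] by (simp add: algebra_simps)
  qed
  define k where "k = Polynomial.degree D"
  define lhs where "lhs = [:- b, 1:] * [:- (1 / b), 1:] * D"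
  define rhs where "rhs = Polynomial.smult (1 / p) ([:p, - (q * c), 1:] * (D \<circ>\<^sub>p [:0, 1 / p:]))"
  have "lhs = rhs"
  proof (rule poly_ext)
    fix A
    show "poly lhs A = poly rhs A"
    proof -
      have "poly lhs A = (A - b) * (A - 1 / b) * poly D A"
        using b(1) by (simp add: lhs_def field_simps)
      moreover have "poly [:p, - (q * c), 1:] A = A ^ 2 - q * c * A + p"
        by (simp add: algebra_simps power2_eq_square)
      moreover have "poly (D \<circ>\<^sub>p [:0, 1 / p:]) A = poly D (A / p)" by (simp add: poly_pcompose)
      ultimately show ?thesis using rec[of A] by (simp only: rhs_def poly_smult poly_mult) simp
    qed
  qed
  moreover have "Polynomial.lead_coeff lhs = Polynomial.lead_coeff D"
    unfolding lhs_def lead_coeff_mult by simp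
  moreover have "Polynomial.lead_coeff rhs = 1 / p * (Polynomial.lead_coeff D * (1 / p) ^ Polynomial.degree D)"
  proof -
    have "Polynomial.lead_coeff (D \<circ>\<^sub>p [:0, 1 / p:]) = Polynomial.lead_coeff D * (1 / p) ^ Polynomial.degree D"
      using p0 by (subst lead_coeff_comp) simp_all
    moreover have "Polynomial.lead_coeff [:p, - (q * c), 1:] = 1" by simp
    ultimately show ?thesis unfolding rhs_def lead_coeff_smult lead_coeff_mult by (simp only: mult_1_left)
  qed
  ultimately have "1 / p * (Polynomial.lead_coeff D * (1 / p) ^ Polynomial.degree D) = Polynomial.lead_coeff D"
    by (simp only:)
  then have "Polynomial.lead_coeff D * (1 / p * (1 / p) ^ Polynomial.degree D) = Polynomial.lead_coeff D * 1"
    by (simp only: mult.left_commute mult_1_right)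
  then have "1 / p * (1 / p) ^ Polynomial.degree D = 1" using D0 by (simp only: mult_cancel_left leading_coeff_0_iff) simp
  then have "(1 / p) ^ Suc (Polynomial.degree D) = 1" by simp
  then have "p ^ Suc (Polynomial.degree D) = 1" by (simp add: power_divide del: power_Suc)
  moreover have "p ^ Suc (Polynomial.degree D) \<noteq> 1" unfolding p_def using degD by (intro q2_pow_less) auto
  ultimately show False by contradiction
qed

text \<open>If the Casimir eigenvalue is one of the nodes, the boundary term vanishes and a zero \<open>A\<close> forces the
  zeros \<open>A/q\<^sup>2, A/q\<^sup>4, \<dots>\<close>, since the roots of the quadratic factor are roots of unity. These are \<open>\<ell>\<close> zeros of
  a polynomial of degree below \<open>\<ell>\<close>.\<close>

lemma Npoly_nonzero:
  assumes A: "A ^ CARD('n) \<noteq> 1" and "A \<noteq> 0" and c: "c = \<chi> e + \<chi> (- e)"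
  shows "poly (Npoly (\<chi> \<nu>) c) A \<noteq> 0"
proof
  assume zero: "poly (Npoly (\<chi> \<nu>) c) A = 0"
  define p where "p = q ^ 2"
  have p0: "p \<noteq> 0" by (simp add: p_def)
  have pl: "(p ^ i) ^ CARD('n) = 1" for i
    by (metis mult.commute p_def power_mult power_one prim dvd_refl)
  have iter: "poly (Npoly (\<chi> \<nu>) c) (A / p ^ i) = 0" for i
  proof (induction i)
    case 0
    show ?case using zero by simp
  next
    case (Suc i)
    let ?A = "A / p ^ i"
    have "?A ^ CARD('n) \<noteq> 1" using A by (simp add: power_divide pl)
    then have ne: "?A \<noteq> \<chi> (1 + e)" "?A \<noteq> \<chi> (1 - e)" by (rule not_root_of_unity)+
    have "(\<Prod>j<CARD('n). c - node (\<chi> \<nu>) j) = 0"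
      unfolding prod_nodes by (rule prod_zero) (auto simp: c)
    with Npoly_recurrence[of "\<chi> \<nu>" ?A c] Suc have "(?A ^ 2 - q * c * ?A + p) / p * poly (Npoly (\<chi> \<nu>) c) (?A / p) = 0"
      by (simp add: p_def)
    moreover have "?A ^ 2 - q * c * ?A + p = (?A - \<chi> (1 + e)) * (?A - \<chi> (1 - e))"
    proof -
      have "\<chi> (1 + e) * \<chi> (1 - e) = p" by (simp add: chi_add[symmetric] chi_2 p_def)
      moreover have "\<chi> (1 + e) + \<chi> (1 - e) = q * c" by (simp add: c chi_add chi_diff chi_neg algebra_simps)
      moreover have "z ^ 2 - q * c * z + p = (z - x) * (z - y)" if "x * y = p" "x + y = q * c" for x y z
        unfolding that[symmetric] by (simp add: algebra_simps power2_eq_square)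
      ultimately show ?thesis by blast
    qed
    ultimately have "poly (Npoly (\<chi> \<nu>) c) (?A / p) = 0" using ne p0 by simp
    then show ?case by (simp add: mult.commute)
  qed
  have inj: "inj_on (\<lambda>i. A / p ^ i) {..<CARD('n)}"
  proof (rule linorder_inj_onI)
    fix i j :: nat assume ij: "i < j" "j \<in> {..<CARD('n)}"
    show "A / p ^ i \<noteq> A / p ^ j"
    proof
      assume "A / p ^ i = A / p ^ j"
      then have "p ^ i = p ^ j" using p0 \<open>A \<noteq> 0\<close> by simp
      moreover have "p ^ j = p ^ i * p ^ (j - i)" using ij by (simp flip: power_add)
      ultimately have "p ^ (j - i) = 1" using p0 by simp
      moreover have "p ^ (j - i) \<noteq> 1" unfolding p_def using ij by (intro q2_pow_less) auto
      ultimately show False by contradiction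
    qed
  qed auto
  have N0: "Npoly (\<chi> \<nu>) c \<noteq> 0" using Npoly_lead(2)[of "\<chi> \<nu>" c] by auto
  have "card ((\<lambda>i. A / p ^ i) ` {..<CARD('n)}) \<le> card {x. poly (Npoly (\<chi> \<nu>) c) x = 0}"
    using iter by (intro card_mono poly_roots_finite[OF N0]) auto
  also have "\<dots> \<le> Polynomial.degree (Npoly (\<chi> \<nu>) c)" by (rule card_poly_roots_bound[OF N0])
  also have "\<dots> \<le> CARD('n) - 1" by (rule Npoly_lead(1))
  finally show False using card_gt by (simp add: card_image[OF inj])
qed

text \<open>The same series as a polynomial in the Casimir element, with its denominators.\<close>

definition Qpoly :: "complex \<Rightarrow> complex \<Rightarrow> complex poly" where
  "Qpoly A b = (\<Sum>n<CARD('n). Polynomial.smult (sfac n * (\<Prod>j<n. inverse (A - (q ^ 2) ^ Suc j / b)))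
     (\<Prod>j<n. [:- node b j, 1:]))"

lemma Qpoly_Npoly:
  assumes A: "A ^ CARD('n) \<noteq> 1"
  shows "(\<Prod>\<mu>\<in>UNIV. A - \<chi> \<mu>) * poly (Qpoly A (\<chi> \<nu>)) c = (A - 1 / \<chi> \<nu>) * poly (Npoly (\<chi> \<nu>) c) A"
proof -
  define b where "b = \<chi> \<nu>"
  define r where "r j = A - (q ^ 2) ^ j / b" for j
  have r0: "r j \<noteq> 0" for j
    using not_root_of_unity[OF A, of "2 * of_nat j + - \<nu>"] unfolding chi_add chi_2_of_nat chi_neg
    by (simp add: r_def b_def divide_inverse)
  have full: "(\<Prod>\<mu>\<in>UNIV. A - \<chi> \<mu>) = (\<Prod>j<CARD('n). r j)"
    unfolding prod_full[of A \<nu>, symmetric] r_def b_def ..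
  have "(\<Prod>j<CARD('n). r j) * (\<Prod>j<n. inverse (r (Suc j))) = r 0 * (\<Prod>j\<in>{Suc n..<CARD('n)}. r j)" if "n < CARD('n)" for n
  proof -
    have "(\<Prod>j<CARD('n). r j) = (\<Prod>j<Suc n. r j) * (\<Prod>j\<in>{Suc n..<CARD('n)}. r j)"
      unfolding lessThan_atLeast0 using that by (intro prod.atLeastLessThan_concat[symmetric]) auto
    also have "(\<Prod>j<Suc n. r j) = r 0 * (\<Prod>j<n. r (Suc j))" by (rule prod.lessThan_Suc_shift)
    finally have "(\<Prod>j<CARD('n). r j) * (\<Prod>j<n. inverse (r (Suc j))) =
        r 0 * (\<Prod>j\<in>{Suc n..<CARD('n)}. r j) * ((\<Prod>j<n. r (Suc j)) * (\<Prod>j<n. inverse (r (Suc j))))" by (simp only: mult_ac)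
    also have "(\<Prod>j<n. r (Suc j)) * (\<Prod>j<n. inverse (r (Suc j))) = 1"
      unfolding prod.distrib[symmetric] using r0 by simp
    finally show ?thesis by simp
  qed
  note * = this
  have "(\<Prod>j<CARD('n). r j) * poly (Qpoly A b) c =
      (\<Sum>n<CARD('n). (sfac n * (\<Prod>j<n. c - node b j)) * ((\<Prod>j<CARD('n). r j) * (\<Prod>j<n. inverse (r (Suc j)))))"
    unfolding Qpoly_def r_def by (simp add: poly_sum poly_prod sum_distrib_left mult_ac)
  also have "\<dots> = (\<Sum>n<CARD('n). (sfac n * (\<Prod>j<n. c - node b j)) * (r 0 * (\<Prod>j\<in>{Suc n..<CARD('n)}. r j)))"
    by (intro sum.cong refl) (simp only: * lessThan_iff)
  also have "\<dots> = r 0 * poly (Npoly b c) A"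
    unfolding Npoly_def r_def by (simp add: poly_sum poly_prod sum_distrib_left mult_ac)
  finally show ?thesis by (simp add: full r_def b_def)
qed

lemma full_nonzero: "A ^ CARD('n) \<noteq> 1 \<Longrightarrow> (\<Prod>\<mu>\<in>UNIV. A - \<chi> \<mu>) \<noteq> 0"
  using not_root_of_unity[of A] by auto

lemma Qpoly_symmetric:
  assumes A: "A ^ CARD('n) \<noteq> 1"
  shows "Polynomial.smult (A - \<chi> \<nu>) (Qpoly A (\<chi> \<nu>)) = Polynomial.smult (A - inverse (\<chi> \<nu>)) (Qpoly A (\<chi> (- \<nu>)))"
proof (rule poly_ext)
  fix c
  have "(\<Prod>\<mu>\<in>UNIV. A - \<chi> \<mu>) * ((A - \<chi> \<nu>) * poly (Qpoly A (\<chi> \<nu>)) c) =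
      (\<Prod>\<mu>\<in>UNIV. A - \<chi> \<mu>) * ((A - inverse (\<chi> \<nu>)) * poly (Qpoly A (\<chi> (- \<nu>))) c)"
    using Qpoly_Npoly[OF A, of \<nu> c] Qpoly_Npoly[OF A, of "- \<nu>" c]
    unfolding Npoly_symmetric by (simp add: chi_neg divide_inverse mult.left_commute)
  then show "poly (Polynomial.smult (A - \<chi> \<nu>) (Qpoly A (\<chi> \<nu>))) c =
      poly (Polynomial.smult (A - inverse (\<chi> \<nu>)) (Qpoly A (\<chi> (- \<nu>)))) c"
    using full_nonzero[OF A] by simp
qed

lemma Qpoly_bezout:
  assumes A: "A ^ CARD('n) \<noteq> 1" "A \<noteq> 0"
  shows "\<exists>u v. u * Qpoly A (\<chi> \<nu>) + v * (\<Prod>j<CARD('n). [:- node (\<chi> \<nu>) j, 1:]) = 1"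
proof (rule bezout_linear_factors)
  fix j
  have "A - 1 / \<chi> \<nu> \<noteq> 0" using not_root_of_unity[OF A(1), of "- \<nu>"] by (simp add: chi_neg divide_inverse)
  then show "poly (Qpoly A (\<chi> \<nu>)) (node (\<chi> \<nu>) j) \<noteq> 0"
    using Qpoly_Npoly[OF A(1), of \<nu> "node (\<chi> \<nu>) j"] Npoly_nonzero[OF A node_chi, of \<nu> \<nu> j] full_nonzero[OF A(1)]
    by auto
qed

end

section \<open>The Casimir element and the element \<open>Q\<close>\<close>

context sl2_root
begin

abbreviation "dd \<equiv> (q - inverse q) ^ 2"

text \<open>The quantum Casimir element, normalised to be free of denominators.\<close>

definition cas :: 'u where
  "cas = dd *\<^sub>C (E * F) + inverse q *\<^sub>C K + q *\<^sub>C Ki"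

lemma cas_F: "cas = dd *\<^sub>C (F * E) + q *\<^sub>C K + inverse q *\<^sub>C Ki"
proof -
  have "dd * cq = q - inverse q" using q_inv_neq by (simp add: power2_eq_square)
  then have "dd *\<^sub>C (E * F) = dd *\<^sub>C (F * E) + (q - inverse q) *\<^sub>C K - (q - inverse q) *\<^sub>C Ki"
    by (simp add: EF scaleC_add_right scaleC_scaleC cvec.scale_right_diff_distrib)
  then show ?thesis by (simp add: cas_def cvec.scale_left_diff_distrib)
qed

lemma Ki_E: "Ki * E = inverse (q ^ 2) *\<^sub>C (E * Ki)"
proof -
  have "E * Ki = Ki * (K * E) * Ki" by (simp add: mult.assoc[symmetric] rel(2))
  also have "\<dots> = q ^ 2 *\<^sub>C (Ki * E * (K * Ki))"
    unfolding rel(3) by (simp add: scaleC_mult_left scaleC_mult_right mult.assoc)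
  finally show ?thesis by (simp add: rel(1) scaleC_one)
qed

lemma q_simps: "inverse q * q ^ 2 = q" "q * inverse (q ^ 2) = inverse q"
  by (simp_all add: power2_eq_square)

lemma cas_E: "cas * E = E * cas"
proof -
  have "cas * E = dd *\<^sub>C (E * F * E) + q *\<^sub>C (E * K) + inverse q *\<^sub>C (E * Ki)"
    unfolding cas_def by (simp add: distrib_right scaleC_mult_left rel(3) Ki_E q_simps scaleC_scaleC)
  moreover have "E * cas = dd *\<^sub>C (E * F * E) + q *\<^sub>C (E * K) + inverse q *\<^sub>C (E * Ki)"
    unfolding cas_F by (simp add: distrib_left scaleC_mult_right mult.assoc)
  ultimately show ?thesis by simp
qed

lemma cas_K: "cas * K = K * cas"
proof -
  have "K * (E * F) = E * F * K"
    by (simp add: mult.assoc[symmetric] rel(3) scaleC_mult_left)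
      (simp add: mult.assoc rel(4) scaleC_mult_right scaleC_scaleC scaleC_one)
  then show ?thesis
    unfolding cas_def by (simp add: distrib_left distrib_right scaleC_mult_left scaleC_mult_right rel(1,2))
qed

lemma cas_P: "cas * P \<mu> = P \<mu> * cas"
  using weight_idem_cong[of cas K 1 0 \<mu>] cas_K by (simp add: scaleC_one)

lemma aeval_cas_P: "aeval cas f * P \<mu> = P \<mu> * aeval cas f"
  by (rule aeval_commute) (rule cas_P)

lemma S_P: "S (P \<mu>) = P (- \<mu>)"
proof -
  note S = alg_antihomD[OF antipode(1)]
  have SKi: "S (P \<mu>) * Ki = \<chi> \<mu> *\<^sub>C S (P \<mu>)" for \<mu>
    using arg_cong[OF K_P[of \<mu>], of S] by (simp add: S antipode clinear_scaleC[OF S(1)])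
  have *: "S (P \<mu>) * P \<nu> = 0" if "\<nu> \<noteq> - \<mu>" for \<mu> \<nu>
  proof -
    have "inverse (\<chi> \<nu>) *\<^sub>C (S (P \<mu>) * P \<nu>) = S (P \<mu>) * (Ki * P \<nu>)" by (simp add: Ki_P scaleC_mult_right)
    also have "\<dots> = \<chi> \<mu> *\<^sub>C (S (P \<mu>) * P \<nu>)" by (simp add: mult.assoc[symmetric] SKi scaleC_mult_left)
    finally have "(\<chi> (- \<nu>) - \<chi> \<mu>) *\<^sub>C (S (P \<mu>) * P \<nu>) = 0" by (simp add: chi_neg cvec.scale_left_diff_distrib)
    moreover have "- \<nu> \<noteq> \<mu>" using that by auto
    ultimately show ?thesis by simp
  qed
  have "S (P \<mu>) = S (P \<mu>) * (\<Sum>\<nu>\<in>UNIV. P \<nu>)" by (simp add: P_sum)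
  also have "\<dots> = S (P \<mu>) * P (- \<mu>)"
    unfolding sum_distrib_left by (rule sum_eq_single) (auto simp: *)
  also have "\<dots> = (\<Sum>\<nu>\<in>UNIV. S (P \<nu>) * P (- \<mu>))"
    by (rule sum_eq_single[symmetric]) (auto intro!: *)
  also have "\<dots> = S (\<Sum>\<nu>\<in>UNIV. P \<nu>) * P (- \<mu>)" by (simp add: sum_distrib_right clinear_sum[OF S(1)])
  finally show ?thesis by (simp add: P_sum S(2))
qed

lemma S_Ki: "S Ki = K"
proof -
  have "S Ki * Ki = 1"
    using arg_cong[OF rel(1), of S] by (simp add: alg_antihomD[OF antipode(1)] antipode)
  then have "S Ki * Ki * K = K" by simp
  then show ?thesis by (simp add: mult.assoc rel)
qed

lemma S_cas: "S cas = cas"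
proof -
  note S = alg_antihomD[OF antipode(1)]
  have "S (E * F) = F * E" by (simp add: S antipode mult.assoc) (simp add: mult.assoc[symmetric] rel(1) mult.assoc[of F K Ki])
  then have "S cas = dd *\<^sub>C (F * E) + q *\<^sub>C K + inverse q *\<^sub>C Ki"
    unfolding cas_def by (simp add: clinear_add[OF S(1)] clinear_scaleC[OF S(1)] antipode S_Ki)
  then show ?thesis by (simp add: cas_F)
qed

lemma E_F_P: "E ^ n * F ^ n * P \<nu> = P \<nu> * (E ^ n * F ^ n)"
proof -
  have "E ^ n * F ^ n * P \<nu> = E ^ n * P (\<nu> - 2 * of_nat n) * F ^ n" by (simp add: mult.assoc F_pow_P)
  then show ?thesis by (simp add: E_pow_P mult.assoc)
qed

text \<open>On each weight, \<open>E F\<close> is, up to normalisation, the Casimir element minus a constant; peel off the factors one by one from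
  the inside, where the weight is \<open>\<nu> - 2n\<close>.\<close>

lemma E_F_cas: "dd ^ n *\<^sub>C (E ^ n * F ^ n * P \<nu>) = aeval cas (\<Prod>j<n. [:- node (\<chi> \<nu>) j, 1:]) * P \<nu>"
proof (induction n)
  case 0
  show ?case by (simp add: scaleC_one)
next
  case (Suc n)
  let ?\<delta> = "\<nu> - 2 * of_nat n"
  have nd: "inverse q * \<chi> ?\<delta> + q * inverse (\<chi> ?\<delta>) = node (\<chi> \<nu>) n"
    unfolding node_def chi_diff chi_2_of_nat by (simp add: divide_inverse mult_ac add.commute)
  have "dd *\<^sub>C (E * F * P ?\<delta>) = cas * P ?\<delta> - (inverse q * \<chi> ?\<delta> + q * inverse (\<chi> ?\<delta>)) *\<^sub>C P ?\<delta>"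
    unfolding cas_def by (simp add: distrib_right scaleC_mult_left K_P Ki_P scaleC_scaleC scaleC_add_left)
  then have 1: "dd *\<^sub>C (E * F * P ?\<delta>) = cas * P ?\<delta> - node (\<chi> \<nu>) n *\<^sub>C P ?\<delta>" unfolding nd .
  have comm: "cas * E ^ n = E ^ n * cas"
    by (rule power_commuting_commutes[symmetric]) (rule cas_E[symmetric])
  have "dd ^ Suc n *\<^sub>C (E ^ Suc n * F ^ Suc n * P \<nu>) = dd ^ n *\<^sub>C (E ^ n * (dd *\<^sub>C (E * F * P ?\<delta>)) * F ^ n)"
  proof -
    have "E ^ Suc n * F ^ Suc n * P \<nu> = E ^ n * (E * F) * (F ^ n * P \<nu>)"
      by (simp only: power_Suc2[of E] power_Suc[of F] mult.assoc)
    then show ?thesis by (simp add: F_pow_P mult.assoc scaleC_mult_right scaleC_mult_left scaleC_scaleC mult.commute)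
  qed
  also have "\<dots> = dd ^ n *\<^sub>C (cas * (E ^ n * P ?\<delta> * F ^ n) - node (\<chi> \<nu>) n *\<^sub>C (E ^ n * P ?\<delta> * F ^ n))"
    unfolding 1 by (simp add: right_diff_distrib left_diff_distrib scaleC_mult_right scaleC_mult_left mult.assoc[symmetric] comm)
  also have "E ^ n * P ?\<delta> * F ^ n = E ^ n * F ^ n * P \<nu>" by (simp add: mult.assoc F_pow_P)
  also have "dd ^ n *\<^sub>C (cas * (E ^ n * F ^ n * P \<nu>) - node (\<chi> \<nu>) n *\<^sub>C (E ^ n * F ^ n * P \<nu>)) =
      aeval cas [:- node (\<chi> \<nu>) n, 1:] * (dd ^ n *\<^sub>C (E ^ n * F ^ n * P \<nu>))"
    by (simp add: aeval_pCons left_diff_distrib scaleC_mult_left scaleC_mult_right cvec.scale_right_diff_distrib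
        scaleC_scaleC scaleC_one mult.commute)
  also have "\<dots> = aeval cas (\<Prod>j<Suc n. [:- node (\<chi> \<nu>) j, 1:]) * P \<nu>"
    unfolding Suc prod.lessThan_Suc
    by (simp only: mult.commute[of "\<Prod>j<n. [:- node (\<chi> \<nu>) j, 1:]"] aeval_mult mult.assoc)
  finally show ?case .
qed

definition mS :: "('u, 'u) tensor \<Rightarrow> 'u" where
  "mS = tensor_lift (\<lambda>a b. S a * b)"

lemma cbilinear_mS: "cbilinear (\<lambda>a b. S a * b)"
  by (rule cbilinear_compose[OF cbilinear_mult alg_antihomD(1)[OF antipode(1)] clinear_id])

lemma clinear_mS: "clinear mS"
  unfolding mS_def by (rule clinear_tensor_lift[OF cbilinear_mS])

lemma mS_tens: "mS (a \<boxtimes> b) = S a * b"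
  unfolding mS_def by (rule tensor_lift_tens[OF cbilinear_mS])

lemma S_E_pow_P: "S E ^ n * P \<delta> = ((- 1) ^ n * inverse (\<chi> \<delta> ^ n * q ^ (n * Suc n))) *\<^sub>C (E ^ n * P \<delta>)"
proof (induction n)
  case 0
  show ?case by (simp add: scaleC_one)
next
  case (Suc n)
  have KiE: "Ki * (E ^ Suc n * P \<delta>) = inverse (\<chi> \<delta> * (q ^ 2) ^ Suc n) *\<^sub>C (E ^ Suc n * P \<delta>)"
    unfolding E_pow_P mult.assoc[symmetric] Ki_P scaleC_mult_left chi_add chi_2_of_nat ..
  have "S E ^ Suc n * P \<delta> = S E * (S E ^ n * P \<delta>)" by (simp add: mult.assoc)
  also have "\<dots> = ((- 1) ^ n * inverse (\<chi> \<delta> ^ n * q ^ (n * Suc n))) *\<^sub>C - (Ki * (E ^ Suc n * P \<delta>))"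
    unfolding Suc by (simp add: antipode scaleC_mult_right mult.assoc)
  also have "\<dots> = ((- 1) ^ Suc n * (inverse (\<chi> \<delta> ^ n * q ^ (n * Suc n)) * inverse (\<chi> \<delta> * (q ^ 2) ^ Suc n))) *\<^sub>C (E ^ Suc n * P \<delta>)"
    unfolding KiE by (simp add: scaleC_scaleC mult_ac)
  also have "inverse (\<chi> \<delta> ^ n * q ^ (n * Suc n)) * inverse (\<chi> \<delta> * (q ^ 2) ^ Suc n) =
      inverse (\<chi> \<delta> ^ Suc n * (q ^ (n * Suc n) * (q ^ 2) ^ Suc n))" by (simp add: mult_ac)
  also have "q ^ (n * Suc n) * (q ^ 2) ^ Suc n = q ^ (Suc n * Suc (Suc n))"
    unfolding power_mult[symmetric] power_add[symmetric]
    by (rule arg_cong[where f = "power q"]) (simp add: algebra_simps)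
  finally show ?case .
qed

lemma S_E_F_P: "S E ^ n * (F ^ n * P \<nu>) =
  ((- 1) ^ n * ((q ^ 2) ^ n) ^ n * inverse (\<chi> \<nu> ^ n * q ^ (n * Suc n))) *\<^sub>C (E ^ n * F ^ n * P \<nu>)"
proof -
  have "S E ^ n * (F ^ n * P \<nu>) = S E ^ n * P (\<nu> - 2 * of_nat n) * F ^ n" by (simp add: F_pow_P mult.assoc)
  also have "\<dots> = ((- 1) ^ n * inverse (\<chi> (\<nu> - 2 * of_nat n) ^ n * q ^ (n * Suc n))) *\<^sub>C (E ^ n * P (\<nu> - 2 * of_nat n) * F ^ n)"
    unfolding S_E_pow_P by (simp add: scaleC_mult_left)
  also have "E ^ n * P (\<nu> - 2 * of_nat n) * F ^ n = E ^ n * F ^ n * P \<nu>" by (simp add: F_pow_P mult.assoc)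
  also have "\<chi> (\<nu> - 2 * of_nat n) ^ n = \<chi> \<nu> ^ n * inverse (((q ^ 2) ^ n) ^ n)"
    unfolding chi_diff chi_2_of_nat by (simp add: power_mult_distrib power_inverse)
  finally show ?thesis by (simp add: mult_ac)
qed

lemma mS_zero_weight:
  "mS (zero_weight f) * P \<nu> = (\<Sum>n<CARD('n). (f n (- \<nu>) \<nu> *
     ((- 1) ^ n * ((q ^ 2) ^ n) ^ n * inverse (\<chi> \<nu> ^ n * q ^ (n * Suc n)))) *\<^sub>C (E ^ n * F ^ n * P \<nu>))"
proof -
  note S = alg_antihomD[OF antipode(1)] alg_antihom_power[OF antipode(1)]
  let ?c = "\<lambda>n \<nu>. (- 1) ^ n * ((q ^ 2) ^ n) ^ n * inverse (\<chi> \<nu> ^ n * q ^ (n * Suc n))"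
  have one: "mS ((E ^ n * P \<mu>) \<boxtimes> (F ^ n * P \<nu>')) * P \<nu> =
      (if \<nu>' = \<nu> then if \<mu> = - \<nu> then ?c n \<nu> *\<^sub>C (E ^ n * F ^ n * P \<nu>) else 0 else 0)" for n \<mu> \<nu>'
  proof -
    have "mS ((E ^ n * P \<mu>) \<boxtimes> (F ^ n * P \<nu>')) * P \<nu> = P (- \<mu>) * (S E ^ n * (F ^ n * (P \<nu>' * P \<nu>)))"
      by (simp add: mS_tens S S_P mult.assoc)
    also have "\<dots> = (if \<nu>' = \<nu> then P (- \<mu>) * (S E ^ n * (F ^ n * P \<nu>)) else 0)" by (simp add: P_P)
    also have "P (- \<mu>) * (S E ^ n * (F ^ n * P \<nu>)) = ?c n \<nu> *\<^sub>C (P (- \<mu>) * P \<nu> * (E ^ n * F ^ n))"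
      unfolding S_E_F_P E_F_P by (simp add: scaleC_mult_right mult.assoc)
    also have "\<dots> = (if \<mu> = - \<nu> then ?c n \<nu> *\<^sub>C (E ^ n * F ^ n * P \<nu>) else 0)"
      by (auto simp: P_P E_F_P)
    finally show ?thesis .
  qed
  have "mS (zero_weight f) * P \<nu> = (\<Sum>n<CARD('n). \<Sum>\<mu>\<in>UNIV. \<Sum>\<nu>'\<in>UNIV.
      f n \<mu> \<nu>' *\<^sub>C (mS ((E ^ n * P \<mu>) \<boxtimes> (F ^ n * P \<nu>')) * P \<nu>))"
    unfolding zero_weight_def E_F_diag
    by (simp add: clinear_sum[OF clinear_mS] clinear_scaleC[OF clinear_mS] sum_distrib_right scaleC_mult_left)
  also have "\<dots> = (\<Sum>n<CARD('n). (f n (- \<nu>) \<nu> * ?c n \<nu>) *\<^sub>C (E ^ n * F ^ n * P \<nu>))"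
  proof (rule sum.cong[OF refl])
    fix n
    show "(\<Sum>\<mu>\<in>UNIV. \<Sum>\<nu>'\<in>UNIV. f n \<mu> \<nu>' *\<^sub>C (mS ((E ^ n * P \<mu>) \<boxtimes> (F ^ n * P \<nu>')) * P \<nu>)) =
        (f n (- \<nu>) \<nu> * ?c n \<nu>) *\<^sub>C (E ^ n * F ^ n * P \<nu>)"
      unfolding one
      by (subst sum_eq_single[of _ "- \<nu>"], simp, simp, simp, subst sum_eq_single[of _ \<nu>]) (simp_all add: scaleC_scaleC)
  qed
  finally show ?thesis .
qed

text \<open>The element \<open>Q(\<lambda>) = \<Sum> S(J\<^sub>1) J\<^sub>2\<close> of the theory of twists; conjugation by it corrects the antipode.\<close>

definition Qel :: "complex \<Rightarrow> 'n mod_ring \<Rightarrow> 'u" where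
  "Qel \<Lambda> lam = mS (zero_weight (jcoef \<Lambda> lam))"

lemma Qel_P: "Qel \<Lambda> lam * P \<nu> = aeval cas (Qpoly (\<Lambda> * \<chi> (2 * lam + \<nu>)) (\<chi> \<nu>)) * P \<nu>"
proof -
  define b where "b = \<chi> \<nu>"
  define A where "A = \<Lambda> * \<chi> (2 * lam + \<nu>)"
  have b0: "b \<noteq> 0" by (simp add: b_def)
  have "jcoef \<Lambda> lam n (- \<nu>) \<nu> * ((- 1) ^ n * ((q ^ 2) ^ n) ^ n * inverse (\<chi> \<nu> ^ n * q ^ (n * Suc n))) =
      (sfac n * (\<Prod>j<n. inverse (A - (q ^ 2) ^ Suc j / b))) * dd ^ n" for n
  proof -
    have "\<Lambda> * \<chi> (2 * lam) - \<chi> (- \<nu> - \<nu>) * (q ^ 2) ^ Suc j = inverse b * (A - (q ^ 2) ^ Suc j / b)" for j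
    proof -
      have "\<chi> (- \<nu> - \<nu>) = inverse b * inverse b" unfolding chi_diff chi_neg b_def ..
      then show ?thesis using b0 by (simp add: A_def b_def[symmetric] chi_add field_simps)
    qed
    then have "(\<Prod>j<n. inverse (\<Lambda> * \<chi> (2 * lam) - \<chi> (- \<nu> - \<nu>) * (q ^ 2) ^ Suc j)) =
        (\<Prod>j<n. b * inverse (A - (q ^ 2) ^ Suc j / b))"
      by (intro prod.cong refl) (simp only: inverse_mult_distrib inverse_inverse_eq)
    also have "\<dots> = b ^ n * (\<Prod>j<n. inverse (A - (q ^ 2) ^ Suc j / b))" by (simp add: prod.distrib)
    finally have j: "jcoef \<Lambda> lam n (- \<nu>) \<nu> = rcoef n * (b ^ n * (\<Prod>j<n. inverse (A - (q ^ 2) ^ Suc j / b)))"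
      unfolding jcoef_def xi_def by simp
    have "(q ^ 2) ^ n = q ^ n * q ^ n" by (simp add: power_mult[symmetric] power_add[symmetric] mult_2)
    then have "((q ^ 2) ^ n) ^ n = q ^ (n * n) * q ^ (n * n)" by (simp add: power_mult_distrib power_mult)
    moreover have "q ^ (n * Suc n) = q ^ n * q ^ (n * n)" by (simp add: power_add)
    moreover have "rcoef n * (- 1) ^ n = q ^ n * dd ^ n / qfact (q ^ 2) n"
      unfolding rcoef_qfact by (simp add: power_mult_distrib[symmetric])
    moreover have "r * (B * R) * (s * (X * X) * inverse (B * (Y * X))) = X / f * R * d"
      if "r * s = Y * d / f" "B \<noteq> 0" "X \<noteq> 0" "Y \<noteq> 0" for r B R s X Y d f :: complex
    proof -
      have "r * (B * R) * (s * (X * X) * inverse (B * (Y * X))) = (r * s) * (R * X / Y)"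
        using that(2-4) by (simp add: field_simps)
      then show ?thesis unfolding that(1) using that(4) by simp
    qed
    ultimately show ?thesis
      unfolding j sfac_def b_def[symmetric] using b0 by simp
  qed
  then have "Qel \<Lambda> lam * P \<nu> = (\<Sum>n<CARD('n). (sfac n * (\<Prod>j<n. inverse (A - (q ^ 2) ^ Suc j / b))) *\<^sub>C (dd ^ n *\<^sub>C (E ^ n * F ^ n * P \<nu>)))"
    unfolding Qel_def mS_zero_weight by (simp add: scaleC_scaleC)
  also have "\<dots> = aeval cas (Qpoly A b) * P \<nu>"
    unfolding E_F_cas Qpoly_def aeval_sum aeval_smult sum_distrib_right scaleC_mult_left b_def ..
  finally show ?thesis by (simp add: A_def b_def)
qed

lemma P_Qel: "P \<nu> * Qel \<Lambda> lam = Qel \<Lambda> lam * P \<nu>"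
proof -
  have "P \<nu> * (Qel \<Lambda> lam * P \<mu>) = (if \<mu> = \<nu> then Qel \<Lambda> lam * P \<nu> else 0)" for \<mu>
    unfolding Qel_P aeval_cas_P mult.assoc[symmetric] P_P by auto
  then have "P \<nu> * Qel \<Lambda> lam * (\<Sum>\<mu>\<in>UNIV. P \<mu>) = Qel \<Lambda> lam * P \<nu>"
    by (simp add: sum_distrib_left mult.assoc)
  then show ?thesis by (simp add: P_sum)
qed

text \<open>On the weight \<open>\<nu>\<close> the Casimir element is annihilated by the product over all nodes, because this
  product is a multiple of \<open>E\<^sup>\<ell> F\<^sup>\<ell> = 0\<close>. The polynomial representing \<open>Q\<close> is coprime to it.\<close>

lemma Qel_inverse:
  assumes "\<Lambda> ^ CARD('n) \<noteq> 1" "\<Lambda> \<noteq> 0"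
  shows "\<exists>v. v * (Qel \<Lambda> lam * P \<nu>) = P \<nu> \<and> (Qel \<Lambda> lam * P \<nu>) * v = P \<nu> \<and> P \<nu> * v = v \<and> v * P \<nu> = v"
proof -
  let ?A = "\<Lambda> * \<chi> (2 * lam + \<nu>)"
  have "?A ^ CARD('n) \<noteq> 1" "?A \<noteq> 0" using assms by (simp_all add: power_mult_distrib chi_card)
  then obtain u v where uv: "u * Qpoly ?A (\<chi> \<nu>) + v * (\<Prod>j<CARD('n). [:- node (\<chi> \<nu>) j, 1:]) = 1"
    using Qpoly_bezout by blast
  have nil: "aeval cas (\<Prod>j<CARD('n). [:- node (\<chi> \<nu>) j, 1:]) * P \<nu> = 0"
    unfolding E_F_cas[symmetric] by (simp add: rel(6))
  have "aeval cas (u * Qpoly ?A (\<chi> \<nu>) + v * (\<Prod>j<CARD('n). [:- node (\<chi> \<nu>) j, 1:])) * P \<nu> = P \<nu>"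
    unfolding uv by simp
  then have 1: "aeval cas u * (Qel \<Lambda> lam * P \<nu>) = P \<nu>"
    unfolding Qel_P by (simp add: aeval_add aeval_mult distrib_right mult.assoc nil)
  have 2: "Qel \<Lambda> lam * P \<nu> * (P \<nu> * aeval cas u) = aeval cas u * (Qel \<Lambda> lam * P \<nu>)"
  proof -
    have "Qel \<Lambda> lam * P \<nu> * (P \<nu> * aeval cas u) = Qel \<Lambda> lam * P \<nu> * aeval cas u" by (simp add: mult.assoc[symmetric]) (simp add: mult.assoc)
    also have "\<dots> = aeval cas (Qpoly ?A (\<chi> \<nu>) * u) * P \<nu>"
      by (simp only: Qel_P aeval_mult mult.assoc aeval_cas_P[of u])
    also have "\<dots> = aeval cas u * (Qel \<Lambda> lam * P \<nu>)"
      unfolding Qel_P by (subst mult.commute[of "Qpoly _ _"]) (simp only: aeval_mult mult.assoc)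
    finally show ?thesis .
  qed
  show ?thesis
  proof (intro exI conjI)
    show "P \<nu> * aeval cas u * (Qel \<Lambda> lam * P \<nu>) = P \<nu>" by (simp add: mult.assoc 1)
    show "Qel \<Lambda> lam * P \<nu> * (P \<nu> * aeval cas u) = P \<nu>" unfolding 2 1 ..
    show "P \<nu> * (P \<nu> * aeval cas u) = P \<nu> * aeval cas u" by (simp add: mult.assoc[symmetric])
    show "P \<nu> * aeval cas u * P \<nu> = P \<nu> * aeval cas u"
      unfolding mult.assoc aeval_cas_P unfolding mult.assoc[symmetric] by simp
  qed
qed

text \<open>The antipode fixes the Casimir element and negates the weight, so \<open>S(Q)\<close> and \<open>Q\<close> are the same series
  with \<open>b\<close> and \<open>1/b\<close> exchanged, at the same value of \<open>A\<close>. The series differ only by the linear factors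
  \<open>A - b\<close> and \<open>A - 1/b\<close>, and these are the values of \<open>y\<close>.\<close>

lemma S_Qel:
  assumes \<Lambda>: "\<Lambda> ^ CARD('n) \<noteq> 1"
  defines "y \<equiv> \<lambda>i. \<Lambda> * \<chi> i - inverse (\<chi> i)"
  shows "S (Qel \<Lambda> (lam + \<mu>) * P (- \<mu>)) = (\<chi> \<mu> * y lam / y (lam + \<mu>)) *\<^sub>C (Qel \<Lambda> lam * P \<mu>)"
proof -
  note S = alg_antihomD[OF antipode(1)]
  define A where "A = \<Lambda> * \<chi> (2 * lam + \<mu>)"
  have A: "A ^ CARD('n) \<noteq> 1" using \<Lambda> by (simp add: A_def power_mult_distrib chi_card)
  have nz: "A - inverse (\<chi> \<mu>) \<noteq> 0" "A - \<chi> \<mu> \<noteq> 0"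
    using not_root_of_unity[OF A, of "- \<mu>"] not_root_of_unity[OF A, of \<mu>] by (simp_all add: chi_neg)
  have e: "\<Lambda> * \<chi> (2 * (lam + \<mu>) + - \<mu>) = A" by (simp add: A_def algebra_simps)
  have "S (Qel \<Lambda> (lam + \<mu>) * P (- \<mu>)) = P \<mu> * aeval cas (Qpoly A (\<chi> (- \<mu>)))"
    unfolding Qel_P e S S_P by (simp add: aeval_antihom[OF antipode(1)] S_cas)
  also have "Qpoly A (\<chi> (- \<mu>)) = Polynomial.smult ((A - \<chi> \<mu>) / (A - inverse (\<chi> \<mu>))) (Qpoly A (\<chi> \<mu>))"
  proof -
    have "Polynomial.smult (inverse (A - inverse (\<chi> \<mu>))) (Polynomial.smult (A - \<chi> \<mu>) (Qpoly A (\<chi> \<mu>))) = Qpoly A (\<chi> (- \<mu>))"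
      unfolding Qpoly_symmetric[OF A] using nz by simp
    then show ?thesis by (simp add: divide_inverse mult.commute)
  qed
  also have "P \<mu> * aeval cas \<dots> = ((A - \<chi> \<mu>) / (A - inverse (\<chi> \<mu>))) *\<^sub>C (Qel \<Lambda> lam * P \<mu>)"
    unfolding Qel_P A_def[symmetric] by (simp add: aeval_smult scaleC_mult_right aeval_cas_P)
  also have "(A - \<chi> \<mu>) / (A - inverse (\<chi> \<mu>)) = \<chi> \<mu> * y lam / y (lam + \<mu>)"
  proof -
    define a where "a = \<chi> lam"
    define b where "b = \<chi> \<mu>"
    have ab: "a \<noteq> 0" "b \<noteq> 0" by (simp_all add: a_def b_def)
    have Ae: "A = \<Lambda> * a ^ 2 * b" by (simp add: A_def chi_add chi_2_mult a_def b_def)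
    have y1: "b * y lam = (A - b) / a" using ab by (simp add: y_def Ae a_def[symmetric] field_simps power2_eq_square)
    have y2: "y (lam + \<mu>) = (A - inverse b) / a"
      using ab by (simp add: y_def Ae chi_add a_def[symmetric] b_def[symmetric] field_simps power2_eq_square)
    show ?thesis unfolding y2 b_def[symmetric] y1 using ab by simp
  qed
  finally show ?thesis .
qed

end

section \<open>Uniqueness of the antipode of a weak Hopf algebra\<close>

definition convolution ::
  "('h::complex_alg \<Rightarrow> ('h, 'h) tensor) \<Rightarrow> ('h \<Rightarrow> 'h) \<Rightarrow> ('h \<Rightarrow> 'h) \<Rightarrow> 'h \<Rightarrow> 'h" where
  "convolution \<Delta> f h x = tensor_lift (\<lambda>a b. f a * h b) (\<Delta> x)"

lemma cbilinear_prod: "clinear f \<Longrightarrow> clinear h \<Longrightarrow> cbilinear (\<lambda>a b. f a * h b :: 'a::complex_alg)"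
  by (rule cbilinear_compose[OF cbilinear_mult])

context weak_hopf_algebra
begin

lemma clinear_convolution: "clinear f \<Longrightarrow> clinear h \<Longrightarrow> clinear (convolution \<Delta> f h)"
  unfolding convolution_def
  by (intro clinear_compose[OF linear(1)] clinear_tensor_lift cbilinear_prod)

lemma convolution_assoc:
  assumes "clinear f" "clinear h" "clinear k"
  shows "convolution \<Delta> (convolution \<Delta> f h) k x = convolution \<Delta> f (convolution \<Delta> h k) x"
proof -
  define T where "T = (\<lambda>a t. tensor_lift (\<lambda>b c. f a * h b * k c) t)"
  have bT1: "cbilinear (\<lambda>b c. f a * h b * k c)" for a
    by (intro cbilinear_compose[OF cbilinear_mult] clinear_mult_const assms)
  have bT: "cbilinear T"
    unfolding T_def
    by (rule cbilinearI)
      (simp_all add: clinear_add[OF clinear_tensor_lift[OF bT1]] clinear_scaleC[OF clinear_tensor_lift[OF bT1]]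
        clinear_add[OF assms(1)] clinear_scaleC[OF assms(1)] distrib_right scaleC_mult_left
        tensor_lift_fun_add tensor_lift_fun_scaleC)
  have 1: "convolution \<Delta> f (convolution \<Delta> h k) x = tensor_lift T (tensor_map id \<Delta> (\<Delta> x))"
  proof -
    have "tensor_lift T (tensor_map id \<Delta> (\<Delta> x)) = tensor_lift (\<lambda>a b. T a (\<Delta> b)) (\<Delta> x)"
      by (subst tensor_lift_map[OF bT]) (simp_all add: linear id_def clinear_id)
    moreover have "T a (\<Delta> b) = f a * convolution \<Delta> h k b" for a b
      unfolding T_def convolution_def mult.assoc
      by (rule tensor_lift_post[symmetric, OF clinear_mult_const(1)[OF clinear_id]])
    ultimately show ?thesis by (simp add: convolution_def[of _ f])
  qed
  have b3: "cbilinear (\<lambda>a b. a \<boxtimes> (b \<boxtimes> c))" for c :: 'h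
    by (rule cbilinearI) (simp_all add: tens_simps)
  have b4: "cbilinear (\<lambda>(t :: ('h, 'h) tensor) (c :: 'h). tensor_lift (\<lambda>a b. a \<boxtimes> (b \<boxtimes> c)) t)"
    by (rule cbilinearI)
      (simp_all add: clinear_add[OF clinear_tensor_lift[OF b3]] clinear_scaleC[OF clinear_tensor_lift[OF b3]]
        tens_simps tensor_lift_fun_add tensor_lift_fun_scaleC)
  have 2: "convolution \<Delta> (convolution \<Delta> f h) k x = tensor_lift T (tensor_assoc (tensor_map \<Delta> id (\<Delta> x)))"
  proof -
    have "tensor_lift T (tensor_assoc (tensor_map \<Delta> id (\<Delta> x))) =
        tensor_lift (\<lambda>t c. tensor_lift T (tensor_lift (\<lambda>a b. a \<boxtimes> (b \<boxtimes> c)) t)) (tensor_map \<Delta> id (\<Delta> x))"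
      unfolding tensor_assoc_def by (rule tensor_lift_post[OF clinear_tensor_lift[OF bT]])
    also have "\<dots> = tensor_lift (\<lambda>a c. tensor_lift T (tensor_lift (\<lambda>a b. a \<boxtimes> (b \<boxtimes> c)) (\<Delta> a))) (\<Delta> x)"
      by (subst tensor_lift_map[OF cbilinear_post[OF b4 clinear_tensor_lift[OF bT]]])
        (simp_all add: linear id_def clinear_id)
    also have "(\<lambda>a c. tensor_lift T (tensor_lift (\<lambda>a b. a \<boxtimes> (b \<boxtimes> c)) (\<Delta> a))) = (\<lambda>a c. convolution \<Delta> f h a * k c)"
    proof (intro ext)
      fix a c
      have "tensor_lift T (tensor_lift (\<lambda>a b. a \<boxtimes> (b \<boxtimes> c)) (\<Delta> a)) = tensor_lift (\<lambda>a b. f a * h b * k c) (\<Delta> a)"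
      proof -
        have "tensor_lift T (a \<boxtimes> (b \<boxtimes> c)) = f a * h b * k c" for a b
          unfolding tensor_lift_tens[OF bT] by (simp add: T_def tensor_lift_tens[OF bT1])
        then show ?thesis by (subst tensor_lift_post[OF clinear_tensor_lift[OF bT]]) simp
      qed
      also have "\<dots> = convolution \<Delta> f h a * k c"
        unfolding convolution_def by (rule tensor_lift_post[symmetric, OF clinear_mult_const(2)[OF clinear_id]])
      finally show "tensor_lift T (tensor_lift (\<lambda>a b. a \<boxtimes> (b \<boxtimes> c)) (\<Delta> a)) = convolution \<Delta> f h a * k c" .
    qed
    finally show ?thesis by (simp add: convolution_def[of _ "convolution \<Delta> f h"] id_def)
  qed
  show ?thesis unfolding 1 2 coassoc ..
qed

lemma antipode_convolution: "convolution \<Delta> S (counital_target \<Delta> \<epsilon>) x = S x"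
proof -
  have bT1: "cbilinear (\<lambda>b c. S a * b * S c)" for a
    by (intro cbilinear_compose[OF cbilinear_mult] clinear_mult_const linear clinear_id)
  have bT: "cbilinear (\<lambda>a t. tensor_lift (\<lambda>b c. S a * b * S c) t)"
    by (rule cbilinearI)
      (simp_all add: clinear_add[OF clinear_tensor_lift[OF bT1]] clinear_scaleC[OF clinear_tensor_lift[OF bT1]]
        clinear_add[OF linear(3)] clinear_scaleC[OF linear(3)] distrib_right scaleC_mult_left
        tensor_lift_fun_add tensor_lift_fun_scaleC)
  have "S x = tensor_lift (\<lambda>a b. tensor_lift (\<lambda>b c. S a * b * S c) (\<Delta> b)) (\<Delta> x)"
    unfolding antipode_conv[of x, symmetric]
    by (subst tensor_lift_map[OF bT]) (simp_all add: linear id_def clinear_id)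
  also have "(\<lambda>a b. tensor_lift (\<lambda>b c. S a * b * S c) (\<Delta> b)) = (\<lambda>a b. S a * counital_target \<Delta> \<epsilon> b)"
    unfolding antipode_target[symmetric] mult.assoc
    by (intro ext, rule tensor_lift_post[symmetric, OF clinear_mult_const(1)[OF clinear_id]])
  finally show ?thesis by (simp add: convolution_def)
qed

text \<open>A left convolution inverse in the weak sense is already the antipode:
  \<open>S = \<epsilon>\<^sub>s * S = S' * id * S = S' * \<epsilon>\<^sub>t = S'\<close>.\<close>

lemma antipode_unique:
  assumes S': "clinear S'" "\<And>x. convolution \<Delta> S' (\<lambda>x. x) x = counital_source \<Delta> \<epsilon> x"
    "\<And>x. convolution \<Delta> S' (counital_target \<Delta> \<epsilon>) x = S' x"
  shows "S x = S' x"
proof -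
  have t: "counital_target \<Delta> \<epsilon> = convolution \<Delta> (\<lambda>x. x) S"
    by (rule ext) (simp add: convolution_def antipode_target)
  have s: "convolution \<Delta> S (\<lambda>x. x) = convolution \<Delta> S' (\<lambda>x. x)"
    by (rule ext) (simp add: S'(2), simp add: convolution_def antipode_source)
  have "S x = convolution \<Delta> S (convolution \<Delta> (\<lambda>x. x) S) x"
    using antipode_convolution[of x] unfolding t ..
  also have "\<dots> = convolution \<Delta> (convolution \<Delta> S' (\<lambda>x. x)) S x"
    unfolding convolution_assoc[OF linear(3) clinear_id linear(3), symmetric] s ..
  also have "\<dots> = convolution \<Delta> S' (counital_target \<Delta> \<epsilon>) x"
    unfolding convolution_assoc[OF S'(1) clinear_id linear(3)] t ..
  finally show ?thesis by (simp only: S'(3))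
qed

text \<open>The usual argument for units: \<open>\<epsilon> = \<epsilon>' * \<epsilon> = \<epsilon>'\<close>.\<close>

lemma counit_unique:
  assumes "clinear \<epsilon>'" "\<And>x. tensor_lift (\<lambda>a b. \<epsilon>' a *\<^sub>C b) (\<Delta> x) = x"
  shows "\<epsilon> x = \<epsilon>' x"
proof -
  have "\<epsilon> x = tensor_lift (\<lambda>a b. \<epsilon> (\<epsilon>' a *\<^sub>C b)) (\<Delta> x)"
    by (subst (1) assms(2)[symmetric]) (rule tensor_lift_post[OF linear(2)])
  also have "\<dots> = tensor_lift (\<lambda>a b. \<epsilon>' (\<epsilon> b *\<^sub>C a)) (\<Delta> x)"
    by (simp add: clinear_scaleC[OF linear(2)] clinear_scaleC[OF assms(1)] scaleC_complex_def mult.commute)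
  also have "\<dots> = \<epsilon>' x"
    by (subst tensor_lift_post[OF assms(1), symmetric]) (simp add: counit_right)
  finally show ?thesis .
qed

end

section \<open>Block matrices over an algebra\<close>

abbreviation munit :: "'d \<Rightarrow> 'd \<Rightarrow> 'u \<Rightarrow> ('d::finite sqmat, 'u::complex_alg) tensor" where
  "munit i j u \<equiv> matrix_unit i j \<boxtimes> u"

lemma entry_matrix_unit: "entry (matrix_unit i j) a b = (if a = i \<and> b = j then 1 else 0)"
  by (simp add: matrix_unit_def)

lemma matrix_unit_mult: "matrix_unit i j * matrix_unit k m = (if j = k then matrix_unit i m else (0 :: 'd::finite sqmat))"
proof (rule sqmat_eqI)
  fix a b
  have "entry (matrix_unit i j * matrix_unit k m) a b = entry (matrix_unit i j) a j * entry (matrix_unit k m) j b"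
    unfolding times_sqmat.rep_eq by (rule sum_eq_single) (simp_all add: entry_matrix_unit)
  then show "entry (matrix_unit i j * matrix_unit k m) a b = entry (if j = k then matrix_unit i m else 0) a b"
    by (simp add: entry_matrix_unit zero_sqmat.rep_eq)
qed

lemma sqmat_expand: "A = (\<Sum>i\<in>UNIV. \<Sum>j\<in>UNIV. entry A i j *\<^sub>C matrix_unit i (j :: 'd::finite))"
proof (rule sqmat_eqI)
  fix a b
  have "entry (\<Sum>i\<in>UNIV. \<Sum>j\<in>UNIV. entry A i j *\<^sub>C matrix_unit i j) a b =
      (\<Sum>i\<in>UNIV. \<Sum>j\<in>UNIV. if i = a then if j = b then entry A a b else 0 else 0)"
    unfolding entry_sum by (intro sum.cong refl) (simp add: scaleC_sqmat.rep_eq entry_matrix_unit)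
  also have "\<dots> = entry A a b" by (subst sum_eq_single[of _ a]) auto
  finally show "entry A a b = entry (\<Sum>i\<in>UNIV. \<Sum>j\<in>UNIV. entry A i j *\<^sub>C matrix_unit i j) a b" ..
qed

lemma one_sqmat_expand: "1 = (\<Sum>i\<in>UNIV. matrix_unit i (i :: 'd::finite))"
proof (rule sqmat_eqI)
  fix a b :: 'd
  have "entry (\<Sum>i\<in>UNIV. matrix_unit i i) a b = (\<Sum>i\<in>UNIV. if i = a then if a = b then 1 else 0 else 0)"
    unfolding entry_sum by (intro sum.cong refl) (auto simp: entry_matrix_unit)
  then show "entry 1 a b = entry (\<Sum>i\<in>UNIV. matrix_unit i i) a b" by (simp add: one_sqmat.rep_eq)
qed

lemma munit_mult: "munit i j u * munit k m v = (if j = k then munit i m (u * v) else 0)"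
  by (simp add: tens_mult_tens matrix_unit_mult)

lemma weak_alg_eqI:
  fixes f h :: "('d::finite sqmat, 'u::complex_alg) tensor \<Rightarrow> 'c::complex_vec"
  assumes "clinear f" "clinear h" "\<And>i j u. f (munit i j u) = h (munit i j u)"
  shows "f x = h x"
proof (rule clinear_tensor_eqI[OF assms(1,2)])
  fix A :: "'d sqmat" and u :: 'u
  have "A \<boxtimes> u = (\<Sum>i\<in>UNIV. \<Sum>j\<in>UNIV. entry A i j *\<^sub>C munit i j u)"
    by (subst sqmat_expand[of A]) (simp add: tens_sum tens_simps)
  then show "f (A \<boxtimes> u) = h (A \<boxtimes> u)"
    by (simp add: clinear_sum[OF assms(1)] clinear_sum[OF assms(2)] clinear_scaleC[OF assms(1)]
        clinear_scaleC[OF assms(2)] assms(3))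
qed

definition blocks :: "('d::finite \<Rightarrow> 'd \<Rightarrow> 'u::complex_alg) \<Rightarrow> ('d sqmat, 'u) tensor" where
  "blocks f = (\<Sum>a\<in>UNIV. \<Sum>b\<in>UNIV. munit a b (f a b))"

lemma munit_mult_blocks: "munit i j u * blocks f = (\<Sum>b\<in>UNIV. munit i b (u * f j b))"
  unfolding blocks_def sum_distrib_left
  by (subst sum_eq_single[of _ j]) (simp_all add: munit_mult)

lemma blocks_mult_munit: "blocks f * munit i j u = (\<Sum>a\<in>UNIV. munit a j (f a i * u))"
  unfolding blocks_def sum_distrib_right
  by (intro sum.cong refl, subst sum_eq_single[of _ i]) (simp_all add: munit_mult)

lemma blocks_mult: "blocks f * blocks h = blocks (\<lambda>a b. \<Sum>c\<in>UNIV. f a c * h c b)"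
proof -
  have "blocks f * blocks h = (\<Sum>a\<in>UNIV. \<Sum>c\<in>UNIV. \<Sum>b\<in>UNIV. munit a b (f a c * h c b))"
    unfolding blocks_def[of f] sum_distrib_right munit_mult_blocks ..
  also have "\<dots> = blocks (\<lambda>a b. \<Sum>c\<in>UNIV. f a c * h c b)"
    unfolding blocks_def tens_sum(1) by (rule sum.cong[OF refl], rule sum.swap)
  finally show ?thesis .
qed

lemma blocks_diag: "blocks (\<lambda>a b. if a = b then f a else 0) = (\<Sum>a\<in>UNIV. munit a a (f a))"
  unfolding blocks_def by (intro sum.cong refl, subst sum_eq_single) auto

lemma blocks_1: "blocks (\<lambda>a b. if a = b then 1 else 0) = 1"
  unfolding blocks_diag one_tensor_def one_sqmat_expand tens_sum ..

lemma tens_blocks: "1 \<boxtimes> u = blocks (\<lambda>a b. if a = b then u else 0)"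
  unfolding blocks_diag one_sqmat_expand tens_sum ..

lemma base_elem_blocks: "base_elem f = blocks (\<lambda>a b. if a = b then f a *\<^sub>C 1 else 0)"
  unfolding blocks_diag base_elem_def by (simp add: tens_simps)

lemma mat_transp_matrix_unit: "mat_transp (matrix_unit i j) = matrix_unit j i"
  by (rule sqmat_eqI) (auto simp: mat_transp_def entry_matrix_unit)

lemma clinear_mat_transp: "clinear (mat_transp :: 'd::finite sqmat \<Rightarrow> 'd sqmat)"
  by (rule clinearI; rule sqmat_eqI; simp add: mat_transp_def plus_sqmat.rep_eq scaleC_sqmat.rep_eq)

lemma mat_transp_mult: "mat_transp (A * B) = mat_transp B * (mat_transp A :: 'd::finite sqmat)"
  by (rule sqmat_eqI) (simp add: mat_transp_def times_sqmat.rep_eq mult.commute)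

lemma mat_transp_mat_transp: "mat_transp (mat_transp A) = A"
  by (rule sqmat_eqI) (simp add: mat_transp_def)

lemma mat_transp_1: "mat_transp (1 :: 'd::finite sqmat) = 1"
  by (rule sqmat_eqI) (simp add: mat_transp_def one_sqmat.rep_eq eq_commute)

definition mat_antipode :: "('u::complex_alg \<Rightarrow> 'u) \<Rightarrow> ('d::finite sqmat, 'u) tensor \<Rightarrow> ('d sqmat, 'u) tensor" where
  "mat_antipode S = tensor_lift (\<lambda>A u. mat_transp A \<boxtimes> S u)"

lemma mat_antipode:
  fixes S :: "'u::complex_alg \<Rightarrow> 'u" and A :: "'d::finite sqmat"
  assumes "alg_antihom S"
  shows "alg_antihom (mat_antipode S :: ('d::finite sqmat, 'u) tensor \<Rightarrow> _)"
    "mat_antipode S (A \<boxtimes> u) = mat_transp A \<boxtimes> S u"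
    "mat_antipode S (blocks f) = blocks (\<lambda>a b. S (f b (a :: 'd)))"
proof -
  have b: "cbilinear (\<lambda>A u. mat_transp A \<boxtimes> S u)"
    by (rule cbilinear_compose[OF cbilinear_tens clinear_mat_transp alg_antihomD(1)[OF assms]])
  have l: "clinear (mat_antipode S :: ('d sqmat, 'u) tensor \<Rightarrow> _)"
    unfolding mat_antipode_def by (rule clinear_tensor_lift[OF b])
  have t: "mat_antipode S (A \<boxtimes> u) = mat_transp A \<boxtimes> S u" for A :: "'d sqmat" and u
    unfolding mat_antipode_def by (rule tensor_lift_tens[OF b])
  then show "mat_antipode S (A \<boxtimes> u) = mat_transp A \<boxtimes> S u" .
  have "mat_antipode S (x * y) = mat_antipode S y * mat_antipode S x" for x y :: "('d sqmat, 'u) tensor"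
  proof (induction x rule: tensor_induct)
    case (1 A u)
    show ?case
      by (induction y rule: tensor_induct)
        (simp_all add: tens_mult_tens t mat_transp_mult alg_antihomD(3)[OF assms] distrib_left distrib_right clinear_add[OF l])
  qed (simp add: distrib_left distrib_right clinear_add[OF l])
  then show "alg_antihom (mat_antipode S :: ('d sqmat, 'u) tensor \<Rightarrow> _)"
    unfolding alg_antihom_def using l by (simp add: one_tensor_def t mat_transp_1 alg_antihomD(2)[OF assms])
  show "mat_antipode S (blocks f) = blocks (\<lambda>a b. S (f b (a :: 'd)))"
    unfolding blocks_def by (simp add: clinear_sum[OF l] t mat_transp_matrix_unit) (rule sum.swap)
qed

text \<open>The embedding of \<open>U \<otimes> U\<close> as a pair of matrix entries.\<close>

definition iota :: "'d \<Rightarrow> 'd \<Rightarrow> 'd \<Rightarrow> 'd \<Rightarrow> ('u, 'u) tensor \<Rightarrow>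
    (('d::finite sqmat, 'u::complex_alg) tensor, ('d sqmat, 'u) tensor) tensor" where
  "iota i j k m = tensor_map (\<lambda>a. munit i j a) (\<lambda>b. munit k m b)"

lemma clinear_iota: "clinear (iota i j k m)"
  unfolding iota_def by (intro clinear_tensor_map clinear_tens clinear_id)

lemma iota_tens: "iota i j k m (a \<boxtimes> b) = munit i j a \<boxtimes> munit k m b"
  unfolding iota_def by (intro tensor_map_tens clinear_tens clinear_id)

lemma iota_mult: "iota i j k m s * iota i' j' k' m' t = (if j = i' then if m = k' then iota i j' k m' (s * t) else 0 else 0)"
proof (induction s rule: tensor_induct)
  case (1 a b)
  show ?case
    by (induction t rule: tensor_induct)
      (auto simp: iota_tens tens_mult_tens matrix_unit_mult clinear_add[OF clinear_iota] distrib_left)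
qed (auto simp: clinear_add[OF clinear_iota] distrib_right)

lemma tensor_lift_iota:
  assumes "cbilinear f"
  shows "tensor_lift f (iota i j k m t) = tensor_lift (\<lambda>a b. f (munit i j a) (munit k m b)) t"
  unfolding iota_def by (intro tensor_lift_map assms clinear_tens clinear_id)

lemma mat_comult_munit:
  fixes \<Delta> :: "'u::complex_alg \<Rightarrow> ('u, 'u) tensor" and i j :: "'n::nontriv mod_ring"
  assumes "clinear \<Delta>"
  shows "mat_comult \<Delta> (munit i j u) = iota i j i j (\<Delta> u)"
proof -
  have "cbilinear (\<lambda>(A :: 'n mod_ring sqmat) u. \<Sum>i\<in>UNIV. \<Sum>j\<in>UNIV. entry A i j *\<^sub>C
     tensor_map (\<lambda>a. matrix_unit i j \<boxtimes> a) (\<lambda>b. matrix_unit i j \<boxtimes> b) (\<Delta> u))"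
    unfolding iota_def[symmetric]
    by (rule cbilinearI) (simp_all add: plus_sqmat.rep_eq scaleC_sqmat.rep_eq scaleC_add_left scaleC_add_right
        sum.distrib clinear_add[OF assms] clinear_scaleC[OF assms] clinear_add[OF clinear_iota]
        clinear_scaleC[OF clinear_iota] cvec.scale_sum_right mult.commute)
  then have "mat_comult \<Delta> (munit i j u) = (\<Sum>i'\<in>UNIV. \<Sum>j'\<in>UNIV. entry (matrix_unit i j) i' j' *\<^sub>C iota i' j' i' j' (\<Delta> u))"
    unfolding mat_comult_def iota_def by (rule tensor_lift_tens)
  also have "\<dots> = iota i j i j (\<Delta> u)"
    unfolding entry_matrix_unit
    by (subst sum_eq_single[of _ i], simp, simp, simp, subst sum_eq_single[of _ j]) (simp_all add: scaleC_one)
  finally show ?thesis .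
qed

section \<open>The Hopf algebra structure of the small quantum group\<close>

context sl2_root
begin

lemma comult_Ki: "\<Delta> Ki = Ki \<boxtimes> Ki"
proof -
  note D = alg_homD[OF comult(1)]
  have "\<Delta> Ki * \<Delta> K = 1" unfolding D(3)[symmetric] rel(2) by (rule D(2))
  then have "\<Delta> Ki * (K \<boxtimes> K) * (Ki \<boxtimes> Ki) = Ki \<boxtimes> Ki" by (simp add: comult)
  then show ?thesis by (simp add: mult.assoc tens_mult_tens rel(1) one_tensor_def[symmetric])
qed

lemma counit_Ki: "\<epsilon> Ki = 1"
  using alg_homD(3)[OF counit(1), of K Ki] by (simp add: rel(1) counit alg_homD(2)[OF counit(1)])

lemma counit_P: "\<epsilon> (P \<mu>) = (if \<mu> = 0 then 1 else 0)"
proof -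
  note e = alg_homD[OF counit(1)]
  have "\<epsilon> (P \<mu>) = \<chi> \<mu> * \<epsilon> (P \<mu>)" for \<mu>
    using arg_cong[OF K_P[of \<mu>], of \<epsilon>] by (simp add: e(3) counit clinear_scaleC[OF e(1)] scaleC_complex_def)
  then have z: "\<epsilon> (P \<mu>) = 0" if "\<mu> \<noteq> 0" for \<mu>
    using that by (metis chi_eq_1 mult_cancel_right1)
  have "\<epsilon> (P 0) = (\<Sum>\<mu>\<in>UNIV. \<epsilon> (P \<mu>))"
    by (rule sum_eq_single[symmetric]) (auto simp: z)
  also have "\<dots> = 1" by (simp add: clinear_sum[OF e(1), symmetric] P_sum e(2))
  finally show ?thesis using z by auto
qed

definition epsL :: "('u, 'u) tensor \<Rightarrow> 'u" where "epsL = tensor_lift (\<lambda>a b. \<epsilon> a *\<^sub>C b)"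
definition epsR :: "('u, 'u) tensor \<Rightarrow> 'u" where "epsR = tensor_lift (\<lambda>a b. \<epsilon> b *\<^sub>C a)"

lemma eps_bilinear: "cbilinear (\<lambda>a b. \<epsilon> a *\<^sub>C (b :: 'u))" "cbilinear (\<lambda>a b. \<epsilon> b *\<^sub>C (a :: 'u))"
  by (rule cbilinear_compose[OF cbilinear_scale alg_homD(1)[OF counit(1)] clinear_id])
    (rule cbilinear_compose[OF cbilinear_scale' clinear_id alg_homD(1)[OF counit(1)]])

lemma epsL: "alg_hom epsL" "epsL (a \<boxtimes> b) = \<epsilon> a *\<^sub>C b"
  unfolding epsL_def
  by (rule alg_hom_tensor_lift[OF eps_bilinear(1)])
    (simp_all add: alg_homD(2,3)[OF counit(1)] scaleC_one scaleC_mult_left scaleC_mult_right scaleC_scaleC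
      mult.commute tensor_lift_tens[OF eps_bilinear(1)])

lemma epsR: "alg_hom epsR" "epsR (a \<boxtimes> b) = \<epsilon> b *\<^sub>C a"
  unfolding epsR_def
  by (rule alg_hom_tensor_lift[OF eps_bilinear(2)])
    (simp_all add: alg_homD(2,3)[OF counit(1)] scaleC_one scaleC_mult_left scaleC_mult_right scaleC_scaleC
      mult.commute tensor_lift_tens[OF eps_bilinear(2)])

lemma alg_hom_compose: "alg_hom f \<Longrightarrow> alg_hom h \<Longrightarrow> alg_hom (\<lambda>x. h (f x))"
  unfolding alg_hom_def by (auto intro: clinear_compose)

lemma eps_comult: "epsL (\<Delta> u) = u" "epsR (\<Delta> u) = u"
proof -
  have gen: "epsL (\<Delta> (g x)) = g x" "epsR (\<Delta> (g x)) = g x" for x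
    by (cases x; simp add: comult comult_Ki clinear_add[OF alg_homD(1)[OF epsL(1)]] clinear_add[OF alg_homD(1)[OF epsR(1)]]
      epsL(2) epsR(2) counit counit_Ki alg_homD(2)[OF counit(1)] scaleC_one)+
  show "epsL (\<Delta> u) = u"
    by (rule presented_by_alg_hom_eqI[OF presentation alg_hom_compose[OF comult(1) epsL(1)] alg_hom_id(1) gen(1)])
  show "epsR (\<Delta> u) = u"
    by (rule presented_by_alg_hom_eqI[OF presentation alg_hom_compose[OF comult(1) epsR(1)] alg_hom_id(1) gen(2)])
qed

lemma eps_zero_weight:
  assumes "f 0 = (\<lambda>\<mu> \<nu>. 1)"
  shows "epsL (zero_weight f) = 1" "epsR (zero_weight f) = 1"
proof -
  note L = alg_homD[OF epsL(1)] and R = alg_homD[OF epsR(1)]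
  have "epsL ((E ^ n \<boxtimes> F ^ n) * diag (f n)) = 0" "epsR ((E ^ n \<boxtimes> F ^ n) * diag (f n)) = 0" if "n \<in> {1..<CARD('n)}" for n
    using that by (simp_all add: L(3) R(3) epsL(2) epsR(2) alg_hom_power[OF counit(1)] counit power_0_left)
  then show "epsL (zero_weight f) = 1" "epsR (zero_weight f) = 1"
    unfolding zero_weight_split assms diag_1
    by (simp_all add: clinear_add[OF L(1)] clinear_add[OF R(1)] clinear_sum[OF L(1)] clinear_sum[OF R(1)] L(2) R(2))
qed

text \<open>The contraction \<open>a \<otimes> b \<mapsto> S(a) x b\<close> is multiplicative in the sense that a product \<open>s * t\<close> may be
  contracted with \<open>s\<close> first and then with \<open>t\<close>. So a coproduct on the left contracts to a
  scalar, and a factor that was contracted into \<open>x\<close> can be cancelled against its inverse.\<close>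

definition mSx :: "'u \<Rightarrow> ('u, 'u) tensor \<Rightarrow> 'u" where
  "mSx x = tensor_lift (\<lambda>a b. S a * x * b)"

lemma mSx_bilinear: "cbilinear (\<lambda>a b. S a * x * b)"
  by (rule cbilinear_compose[OF cbilinear_mult clinear_mult_const(2)[OF alg_antihomD(1)[OF antipode(1)]] clinear_id])

lemma clinear_mSx: "clinear (mSx x)"
  unfolding mSx_def by (rule clinear_tensor_lift[OF mSx_bilinear])

lemma mSx_tens: "mSx x (a \<boxtimes> b) = S a * x * b"
  unfolding mSx_def by (rule tensor_lift_tens[OF mSx_bilinear])

lemma mSx_add: "mSx (x + y) t = mSx x t + mSx y t"
  by (induction t rule: tensor_induct) (simp_all add: mSx_tens clinear_add[OF clinear_mSx] algebra_simps)

lemma mSx_scale: "mSx (c *\<^sub>C x) t = c *\<^sub>C mSx x t"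
  by (induction t rule: tensor_induct)
    (simp_all add: mSx_tens clinear_add[OF clinear_mSx] scaleC_mult_left scaleC_mult_right scaleC_add_right)

lemma mSx_mult: "mSx x (s * t) = mSx (mSx x s) t"
proof (induction s rule: tensor_induct)
  case (1 a b)
  show ?case
    by (induction t rule: tensor_induct)
      (simp_all add: tens_mult_tens mSx_tens clinear_add[OF clinear_mSx] distrib_left
        alg_antihomD(3)[OF antipode(1)] mult.assoc)
qed (simp add: clinear_add[OF clinear_mSx] distrib_right mSx_add)

lemma mSx_1: "mSx x 1 = x"
  unfolding one_tensor_def by (simp add: mSx_tens alg_antihomD(2)[OF antipode(1)])

lemma mSx_right: "mSx x (t * (1 \<boxtimes> d)) = mSx x t * d"
  unfolding mSx_mult by (simp add: mSx_tens alg_antihomD(2)[OF antipode(1)])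

lemma mS_eq: "mS = mSx 1"
  by (simp add: mS_def mSx_def)

lemma mSx_comult: "mSx 1 (\<Delta> u) = \<epsilon> u *\<^sub>C 1"
  using presentation
proof (induction u rule: presented_by_induct)
  case (word w)
  note D = alg_homD[OF comult(1)] and e = alg_homD[OF counit(1)]
  have gen: "mSx 1 (\<Delta> (g x)) = \<epsilon> (g x) *\<^sub>C 1" for x
    by (cases x)
      (simp_all add: comult comult_Ki clinear_add[OF clinear_mSx] mSx_tens antipode S_Ki counit counit_Ki rel(1,2)
        alg_antihomD(2)[OF antipode(1)] scaleC_one mult.assoc)
  show ?case
  proof (induction w)
    case Nil
    show ?case by (simp add: D(2) e(2) mSx_1 scaleC_one)
  next
    case (Cons x w)
    then show ?case by (simp add: D(3) e(3) mSx_mult gen mSx_scale scaleC_scaleC mult.commute)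
  qed
qed (simp_all add: clinear_add[OF clinear_mSx] clinear_scaleC[OF clinear_mSx] scaleC_add_left scaleC_scaleC
    clinear_add[OF alg_homD(1)[OF comult(1)]] clinear_scaleC[OF alg_homD(1)[OF comult(1)]]
    clinear_add[OF alg_homD(1)[OF counit(1)]] clinear_scaleC[OF alg_homD(1)[OF counit(1)]] scaleC_complex_def)

text \<open>Both sides are algebra maps, and they agree on the generators.\<close>

lemma S_S: "S (S u) = Ki * u * K"
proof -
  note S = alg_antihomD[OF antipode(1)]
  have 1: "alg_hom (\<lambda>u. S (S u))"
    unfolding alg_hom_def using S by (auto intro: clinear_compose)
  have 2: "alg_hom (\<lambda>u. Ki * u * K)"
    unfolding alg_hom_def
    by (auto intro!: clinear_mult_const clinear_id simp: rel(2) mult.assoc)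
      (simp add: mult.assoc[symmetric] mult.assoc[of _ K Ki] rel(1))
  have 3: "S (S (g x)) = Ki * g x * K" for x
    by (cases x)
      (simp_all add: antipode S S_Ki rel clinear_neg[OF S(1)] mult.assoc)
  show ?thesis by (rule presented_by_alg_hom_eqI[OF presentation 1 2 3])
qed

lemma pivotal_Ki: "pivotal_element \<Delta> S Ki"
proof -
  have "alg_inv Ki = K" by (rule alg_inv_eqI) (simp_all add: rel)
  then show ?thesis
    unfolding pivotal_element_def grouplike_def
    by (auto simp: S_S comult_Ki alg_homD(2)[OF comult(1)] intro!: unit_elemI[of Ki K] rel)
qed

end

section \<open>The twisted weak Hopf algebra\<close>

text \<open>The twist enters through its explicit form. Of the weak Hopf algebra structure only the coproduct
  is prescribed; counit and antipode will be computed from it.\<close>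

locale twisted_sl2 = sl2_root q ty g \<Delta> \<epsilon> S
  for q :: complex and ty :: "'n::nontriv itself" and g :: "gen \<Rightarrow> 'u::complex_alg"
    and \<Delta> :: "'u \<Rightarrow> ('u, 'u) tensor" and \<epsilon> :: "'u \<Rightarrow> complex" and S :: "'u \<Rightarrow> 'u" +
  fixes \<Lambda> :: complex and J :: "'n mod_ring \<Rightarrow> ('u, 'u) tensor"
    and \<Delta>H :: "('n, 'u) weak_alg \<Rightarrow> (('n, 'u) weak_alg, ('n, 'u) weak_alg) tensor"
    and \<epsilon>H :: "('n, 'u) weak_alg \<Rightarrow> complex" and SH :: "('n, 'u) weak_alg \<Rightarrow> ('n, 'u) weak_alg"
  assumes \<Lambda>: "\<Lambda> ^ CARD('n) \<noteq> 1" "\<Lambda> \<noteq> 0" and J: "J lam = zero_weight (jcoef \<Lambda> lam)"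
    and \<Delta>H: "\<Delta>H = twisted_comult \<Delta> P J" and weak: "weak_hopf_algebra \<Delta>H \<epsilon>H SH"
begin

lemma J_unit: "unit_elem (J lam)"
  unfolding J by (rule zero_weight_unit[of "jcoef \<Lambda> lam", OF jcoef_0])

abbreviation "Ji lam \<equiv> alg_inv (J lam)"

lemmas J_cancel = alg_inv_cancel[OF J_unit]

lemma eps_J: "epsL (J lam) = 1" "epsR (J lam) = 1" "epsL (Ji lam) = 1" "epsR (Ji lam) = 1"
proof -
  show 1: "epsL (J lam) = 1" "epsR (J lam) = 1"
    unfolding J using eps_zero_weight[of "jcoef \<Lambda> lam", OF jcoef_0] by blast+
  show "epsL (Ji lam) = 1"
    using alg_homD(3)[OF epsL(1), of "J lam" "Ji lam"] by (simp add: J_cancel 1 alg_homD(2)[OF epsL(1)])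
  show "epsR (Ji lam) = 1"
    using alg_homD(3)[OF epsR(1), of "J lam" "Ji lam"] by (simp add: J_cancel 1 alg_homD(2)[OF epsR(1)])
qed

text \<open>The component of the twisted coproduct of an entry in row \<open>i\<close> and column \<open>j\<close> whose first tensor leg lies
  in row \<open>i + \<mu>\<close> and column \<open>j + \<nu>\<close>.\<close>

definition twist :: "'n mod_ring \<Rightarrow> 'n mod_ring \<Rightarrow> 'n mod_ring \<Rightarrow> 'n mod_ring \<Rightarrow> 'u \<Rightarrow> ('u, 'u) tensor" where
  "twist i j \<mu> \<nu> u = (1 \<boxtimes> P \<mu>) * Ji i * \<Delta> u * J j * (1 \<boxtimes> P \<nu>)"

lemma comultH_munit: "\<Delta>H (munit i j u) = (\<Sum>\<mu>\<in>UNIV. \<Sum>\<nu>\<in>UNIV. iota (i + \<mu>) (j + \<nu>) i j (twist i j \<mu> \<nu> u))"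
proof -
  have T: "Theta P J = (\<Sum>lam\<in>UNIV. \<Sum>\<nu>\<in>UNIV. iota lam (lam + \<nu>) lam lam (J lam * (1 \<boxtimes> P \<nu>)))"
    "Theta_bar P J = (\<Sum>lam\<in>UNIV. \<Sum>\<mu>\<in>UNIV. iota (lam + \<mu>) lam lam lam ((1 \<boxtimes> P \<mu>) * Ji lam))"
    by (simp_all add: Theta_def Theta_bar_def iota_def)
  have "Theta_bar P J * iota i j i j (\<Delta> u) = (\<Sum>\<mu>\<in>UNIV. iota (i + \<mu>) j i j ((1 \<boxtimes> P \<mu>) * Ji i * \<Delta> u))"
    unfolding T sum_distrib_right by (subst sum_eq_single[of _ i]) (simp_all add: iota_mult)
  moreover have "iota (i + \<mu>) j i j t * Theta P J = (\<Sum>\<nu>\<in>UNIV. iota (i + \<mu>) (j + \<nu>) i j (t * (J j * (1 \<boxtimes> P \<nu>))))" for \<mu> t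
    unfolding T sum_distrib_left by (subst sum_eq_single[of _ j]) (simp_all add: iota_mult)
  ultimately show ?thesis
    unfolding \<Delta>H twisted_comult_def mat_comult_munit[OF alg_homD(1)[OF comult(1)]]
    by (simp add: sum_distrib_right twist_def mult.assoc)
qed

lemma eps_twist: "epsL (twist i j \<mu> \<nu> u) = P \<mu> * u * P \<nu>"
    "epsR (twist i j \<mu> \<nu> u) = (if \<mu> = 0 \<and> \<nu> = 0 then u else 0)"
  unfolding twist_def
  by (simp_all add: alg_homD(3)[OF epsL(1)] alg_homD(3)[OF epsR(1)] eps_J eps_comult epsL(2) epsR(2)
      alg_homD(2)[OF counit(1)] counit_P scaleC_one)

interpretation weak: weak_hopf_algebra \<Delta>H \<epsilon>H SH by (rule weak)

definition mat_counit :: "('n, 'u) weak_alg \<Rightarrow> complex" where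
  "mat_counit = tensor_lift (\<lambda>A u. (\<Sum>i\<in>UNIV. \<Sum>j\<in>UNIV. entry A i j) * \<epsilon> u)"

lemma mat_counit: "clinear mat_counit" "mat_counit (munit i j u) = \<epsilon> u"
proof -
  have "clinear (\<lambda>A :: 'n mod_ring sqmat. \<Sum>i\<in>UNIV. \<Sum>j\<in>UNIV. entry A i j)"
    by (rule clinearI) (simp_all add: plus_sqmat.rep_eq scaleC_sqmat.rep_eq sum.distrib scaleC_complex_def sum_distrib_left)
  then have b: "cbilinear (\<lambda>(A :: 'n mod_ring sqmat) u. (\<Sum>i\<in>UNIV. \<Sum>j\<in>UNIV. entry A i j) * \<epsilon> u)"
    by (rule cbilinear_cmult[OF _ alg_homD(1)[OF counit(1)]])
  show "clinear mat_counit" unfolding mat_counit_def by (rule clinear_tensor_lift[OF b])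
  have "mat_counit (munit i j u) = (\<Sum>a\<in>UNIV. \<Sum>b\<in>UNIV. entry (matrix_unit i j) a b) * \<epsilon> u"
    unfolding mat_counit_def by (rule tensor_lift_tens[OF b])
  also have "(\<Sum>a\<in>UNIV. \<Sum>b\<in>UNIV. entry (matrix_unit i j) a b) = (1 :: complex)"
    unfolding entry_matrix_unit by (subst sum_eq_single[of _ i], simp, simp, simp, subst sum_eq_single[of _ j]) simp_all
  finally show "mat_counit (munit i j u) = \<epsilon> u" by simp
qed

text \<open>The twist is counital, so the counit of the untwisted algebra is still a left counit.\<close>

lemma counit_eq: "\<epsilon>H = mat_counit"
proof
  fix x
  have b: "cbilinear (\<lambda>a b. mat_counit a *\<^sub>C (b :: ('n, 'u) weak_alg))"
    by (rule cbilinear_compose[OF cbilinear_scale mat_counit(1) clinear_id])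
  show "\<epsilon>H x = mat_counit x"
  proof (rule weak.counit_unique[OF mat_counit(1)])
    fix x
    show "tensor_lift (\<lambda>a b. mat_counit a *\<^sub>C b) (\<Delta>H x) = x"
    proof (rule weak_alg_eqI[where h = "\<lambda>x. x"])
      show "clinear (\<lambda>x. tensor_lift (\<lambda>a b. mat_counit a *\<^sub>C b) (\<Delta>H x))"
        by (rule clinear_compose[OF weak.linear(1) clinear_tensor_lift[OF b]])
      fix i j u
      have "tensor_lift (\<lambda>a b. mat_counit a *\<^sub>C b) (iota i' j' i j t) = munit i j (epsL t)" for i' j' t
        unfolding tensor_lift_iota[OF b] mat_counit(2) epsL_def
        by (subst tensor_lift_post[OF clinear_tens(1)[OF clinear_id]]) (simp add: tens_simps)
      then have "tensor_lift (\<lambda>a b. mat_counit a *\<^sub>C b) (\<Delta>H (munit i j u)) =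
          munit i j (\<Sum>\<mu>\<in>UNIV. \<Sum>\<nu>\<in>UNIV. P \<mu> * u * P \<nu>)"
        unfolding comultH_munit by (simp add: clinear_sum[OF clinear_tensor_lift[OF b]] eps_twist tens_sum)
      also have "(\<Sum>\<mu>\<in>UNIV. \<Sum>\<nu>\<in>UNIV. P \<mu> * u * P \<nu>) = (\<Sum>\<mu>\<in>UNIV. P \<mu>) * u * (\<Sum>\<nu>\<in>UNIV. P \<nu>)"
        by (simp add: sum_distrib_left sum_distrib_right) (rule sum.swap)
      finally show "tensor_lift (\<lambda>a b. mat_counit a *\<^sub>C b) (\<Delta>H (munit i j u)) = munit i j u"
        by (simp add: P_sum)
    qed (rule clinear_id)
  qed
qed

text \<open>The minimal idempotents of the target base. Unlike the source base it is changed by the twist.\<close>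

definition target_idem :: "'n mod_ring \<Rightarrow> ('n, 'u) weak_alg" where
  "target_idem a = blocks (\<lambda>i j. if i = j then P (a - i) else 0)"

lemma comultH_idem: "\<Delta>H (munit i i 1) = (\<Sum>\<mu>\<in>UNIV. munit (i + \<mu>) (i + \<mu>) 1 \<boxtimes> munit i i (P \<mu>))"
proof -
  have "twist i i \<mu> \<nu> 1 = (if \<nu> = \<mu> then 1 \<boxtimes> P \<mu> else 0)" for \<mu> \<nu>
    unfolding twist_def by (simp add: mult.assoc alg_homD(2)[OF comult(1)] J_cancel mult.assoc[symmetric, of "Ji i" "J i"] tens_mult_tens P_P)
  then show ?thesis
    unfolding comultH_munit by (intro sum.cong refl, subst sum_eq_single) (auto simp: iota_tens clinear_0[OF clinear_iota])
qed

lemma comultH_1: "\<Delta>H 1 = (\<Sum>i\<in>UNIV. \<Sum>\<mu>\<in>UNIV. munit (i + \<mu>) (i + \<mu>) 1 \<boxtimes> munit i i (P \<mu>))"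
proof -
  have "\<Delta>H 1 = (\<Sum>i\<in>UNIV. \<Delta>H (munit i i 1))"
    unfolding blocks_1[symmetric] blocks_diag by (rule clinear_sum[OF weak.linear(1)])
  then show ?thesis by (simp only: comultH_idem)
qed

lemma counital_target_munit: "counital_target \<Delta>H \<epsilon>H (munit a b u) = \<epsilon> u *\<^sub>C target_idem a"
proof -
  have bil: "cbilinear (\<lambda>x y. mat_counit (x * munit a b u) *\<^sub>C (y :: ('n, 'u) weak_alg))"
    by (rule cbilinear_compose[OF cbilinear_scale clinear_compose[OF clinear_mult_const(2)[OF clinear_id] mat_counit(1)] clinear_id])
  have "counital_target \<Delta>H \<epsilon>H (munit a b u) =
      (\<Sum>i\<in>UNIV. \<Sum>\<mu>\<in>UNIV. mat_counit (munit (i + \<mu>) (i + \<mu>) 1 * munit a b u) *\<^sub>C munit i i (P \<mu>))"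
    unfolding counital_target_def counit_eq comultH_1
    by (simp add: clinear_sum[OF clinear_tensor_lift[OF bil]] tensor_lift_tens[OF bil])
  also have "\<dots> = (\<Sum>i\<in>UNIV. \<epsilon> u *\<^sub>C munit i i (P (a - i)))"
    by (intro sum.cong refl, subst sum_eq_single[of _ "a - _"])
      (auto simp: munit_mult mat_counit(2) clinear_0[OF mat_counit(1)])
  also have "\<dots> = \<epsilon> u *\<^sub>C target_idem a"
    unfolding target_idem_def blocks_diag cvec.scale_sum_right ..
  finally show ?thesis .
qed

lemma counital_source_munit: "counital_source \<Delta>H \<epsilon>H (munit a b u) = \<epsilon> u *\<^sub>C munit b b 1"
proof -
  have bil: "cbilinear (\<lambda>x y. mat_counit (munit a b u * y) *\<^sub>C (x :: ('n, 'u) weak_alg))"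
    by (rule cbilinear_compose[OF cbilinear_scale' clinear_id clinear_compose[OF clinear_mult_const(1)[OF clinear_id] mat_counit(1)]])
  have "counital_source \<Delta>H \<epsilon>H (munit a b u) =
      (\<Sum>i\<in>UNIV. \<Sum>\<mu>\<in>UNIV. mat_counit (munit a b u * munit i i (P \<mu>)) *\<^sub>C munit (i + \<mu>) (i + \<mu>) 1)"
    unfolding counital_source_def counit_eq comultH_1
    by (simp add: clinear_sum[OF clinear_tensor_lift[OF bil]] tensor_lift_tens[OF bil])
  also have "\<dots> = (\<Sum>i\<in>UNIV. \<Sum>\<mu>\<in>UNIV. if i = b then if \<mu> = (0 :: 'n mod_ring) then \<epsilon> u *\<^sub>C munit b b 1 else 0 else 0)"
    by (rule sum.cong[OF refl], rule sum.cong[OF refl])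
      (auto simp: munit_mult mat_counit(2) clinear_0[OF mat_counit(1)] alg_homD(3)[OF counit(1)] counit_P)
  also have "\<dots> = \<epsilon> u *\<^sub>C munit b b 1"
    by (subst sum_eq_single[of _ b]) auto
  finally show ?thesis .
qed

subsection \<open>The antipode\<close>

text \<open>The blocks of the global element \<open>QH\<close>: column \<open>lam\<close> contains the components \<open>Q(lam) P\<^sub>\<mu>\<close> in the rows
  \<open>lam + \<mu>\<close>.\<close>

definition \<kappa> :: "'n mod_ring \<Rightarrow> 'n mod_ring \<Rightarrow> 'u" where
  "\<kappa> lam \<mu> = Qel \<Lambda> lam * P \<mu>"

definition \<kappa>i :: "'n mod_ring \<Rightarrow> 'n mod_ring \<Rightarrow> 'u" where
  "\<kappa>i lam \<mu> = (SOME v. v * \<kappa> lam \<mu> = P \<mu> \<and> \<kappa> lam \<mu> * v = P \<mu> \<and> P \<mu> * v = v \<and> v * P \<mu> = v)"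

lemma \<kappa>i: "\<kappa>i lam \<mu> * \<kappa> lam \<mu> = P \<mu>" "\<kappa> lam \<mu> * \<kappa>i lam \<mu> = P \<mu>" "P \<mu> * \<kappa>i lam \<mu> = \<kappa>i lam \<mu>"
    "\<kappa>i lam \<mu> * P \<mu> = \<kappa>i lam \<mu>"
  using someI_ex[OF Qel_inverse[OF \<Lambda>, of lam \<mu>]] unfolding \<kappa>i_def \<kappa>_def by blast+

lemma \<kappa>: "\<kappa> lam \<mu> * P \<mu> = \<kappa> lam \<mu>" "P \<mu> * \<kappa> lam \<mu> = \<kappa> lam \<mu>"
  by (simp_all add: \<kappa>_def mult.assoc) (simp add: mult.assoc[symmetric] P_Qel, simp add: mult.assoc)

definition QH :: "('n, 'u) weak_alg" where "QH = blocks (\<lambda>a b. \<kappa> b (a - b))"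
definition QHi :: "('n, 'u) weak_alg" where "QHi = blocks (\<lambda>a b. \<kappa>i a (b - a))"

lemma P_diff: "(\<Sum>c\<in>UNIV. P (c - a)) = 1" "(\<Sum>c\<in>UNIV. P (a - c)) = 1"
proof -
  have "bij (\<lambda>c. c - a :: 'n mod_ring)" by (rule bijI') (auto intro: exI[of _ "_ + a"])
  from sum.reindex_bij_betw[OF this, of P] show "(\<Sum>c\<in>UNIV. P (c - a)) = 1" by (simp add: P_sum)
  have "bij (\<lambda>c. a - c :: 'n mod_ring)" by (rule bijI') (auto intro: exI[of _ "a - _"])
  from sum.reindex_bij_betw[OF this, of P] show "(\<Sum>c\<in>UNIV. P (a - c)) = 1" by (simp add: P_sum)
qed

lemma QH_inverse: "QHi * QH = 1" "QH * QHi = 1"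
proof -
  have "\<kappa>i a (c - a) * \<kappa> b (c - b) = (if a = b then P (c - a) else 0)" for a b c
  proof -
    have "\<kappa>i a (c - a) * \<kappa> b (c - b) = \<kappa>i a (c - a) * (P (c - a) * P (c - b)) * \<kappa> b (c - b)"
      by (metis \<kappa>(2) \<kappa>i(4) mult.assoc)
    then show ?thesis by (auto simp: P_P \<kappa>i)
  qed
  then have "(\<lambda>a b. \<Sum>c\<in>UNIV. \<kappa>i a (c - a) * \<kappa> b (c - b)) = (\<lambda>a b. if a = b then 1 else 0)"
    by (intro ext) (auto simp: P_diff)
  then show "QHi * QH = 1" unfolding QHi_def QH_def blocks_mult blocks_1[symmetric] by simp
  have "\<kappa> c (a - c) * \<kappa>i c (b - c) = (if a = b then P (a - c) else 0)" for a b c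
  proof -
    have "\<kappa> c (a - c) * \<kappa>i c (b - c) = \<kappa> c (a - c) * (P (a - c) * P (b - c)) * \<kappa>i c (b - c)"
      by (metis \<kappa>(1) \<kappa>i(3) mult.assoc)
    then show ?thesis by (auto simp: P_P \<kappa>i)
  qed
  then have "(\<lambda>a b. \<Sum>c\<in>UNIV. \<kappa> c (a - c) * \<kappa>i c (b - c)) = (\<lambda>a b. if a = b then 1 else 0)"
    by (intro ext) (auto simp: P_diff)
  then show "QH * QHi = 1" unfolding QHi_def QH_def blocks_mult blocks_1[symmetric] by simp
qed

abbreviation Sm :: "('n, 'u) weak_alg \<Rightarrow> ('n, 'u) weak_alg" where "Sm \<equiv> mat_antipode S"

lemmas Sm = alg_antihomD[OF mat_antipode(1)[OF antipode(1)]]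

lemma Sm_munit: "Sm (munit i j u) = munit j i (S u)"
  by (simp add: mat_antipode(2)[OF antipode(1)] mat_transp_matrix_unit)

lemma QH_target: "QH * target_idem a = munit a a 1 * QH"
proof -
  have "QH * target_idem a = blocks (\<lambda>i j. if i = a then \<kappa> j (a - j) else 0)"
  proof -
    have "(\<Sum>c\<in>UNIV. \<kappa> c (i - c) * (if c = j then P (a - c) else 0)) = (if i = a then \<kappa> j (a - j) else 0)" for i j
      by (subst sum_eq_single[of _ j]) (auto simp: \<kappa>, auto simp: \<kappa>_def mult.assoc P_P)
    then show ?thesis unfolding QH_def target_idem_def blocks_mult by simp
  qed
  also have "\<dots> = munit a a 1 * QH"
    unfolding QH_def munit_mult_blocks unfolding blocks_def by (subst sum_eq_single[of _ a]) auto
  finally show ?thesis .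
qed

lemma QH_column: "(\<Sum>\<nu>\<in>UNIV. munit (j + \<nu>) j (\<kappa> j \<nu>)) = QH * munit j j 1"
proof -
  have "bij (\<lambda>\<nu>. j + \<nu> :: 'n mod_ring)" by (rule bijI') (auto intro: exI[of _ "_ - j"])
  from sum.reindex_bij_betw[OF this, of "\<lambda>a. munit a j (\<kappa> j (a - j))"]
  show ?thesis unfolding QH_def blocks_mult_munit by simp
qed

definition S' :: "('n, 'u) weak_alg \<Rightarrow> ('n, 'u) weak_alg" where "S' x = QHi * Sm x * QH"

lemma clinear_S': "clinear S'"
  unfolding S'_def by (intro clinear_mult_const Sm(1))

lemma S_QH_munit: "Sm (munit i' j' a) * QH * munit i j b = munit j' j (S a * \<kappa> i (i' - i) * b)"
  unfolding Sm_munit QH_def munit_mult_blocks sum_distrib_right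
  by (subst sum_eq_single[of _ i]) (auto simp: munit_mult)

text \<open>In a block the contraction of the twisted coproduct starts with \<open>Q(i)\<close>, which is itself the
  contraction of \<open>J(i)\<close>; this cancels the factor \<open>J(i)\<^sup>-\<^sup>1\<close>. The coproduct of \<open>u\<close> then contracts to \<open>\<epsilon>(u)\<close>, and
  the factor \<open>J(j)\<close> that is left contracts to \<open>Q(j)\<close>.\<close>

lemma S'_source: "convolution \<Delta>H S' (\<lambda>x. x) x = counital_source \<Delta>H \<epsilon>H x"
proof (rule weak_alg_eqI[where f = "convolution \<Delta>H S' (\<lambda>x. x)" and h = "counital_source \<Delta>H \<epsilon>H"])
  show "clinear (convolution \<Delta>H S' (\<lambda>x. x))" by (rule weak.clinear_convolution[OF clinear_S' clinear_id])
  show "clinear (counital_source \<Delta>H \<epsilon>H)"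
  proof -
    have "counital_source \<Delta>H \<epsilon>H = (\<lambda>x. convolution \<Delta>H SH (\<lambda>x. x) x)"
      by (rule ext) (simp add: convolution_def weak.antipode_source)
    then show ?thesis using weak.clinear_convolution[OF weak.linear(3) clinear_id] by simp
  qed
  fix i j u
  have bil: "cbilinear (\<lambda>x y. S' x * y)" by (rule cbilinear_prod[OF clinear_S' clinear_id])
  have io: "tensor_lift (\<lambda>x y. S' x * y) (iota (i + \<mu>) (j + \<nu>) i j t) = QHi * munit (j + \<nu>) j (mSx (\<kappa> i \<mu>) t)" for \<mu> \<nu> t
  proof -
    have "S' (munit (i + \<mu>) (j + \<nu>) a) * munit i j b = QHi * munit (j + \<nu>) j (S a * \<kappa> i \<mu> * b)" for a b
      unfolding S'_def mult.assoc S_QH_munit[unfolded mult.assoc] by simp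
    then show ?thesis
      unfolding tensor_lift_iota[OF bil] mSx_def
      by (subst tensor_lift_post[OF clinear_mult_const(1)[OF clinear_tens(1)[OF clinear_id]]]) simp
  qed
  have tw: "(\<Sum>\<mu>\<in>UNIV. mSx (\<kappa> i \<mu>) (twist i j \<mu> \<nu> u)) = \<epsilon> u *\<^sub>C \<kappa> j \<nu>" for \<nu>
  proof -
    have "mSx (\<kappa> i \<mu>) (twist i j \<mu> \<nu> u) = mSx (\<kappa> i \<mu>) (Ji i * \<Delta> u * J j * (1 \<boxtimes> P \<nu>))" for \<mu>
      unfolding twist_def mult.assoc mSx_mult[of _ "1 \<boxtimes> P \<mu>"] by (simp add: mSx_tens alg_antihomD(2)[OF antipode(1)] \<kappa>)
    then have "(\<Sum>\<mu>\<in>UNIV. mSx (\<kappa> i \<mu>) (twist i j \<mu> \<nu> u)) = (\<Sum>\<mu>\<in>UNIV. mSx (\<kappa> i \<mu>) (Ji i * \<Delta> u * J j * (1 \<boxtimes> P \<nu>)))" by simp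
    also have "\<dots> = mSx (\<Sum>\<mu>\<in>UNIV. \<kappa> i \<mu>) (Ji i * \<Delta> u * J j * (1 \<boxtimes> P \<nu>))"
    proof -
      have lin: "clinear (\<lambda>x. mSx x t)" for t by (rule clinearI) (simp_all add: mSx_add mSx_scale)
      show ?thesis by (rule clinear_sum[OF lin, symmetric])
    qed
    also have "(\<Sum>\<mu>\<in>UNIV. \<kappa> i \<mu>) = mSx 1 (J i)"
      unfolding \<kappa>_def sum_distrib_left[symmetric] P_sum Qel_def J mS_eq by simp
    also have "mSx (mSx 1 (J i)) (Ji i * \<Delta> u * J j * (1 \<boxtimes> P \<nu>)) = mSx 1 (J i * Ji i * (\<Delta> u * J j * (1 \<boxtimes> P \<nu>)))"
      by (simp only: mSx_mult mult.assoc)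
    also have "\<dots> = mSx (mSx 1 (\<Delta> u)) (J j * (1 \<boxtimes> P \<nu>))"
      by (simp only: J_cancel mult_1_left mult.assoc mSx_mult)
    also have "\<dots> = \<epsilon> u *\<^sub>C \<kappa> j \<nu>"
      unfolding mSx_comult mSx_scale mSx_right \<kappa>_def Qel_def mS_eq J scaleC_mult_left ..
    finally show ?thesis .
  qed
  have "convolution \<Delta>H S' (\<lambda>x. x) (munit i j u) =
      (\<Sum>\<mu>\<in>UNIV. \<Sum>\<nu>\<in>UNIV. QHi * munit (j + \<nu>) j (mSx (\<kappa> i \<mu>) (twist i j \<mu> \<nu> u)))"
    unfolding convolution_def comultH_munit by (simp add: clinear_sum[OF clinear_tensor_lift[OF bil]] io)
  also have "\<dots> = (\<Sum>\<nu>\<in>UNIV. QHi * munit (j + \<nu>) j (\<Sum>\<mu>\<in>UNIV. mSx (\<kappa> i \<mu>) (twist i j \<mu> \<nu> u)))"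
    by (subst sum.swap) (simp add: sum_distrib_left tens_sum)
  also have "\<dots> = \<epsilon> u *\<^sub>C (QHi * (\<Sum>\<nu>\<in>UNIV. munit (j + \<nu>) j (\<kappa> j \<nu>)))"
    unfolding tw by (simp add: tens_simps scaleC_mult_right sum_distrib_left cvec.scale_sum_right)
  also have "(\<Sum>\<nu>\<in>UNIV. munit (j + \<nu>) j (\<kappa> j \<nu>)) = QH * munit j j 1" by (rule QH_column)
  finally show "convolution \<Delta>H S' (\<lambda>x. x) (munit i j u) = counital_source \<Delta>H \<epsilon>H (munit i j u)"
    by (simp add: counital_source_munit mult.assoc[symmetric] QH_inverse)
qed

lemma clinear_target: "clinear (counital_target \<Delta>H \<epsilon>H)"
proof -
  have "counital_target \<Delta>H \<epsilon>H = (\<lambda>x. convolution \<Delta>H (\<lambda>x. x) SH x)"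
    by (rule ext) (simp add: convolution_def weak.antipode_target)
  then show ?thesis using weak.clinear_convolution[OF clinear_id weak.linear(3)] by simp
qed

lemma S'_target: "convolution \<Delta>H S' (counital_target \<Delta>H \<epsilon>H) x = S' x"
proof (rule weak_alg_eqI[OF weak.clinear_convolution[OF clinear_S' clinear_target] clinear_S'])
  fix i j u
  have bil: "cbilinear (\<lambda>x y. S' x * counital_target \<Delta>H \<epsilon>H y)" by (rule cbilinear_prod[OF clinear_S' clinear_target])
  have io: "tensor_lift (\<lambda>x y. S' x * counital_target \<Delta>H \<epsilon>H y) (iota i' j' i j t) = S' (munit i' j' (epsR t)) * target_idem i" for i' j' t
  proof -
    have "S' (munit i' j' a) * counital_target \<Delta>H \<epsilon>H (munit i j b) = S' (munit i' j' (\<epsilon> b *\<^sub>C a)) * target_idem i" for a b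
      unfolding counital_target_munit by (simp add: tens_simps clinear_scaleC[OF clinear_S'] scaleC_mult_left scaleC_mult_right)
    then show ?thesis
      unfolding tensor_lift_iota[OF bil] epsR_def
      by (subst tensor_lift_post[where g = "\<lambda>u. S' (munit i' j' u) * target_idem i"])
        (auto intro!: clinear_mult_const clinear_compose[OF clinear_tens(1) clinear_S'] clinear_id)
  qed
  have "convolution \<Delta>H S' (counital_target \<Delta>H \<epsilon>H) (munit i j u) =
      (\<Sum>\<mu>\<in>UNIV. \<Sum>\<nu>\<in>UNIV. S' (munit (i + \<mu>) (j + \<nu>) (epsR (twist i j \<mu> \<nu> u))) * target_idem i)"
    unfolding convolution_def comultH_munit by (simp add: clinear_sum[OF clinear_tensor_lift[OF bil]] io)
  also have "\<dots> = (\<Sum>\<mu>\<in>UNIV. \<Sum>\<nu>\<in>UNIV. if \<mu> = (0 :: 'n mod_ring) then if \<nu> = (0 :: 'n mod_ring) then S' (munit i j u) * target_idem i else 0 else 0)"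
    by (rule sum.cong[OF refl], rule sum.cong[OF refl]) (auto simp: eps_twist clinear_0[OF clinear_S'])
  also have "\<dots> = S' (munit i j u) * target_idem i"
    by (subst sum_eq_single[of _ 0]) auto
  also have "\<dots> = S' (munit i j u)"
    unfolding S'_def mult.assoc QH_target Sm_munit
    by (simp add: mult.assoc[symmetric]) (simp add: mult.assoc[of QHi] munit_mult)
  finally show "convolution \<Delta>H S' (counital_target \<Delta>H \<epsilon>H) (munit i j u) = S' (munit i j u)" .
qed

text \<open>The antipode of the untwisted algebra, conjugated by \<open>QH\<close>, has the properties of a left convolution
  inverse, and the antipode is unique.\<close>

lemma SH_eq: "SH x = QHi * Sm x * QH"
  using weak.antipode_unique[OF clinear_S' S'_source S'_target] by (simp add: S'_def)

end

context twisted_sl2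
begin

interpretation weak: weak_hopf_algebra \<Delta>H \<epsilon>H SH by (rule weak)

subsection \<open>The target base and the pivotal element\<close>

lemma base_elem_sum: "base_elem f = (\<Sum>i\<in>UNIV. f i *\<^sub>C munit i i (1 :: 'u))"
  by (simp add: base_elem_def)

lemma base_elem_mult: "base_elem f * base_elem h = (base_elem (\<lambda>i. f i * h i) :: ('n, 'u) weak_alg)"
proof -
  have "(f a *\<^sub>C munit a a (1 :: 'u)) * (h b *\<^sub>C munit b b 1) = (if b = a then (f a * h a) *\<^sub>C munit a a 1 else 0)" for a b
    by (simp add: scaleC_mult_left scaleC_mult_right scaleC_scaleC munit_mult mult.commute)
  then show ?thesis
    unfolding base_elem_sum sum_distrib_left sum_distrib_right
    by (subst sum.swap) (simp add: sum.delta)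
qed

lemma base_elem_1: "base_elem (\<lambda>i. 1) = (1 :: ('n, 'u) weak_alg)"
  unfolding base_elem_blocks scaleC_one blocks_1 ..

lemma Sm_base_elem: "Sm (base_elem f) = base_elem f"
  unfolding base_elem_sum by (simp add: clinear_sum[OF Sm(1)] clinear_scaleC[OF Sm(1)] Sm_munit alg_antihomD(2)[OF antipode(1)])

definition target_elem :: "('n mod_ring \<Rightarrow> complex) \<Rightarrow> ('n, 'u) weak_alg" where
  "target_elem f = (\<Sum>a\<in>UNIV. f a *\<^sub>C target_idem a)"

text \<open>The target base is the conjugate of the source base by \<open>QH\<close>; this makes its algebra obvious.\<close>

lemma target_elem_eq: "target_elem f = QHi * base_elem f * QH"
proof -
  have "target_idem a = QHi * munit a a 1 * QH" for a
    unfolding mult.assoc QH_target[symmetric] by (simp add: mult.assoc[symmetric] QH_inverse)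
  then show ?thesis
    unfolding target_elem_def base_elem_sum
    by (simp add: sum_distrib_left sum_distrib_right scaleC_mult_left scaleC_mult_right)
qed

lemma SH_base_elem: "SH (base_elem f) = target_elem f"
  by (simp add: SH_eq target_elem_eq Sm_base_elem)

lemma target_elem_mult: "target_elem f * target_elem h = target_elem (\<lambda>i. f i * h i)"
proof -
  have "target_elem f * target_elem h = QHi * base_elem f * (QH * QHi) * base_elem h * QH"
    unfolding target_elem_eq mult.assoc ..
  then show ?thesis by (simp add: QH_inverse target_elem_eq base_elem_mult[symmetric] mult.assoc)
qed

lemma target_elem_1: "target_elem (\<lambda>i. 1) = 1"
  by (simp add: target_elem_eq base_elem_1 QH_inverse)

lemma target_idem_mult: "target_idem a * target_elem f = f a *\<^sub>C target_idem a" "target_elem f * target_idem a = f a *\<^sub>C target_idem a"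
proof -
  have t: "target_idem a = target_elem (\<lambda>i. if i = a then 1 else 0)"
    unfolding target_elem_def by (subst sum_eq_single[of _ a]) (auto simp: scaleC_one)
  have s: "f a *\<^sub>C target_idem a = target_elem (\<lambda>i. if i = a then f a else 0)"
    unfolding target_elem_def by (subst sum_eq_single[of _ a]) auto
  show "target_idem a * target_elem f = f a *\<^sub>C target_idem a"
    unfolding s by (simp add: t target_elem_mult) (rule arg_cong[where f = target_elem], auto)
  show "target_elem f * target_idem a = f a *\<^sub>C target_idem a"
    unfolding s by (simp add: t target_elem_mult) (rule arg_cong[where f = target_elem], auto)
qed

lemma target_base_commute: "target_elem f * base_elem h = base_elem h * target_elem f"
proof -
  have "target_idem a * munit i i 1 = munit i i 1 * target_idem a" for a i
    unfolding target_idem_def blocks_mult_munit munit_mult_blocks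
    by (subst (1 2) sum_eq_single[of _ i]) auto
  then show ?thesis
    unfolding target_elem_def base_elem_sum
    by (simp add: sum_distrib_left sum_distrib_right scaleC_mult_left scaleC_mult_right scaleC_scaleC mult.commute
        cvec.scale_sum_right) (rule sum.swap)
qed

text \<open>On the left the target base element \<open>f\<close> acts on row \<open>i\<close> and left weight \<open>\<gamma>\<close> by \<open>f(i + \<gamma>)\<close>, because the
  idempotent with index \<open>c\<close> projects to \<open>i + \<gamma> = c\<close>.\<close>

lemma target_elem_munit:
  "target_elem f * munit i j (P \<gamma> * u) = f (i + \<gamma>) *\<^sub>C munit i j (P \<gamma> * u)"
  "munit i j (u * P \<delta>) * target_elem f = f (j + \<delta>) *\<^sub>C munit i j (u * P \<delta>)"
proof -
  have "target_idem c * munit i j (P \<gamma> * u) = (if c = i + \<gamma> then munit i j (P \<gamma> * u) else 0)" for c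
    unfolding target_idem_def blocks_mult_munit
    by (subst sum_eq_single[of _ i]) (auto simp: mult.assoc[symmetric] P_P)
  then show "target_elem f * munit i j (P \<gamma> * u) = f (i + \<gamma>) *\<^sub>C munit i j (P \<gamma> * u)"
    unfolding target_elem_def sum_distrib_right scaleC_mult_left
    by (subst sum_eq_single[of _ "i + \<gamma>"]) auto
  have "munit i j (u * P \<delta>) * target_idem c = (if c = j + \<delta> then munit i j (u * P \<delta>) else 0)" for c
    unfolding target_idem_def munit_mult_blocks
    by (subst sum_eq_single[of _ j]) (auto simp: mult.assoc P_P)
  then show "munit i j (u * P \<delta>) * target_elem f = f (j + \<delta>) *\<^sub>C munit i j (u * P \<delta>)"
    unfolding target_elem_def sum_distrib_left scaleC_mult_right
    by (subst sum_eq_single[of _ "j + \<delta>"]) auto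
qed

definition y :: "'n mod_ring \<Rightarrow> complex" where
  "y i = \<Lambda> * \<chi> i - inverse (\<chi> i)"

abbreviation yi :: "'n mod_ring \<Rightarrow> complex" where
  "yi \<equiv> \<lambda>i. inverse (y i)"

text \<open>A zero would make \<open>\<Lambda> = q\<^sup>-\<^sup>2\<^sup>i\<close> an \<open>\<ell>\<close>-th root of unity.\<close>

lemma y_nonzero: "y i \<noteq> 0"
proof
  assume "y i = 0"
  then have "\<Lambda> = \<chi> (- (i + i))"
    by (simp only: y_def chi_neg chi_add) (simp add: field_simps)
  then show False using not_root_of_unity[OF \<Lambda>(1)] by blast
qed

lemma y_inverse:
  "base_elem y * base_elem yi = (1 :: ('n, 'u) weak_alg)" "base_elem yi * base_elem y = (1 :: ('n, 'u) weak_alg)"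
  "target_elem y * target_elem yi = 1" "target_elem yi * target_elem y = 1"
  by (simp_all add: base_elem_mult target_elem_mult y_nonzero base_elem_1 target_elem_1)

lemma inverse_target_y: "alg_inv (SH (base_elem y)) = target_elem yi"
  unfolding SH_base_elem by (rule alg_inv_eqI) (simp_all add: y_inverse)

lemma units_y: "unit_elem (base_elem y :: ('n, 'u) weak_alg)" "unit_elem (SH (base_elem y))"
  using y_inverse unfolding SH_base_elem by (auto intro: unit_elemI)

text \<open>This is \<open>y S(y)\<^sup>-\<^sup>1\<close>, since the antipode exchanges the two bases.\<close>

definition hH :: "('n, 'u) weak_alg" where
  "hH = base_elem y * target_elem yi"

lemma hH_eq: "hH = base_elem y * alg_inv (SH (base_elem y))"
  by (simp add: hH_def inverse_target_y)

lemma trivial_grouplike_hH: "trivial_grouplike SH hH"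
  unfolding trivial_grouplike_def source_base_def hH_eq using units_y by blast

lemma hH_inverse: "alg_inv hH = base_elem yi * target_elem y" "unit_elem hH"
proof -
  have 1: "hH * (base_elem yi * target_elem y) = 1"
  proof -
    have "hH * (base_elem yi * target_elem y) = base_elem y * (target_elem yi * base_elem yi) * target_elem y"
      by (simp add: hH_def mult.assoc)
    also have "\<dots> = (base_elem y * base_elem yi) * (target_elem yi * target_elem y)"
      unfolding target_base_commute by (simp only: mult.assoc)
    finally show ?thesis by (simp add: y_inverse)
  qed
  have 2: "(base_elem yi * target_elem y) * hH = 1"
  proof -
    have "(base_elem yi * target_elem y) * hH = base_elem yi * (target_elem y * base_elem y) * target_elem yi"
      by (simp add: hH_def mult.assoc)
    also have "\<dots> = (base_elem yi * base_elem y) * (target_elem y * target_elem yi)"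
      unfolding target_base_commute by (simp only: mult.assoc)
    finally show ?thesis by (simp add: y_inverse)
  qed
  show "alg_inv hH = base_elem yi * target_elem y" by (rule alg_inv_eqI[OF 1 2])
  show "unit_elem hH" by (rule unit_elemI[OF 1 2])
qed

subsection \<open>The square of the antipode\<close>

text \<open>Conjugating by \<open>QH\<close> turns the target part of \<open>hH\<close> into a source element, so the left side has the
  blocks of \<open>QH\<close> rescaled by \<open>y\<^sub>b / y\<^sub>a\<close>. By the symmetry of \<open>Q\<close> under \<open>S\<close> the right side has the same blocks.\<close>

lemma QH_hH: "QH * hH = Sm QH * (1 \<boxtimes> Ki)"
proof -
  have "QH * hH = base_elem yi * QH * base_elem y"
  proof -
    have "QH * hH = QH * (target_elem yi * base_elem y)" unfolding target_base_commute hH_def ..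
    also have "\<dots> = (QH * QHi) * base_elem yi * QH * base_elem y" unfolding target_elem_eq by (simp only: mult.assoc)
    finally show ?thesis by (simp add: QH_inverse)
  qed
  also have "\<dots> = blocks (\<lambda>a b. (y b / y a) *\<^sub>C \<kappa> b (a - b))"
  proof -
    have 1: "blocks (\<lambda>a b. if a = b then f a *\<^sub>C 1 else 0) * blocks h = blocks (\<lambda>a b. f a *\<^sub>C h a b)"
      for f :: "'n mod_ring \<Rightarrow> complex" and h :: "'n mod_ring \<Rightarrow> 'n mod_ring \<Rightarrow> 'u"
    proof -
      have "(\<Sum>c\<in>UNIV. (if a = c then f a *\<^sub>C 1 else 0) * h c b) = f a *\<^sub>C h a b" for a b
        by (subst sum_eq_single[of _ a]) (auto simp: scaleC_mult_left)
      then show ?thesis unfolding blocks_mult by simp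
    qed
    have 2: "blocks h * blocks (\<lambda>a b. if a = b then f a *\<^sub>C 1 else 0) = blocks (\<lambda>a b. f b *\<^sub>C h a b)"
      for f :: "'n mod_ring \<Rightarrow> complex" and h :: "'n mod_ring \<Rightarrow> 'n mod_ring \<Rightarrow> 'u"
    proof -
      have "(\<Sum>c\<in>UNIV. h a c * (if c = b then f c *\<^sub>C 1 else 0)) = f b *\<^sub>C h a b" for a b
        by (subst sum_eq_single[of _ b]) (auto simp: scaleC_mult_right)
      then show ?thesis unfolding blocks_mult by simp
    qed
    show ?thesis unfolding base_elem_blocks QH_def 1 2 by (simp add: scaleC_scaleC divide_inverse mult.commute)
  qed
  also have "\<dots> = Sm QH * (1 \<boxtimes> Ki)"
  proof -
    have "S (\<kappa> a (b - a)) * Ki = (y b / y a) *\<^sub>C \<kappa> b (a - b)" for a b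
    proof -
      have "S (\<kappa> a (b - a)) = (\<chi> (a - b) * y b / y a) *\<^sub>C \<kappa> b (a - b)"
        using S_Qel[OF \<Lambda>(1), of b "a - b"] by (simp add: \<kappa>_def y_def)
      moreover have "\<kappa> b (a - b) * Ki = inverse (\<chi> (a - b)) *\<^sub>C \<kappa> b (a - b)"
        by (simp add: \<kappa>_def mult.assoc P_Ki scaleC_mult_right)
      ultimately show ?thesis by (simp add: scaleC_mult_left scaleC_scaleC)
    qed
    then have "(\<Sum>c\<in>UNIV. S (\<kappa> a (c - a)) * (if c = b then Ki else 0)) = (y b / y a) *\<^sub>C \<kappa> b (a - b)" for a b
      by (subst sum_eq_single[of _ b]) auto
    then show ?thesis
      unfolding QH_def mat_antipode(3)[OF antipode(1)] tens_blocks blocks_mult by simp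
  qed
  finally show ?thesis .
qed

lemma Sm_Sm: "Sm (Sm x) = (1 \<boxtimes> Ki) * x * (1 \<boxtimes> K)"
  by (rule weak_alg_eqI[where f = "\<lambda>x. Sm (Sm x)"])
    (simp_all add: clinear_compose[OF Sm(1) Sm(1)] clinear_mult_const clinear_id Sm_munit S_S tens_mult_tens)

text \<open>The square of the antipode is conjugation by \<open>Q\<^sup>-\<^sup>1 S(Q)\<close> after \<open>S\<^sup>2\<close>, which is conjugation by \<open>K\<^sup>-\<^sup>1\<close>; together they are
  conjugation by \<open>hH\<close>.\<close>

lemma SH_SH: "SH (SH x) = hH * x * alg_inv hH"
proof -
  have inv: "Sm QH * Sm QHi = 1" "Sm QHi * Sm QH = 1"
    by (simp_all add: Sm(2) Sm(3)[symmetric] QH_inverse)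
  have k: "(1 \<boxtimes> Ki) * (1 \<boxtimes> K) = (1 :: ('n, 'u) weak_alg)" "(1 \<boxtimes> K) * (1 \<boxtimes> Ki) = (1 :: ('n, 'u) weak_alg)"
    by (simp_all add: tens_mult_tens rel one_tensor_def)
  have h: "hH = QHi * Sm QH * (1 \<boxtimes> Ki)"
  proof -
    have "hH = QHi * (QH * hH)" by (simp add: mult.assoc[symmetric] QH_inverse)
    then show ?thesis by (simp add: QH_hH mult.assoc)
  qed
  have "alg_inv hH = (1 \<boxtimes> K) * Sm QHi * QH"
  proof (rule alg_inv_eqI)
    have "hH * ((1 \<boxtimes> K) * Sm QHi * QH) = QHi * (Sm QH * (((1 \<boxtimes> Ki) * (1 \<boxtimes> K)) * Sm QHi)) * QH"
      unfolding h by (simp only: mult.assoc)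
    then show "hH * ((1 \<boxtimes> K) * Sm QHi * QH) = 1" by (simp add: k inv QH_inverse)
    have "(1 \<boxtimes> K) * Sm QHi * QH * hH = (1 \<boxtimes> K) * (Sm QHi * ((QH * QHi) * Sm QH)) * (1 \<boxtimes> Ki)"
      unfolding h by (simp only: mult.assoc)
    then show "(1 \<boxtimes> K) * Sm QHi * QH * hH = 1" by (simp add: k inv QH_inverse)
  qed
  then have "hH * x * alg_inv hH = QHi * (Sm QH * ((1 \<boxtimes> Ki) * x * (1 \<boxtimes> K)) * Sm QHi) * QH"
    by (simp only: h mult.assoc)
  also have "\<dots> = SH (SH x)"
    unfolding Sm_Sm[symmetric] SH_eq by (simp add: Sm(3) mult.assoc)
  finally show ?thesis ..
qed

subsection \<open>Grouplikeness\<close>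

lemma comultH_1_target: "\<Delta>H 1 = (\<Sum>a\<in>UNIV. munit a a 1 \<boxtimes> target_idem a)"
proof -
  have "(\<Sum>\<mu>\<in>UNIV. munit (i + \<mu>) (i + \<mu>) (1 :: 'u) \<boxtimes> munit i i (P \<mu>)) = (\<Sum>a\<in>UNIV. munit a a 1 \<boxtimes> munit i i (P (a - i)))" for i
  proof -
    have "bij (\<lambda>\<nu>. i + \<nu> :: 'n mod_ring)" by (rule bijI') (auto intro: exI[of _ "_ - i"])
    from sum.reindex_bij_betw[OF this, of "\<lambda>a. munit a a (1 :: 'u) \<boxtimes> munit i i (P (a - i))"] show ?thesis by simp
  qed
  then show ?thesis
    unfolding comultH_1 target_idem_def blocks_diag tens_sum by simp (rule sum.swap)
qed

lemma comultH_base: "\<Delta>H (base_elem f) = (1 \<boxtimes> base_elem f) * \<Delta>H 1" "\<Delta>H (base_elem f) = \<Delta>H 1 * (1 \<boxtimes> base_elem f)"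
proof -
  have 1: "\<Delta>H (munit i i 1) = (1 \<boxtimes> munit i i 1) * \<Delta>H 1" for i
    unfolding comultH_idem comultH_1 sum_distrib_left
    by (subst sum_eq_single[of _ i]) (auto simp: tens_mult_tens[of 1] munit_mult)
  have 2: "\<Delta>H (munit i i 1) = \<Delta>H 1 * (1 \<boxtimes> munit i i 1)" for i
    unfolding comultH_idem comultH_1 sum_distrib_right
    by (subst sum_eq_single[of _ i]) (auto simp: tens_mult_tens[of _ _ 1] munit_mult)
  note lin = clinear_sum[OF weak.linear(1)] clinear_scaleC[OF weak.linear(1)]
  show "\<Delta>H (base_elem f) = (1 \<boxtimes> base_elem f) * \<Delta>H 1"
    unfolding base_elem_sum lin 1 tens_sum tens_simps sum_distrib_right scaleC_mult_left ..
  show "\<Delta>H (base_elem f) = \<Delta>H 1 * (1 \<boxtimes> base_elem f)"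
    unfolding base_elem_sum lin 2 tens_sum tens_simps sum_distrib_left scaleC_mult_right ..
qed

text \<open>Obtained by slicing the compatibility of the coproduct with the unit along the idempotents of the source base.\<close>

lemma comultH_target: "\<Delta>H (target_elem f) = (target_elem f \<boxtimes> 1) * \<Delta>H 1" "\<Delta>H (target_elem f) = \<Delta>H 1 * (target_elem f \<boxtimes> 1)"
proof -
  define sl :: "'n mod_ring \<Rightarrow> (('n, 'u) weak_alg, (('n, 'u) weak_alg, ('n, 'u) weak_alg) tensor) tensor \<Rightarrow> _"
    where "sl a = tensor_lift (\<lambda>x t. mat_counit (x * munit a a 1) *\<^sub>C t)" for a
  have bil: "cbilinear (\<lambda>x (t :: (('n, 'u) weak_alg, ('n, 'u) weak_alg) tensor). mat_counit (x * munit a a 1) *\<^sub>C t)" for a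
    by (rule cbilinear_compose[OF cbilinear_scale clinear_compose[OF clinear_mult_const(2)[OF clinear_id] mat_counit(1)] clinear_id])
  have sl: "sl a (\<Sum>b\<in>UNIV. munit b b 1 \<boxtimes> t b) = t a" for a t
  proof -
    have "sl a (\<Sum>b\<in>UNIV. munit b b 1 \<boxtimes> t b) = (\<Sum>b\<in>UNIV. mat_counit (munit b b 1 * munit a a 1) *\<^sub>C t b)"
      unfolding sl_def clinear_sum[OF clinear_tensor_lift[OF bil]] tensor_lift_tens[OF bil] ..
    also have "\<dots> = t a"
      by (subst sum_eq_single[of _ a])
        (auto simp: munit_mult mat_counit(2) clinear_0[OF mat_counit(1)] alg_homD(2)[OF counit(1)] scaleC_one)
    finally show ?thesis .
  qed
  have L: "tensor_map id \<Delta>H (\<Delta>H 1) = (\<Sum>a\<in>UNIV. munit a a 1 \<boxtimes> \<Delta>H (target_idem a))"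
  proof -
    have "clinear (id :: ('n, 'u) weak_alg \<Rightarrow> _)" using clinear_id by (simp add: id_def)
    then show ?thesis
      unfolding comultH_1_target
      by (simp add: clinear_sum[OF clinear_tensor_map[OF _ weak.linear(1)]] tensor_map_tens[OF _ weak.linear(1)])
  qed
  have bil2: "cbilinear (\<lambda>(a :: ('n, 'u) weak_alg) (b :: ('n, 'u) weak_alg). a \<boxtimes> (b \<boxtimes> (c :: ('n, 'u) weak_alg)))" for c
    by (rule cbilinear_compose[OF cbilinear_tens clinear_id clinear_tens(2)[OF clinear_id]])
  have bil1: "cbilinear (\<lambda>(t :: (('n, 'u) weak_alg, ('n, 'u) weak_alg) tensor) (c :: ('n, 'u) weak_alg). tensor_lift (\<lambda>a b. a \<boxtimes> (b \<boxtimes> c)) t)"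
    by (rule cbilinearI)
      (simp_all add: clinear_add[OF clinear_tensor_lift[OF bil2]] clinear_scaleC[OF clinear_tensor_lift[OF bil2]]
        tens_simps tensor_lift_fun_add tensor_lift_fun_scaleC)
  have A: "tensor_assoc (\<Delta>H 1 \<boxtimes> (1 :: ('n, 'u) weak_alg)) = (\<Sum>a\<in>UNIV. munit a a 1 \<boxtimes> (target_idem a \<boxtimes> 1))"
    unfolding tensor_assoc_def tensor_lift_tens[OF bil1] comultH_1_target
    by (simp add: clinear_sum[OF clinear_tensor_lift[OF bil2]] tensor_lift_tens[OF bil2])
  have 1: "\<Delta>H (target_idem a) = (target_idem a \<boxtimes> 1) * \<Delta>H 1" for a
  proof -
    have "(\<Sum>a\<in>UNIV. munit a a (1 :: 'u) \<boxtimes> \<Delta>H (target_idem a)) = (\<Sum>a\<in>UNIV. munit a a (1 :: 'u) \<boxtimes> ((target_idem a \<boxtimes> 1) * \<Delta>H 1))"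
      unfolding L[symmetric] weak.comult_one(1) A sum_distrib_right tens_mult_tens[of _ _ 1] mult_1_right ..
    from arg_cong[OF this, of "sl a"] show ?thesis unfolding sl .
  qed
  have 2: "\<Delta>H (target_idem a) = \<Delta>H 1 * (target_idem a \<boxtimes> 1)" for a
  proof -
    have "(\<Sum>a\<in>UNIV. munit a a (1 :: 'u) \<boxtimes> \<Delta>H (target_idem a)) = (\<Sum>a\<in>UNIV. munit a a (1 :: 'u) \<boxtimes> (\<Delta>H 1 * (target_idem a \<boxtimes> 1)))"
      unfolding L[symmetric] weak.comult_one(2) A sum_distrib_left tens_mult_tens[of 1] mult_1_left ..
    from arg_cong[OF this, of "sl a"] show ?thesis unfolding sl .
  qed
  note lin = clinear_sum[OF weak.linear(1)] clinear_scaleC[OF weak.linear(1)]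
  show "\<Delta>H (target_elem f) = (target_elem f \<boxtimes> 1) * \<Delta>H 1"
    unfolding target_elem_def lin 1 tens_sum tens_simps sum_distrib_right scaleC_mult_left ..
  show "\<Delta>H (target_elem f) = \<Delta>H 1 * (target_elem f \<boxtimes> 1)"
    unfolding target_elem_def lin 2 tens_sum tens_simps sum_distrib_left scaleC_mult_right ..
qed

lemma comultH_1_balanced:
  "\<Delta>H 1 * (base_elem f \<boxtimes> 1) = \<Delta>H 1 * (1 \<boxtimes> target_elem f)" "(base_elem f \<boxtimes> 1) * \<Delta>H 1 = (1 \<boxtimes> target_elem f) * \<Delta>H 1"
proof -
  have b: "munit a a 1 * base_elem f = f a *\<^sub>C munit a a (1 :: 'u)" "base_elem f * munit a a 1 = f a *\<^sub>C munit a a (1 :: 'u)" for a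
    unfolding base_elem_sum sum_distrib_left sum_distrib_right
    by ((subst sum_eq_single[of _ a]), auto simp: munit_mult scaleC_mult_right scaleC_mult_left)+
  show "\<Delta>H 1 * (base_elem f \<boxtimes> 1) = \<Delta>H 1 * (1 \<boxtimes> target_elem f)"
    unfolding comultH_1_target sum_distrib_right tens_mult_tens[of "munit _ _ _"] b target_idem_mult tens_simps mult_1_right ..
  show "(base_elem f \<boxtimes> 1) * \<Delta>H 1 = (1 \<boxtimes> target_elem f) * \<Delta>H 1"
    unfolding comultH_1_target sum_distrib_left tens_mult_tens[of _ _ "munit _ _ _"] b target_idem_mult tens_simps mult_1_left ..
qed

text \<open>The coproduct multiplies the second leg by a source element and the first by a target element, and
  \<open>\<Delta>(1)\<close> is balanced over the two bases. In \<open>(hH \<otimes> hH) \<Delta>(1)\<close> the inner pair \<open>y \<otimes> S(y)\<^sup>-\<^sup>1\<close> therefore cancels.\<close>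

lemma grouplike_hH: "grouplike \<Delta>H hH"
proof -
  let ?Y = "base_elem y :: ('n, 'u) weak_alg" and ?T = "target_elem yi"
  have 11: "\<Delta>H 1 * \<Delta>H 1 = \<Delta>H 1" using weak.comult_mult[of 1 1] by simp
  have h: "hH = ?T * ?Y" unfolding hH_def target_base_commute ..
  have h2: "hH \<boxtimes> hH = (?T * ?Y) \<boxtimes> (?Y * ?T)" by (simp only: h target_base_commute)
  have D: "\<Delta>H hH = (?T \<boxtimes> ?Y) * \<Delta>H 1" "\<Delta>H hH = \<Delta>H 1 * (?T \<boxtimes> ?Y)"
  proof -
    have "\<Delta>H hH = (?T \<boxtimes> 1) * \<Delta>H 1 * ((1 \<boxtimes> ?Y) * \<Delta>H 1)"
      unfolding h weak.comult_mult comultH_target(1) comultH_base(1) ..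
    also have "\<dots> = (?T \<boxtimes> 1) * (\<Delta>H 1 * (1 \<boxtimes> ?Y)) * \<Delta>H 1" by (simp only: mult.assoc)
    also have "\<dots> = ((?T \<boxtimes> 1) * (1 \<boxtimes> ?Y)) * (\<Delta>H 1 * \<Delta>H 1)"
      unfolding comultH_base(2)[symmetric] comultH_base(1) by (simp only: mult.assoc)
    finally show "\<Delta>H hH = (?T \<boxtimes> ?Y) * \<Delta>H 1" by (simp add: 11 tens_mult_tens)
    have "\<Delta>H hH = \<Delta>H 1 * (?T \<boxtimes> 1) * (\<Delta>H 1 * (1 \<boxtimes> ?Y))"
      unfolding h weak.comult_mult comultH_target(2) comultH_base(2) ..
    also have "\<dots> = \<Delta>H 1 * ((?T \<boxtimes> 1) * \<Delta>H 1) * (1 \<boxtimes> ?Y)" by (simp only: mult.assoc)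
    also have "\<dots> = (\<Delta>H 1 * \<Delta>H 1) * ((?T \<boxtimes> 1) * (1 \<boxtimes> ?Y))"
      unfolding comultH_target(1)[symmetric] comultH_target(2) by (simp only: mult.assoc)
    finally show "\<Delta>H hH = \<Delta>H 1 * (?T \<boxtimes> ?Y)" by (simp add: 11 tens_mult_tens)
  qed
  have "(hH \<boxtimes> hH) * \<Delta>H 1 = (?T \<boxtimes> ?Y) * ((1 \<boxtimes> ?T) * ((?Y \<boxtimes> 1) * \<Delta>H 1))"
    unfolding mult.assoc[symmetric] tens_mult_tens h2 by simp
  also have "\<dots> = (?T \<boxtimes> ?Y) * (((1 \<boxtimes> ?T) * (1 \<boxtimes> target_elem y)) * \<Delta>H 1)"
    unfolding comultH_1_balanced by (simp only: mult.assoc)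
  also have "\<dots> = \<Delta>H hH" unfolding D(1) tens_mult_tens y_inverse by (simp add: one_tensor_def[symmetric])
  finally have 1: "\<Delta>H hH = (hH \<boxtimes> hH) * \<Delta>H 1" ..
  have "\<Delta>H 1 * (hH \<boxtimes> hH) = ((\<Delta>H 1 * (?Y \<boxtimes> 1)) * (1 \<boxtimes> ?T)) * (?T \<boxtimes> ?Y)"
    unfolding mult.assoc tens_mult_tens h2 by (simp add: target_base_commute)
  also have "\<dots> = (\<Delta>H 1 * ((1 \<boxtimes> target_elem y) * (1 \<boxtimes> ?T))) * (?T \<boxtimes> ?Y)"
    unfolding comultH_1_balanced by (simp only: mult.assoc)
  also have "\<dots> = \<Delta>H hH" unfolding D(2) tens_mult_tens y_inverse by (simp add: one_tensor_def[symmetric])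
  finally have 2: "\<Delta>H hH = \<Delta>H 1 * (hH \<boxtimes> hH)" ..
  show ?thesis unfolding grouplike_def using hH_inverse(2) 1 2 by blast
qed

lemma pivotal_hH: "pivotal_element \<Delta>H SH hH"
  unfolding pivotal_element_def using grouplike_hH SH_SH by blast

end

section \<open>Transport of the pivotal structure\<close>

lemma clinear_entry: "clinear (\<lambda>A :: 'd::finite sqmat. entry A i j)"
  by (rule clinearI) (simp_all add: entry_simps scaleC_complex_def)

lemma clinear_mat_apply: "clinear (\<lambda>A :: 'd::finite sqmat. mat_apply A v i)"
  by (rule clinearI)
    (simp_all add: mat_apply_def entry_simps distrib_right sum.distrib scaleC_complex_def sum_distrib_left mult.assoc)

lemma mat_apply_kron:
  fixes A :: "'d::finite sqmat" and B :: "'e::finite sqmat"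
  shows "mat_apply (kron A B) (\<lambda>(j, k). f j * v k) (i, m) = mat_apply A f i * mat_apply B v m"
proof -
  have "mat_apply (kron A B) (\<lambda>(j, k). f j * v k) (i, m) =
      (\<Sum>(j, k)\<in>UNIV \<times> UNIV. (entry A i j * f j) * (entry B m k * v k))"
    unfolding mat_apply_def by (rule sum.cong) (auto simp: entry_kron)
  also have "\<dots> = mat_apply A f i * mat_apply B v m"
    unfolding mat_apply_def sum_product sum.cartesian_product ..
  finally show ?thesis .
qed

lemma mat_apply_matrix_unit: "mat_apply (matrix_unit a b) f i = (if i = a then f (b :: 'd::finite) else 0)"
  unfolding mat_apply_def entry_matrix_unit by (subst sum_eq_single[of _ b]) auto

lemma mat_apply_kron_matrix_unit:
  "i \<noteq> a \<Longrightarrow> mat_apply (kron (matrix_unit (a :: 'd::finite) b) B) v (i, d :: 'e::finite) = 0"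
  unfolding mat_apply_def by (rule sum.neutral) (auto simp: entry_kron entry_matrix_unit)

lemma mat_transp_kron: "mat_transp (kron A B) = kron (mat_transp A) (mat_transp B)"
  by (rule sqmat_eqI) (auto simp: mat_transp_def entry_kron)

lemma entry_mult_idem_mult:
  fixes A B :: "('d::finite \<times> 'e::finite) sqmat"
  shows "entry (A * kron (matrix_unit a a) 1 * B) p r = (\<Sum>d\<in>UNIV. entry A p (a, d) * entry B (a, d) r)"
proof -
  have "entry (A * kron (matrix_unit a a) 1) p (i, d) = (if i = a then entry A p (a, d) else 0)" for i d
  proof -
    have "entry (A * kron (matrix_unit a a) 1) p (i, d) =
        (\<Sum>k\<in>UNIV. entry A p k * entry (kron (matrix_unit a a) 1) k (i, d))"
      by (simp add: entry_simps)
    also have "\<dots> = entry A p (a, d) * entry (kron (matrix_unit a a) 1) (a, d) (i, d)"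
      by (rule sum_eq_single) (auto simp: entry_kron entry_matrix_unit entry_simps split: if_splits)
    finally show ?thesis by (simp add: entry_kron entry_matrix_unit entry_simps)
  qed
  then have "entry (A * kron (matrix_unit a a) 1 * B) p r =
      (\<Sum>(i, d)\<in>UNIV \<times> UNIV. (if i = a then entry A p (a, d) else 0) * entry B (i, d) r)"
    by (subst times_sqmat.rep_eq) (auto intro!: sum.cong)
  also have "\<dots> = (\<Sum>i\<in>UNIV. \<Sum>d\<in>UNIV. (if i = a then entry A p (a, d) else 0) * entry B (i, d) r)"
    by (rule sum.cartesian_product[symmetric])
  also have "\<dots> = (\<Sum>d\<in>UNIV. entry A p (a, d) * entry B (a, d) r)"
    by (subst sum_eq_single[of _ a]) auto
  finally show ?thesis .
qed

lemma alg_hom_base_functor: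
  fixes \<rho> :: "'u::complex_alg \<Rightarrow> 'd::finite sqmat"
  assumes "alg_hom \<rho>"
  shows "alg_hom (base_functor \<rho> :: ('n::nontriv, 'u) weak_alg \<Rightarrow> _)"
    "base_functor \<rho> ((A :: 'n mod_ring sqmat) \<boxtimes> u) = kron A (\<rho> u)"
  unfolding base_functor_def using alg_hom_kron[OF alg_hom_id(1) assms] by (simp_all add: tensor_lift_tens[OF alg_hom_kron(1)[OF alg_hom_id(1) assms]])

lemma alg_hom_dual_rep:
  assumes "alg_antihom S" "alg_hom \<rho>"
  shows "alg_hom (dual_rep S \<rho> :: 'u::complex_alg \<Rightarrow> 'd::finite sqmat)"
  unfolding alg_hom_def dual_rep_def
  using clinear_compose[OF clinear_compose[OF alg_antihomD(1)[OF assms(1)] alg_homD(1)[OF assms(2)]] clinear_mat_transp]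
  by (auto simp: alg_antihomD(2,3)[OF assms(1)] alg_homD(2,3)[OF assms(2)] mat_transp_1 mat_transp_mult)

context twisted_sl2
begin

interpretation weak: weak_hopf_algebra \<Delta>H \<epsilon>H SH by (rule weak)

lemma Theta_eq: "Theta P J = (\<Sum>lam\<in>UNIV. \<Sum>\<nu>\<in>UNIV. iota lam (lam + \<nu>) lam lam (J lam * (1 \<boxtimes> P \<nu>)))"
  by (simp add: Theta_def iota_def)

lemma counital_target_eq:
  "counital_target \<Delta>H \<epsilon>H x = target_elem (\<lambda>a. mat_counit (munit a a 1 * x))"
proof (rule weak_alg_eqI[where f = "counital_target \<Delta>H \<epsilon>H" and h = "\<lambda>x. target_elem (\<lambda>a. mat_counit (munit a a 1 * x))"])
  show "clinear (counital_target \<Delta>H \<epsilon>H)" by (rule clinear_target)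
  show "clinear (\<lambda>x. target_elem (\<lambda>a. mat_counit (munit a a 1 * x)))"
    unfolding target_elem_def
    by (intro clinear_sum_fun clinear_vec clinear_compose[OF clinear_mult_const(1)[OF clinear_id] mat_counit(1)])
  fix i j u
  show "counital_target \<Delta>H \<epsilon>H (munit i j u) = target_elem (\<lambda>a. mat_counit (munit a a 1 * munit i j u))"
    unfolding counital_target_munit target_elem_def
    by (subst sum_eq_single[of _ i]) (auto simp: munit_mult mat_counit(2) clinear_0[OF mat_counit(1)])
qed

lemma mat_counit_base: "mat_counit (munit a a 1 * base_elem f) = f a"
proof -
  have "munit a a 1 * base_elem f = f a *\<^sub>C munit a a (1 :: 'u)"
    unfolding base_elem_sum sum_distrib_left
    by (subst sum_eq_single[of _ a]) (auto simp: munit_mult scaleC_mult_right)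
  then show ?thesis
    by (simp add: clinear_scaleC[OF mat_counit(1)] mat_counit(2) alg_homD(2)[OF counit(1)] scaleC_complex_def)
qed

text \<open>Identifies the unit object of the category of modules with the functions on \<open>\<int>/\<ell>\<close>.\<close>

lemma range_counital_target: "range (counital_target \<Delta>H \<epsilon>H) = range target_elem"
proof -
  have "target_elem f = counital_target \<Delta>H \<epsilon>H (base_elem f)" for f
    by (simp add: counital_target_eq mat_counit_base)
  then show ?thesis by (auto simp: counital_target_eq)
qed

text \<open>The diagonal of the matrix factor together with the counit of the other factor; on the target base
  it recovers the coefficient function.\<close>

definition \<eta> :: "('n, 'u) weak_alg \<Rightarrow> 'n mod_ring \<Rightarrow> complex" where
  "\<eta> z i = tensor_lift (\<lambda>A u. entry A i i * \<epsilon> u) z"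

lemma \<eta>: "clinear (\<lambda>z. \<eta> z i)" "\<eta> (munit a b u) i = (if a = i then if b = i then \<epsilon> u else 0 else 0)"
proof -
  have b: "cbilinear (\<lambda>(A :: 'n mod_ring sqmat) u. entry A i i * \<epsilon> u)"
    by (rule cbilinear_cmult[OF clinear_entry alg_homD(1)[OF counit(1)]])
  show "clinear (\<lambda>z. \<eta> z i)" unfolding \<eta>_def by (rule clinear_tensor_lift[OF b])
  show "\<eta> (munit a b u) i = (if a = i then if b = i then \<epsilon> u else 0 else 0)"
    unfolding \<eta>_def tensor_lift_tens[OF b] by (simp add: entry_matrix_unit)
qed

lemma \<eta>_target_idem: "\<eta> (target_idem a) i = (if a = i then 1 else 0)"
  unfolding target_idem_def blocks_diag clinear_sum[OF \<eta>(1)]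
  by (subst sum_eq_single[of _ i]) (auto simp: \<eta>(2) counit_P)

lemma \<eta>_target: "\<eta> (target_elem f) = f"
proof
  fix i
  show "\<eta> (target_elem f) i = f i"
    unfolding target_elem_def clinear_sum[OF \<eta>(1)] clinear_scaleC[OF \<eta>(1)] \<eta>_target_idem
    by (subst sum_eq_single[of _ i]) (auto simp: scaleC_complex_def)
qed

lemma unit_rep_munit: "clinear (unit_rep \<epsilon> :: ('n, 'u) weak_alg \<Rightarrow> _)"
    "alg_hom (unit_rep \<epsilon> :: ('n, 'u) weak_alg \<Rightarrow> _)"
    "unit_rep \<epsilon> (munit i (j :: 'n mod_ring) u) = \<epsilon> u *\<^sub>C matrix_unit i j"
proof -
  have b: "cbilinear (\<lambda>(A :: 'n mod_ring sqmat) u. \<epsilon> u *\<^sub>C A)"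
    by (rule cbilinear_compose[OF cbilinear_scale' clinear_id alg_homD(1)[OF counit(1)]])
  show "clinear (unit_rep \<epsilon> :: ('n, 'u) weak_alg \<Rightarrow> _)" unfolding unit_rep_def by (rule clinear_tensor_lift[OF b])
  show "unit_rep \<epsilon> (munit i (j :: 'n mod_ring) u) = \<epsilon> u *\<^sub>C matrix_unit i j"
    unfolding unit_rep_def by (rule tensor_lift_tens[OF b])
  show "alg_hom (unit_rep \<epsilon> :: ('n, 'u) weak_alg \<Rightarrow> _)"
    unfolding unit_rep_def
    by (rule alg_hom_tensor_lift[OF b])
      (simp_all add: alg_homD(2,3)[OF counit(1)] scaleC_one scaleC_mult_left scaleC_mult_right scaleC_scaleC mult.commute)
qed

lemma unit_constraint_\<eta>:
  fixes \<rho> :: "'u \<Rightarrow> 'd::finite sqmat"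
  assumes \<rho>: "alg_hom \<rho>"
  shows "unit_constraint \<epsilon> (Theta P J) \<Delta>H \<epsilon>H \<rho> \<eta>"
proof -
  note F = alg_hom_base_functor[OF \<rho>]
  have bij: "bij_betw \<eta> (range target_elem) UNIV"
    by (rule bij_betw_byWitness[where f' = target_elem]) (auto simp: \<eta>_target)
  have modu: "\<eta> (counital_target \<Delta>H \<epsilon>H (h * target_elem f)) = mat_apply (unit_rep \<epsilon> h) f" for h f
  proof
    fix a
    have "mat_counit (munit a a 1 * (h * target_elem f)) = mat_apply (unit_rep \<epsilon> h) f a"
    proof (rule weak_alg_eqI[where f = "\<lambda>h. mat_counit (munit a a 1 * (h * target_elem f))" and h = "\<lambda>h. mat_apply (unit_rep \<epsilon> h) f a"])
      show "clinear (\<lambda>h. mat_counit (munit a a 1 * (h * target_elem f)))"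
        by (rule clinear_compose[OF clinear_mult_const(1)[OF clinear_mult_const(2)[OF clinear_id]] mat_counit(1)])
      show "clinear (\<lambda>h. mat_apply (unit_rep \<epsilon> h) f a)"
        by (rule clinear_compose[OF unit_rep_munit(1) clinear_mat_apply])
      fix i j :: "'n mod_ring" and u :: 'u
      have "mat_counit (munit i j u * target_idem c) = (if c = j then \<epsilon> u else 0)" for c
        unfolding target_idem_def munit_mult_blocks clinear_sum[OF mat_counit(1)]
        by (subst sum_eq_single[of _ j])
          (auto simp: mat_counit(2) clinear_0[OF mat_counit(1)] alg_homD(3)[OF counit(1)] counit_P)
      then have m: "mat_counit (munit i j u * target_elem f) = \<epsilon> u * f j"
        unfolding target_elem_def sum_distrib_left scaleC_mult_right clinear_sum[OF mat_counit(1)] clinear_scaleC[OF mat_counit(1)]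
        by (subst sum_eq_single[of _ j]) (auto simp: scaleC_complex_def)
      have "munit a a 1 * munit i j u * target_elem f = (if a = i then munit i j u * target_elem f else 0)"
        by (simp add: munit_mult)
      then show "mat_counit (munit a a 1 * (munit i j u * target_elem f)) = mat_apply (unit_rep \<epsilon> (munit i j u)) f a"
        unfolding unit_rep_munit(3) clinear_scaleC[OF clinear_mat_apply] mat_apply_matrix_unit mult.assoc[symmetric]
        by (simp add: m clinear_0[OF mat_counit(1)] scaleC_complex_def)
    qed
    then show "\<eta> (counital_target \<Delta>H \<epsilon>H (h * target_elem f)) a = mat_apply (unit_rep \<epsilon> h) f a"
      by (simp add: counital_target_eq \<eta>_target)
  qed
  have coh: "act2 (unit_rep \<epsilon>) (base_functor \<rho>) (Theta P J) (\<lambda>(j, k). f j * v k) (i, (i, d)) =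
      mat_apply (base_functor \<rho> (target_elem f)) v (i, d)" for f v i d
  proof -
    define w where "w c = mat_apply (kron (matrix_unit i i) (\<rho> (P (c - i)))) v (i, d)" for c
    have b: "cbilinear (\<lambda>(a :: ('n, 'u) weak_alg) b. kron (unit_rep \<epsilon> a) (base_functor \<rho> (b :: ('n, 'u) weak_alg)))"
      by (rule alg_hom_kron(1)[OF unit_rep_munit(2) F(1)])
    have io: "tensor_lift (\<lambda>a b. kron (unit_rep \<epsilon> a) (base_functor \<rho> b)) (iota i j k m t) =
        kron (matrix_unit i j) (kron (matrix_unit k m) (\<rho> (epsL t)))" for i j k m :: "'n mod_ring" and t
    proof -
      have lin: "clinear (\<lambda>u. kron (matrix_unit i j) (kron (matrix_unit k m) (\<rho> u)))"
        by (rule clinear_compose[OF alg_homD(1)[OF \<rho>]])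
          (rule clinear_compose[where g = "kron (matrix_unit i j)"];
            use cbilinear_kron in \<open>unfold cbilinear_def, blast\<close>)
      have "kron (unit_rep \<epsilon> (munit i j a)) (base_functor \<rho> (munit k m b)) =
          kron (matrix_unit i j) (kron (matrix_unit k m) (\<rho> (\<epsilon> a *\<^sub>C b)))" for a b
        by (simp add: unit_rep_munit(3) F(2) clinear_scaleC[OF alg_homD(1)[OF \<rho>]] cbilinearD[OF cbilinear_kron])
      then show ?thesis
        unfolding tensor_lift_iota[OF b] epsL_def tensor_lift_post[OF lin] by simp
    qed
    have eJ: "epsL (J lam * (1 \<boxtimes> P \<nu>)) = P \<nu>" for lam \<nu>
      by (simp add: alg_homD(3)[OF epsL(1)] eps_J epsL(2) alg_homD(2)[OF counit(1)] scaleC_one)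
    have "act2 (unit_rep \<epsilon>) (base_functor \<rho>) (Theta P J) (\<lambda>(j, k). f j * v k) (i, (i, d)) =
        (\<Sum>lam\<in>UNIV. \<Sum>\<nu>\<in>UNIV. (if i = lam then f (lam + \<nu>) else 0) *
           mat_apply (kron (matrix_unit lam lam) (\<rho> (P \<nu>))) v (i, d))"
      unfolding act2_def Theta_eq
      by (simp only: clinear_sum[OF clinear_tensor_lift[OF b]] io eJ clinear_sum[OF clinear_mat_apply]
          mat_apply_kron mat_apply_matrix_unit)
    also have "\<dots> = (\<Sum>\<nu>\<in>UNIV. f (i + \<nu>) * w (i + \<nu>))"
      by (subst sum_eq_single[of _ i]) (auto simp: w_def)
    also have "\<dots> = (\<Sum>c\<in>UNIV. f c * w c)"
    proof -
      have "bij (\<lambda>\<nu>. i + \<nu> :: 'n mod_ring)" by (rule bijI') (auto intro: exI[of _ "_ - i"])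
      from sum.reindex_bij_betw[OF this, of "\<lambda>c. f c * w c"] show ?thesis .
    qed
    also have "\<dots> = mat_apply (base_functor \<rho> (target_elem f)) v (i, d)"
    proof -
      have "mat_apply (base_functor \<rho> (target_idem c)) v (i, d) = w c" for c
        unfolding target_idem_def blocks_diag clinear_sum[OF alg_homD(1)[OF F(1)]] clinear_sum[OF clinear_mat_apply] F(2) w_def
        by (rule sum_eq_single) (auto intro: mat_apply_kron_matrix_unit)
      then show ?thesis
        unfolding target_elem_def clinear_sum[OF alg_homD(1)[OF F(1)]] clinear_scaleC[OF alg_homD(1)[OF F(1)]]
          clinear_sum[OF clinear_mat_apply] clinear_scaleC[OF clinear_mat_apply]
        by (simp add: scaleC_complex_def)
    qed
    finally show ?thesis .
  qed
  show ?thesis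
    unfolding unit_constraint_def Let_def range_counital_target
    using bij \<eta>(1) modu coh by (auto simp: \<eta>_target)
qed

text \<open>The matrix factor contributes a transpose, which is exactly the transpose in the untwisted antipode.\<close>

lemma base_functor_dual:
  fixes \<rho> :: "'u \<Rightarrow> 'd::finite sqmat"
  assumes \<rho>: "alg_hom \<rho>"
  shows "base_functor (dual_rep S \<rho>) h = mat_transp (base_functor \<rho> (Sm h))"
proof (rule weak_alg_eqI[where f = "base_functor (dual_rep S \<rho>)" and h = "\<lambda>h. mat_transp (base_functor \<rho> (Sm h))"])
  note F = alg_hom_base_functor[OF \<rho>] and F' = alg_hom_base_functor[OF alg_hom_dual_rep[OF antipode(1) \<rho>]]
  show "clinear (base_functor (dual_rep S \<rho>) :: ('n, 'u) weak_alg \<Rightarrow> _)" by (rule alg_homD(1)[OF F'(1)])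
  show "clinear (\<lambda>h :: ('n, 'u) weak_alg. mat_transp (base_functor \<rho> (Sm h)))"
    by (rule clinear_compose[OF clinear_compose[OF Sm(1) alg_homD(1)[OF F(1)]] clinear_mat_transp])
  show "base_functor (dual_rep S \<rho>) (munit i j u) = mat_transp (base_functor \<rho> (Sm (munit i j u)))" for i j :: "'n mod_ring" and u
    by (simp add: F(2) F'(2) Sm_munit mat_transp_kron mat_transp_matrix_unit dual_rep_def)
qed

text \<open>The global version of \<open>Q = \<Sum> S(J\<^sub>1) J\<^sub>2\<close>, one column at a time.\<close>

lemma twist_contraction:
  "tensor_lift (\<lambda>s t. Sm s * munit a a 1 * t) (Theta P J) = QH * munit a a 1"
proof -
  have b: "cbilinear (\<lambda>s t. Sm s * munit a a 1 * t)"
    by (rule cbilinear_prod[OF clinear_mult_const(2)[OF Sm(1)] clinear_id])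
  have io: "tensor_lift (\<lambda>s t. Sm s * munit a a 1 * t) (iota i j k k t) =
      (if i = a then if k = a then munit j a (mS t) else 0 else 0)" for i j k :: "'n mod_ring" and t
  proof -
    have "Sm (munit i j s) * munit a a 1 * munit k k t = (if i = a then if k = a then munit j a (S s * t) else 0 else 0)" for s t
      by (simp add: Sm_munit munit_mult)
    moreover have "tensor_lift (\<lambda>s t. munit j a (S s * t)) t = munit j a (mS t)"
      unfolding mS_def by (rule tensor_lift_post[OF clinear_tens(1)[OF clinear_id], symmetric])
    moreover have "tensor_lift (\<lambda>(s :: 'u) (t :: 'u). 0 :: ('n, 'u) weak_alg) t = 0"
      using tensor_lift_fun_scaleC[of 0 "\<lambda>(s :: 'u) (t :: 'u). 0 :: ('n, 'u) weak_alg" t] by simp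
    ultimately show ?thesis unfolding tensor_lift_iota[OF b] by auto
  qed
  have mSJ: "mS (J lam * (1 \<boxtimes> P \<nu>)) = \<kappa> lam \<nu>" for lam \<nu>
    unfolding mS_eq mSx_right \<kappa>_def Qel_def J ..
  have "tensor_lift (\<lambda>s t. Sm s * munit a a 1 * t) (Theta P J) = (\<Sum>\<nu>\<in>UNIV. munit (a + \<nu>) a (\<kappa> a \<nu>))"
    unfolding Theta_eq clinear_sum[OF clinear_tensor_lift[OF b]] io mSJ
    by (subst sum_eq_single[of _ a]) auto
  then show ?thesis unfolding QH_column .
qed

text \<open>The dual of \<open>A \<otimes> V\<close> and the image of the dual of \<open>V\<close> differ by the passage from the untwisted
  antipode to the twisted one, hence by \<open>QH\<close>. Both evaluations pair the coefficients of \<open>x\<close> with the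
  matrix entries of \<open>QH\<close> followed by a diagonal matrix unit.\<close>

lemma duality_iso_QH:
  fixes \<rho> :: "'u \<Rightarrow> 'd::finite sqmat"
  assumes \<rho>: "alg_hom \<rho>"
  shows "duality_iso S (Theta P J) \<Delta>H SH \<eta> \<rho> (mat_transp (base_functor \<rho> QH))"
proof -
  note F = alg_hom_base_functor[OF \<rho>]
  note Fl = alg_homD(1)[OF F(1)] and Fm = alg_homD(3)[OF F(1)] and F1 = alg_homD(2)[OF F(1)]
  note F' = alg_hom_base_functor[OF alg_hom_dual_rep[OF antipode(1) \<rho>]]
  let ?F = "base_functor \<rho> :: ('n, 'u) weak_alg \<Rightarrow> _"
  let ?F' = "base_functor (dual_rep S \<rho>) :: ('n, 'u) weak_alg \<Rightarrow> _"
  let ?\<xi> = "mat_transp (?F QH)"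
  have unit: "unit_elem ?\<xi>"
    by (rule unit_elemI[of _ "mat_transp (?F QHi)"])
      (simp_all add: mat_transp_mult[symmetric] Fm[symmetric] QH_inverse F1 mat_transp_1)
  have inter: "?\<xi> * ?F' h = dual_rep SH ?F h * ?\<xi>" for h
  proof -
    have "Sm h * QH = QH * SH h"
      unfolding SH_eq by (simp add: mult.assoc[symmetric] QH_inverse)
    then show ?thesis
      unfolding base_functor_dual[OF \<rho>] dual_rep_def mat_transp_mult[symmetric] Fm[symmetric] by simp
  qed
  have L: "\<eta> (weak_ev \<Delta>H ?F (mat_apply (kron ?\<xi> 1) x)) a =
      (\<Sum>p\<in>UNIV. \<Sum>r\<in>UNIV. x (p, r) * entry (?F (QH * munit a a 1)) p r)" for x a
  proof -
    let ?x = "mat_apply (kron ?\<xi> 1) x"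
    have x: "?x (p, r) = (\<Sum>p'\<in>UNIV. entry (?F QH) p' p * x (p', r))" for p r
    proof -
      have "?x (p, r) = (\<Sum>(p', r')\<in>UNIV \<times> UNIV. entry (?F QH) p' p * (if r = r' then 1 else 0) * x (p', r'))"
        unfolding mat_apply_def by (rule sum.cong) (auto simp: entry_kron mat_transp_def entry_simps)
      also have "\<dots> = (\<Sum>p'\<in>UNIV. \<Sum>r'\<in>UNIV. entry (?F QH) p' p * (if r = r' then 1 else 0) * x (p', r'))"
        by (rule sum.cartesian_product[symmetric])
      also have "\<dots> = (\<Sum>p'\<in>UNIV. entry (?F QH) p' p * x (p', r))"
        by (intro sum.cong refl, subst sum_eq_single[of _ r]) auto
      finally show ?thesis .
    qed
    define \<phi> where "\<phi> s = (\<Sum>i\<in>UNIV. \<Sum>j\<in>UNIV. ?x (i, j) * entry (?F s) i j)" for s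
    have "clinear \<phi>"
      unfolding \<phi>_def
      by (intro clinear_sum_fun clinear_mult_const(1) clinear_compose[OF Fl clinear_entry])
    then have b: "cbilinear (\<lambda>s (t :: ('n, 'u) weak_alg). \<phi> s *\<^sub>C t)"
      by (rule cbilinear_compose[OF cbilinear_scale _ clinear_id])
    have "weak_ev \<Delta>H ?F ?x = target_elem (\<lambda>a. \<phi> (munit a a 1))"
      unfolding weak_ev_def \<phi>_def[symmetric] comultH_1_target clinear_sum[OF clinear_tensor_lift[OF b]] tensor_lift_tens[OF b]
        target_elem_def ..
    then have "\<eta> (weak_ev \<Delta>H ?F ?x) a = \<phi> (munit a a 1)" by (simp add: \<eta>_target)
    also have "\<dots> = (\<Sum>i\<in>UNIV. \<Sum>j\<in>UNIV. \<Sum>p\<in>UNIV. x (p, j) * (entry (?F QH) p i * entry (?F (munit a a 1)) i j))"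
      unfolding \<phi>_def x by (simp add: sum_distrib_right sum_distrib_left mult_ac)
    also have "\<dots> = (\<Sum>i\<in>UNIV. \<Sum>p\<in>UNIV. \<Sum>j\<in>UNIV. x (p, j) * (entry (?F QH) p i * entry (?F (munit a a 1)) i j))"
      by (rule sum.cong[OF refl], rule sum.swap)
    also have "\<dots> = (\<Sum>p\<in>UNIV. \<Sum>i\<in>UNIV. \<Sum>j\<in>UNIV. x (p, j) * (entry (?F QH) p i * entry (?F (munit a a 1)) i j))"
      by (rule sum.swap)
    also have "\<dots> = (\<Sum>p\<in>UNIV. \<Sum>j\<in>UNIV. \<Sum>i\<in>UNIV. x (p, j) * (entry (?F QH) p i * entry (?F (munit a a 1)) i j))"
      by (rule sum.cong[OF refl], rule sum.swap)
    also have "\<dots> = (\<Sum>p\<in>UNIV. \<Sum>r\<in>UNIV. x (p, r) * entry (?F (QH * munit a a 1)) p r)"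
      unfolding Fm times_sqmat.rep_eq sum_distrib_left ..
    finally show ?thesis .
  qed
  have R: "(\<Sum>d\<in>UNIV. functor_tensor (Theta P J) (dual_rep S \<rho>) \<rho> x (a, (d, d))) =
      (\<Sum>p\<in>UNIV. \<Sum>r\<in>UNIV. x (p, r) * entry (?F (QH * munit a a 1)) p r)" for x a
  proof -
    define M where "M = tensor_lift (\<lambda>s t. kron (?F' s) (?F t)) (Theta P J)"
    have b: "cbilinear (\<lambda>s t. kron (?F' s) (?F t))" by (rule alg_hom_kron(1)[OF F'(1) F(1)])
    have M: "(\<Sum>d\<in>UNIV. entry M ((a, d), (a, d)) (p, r)) = entry (?F (QH * munit a a 1)) p r" for p r
    proof -
      have lin1: "clinear (\<lambda>A. \<Sum>d\<in>UNIV. entry A ((a, d), (a, d)) (p, r))"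
        by (intro clinear_sum_fun clinear_entry)
      have lin2: "clinear (\<lambda>h. entry (?F h) p r)" by (rule clinear_compose[OF Fl clinear_entry])
      have "(\<Sum>d\<in>UNIV. entry M ((a, d), (a, d)) (p, r)) =
          tensor_lift (\<lambda>s t. \<Sum>d\<in>UNIV. entry (kron (?F' s) (?F t)) ((a, d), (a, d)) (p, r)) (Theta P J)"
        unfolding M_def by (rule tensor_lift_post[OF lin1])
      also have "(\<lambda>s t. \<Sum>d\<in>UNIV. entry (kron (?F' s) (?F t)) ((a, d), (a, d)) (p, r)) =
          (\<lambda>s t. entry (?F (Sm s * munit a a 1 * t)) p r)"
      proof (intro ext)
        fix s t
        have "entry (?F (Sm s * munit a a 1 * t)) p r = (\<Sum>d\<in>UNIV. entry (?F (Sm s)) p (a, d) * entry (?F t) (a, d) r)"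
          unfolding Fm F(2) alg_homD(2)[OF \<rho>] by (rule entry_mult_idem_mult)
        then show "(\<Sum>d\<in>UNIV. entry (kron (?F' s) (?F t)) ((a, d), (a, d)) (p, r)) = entry (?F (Sm s * munit a a 1 * t)) p r"
          by (simp add: entry_kron base_functor_dual[OF \<rho>] mat_transp_def)
      qed
      also have "tensor_lift (\<lambda>s t. entry (?F (Sm s * munit a a 1 * t)) p r) (Theta P J) = entry (?F (QH * munit a a 1)) p r"
        unfolding tensor_lift_post[OF lin2, symmetric] twist_contraction ..
      finally show ?thesis .
    qed
    have "(\<Sum>d\<in>UNIV. functor_tensor (Theta P J) (dual_rep S \<rho>) \<rho> x (a, (d, d))) =
        (\<Sum>d\<in>UNIV. \<Sum>k\<in>UNIV. entry M ((a, d), (a, d)) k * x k)"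
      by (simp add: functor_tensor_def act2_def mat_apply_def M_def)
    also have "\<dots> = (\<Sum>k\<in>UNIV. \<Sum>d\<in>UNIV. entry M ((a, d), (a, d)) k * x k)" by (rule sum.swap)
    also have "\<dots> = (\<Sum>(p, r)\<in>UNIV \<times> UNIV. x (p, r) * entry (?F (QH * munit a a 1)) p r)"
      proof (rule sum.cong)
      fix k :: "('n mod_ring \<times> 'd) \<times> ('n mod_ring \<times> 'd)"
      obtain p r where k: "k = (p, r)" by (cases k)
      show "(\<Sum>d\<in>UNIV. entry M ((a, d), (a, d)) k * x k) = (case k of (p, r) \<Rightarrow> x (p, r) * entry (?F (QH * munit a a 1)) p r)"
        unfolding k sum_distrib_right[symmetric] M by simp
    qed simp
    also have "\<dots> = (\<Sum>p\<in>UNIV. \<Sum>r\<in>UNIV. x (p, r) * entry (?F (QH * munit a a 1)) p r)"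
      by (rule sum.cartesian_product[symmetric])
    finally show ?thesis .
  qed
  show ?thesis
    unfolding duality_iso_def using unit inter by (auto simp: L R)
qed

text \<open>After transposition the required identity is the image of \<open>QH * hH = S(QH) (1 \<otimes> K\<^sup>-\<^sup>1)\<close>.\<close>

lemma transports_hH:
  fixes \<rho> :: "'u \<Rightarrow> 'd::finite sqmat"
  assumes \<rho>: "alg_hom \<rho>"
  shows "transports_pivotal \<epsilon> S (Theta P J) \<Delta>H \<epsilon>H SH \<rho> Ki hH"
proof -
  note F = alg_hom_base_functor[OF \<rho>]
  have "base_functor \<rho> QH * base_functor \<rho> hH = base_functor \<rho> (Sm QH) * kron 1 (\<rho> Ki)"
    using arg_cong[OF QH_hH, of "base_functor \<rho>"] by (simp add: alg_homD(3)[OF F(1)] F(2))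
  then show ?thesis
    unfolding transports_pivotal_def
    using unit_constraint_\<eta>[OF \<rho>] duality_iso_QH[OF \<rho>] duality_iso_QH[OF alg_hom_dual_rep[OF antipode(1) \<rho>]]
    by (intro exI[of _ \<eta>] exI[of _ "mat_transp (base_functor \<rho> QH)"]
        exI[of _ "mat_transp (base_functor (dual_rep S \<rho>) QH)"])
      (simp add: mat_transp_mat_transp base_functor_dual[OF \<rho>])
qed

end

section \<open>The characteristic polynomial\<close>

text \<open>In any ordered basis the matrix of \<open>f\<close> is the diagonal matrix of eigenvalues conjugated by the change
  of basis.\<close>

lemma has_char_poly_diagonal:
  fixes b :: "'i \<Rightarrow> 'a::complex_vec"
  assumes D: "dual_basis I b c" and f: "clinear f" and d: "\<And>i. i \<in> I \<Longrightarrow> f (b i) = d i *\<^sub>C b i"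
  shows "has_char_poly f (\<Prod>i\<in>I. [:- d i, 1:])"
proof -
  note fin = dual_basisD(1)[OF D] and lin = dual_basisD(2)[OF D] and dual = dual_basisD(3)[OF D] and ex = dual_basisD(4)[OF D]
  obtain xs where xs: "set xs = I" "distinct xs" using finite_distinct_list[OF fin] by blast
  define n where "n = length xs"
  have isI: "xs ! k \<in> I" if "k < n" for k using that xs(1) n_def nth_mem by metis
  have bij: "bij_betw ((!) xs) {0..<n} I"
    using bij_betw_nth[OF xs(2), of "{..<length xs}" I] xs(1) by (simp add: n_def atLeast0LessThan)
  have inj: "inj_on b I"
  proof (rule inj_onI)
    fix i j assume "i \<in> I" "j \<in> I" "b i = b j"
    then show "i = j" using dual[of i i] dual[of i j] by (auto split: if_splits)
  qed
  have ind: "cvec.independent (b ` I)"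
  proof (rule cvec.independent_if_scalars_zero)
    show "finite (b ` I)" using fin by simp
    fix u v assume u: "(\<Sum>x\<in>b ` I. u x *\<^sub>C x) = 0" and "v \<in> b ` I"
    then obtain i where i: "i \<in> I" "v = b i" by blast
    have "(\<Sum>j\<in>I. u (b j) *\<^sub>C b j) = 0" using u by (simp add: sum.reindex[OF inj])
    then show "u v = 0"
      using dual_basis_coord_sum[OF D i(1), of "\<lambda>j. u (b j)"] by (simp add: clinear_0[OF lin] i(2))
  qed
  have spn: "cvec.span (b ` I) = UNIV"
  proof -
    have "x \<in> cvec.span (b ` I)" for x
      by (subst ex[of x, symmetric]) (intro cvec.span_sum cvec.span_scale cvec.span_base imageI)
    then show ?thesis by blast
  qed
  have "ordered_basis (map b xs)"
    unfolding ordered_basis_def using xs inj ind spn by (simp add: distinct_map)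
  moreover have "char_poly (matrix_in_basis bs f) = (\<Prod>i\<in>I. [:- d i, 1:])" if bs: "ordered_basis bs" for bs
  proof -
    note bsD = bs[unfolded ordered_basis_def]
    have "card (set bs) = card (b ` I)"
      using cvec.basis_card_eq_dim[of "set bs" UNIV] cvec.basis_card_eq_dim[of "b ` I" UNIV] bsD ind spn by simp
    then have "length bs = card I" using bsD by (simp add: distinct_card card_image[OF inj])
    then have len: "length bs = n" by (simp add: n_def xs(1)[symmetric] distinct_card[OF xs(2)])
    define R where "R v w = cvec.representation (set bs) v w" for v w
    have bij': "bij_betw ((!) bs) {0..<n} (set bs)"
      using bij_betw_nth[of bs "{..<length bs}" "set bs"] bsD by (simp add: len atLeast0LessThan)
    have sc: "(scaleC :: complex \<Rightarrow> complex \<Rightarrow> complex) = (*)" by (intro ext) (simp add: scaleC_complex_def)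
    have Rlin: "clinear (\<lambda>v. R v w)" for w
      using cvec.linear_representation[of "set bs" w] bsD unfolding R_def sc by blast
    have Rex: "(\<Sum>k\<in>{0..<n}. R v (bs ! k) *\<^sub>C (bs ! k)) = v" for v
    proof -
      have "(\<Sum>k\<in>{0..<n}. R v (bs ! k) *\<^sub>C (bs ! k)) = (\<Sum>w\<in>set bs. R v w *\<^sub>C w)"
        by (rule sum.reindex_bij_betw[OF bij'])
      also have "\<dots> = v" unfolding R_def by (rule cvec.sum_representation_eq) (use bsD in auto)
      finally show ?thesis .
    qed
    have cex: "(\<Sum>k\<in>{0..<n}. c (xs ! k) v *\<^sub>C b (xs ! k)) = v" for v
      using sum.reindex_bij_betw[OF bij, of "\<lambda>i. c i v *\<^sub>C b i"] ex by simp
    have Rd: "R (bs ! j) (bs ! i) = (if i = j then 1 else 0)" if "i < n" "j < n" for i j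
      unfolding R_def using cvec.representation_basis[of "set bs" "bs ! j"] bsD that len by (auto simp: nth_eq_iff_index_eq)
    have cd: "c (xs ! i) (b (xs ! j)) = (if i = j then 1 else 0)" if "i < n" "j < n" for i j
      using dual[OF isI[OF that(1)] isI[OF that(2)]] that xs(2) by (auto simp: nth_eq_iff_index_eq n_def)
    define A where "A = mat n n (\<lambda>(i, j). R (b (xs ! j)) (bs ! i))"
    define A' where "A' = mat n n (\<lambda>(i, j). c (xs ! i) (bs ! j))"
    define Dg where "Dg = mat n n (\<lambda>(i, j). if i = j then d (xs ! i) else 0)"
    have carr: "A \<in> carrier_mat n n" "A' \<in> carrier_mat n n" "Dg \<in> carrier_mat n n"
      by (simp_all add: A_def A'_def Dg_def)
    have AA': "A * A' = 1\<^sub>m n"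
    proof (rule eq_matI)
      fix i j assume ij: "i < dim_row (1\<^sub>m n)" "j < dim_col (1\<^sub>m n)"
      then have "(A * A') $$ (i, j) = (\<Sum>k\<in>{0..<n}. c (xs ! k) (bs ! j) * R (b (xs ! k)) (bs ! i))"
        by (simp add: A_def A'_def scalar_prod_def mult.commute)
      also have "\<dots> = R (\<Sum>k\<in>{0..<n}. c (xs ! k) (bs ! j) *\<^sub>C b (xs ! k)) (bs ! i)"
        unfolding clinear_sum[OF Rlin] clinear_scaleC[OF Rlin] scaleC_complex_def ..
      finally show "(A * A') $$ (i, j) = 1\<^sub>m n $$ (i, j)" using ij by (simp add: cex Rd)
    qed (simp_all add: A_def A'_def)
    have A'A: "A' * A = 1\<^sub>m n"
    proof (rule eq_matI)
      fix i j assume ij: "i < dim_row (1\<^sub>m n)" "j < dim_col (1\<^sub>m n)"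
      then have "(A' * A) $$ (i, j) = (\<Sum>k\<in>{0..<n}. R (b (xs ! j)) (bs ! k) * c (xs ! i) (bs ! k))"
        by (simp add: A_def A'_def scalar_prod_def mult.commute)
      also have "\<dots> = c (xs ! i) (\<Sum>k\<in>{0..<n}. R (b (xs ! j)) (bs ! k) *\<^sub>C (bs ! k))"
        unfolding clinear_sum[OF lin] clinear_scaleC[OF lin] scaleC_complex_def ..
      finally show "(A' * A) $$ (i, j) = 1\<^sub>m n $$ (i, j)" using ij by (simp add: Rex cd)
    qed (simp_all add: A_def A'_def)
    have AD: "A * Dg = mat n n (\<lambda>(i, j). d (xs ! j) * R (b (xs ! j)) (bs ! i))"
    proof (rule eq_matI)
      fix i j assume "i < dim_row (mat n n (\<lambda>(i, j). d (xs ! j) * R (b (xs ! j)) (bs ! i)))"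
        "j < dim_col (mat n n (\<lambda>(i, j). d (xs ! j) * R (b (xs ! j)) (bs ! i)))"
      then have ij: "i < n" "j < n" by simp_all
      then have "(A * Dg) $$ (i, j) = (\<Sum>k\<in>{0..<n}. R (b (xs ! k)) (bs ! i) * (if k = j then d (xs ! k) else 0))"
        by (simp add: A_def Dg_def scalar_prod_def)
      also have "\<dots> = R (b (xs ! j)) (bs ! i) * d (xs ! j)"
        using ij by (subst sum_eq_single[of _ j]) auto
      finally show "(A * Dg) $$ (i, j) = mat n n (\<lambda>(i, j). d (xs ! j) * R (b (xs ! j)) (bs ! i)) $$ (i, j)"
        using ij by simp
    qed (simp_all add: A_def Dg_def)
    have M: "matrix_in_basis bs f = A * Dg * A'"
    proof (rule eq_matI)
      fix i j assume "i < dim_row (A * Dg * A')" "j < dim_col (A * Dg * A')"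
      then have ij: "i < n" "j < n" by (simp_all add: A_def A'_def)
      have "(A * Dg * A') $$ (i, j) = (\<Sum>k\<in>{0..<n}. c (xs ! k) (bs ! j) * (d (xs ! k) * R (b (xs ! k)) (bs ! i)))"
        unfolding AD using ij by (simp add: A'_def scalar_prod_def mult.commute)
      also have "\<dots> = R (\<Sum>k\<in>{0..<n}. c (xs ! k) (bs ! j) *\<^sub>C f (b (xs ! k))) (bs ! i)"
        unfolding clinear_sum[OF Rlin] clinear_scaleC[OF Rlin] scaleC_complex_def
        by (intro sum.cong refl) (simp add: d isI clinear_scaleC[OF Rlin] scaleC_complex_def)
      also have "(\<Sum>k\<in>{0..<n}. c (xs ! k) (bs ! j) *\<^sub>C f (b (xs ! k))) = f (bs ! j)"
        unfolding clinear_scaleC[OF f, symmetric] clinear_sum[OF f, symmetric] cex ..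
      finally show "matrix_in_basis bs f $$ (i, j) = (A * Dg * A') $$ (i, j)"
        using ij by (simp add: matrix_in_basis_def len R_def)
    qed (simp_all add: A_def A'_def matrix_in_basis_def len)
    have "similar_mat (matrix_in_basis bs f) Dg"
      using carr by (intro similar_matI[OF _ AA' A'A M]) (simp add: M)
    then have "char_poly (matrix_in_basis bs f) = char_poly Dg" by (rule char_poly_similar)
    also have "\<dots> = (\<Prod>a\<leftarrow>diag_mat Dg. [:- a, 1:])"
      by (rule char_poly_upper_triangular[OF carr(3)]) (simp add: Dg_def upper_triangular_def)
    also have "diag_mat Dg = map (\<lambda>i. d i) xs"
      by (rule nth_equalityI) (simp_all add: diag_mat_def Dg_def n_def)
    also have "(\<Prod>a\<leftarrow>map (\<lambda>i. d i) xs. [:- a, 1:]) = (\<Prod>i\<in>I. [:- d i, 1:])"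
      using prod.distinct_set_conv_list[OF xs(2), of "\<lambda>i. [:- d i, 1:]"] by (simp add: comp_def xs(1))
    finally show ?thesis .
  qed
  ultimately show ?thesis unfolding has_char_poly_def using f by blast
qed

lemma matrix_unit_basis:
  "dual_basis UNIV (\<lambda>(i, j). matrix_unit i (j :: 'd::finite)) (\<lambda>(i, j) A. entry A i j)"
  unfolding dual_basis_def
proof (intro conjI allI ballI)
  fix A :: "'d sqmat"
  have "(\<Sum>p\<in>UNIV. (case p of (i, j) \<Rightarrow> \<lambda>A. entry A i j) A *\<^sub>C (case p of (i, j) \<Rightarrow> matrix_unit i j)) =
      (\<Sum>(i, j)\<in>UNIV \<times> UNIV. entry A i j *\<^sub>C matrix_unit i j)"
    by (rule sum.cong) auto
  also have "\<dots> = (\<Sum>i\<in>UNIV. \<Sum>j\<in>UNIV. entry A i j *\<^sub>C matrix_unit i j)"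
    by (rule sum.cartesian_product[symmetric])
  also have "\<dots> = A" by (rule sqmat_expand[symmetric])
  finally show "(\<Sum>p\<in>UNIV. (case p of (i, j) \<Rightarrow> \<lambda>A. entry A i j) A *\<^sub>C (case p of (i, j) \<Rightarrow> matrix_unit i j)) = A" .
qed (auto simp: entry_matrix_unit clinear_entry split: if_splits)

context twisted_sl2
begin

interpretation weak: weak_hopf_algebra \<Delta>H \<epsilon>H SH by (rule weak)

text \<open>Left and right multiplication by the two factors of \<open>hH\<close> are scalars on entries of fixed row, column
  and weights.\<close>

lemma SH_SH_eigen:
  assumes u: "P \<gamma> * u = u" "u * P \<delta> = u"
  shows "SH (SH (munit i j u)) = (y i * y (j + \<delta>) / (y (i + \<gamma>) * y j)) *\<^sub>C munit i j u"
proof -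
  have T: "target_elem f * munit i j u = f (i + \<gamma>) *\<^sub>C munit i j u" "munit i j u * target_elem f = f (j + \<delta>) *\<^sub>C munit i j u" for f
    using target_elem_munit(1)[of f i j \<gamma> u] target_elem_munit(2)[of i j u \<delta> f] by (simp_all add: u)
  have B: "base_elem f * munit i j u = f i *\<^sub>C munit i j u" "munit i j u * base_elem f = f j *\<^sub>C munit i j u" for f
  proof -
    show "base_elem f * munit i j u = f i *\<^sub>C munit i j u"
      unfolding base_elem_sum sum_distrib_right by (subst sum_eq_single[of _ i]) (auto simp: munit_mult scaleC_mult_left)
    show "munit i j u * base_elem f = f j *\<^sub>C munit i j u"
      unfolding base_elem_sum sum_distrib_left by (subst sum_eq_single[of _ j]) (auto simp: munit_mult scaleC_mult_right)
  qed
  have "SH (SH (munit i j u)) = base_elem y * (target_elem yi * munit i j u) * base_elem yi * target_elem y"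
    unfolding SH_SH hH_inverse(1) unfolding hH_def by (simp only: mult.assoc)
  also have "\<dots> = (y i * y (j + \<delta>) / (y (i + \<gamma>) * y j)) *\<^sub>C munit i j u"
    by (simp add: T B scaleC_mult_left scaleC_mult_right scaleC_scaleC divide_inverse mult_ac)
  finally show ?thesis .
qed

text \<open>The matrix units tensored with the PBW basis are eigenvectors with left weight \<open>\<gamma>\<close> and right weight
  \<open>\<gamma> + 2a - 2b\<close>. When \<open>b\<close> varies the right weight takes every value once, and the exponent \<open>a\<close> only
  contributes the multiplicity \<open>\<ell>\<close>.\<close>

lemma char_poly_SH_SH:
  "has_char_poly (\<lambda>x. SH (SH x)) (\<Prod>i\<in>UNIV. \<Prod>j\<in>UNIV. \<Prod>k\<in>UNIV. \<Prod>m\<in>UNIV.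
     [:- (y j * y k / (y i * y m)), 1:] ^ CARD('n))"
proof -
  define wt :: "'n mod_ring \<times> nat \<times> nat \<Rightarrow> 'n mod_ring" where
    "wt = (\<lambda>(\<gamma>, a, b). \<gamma> + 2 * of_nat a - 2 * of_nat b)"
  define G where "G i j m k = [:- (y i * y k / (y m * y j)), 1:]" for i j m k
  define ev where "ev = (\<lambda>((i, j), r). y i * y (j + wt r) / (y (i + fst r) * y j))"
  let ?b = "\<lambda>(p, r). (case p of (i, j) \<Rightarrow> matrix_unit i j) \<boxtimes> pbw r"
  have pbw: "P \<gamma> * pbw (\<gamma>, a, b) = pbw (\<gamma>, a, b)" "pbw (\<gamma>, a, b) * P (wt (\<gamma>, a, b)) = pbw (\<gamma>, a, b)" for \<gamma> a b
  proof -
    show "P \<gamma> * pbw (\<gamma>, a, b) = pbw (\<gamma>, a, b)" by (simp add: pbw_def mult.assoc[symmetric])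
    have "pbw (\<gamma>, a, b) * P (wt (\<gamma>, a, b)) = P \<gamma> * F ^ a * (P (\<gamma> + 2 * of_nat a) * E ^ b)"
      by (simp add: pbw_def wt_def mult.assoc E_pow_P)
    also have "\<dots> = P \<gamma> * (F ^ a * P (\<gamma> + 2 * of_nat a)) * E ^ b" by (simp only: mult.assoc)
    also have "\<dots> = pbw (\<gamma>, a, b)" by (simp add: P_F_pow[symmetric] pbw_def mult.assoc[symmetric])
    finally show "pbw (\<gamma>, a, b) * P (wt (\<gamma>, a, b)) = pbw (\<gamma>, a, b)" .
  qed
  have "has_char_poly (\<lambda>x. SH (SH x)) (\<Prod>p\<in>UNIV \<times> pbw_index. [:- ev p, 1:])"
  proof (rule has_char_poly_diagonal[OF dual_basis_tensor[OF matrix_unit_basis pbw_basis]])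
    show "clinear (\<lambda>x. SH (SH x))" by (rule clinear_compose[OF weak.linear(3) weak.linear(3)])
    fix p :: "('n mod_ring \<times> 'n mod_ring) \<times> 'n mod_ring \<times> nat \<times> nat"
    obtain i j \<gamma> a b where p: "p = ((i, j), \<gamma>, a, b)" by (cases p) auto
    show "SH (SH (?b p)) = ev p *\<^sub>C ?b p"
      unfolding p ev_def by (simp add: SH_SH_eigen[OF pbw])
  qed
  also have "(\<Prod>p\<in>UNIV \<times> pbw_index. [:- ev p, 1:]) =
      (\<Prod>i\<in>UNIV. \<Prod>j\<in>UNIV. \<Prod>\<gamma>\<in>UNIV. \<Prod>a<CARD('n). \<Prod>b<CARD('n). G i j (i + \<gamma>) (j + wt (\<gamma>, a, b)))"
  proof -
    have times: "(\<Prod>p\<in>A \<times> B. f p) = (\<Prod>x\<in>A. \<Prod>z\<in>B. f (x, z))" for A :: "'x set" and B :: "'z set" and f :: "_ \<Rightarrow> complex poly"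
      by (simp add: prod.cartesian_product)
    show ?thesis
      unfolding pbw_index_def UNIV_Times_UNIV[symmetric] times by (simp add: ev_def G_def)
  qed
  also have "\<dots> = (\<Prod>i\<in>UNIV. \<Prod>j\<in>UNIV. \<Prod>\<gamma>\<in>UNIV. (\<Prod>k\<in>UNIV. G i j (i + \<gamma>) k) ^ CARD('n))"
  proof -
    have "(\<Prod>b<CARD('n). G i j (i + \<gamma>) (j + wt (\<gamma>, a, b))) = (\<Prod>k\<in>UNIV. G i j (i + \<gamma>) k)" for i j \<gamma> a
    proof -
      have neg: "bij_betw uminus UNIV (UNIV :: 'n mod_ring set)"
        by (rule bij_betw_byWitness[where f' = uminus]) auto
      from prod.reindex_bij_betw[OF bij_betw_trans[OF bij_of_nat[of "- (j + \<gamma> + 2 * of_nat a)"] neg], of "G i j (i + \<gamma>)"]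
      show ?thesis by (simp add: wt_def comp_def algebra_simps)
    qed
    then show ?thesis by simp
  qed
  also have "\<dots> = (\<Prod>i\<in>UNIV. \<Prod>j\<in>UNIV. \<Prod>m\<in>UNIV. \<Prod>k\<in>UNIV. G i j m k ^ CARD('n))"
  proof -
    have "(\<Prod>\<gamma>\<in>UNIV. (\<Prod>k\<in>UNIV. G i j (i + \<gamma>) k) ^ CARD('n)) = (\<Prod>m\<in>UNIV. \<Prod>k\<in>UNIV. G i j m k ^ CARD('n))" for i j
    proof -
      have "bij (\<lambda>\<nu>. i + \<nu> :: 'n mod_ring)" by (rule bijI') (auto intro: exI[of _ "_ - i"])
      from prod.reindex_bij_betw[OF this, of "\<lambda>m. (\<Prod>k\<in>UNIV. G i j m k) ^ CARD('n)"] show ?thesis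
        by (simp add: prod_power_distrib)
    qed
    then show ?thesis by simp
  qed
  also have "\<dots> = (\<Prod>j\<in>UNIV. \<Prod>i\<in>UNIV. \<Prod>k\<in>UNIV. \<Prod>m\<in>UNIV. G i j m k ^ CARD('n))"
    by (subst prod.swap) (intro prod.cong refl prod.swap)
  also have "\<dots> = (\<Prod>i\<in>UNIV. \<Prod>j\<in>UNIV. \<Prod>k\<in>UNIV. \<Prod>m\<in>UNIV. [:- (y j * y k / (y i * y m)), 1:] ^ CARD('n))"
    unfolding G_def by (simp add: mult.commute)
  finally show ?thesis .
qed

end

section \<open>Conclusion\<close>

lemma exp_root_of_unity:
  fixes l :: nat and s :: int and q :: complex
  assumes "1 < l" "coprime s (int l)" and q: "q = exp (2 * of_real pi * \<i> * of_int s / of_nat l)"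
  shows "q ^ k = 1 \<longleftrightarrow> l dvd k"
proof -
  define t where "t = 2 * pi * of_int s * real k / real l"
  have "q ^ k = cis t"
    unfolding q exp_of_nat_mult[symmetric] cis_conv_exp t_def by (rule arg_cong[where f = exp]) simp
  moreover have "cis t = 1 \<longleftrightarrow> (\<exists>m :: int. of_int (s * int k) = real_of_int (m * int l))"
  proof
    assume "cis t = 1"
    then have "cos t = 1" by (metis cis.sel(1) one_complex.sel(1))
    then obtain m :: int where "t = of_int m * 2 * pi" unfolding cos_one_2pi_int by blast
    then have "real_of_int s * real k = of_int m * real l" using \<open>1 < l\<close> unfolding t_def by (simp add: field_simps)
    then have "of_int (s * int k) = real_of_int (m * int l)" by simp
    then show "\<exists>m :: int. of_int (s * int k) = real_of_int (m * int l)" ..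
  next
    assume "\<exists>m :: int. of_int (s * int k) = real_of_int (m * int l)"
    then obtain m :: int where "real_of_int s * real k = of_int m * real l" by auto
    then have "t = 2 * pi * of_int m" using \<open>1 < l\<close> unfolding t_def by (simp add: field_simps)
    then show "cis t = 1" by (simp add: cis_multiple_2pi)
  qed
  ultimately have "q ^ k = 1 \<longleftrightarrow> (\<exists>m :: int. s * int k = m * int l)" by (simp only: of_int_eq_iff)
  also have "\<dots> \<longleftrightarrow> int l dvd s * int k" by (auto simp: dvd_def mult.commute)
  also have "\<dots> \<longleftrightarrow> int l dvd int k"
    using assms(2) by (simp add: coprime_dvd_mult_right_iff coprime_commute)
  finally show ?thesis by simp
qed

theorem proposition4p1:
  fixes l :: nat and s :: int and q \<Lambda> :: complex
    and g :: "gen \<Rightarrow> 'u::complex_alg"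
    and \<Delta> :: "'u \<Rightarrow> ('u, 'u) tensor" and \<epsilon> :: "'u \<Rightarrow> complex" and S\<^sub>U :: "'u \<Rightarrow> 'u"
    and P :: "'n::nontriv mod_ring \<Rightarrow> 'u"
    and R :: "('u, 'u) tensor"
    and X J :: "'n mod_ring \<Rightarrow> ('u, 'u) tensor"
    and \<Delta>\<^sub>H :: "('n, 'u) weak_alg \<Rightarrow> (('n, 'u) weak_alg, ('n, 'u) weak_alg) tensor"
    and \<epsilon>\<^sub>H :: "('n, 'u) weak_alg \<Rightarrow> complex"
    and S :: "('n, 'u) weak_alg \<Rightarrow> ('n, 'u) weak_alg"
    and y :: "'n mod_ring \<Rightarrow> complex"
    and h :: "('n, 'u) weak_alg"
  assumes l: "CARD('n) = l" "1 < l" "odd l"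
    and q: "coprime s (int l)" "q = exp (2 * of_real pi * \<i> * of_int s / of_nat l)"
    and \<Lambda>: "\<Lambda> \<noteq> 0" "\<Lambda> ^ l \<noteq> 1"
    and U: "small_quantum_sl2 l q g \<Delta> \<epsilon> S\<^sub>U"
    and P: "P = weight_idem q (g GK)"
    and R: "universal_R_matrix \<Delta> R"
      "\<exists>T\<in>tensor_subspace (I_plus g) (I_minus g). R = (1 + T) * Z_elem q P"
    and X: "\<And>lam. dynamical_X q P g R \<Lambda> lam (X lam)"
    and J: "J = dynamical_twist P X"
    and H: "\<Delta>\<^sub>H = twisted_comult \<Delta> P J" "weak_hopf_algebra \<Delta>\<^sub>H \<epsilon>\<^sub>H S"
    and y: "y = (\<lambda>i. \<Lambda> * qpow q i - inverse (qpow q i))"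
    and h: "h = base_elem y * alg_inv (S (base_elem y))"
  shows "unit_elem (base_elem y :: ('n, 'u) weak_alg) \<and> unit_elem (S (base_elem y)) \<and>
      trivial_grouplike S h \<and>
      (\<forall>x. S (S x) = h * x * alg_inv h) \<and>
      pivotal_element \<Delta> S\<^sub>U (g GKinv) \<and> pivotal_element \<Delta>\<^sub>H S h \<and>
      (\<forall>\<rho> :: 'u \<Rightarrow> 'd::finite sqmat. alg_hom \<rho> \<longrightarrow>
         transports_pivotal \<epsilon> S\<^sub>U (Theta P J) \<Delta>\<^sub>H \<epsilon>\<^sub>H S \<rho> (g GKinv) h) \<and>
      has_char_poly (\<lambda>x. S (S x))
        (\<Prod>i\<in>UNIV. \<Prod>j\<in>UNIV. \<Prod>k\<in>UNIV. \<Prod>m\<in>UNIV.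
          [:- (y j * y k / (y i * y m)), 1:] ^ l)"
proof -
  interpret U: sl2_root q "TYPE('n)" g \<Delta> \<epsilon> S\<^sub>U
  proof (rule sl2_root.intro)
    show "root_of_unity_card TYPE('n) q"
      by unfold_locales (simp_all only: l exp_root_of_unity[OF l(2) q], use l in simp)
    show "small_quantum_sl2 CARD('n) q g \<Delta> \<epsilon> S\<^sub>U" using U by (simp only: l(1))
  qed
  have \<Lambda>': "\<Lambda> ^ CARD('n) \<noteq> 1" using \<Lambda>(2) by (simp only: l(1) not_False_eq_True)
  have Req: "R = (\<Sum>k<CARD('n). U.rcoef k *\<^sub>C (g GE ^ k \<boxtimes> g GF ^ k)) * U.diag U.zf"
    using R(2) U.universal_R_unique[OF R(1)] unfolding P by blast
  have Xeq: "X lam = U.X0 (\<Lambda> * qpow q lam)" for lam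
    by (rule U.dynamical_X_eq[OF Req \<Lambda>']) (use X in \<open>simp only: P\<close>)
  interpret H: twisted_sl2 q "TYPE('n)" g \<Delta> \<epsilon> S\<^sub>U \<Lambda> J \<Delta>\<^sub>H \<epsilon>\<^sub>H S
  proof (intro twisted_sl2.intro twisted_sl2_axioms.intro U.sl2_root_axioms)
    show "J lam = U.zero_weight (U.jcoef \<Lambda> lam)" for lam
      unfolding J P by (rule U.dynamical_twist_eq) (rule Xeq)
    show "\<Delta>\<^sub>H = twisted_comult \<Delta> (weight_idem q (g GK)) J" using H(1) by (simp only: P)
  qed (fact \<Lambda>' \<Lambda>(1) H(2))+
  have y': "y = H.y" by (rule ext) (simp add: y H.y_def)
  have h': "h = H.hH" unfolding h y' H.hH_eq ..
  show ?thesis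
    unfolding h' P using H.units_y H.trivial_grouplike_hH H.SH_SH U.pivotal_Ki H.pivotal_hH H.transports_hH H.char_poly_SH_SH
    unfolding y' l(1) by blast
qed

end
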